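(* 1) For any pretopology on the category of Noetherian affine schemes for which all finite families of jointly surjective closed immersions are coverings, the map $W_{\mathrm{rat}}(\mathcal{O})^{\sharp}\to W_J(\mathcal{O})^{\sharp}$ induced by the inclusion is an isomorphism of sheaves of rings. 2) For any pretopology on the category of Noetherian affine schemes which is finer than the $f$-pretopology, there are canonical isomorphisms of sheaves of subrings of $W(\mathcal{O})^{\sharp}$ $$\underline{\mathbb{Z}}(\mathcal{O})^{\sharp}\xrightarrow{\ \sim\ }W_{\mathrm{rat}}(\mathcal{O})^{\sharp}\xrightarrow{\ \sim\ }W_J(\mathcal{O})^{\sharp}.$$
   Context: All rings are commutative and unital; categories of affine schemes are taken in a suitable small version. For a ring $A$ let $\mathbb{Z}A$ be the monoid ring of the multiplicative monoid $(A,\cdot)$, with basis elements $(a)$, and $\underline{\mathbb{Z}}A=\mathbb{Z}A/\mathbb{Z}(0)$ the reduced monoid ring. $W(A)=1+TA[[T]]$ is the big Witt ring: addition is multiplication of power series (zero element $1$), multiplication is the unique functorial, $T$-adically continuous one with $(1-aT)\cdot(1-bT)=1-abT$, unit $1-T$. $W_{\mathrm{rat}}(A)\subset W(A)$ is the subring of elements $P/Q$ with $P,Q\in A[T]$, $P(0)=1=Q(0)$. The functorial ring homomorphism $\omega:\underline{\mathbb{Z}}A\to W_{\mathrm{rat}}(A)$ is induced by $a\mapsto[a]=1-aT$. For $f=1+a_1T+a_2T^2+\cdots\in W(A)$ put $a_0=1$ and $H(f)=(a_{i+j})_{i,j\ge0}$ (Hankel matrix). $W_J(A)\subset W(A)$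 is the set of $f$ for which there is some $n\ge1$ such that all $(n+1)\times(n+1)$-minors of $H(f)$ vanish; it is a subring of $W(A)$ containing $W_{\mathrm{rat}}(A)$. $\underline{\mathbb{Z}}(\mathcal{O})$, $W_{\mathrm{rat}}(\mathcal{O})$, $W_J(\mathcal{O})$, $W(\mathcal{O})$ are the presheaves of rings $Y\mapsto\underline{\mathbb{Z}}\,\mathcal{O}(Y)$, $W_{\mathrm{rat}}(\mathcal{O}(Y))$, $W_J(\mathcal{O}(Y))$, $W(\mathcal{O}(Y))$; ${}^{\sharp}$ denotes sheafification. The coverings of the $f$- (finite) pretopology are the jointly surjective families of finite morphisms. The maps in 2) are those induced by $\omega$ and by the inclusion $W_{\mathrm{rat}}\subset W_J$. *)

theory Defs
  imports "HOL-Combinatorics.Permutations" "HOL-Algebra.Algebra"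
begin

section \<open>Noetherian affine schemes\<close>

text \<open>
  The small version of the category of Noetherian affine schemes is the opposite of the category of
  all Noetherian commutative rings (the zero ring included) whose carrier lies in a fixed type
  \<open>'a\<close>. A ring \<open>A\<close> stands for \<open>Spec A\<close>, and a ring homomorphism \<open>A \<rightarrow> B\<close>, made extensional so
  that equality of functions is equality of homomorphisms, stands for a morphism
  \<open>Spec B \<rightarrow> Spec A\<close>. If \<open>'a\<close> is infinite, the category is closed, up to isomorphism, under finite
  algebras.
\<close>

definition noeth :: "'a ring set" where
  "noeth = {A. cring A \<and> noetherian_ring A}"

definition homs :: "'a ring \<Rightarrow> 'a ring \<Rightarrow> ('a \<Rightarrow> 'a) set" where
  "homs A B = ring_hom A B \<inter> extensional (carrier A)"

definition id_hom :: "'a ring \<Rightarrow> 'a \<Rightarrow> 'a" where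
  "id_hom A = (\<lambda>a\<in>carrier A. a)"

text \<open>The pair \<open>(B, \<phi>)\<close> stands for the scheme morphism \<open>Spec B \<rightarrow> Spec A\<close> given by \<open>\<phi> : A \<rightarrow> B\<close>.\<close>

type_synonym 'a arrow = "'a ring \<times> ('a \<Rightarrow> 'a)"

definition arrows_into :: "'a ring \<Rightarrow> 'a arrow set" where
  "arrows_into A = {(B, \<phi>). B \<in> noeth \<and> \<phi> \<in> homs A B}"

text \<open>
  \<open>Spec P\<close> with the projections \<open>p\<close>, \<open>q\<close> is a fibre product of \<open>\<phi> : Spec B \<rightarrow> Spec A\<close> and
  \<open>\<psi> : Spec C \<rightarrow> Spec A\<close> in the category of Noetherian affine schemes.
\<close>

definition is_fibre_product ::
  "'a ring \<Rightarrow> 'a ring \<Rightarrow> ('a \<Rightarrow> 'a) \<Rightarrow> 'a ring \<Rightarrow> ('a \<Rightarrow> 'a) \<Rightarrow>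
   'a ring \<Rightarrow> ('a \<Rightarrow> 'a) \<Rightarrow> ('a \<Rightarrow> 'a) \<Rightarrow> bool" where
  "is_fibre_product A B \<phi> C \<psi> P p q \<longleftrightarrow>
     P \<in> noeth \<and> p \<in> homs B P \<and> q \<in> homs C P \<and>
     compose (carrier A) p \<phi> = compose (carrier A) q \<psi> \<and>
     (\<forall>D \<in> noeth. \<forall>u \<in> homs B D. \<forall>v \<in> homs C D.
        compose (carrier A) u \<phi> = compose (carrier A) v \<psi> \<longrightarrow>
        (\<exists>!w. w \<in> homs P D \<and> compose (carrier B) w p = u \<and> compose (carrier C) w q = v))"

definition finite_morphism :: "'a ring \<Rightarrow> 'a ring \<Rightarrow> ('a \<Rightarrow> 'a) \<Rightarrow> bool" where
  "finite_morphism A B \<phi> \<longleftrightarrow>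
     (\<exists>G. finite G \<and> G \<subseteq> carrier B \<and>
        (\<forall>b \<in> carrier B. \<exists>c \<in> G \<rightarrow> carrier A. b = (\<Oplus>\<^bsub>B\<^esub>x\<in>G. \<phi> (c x) \<otimes>\<^bsub>B\<^esub> x)))"

definition closed_immersion :: "'a ring \<Rightarrow> 'a ring \<Rightarrow> ('a \<Rightarrow> 'a) \<Rightarrow> bool" where
  "closed_immersion A B \<phi> \<longleftrightarrow> \<phi> ` carrier A = carrier B"

definition jointly_surjective :: "'a ring \<Rightarrow> 'a arrow set \<Rightarrow> bool" where
  "jointly_surjective A S \<longleftrightarrow>
     (\<forall>I. primeideal I A \<longrightarrow>
        (\<exists>(B, \<phi>) \<in> S. \<exists>J. primeideal J B \<and> I = {a \<in> carrier A. \<phi> a \<in> J}))"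


section \<open>Pretopologies\<close>

text \<open>
  \<open>K A\<close> is the set of coverings of \<open>Spec A\<close>; a family of morphisms is given by the set of its
  members. Base change is required for every choice of fibre products, so that isomorphisms, being
  base changes of identities, are coverings as well.
\<close>

type_synonym 'a covers = "'a ring \<Rightarrow> 'a arrow set set"

definition pretopology :: "'a covers \<Rightarrow> bool" where
  "pretopology K \<longleftrightarrow>
     (\<forall>A \<in> noeth. \<forall>S \<in> K A. S \<subseteq> arrows_into A) \<and>
     (\<forall>A \<in> noeth. {(A, id_hom A)} \<in> K A) \<and>
     (\<forall>A \<in> noeth. \<forall>S \<in> K A. \<forall>C \<in> noeth. \<forall>\<psi> \<in> homs A C. \<forall>(B, \<phi>) \<in> S.
        \<exists>P p q. is_fibre_product A B \<phi> C \<psi> P p q) \<and>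
     (\<forall>A \<in> noeth. \<forall>S \<in> K A. \<forall>C \<in> noeth. \<forall>\<psi> \<in> homs A C. \<forall>P q.
        (\<forall>(B, \<phi>) \<in> S. \<exists>p. is_fibre_product A B \<phi> C \<psi> (P (B, \<phi>)) p (q (B, \<phi>))) \<longrightarrow>
        (\<lambda>s. (P s, q s)) ` S \<in> K C) \<and>
     (\<forall>A \<in> noeth. \<forall>S \<in> K A. \<forall>R. (\<forall>(B, \<phi>) \<in> S. R (B, \<phi>) \<in> K B) \<longrightarrow>
        {(D, compose (carrier A) \<chi> \<phi>) | B \<phi> D \<chi>. (B, \<phi>) \<in> S \<and> (D, \<chi>) \<in> R (B, \<phi>)} \<in> K A)"

definition refines :: "'a ring \<Rightarrow> 'a arrow set \<Rightarrow> 'a arrow set \<Rightarrow> bool" where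
  "refines A R S \<longleftrightarrow>
     (\<forall>(D, \<chi>) \<in> R. \<exists>(B, \<phi>) \<in> S. \<exists>\<rho> \<in> homs B D. \<chi> = compose (carrier A) \<rho> \<phi>)"

text \<open>
  Comparison of the generated topologies: \<open>K\<close> is finer than \<open>L\<close> if every \<open>L\<close>-covering is refined by
  a \<open>K\<close>-covering. In particular this holds if every \<open>L\<close>-covering is a \<open>K\<close>-covering.
\<close>

definition finer :: "'a covers \<Rightarrow> 'a covers \<Rightarrow> bool" where
  "finer K L \<longleftrightarrow> (\<forall>A \<in> noeth. \<forall>S \<in> L A. \<exists>R \<in> K A. refines A R S)"

definition f_pretopology :: "'a covers" where
  "f_pretopology A =
     {S. S \<subseteq> arrows_into A \<and> (\<forall>(B, \<phi>) \<in> S. finite_morphism A B \<phi>) \<and> jointly_surjective A S}"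

definition contains_finite_closed_coverings :: "'a covers \<Rightarrow> bool" where
  "contains_finite_closed_coverings K \<longleftrightarrow>
     (\<forall>A \<in> noeth. \<forall>S. S \<subseteq> arrows_into A \<and> finite S \<and>
        (\<forall>(B, \<phi>) \<in> S. closed_immersion A B \<phi>) \<and> jointly_surjective A S \<longrightarrow> S \<in> K A)"


section \<open>Presheaves and sheaves of rings\<close>

text \<open>\<open>res F A B \<phi>\<close> is the restriction \<open>F (Spec A) \<rightarrow> F (Spec B)\<close> along \<open>\<phi> : Spec B \<rightarrow> Spec A\<close>.\<close>

record ('a, 'b) presheaf =
  sec :: "'a ring \<Rightarrow> 'b ring"
  res :: "'a ring \<Rightarrow> 'a ring \<Rightarrow> ('a \<Rightarrow> 'a) \<Rightarrow> 'b \<Rightarrow> 'b"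

definition presheaf_of_rings :: "('a, 'b) presheaf \<Rightarrow> bool" where
  "presheaf_of_rings F \<longleftrightarrow>
     (\<forall>A \<in> noeth. cring (sec F A)) \<and>
     (\<forall>A \<in> noeth. \<forall>B \<in> noeth. \<forall>\<phi> \<in> homs A B. res F A B \<phi> \<in> ring_hom (sec F A) (sec F B)) \<and>
     (\<forall>A \<in> noeth. \<forall>x \<in> carrier (sec F A). res F A A (id_hom A) x = x) \<and>
     (\<forall>A \<in> noeth. \<forall>B \<in> noeth. \<forall>C \<in> noeth. \<forall>\<phi> \<in> homs A B. \<forall>\<psi> \<in> homs B C.
        \<forall>x \<in> carrier (sec F A).
          res F A C (compose (carrier A) \<psi> \<phi>) x = res F B C \<psi> (res F A B \<phi> x))"

definition compatible_families ::
  "('a, 'b) presheaf \<Rightarrow> 'a ring \<Rightarrow> 'a arrow set \<Rightarrow> ('a arrow \<Rightarrow> 'b) set" where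
  "compatible_families F A S =
     {s \<in> (\<Pi>\<^sub>E (B, \<phi>) \<in> S. carrier (sec F B)).
        \<forall>(B, \<phi>) \<in> S. \<forall>(C, \<psi>) \<in> S. \<forall>P p q. is_fibre_product A B \<phi> C \<psi> P p q \<longrightarrow>
          res F B P p (s (B, \<phi>)) = res F C P q (s (C, \<psi>))}"

definition sheaf_of_rings :: "'a covers \<Rightarrow> ('a, 'b) presheaf \<Rightarrow> bool" where
  "sheaf_of_rings K F \<longleftrightarrow>
     presheaf_of_rings F \<and>
     (\<forall>A \<in> noeth. \<forall>S \<in> K A. \<forall>s \<in> compatible_families F A S.
        \<exists>!x. x \<in> carrier (sec F A) \<and> (\<forall>(B, \<phi>) \<in> S. res F A B \<phi> x = s (B, \<phi>)))"

definition presheaf_morphism ::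
  "('a, 'b) presheaf \<Rightarrow> ('a, 'c) presheaf \<Rightarrow> ('a ring \<Rightarrow> 'b \<Rightarrow> 'c) \<Rightarrow> bool" where
  "presheaf_morphism F G h \<longleftrightarrow>
     (\<forall>A \<in> noeth. h A \<in> ring_hom (sec F A) (sec G A)) \<and>
     (\<forall>A \<in> noeth. \<forall>B \<in> noeth. \<forall>\<phi> \<in> homs A B. \<forall>x \<in> carrier (sec F A).
        h B (res F A B \<phi> x) = res G A B \<phi> (h A x))"

definition sheaf_iso ::
  "'a covers \<Rightarrow> ('a, 'b) presheaf \<Rightarrow> ('a, 'c) presheaf \<Rightarrow> ('a ring \<Rightarrow> 'b \<Rightarrow> 'c) \<Rightarrow> bool" where
  "sheaf_iso K F G h \<longleftrightarrow>
     sheaf_of_rings K F \<and> sheaf_of_rings K G \<and> presheaf_morphism F G h \<and>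
     (\<forall>A \<in> noeth. h A \<in> ring_iso (sec F A) (sec G A))"

definition sheaf_mono ::
  "'a covers \<Rightarrow> ('a, 'b) presheaf \<Rightarrow> ('a, 'c) presheaf \<Rightarrow> ('a ring \<Rightarrow> 'b \<Rightarrow> 'c) \<Rightarrow> bool" where
  "sheaf_mono K F G h \<longleftrightarrow>
     sheaf_of_rings K F \<and> sheaf_of_rings K G \<and> presheaf_morphism F G h \<and>
     (\<forall>A \<in> noeth. inj_on (h A) (carrier (sec F A)))"


section \<open>Sheafification\<close>

text \<open>
  The plus construction \<open>F\<^sup>+(A) = colim H\<^sup>0(S, F)\<close>, the colimit over the coverings \<open>S\<close> of \<open>Spec A\<close>
  under refinement. Its elements are classes of pairs \<open>(S, s)\<close> with \<open>s\<close> a compatible family on \<open>S\<close>.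
\<close>

type_synonym ('a, 'b) local_family = "'a arrow set \<times> ('a arrow \<Rightarrow> 'b)"
type_synonym ('a, 'b) plus_el = "('a, 'b) local_family set"

definition local_families ::
  "'a covers \<Rightarrow> ('a, 'b) presheaf \<Rightarrow> 'a ring \<Rightarrow> ('a, 'b) local_family set" where
  "local_families K F A = {(S, s). S \<in> K A \<and> s \<in> compatible_families F A S}"

text \<open>
  \<open>has_value F A (S, s) (D, \<chi>) t\<close>: the morphism \<open>\<chi> : Spec D \<rightarrow> Spec A\<close> factors through a member of
  \<open>S\<close>, and \<open>t\<close> is the restriction of \<open>s\<close> to \<open>Spec D\<close>. By compatibility \<open>t\<close> does not depend on the
  factorization.
\<close>

definition has_value ::
  "('a, 'b) presheaf \<Rightarrow> 'a ring \<Rightarrow> ('a, 'b) local_family \<Rightarrow> 'a arrow \<Rightarrow> 'b \<Rightarrow> bool" where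
  "has_value F A x c t \<longleftrightarrow>
     (case (x, c) of ((S, s), (D, \<chi>)) \<Rightarrow>
        \<exists>(B, \<phi>) \<in> S. \<exists>\<rho> \<in> homs B D. \<chi> = compose (carrier A) \<rho> \<phi> \<and> t = res F B D \<rho> (s (B, \<phi>)))"

text \<open>Agreement on a common refinement.\<close>

definition plus_rel ::
  "'a covers \<Rightarrow> ('a, 'b) presheaf \<Rightarrow> 'a ring \<Rightarrow> ('a, 'b) local_family rel" where
  "plus_rel K F A =
     {(x, y). x \<in> local_families K F A \<and> y \<in> local_families K F A \<and>
        (\<exists>Q \<in> K A. \<forall>c \<in> Q. \<exists>t. has_value F A x c t \<and> has_value F A y c t)}"

definition plus_unit :: "'a covers \<Rightarrow> ('a, 'b) presheaf \<Rightarrow> 'a ring \<Rightarrow> 'b \<Rightarrow> ('a, 'b) plus_el" where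
  "plus_unit K F A a =
     plus_rel K F A `` {({(A, id_hom A)}, \<lambda>_ \<in> {(A, id_hom A)}. a)}"

text \<open>
  \<open>plus_op K F f A U V\<close> is the class obtained by applying the operation \<open>f\<close> memberwise on a common
  refinement of representatives of \<open>U\<close> and \<open>V\<close>.
\<close>

definition plus_op ::
  "'a covers \<Rightarrow> ('a, 'b) presheaf \<Rightarrow> ('b ring \<Rightarrow> 'b \<Rightarrow> 'b \<Rightarrow> 'b) \<Rightarrow> 'a ring \<Rightarrow>
   ('a, 'b) plus_el \<Rightarrow> ('a, 'b) plus_el \<Rightarrow> ('a, 'b) plus_el" where
  "plus_op K F f A U V =
     {z \<in> local_families K F A. \<exists>x \<in> U. \<exists>y \<in> V. \<exists>Q \<in> K A. \<forall>c \<in> Q. \<exists>a b.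
        has_value F A x c a \<and> has_value F A y c b \<and> has_value F A z c (f (sec F (fst c)) a b)}"

text \<open>
  The restriction of \<open>F\<^sup>+\<close> along \<open>\<psi> : Spec C \<rightarrow> Spec A\<close> is the class of the base change to
  \<open>Spec C\<close> of a representative; here \<open>x\<close> is evaluated on a member \<open>\<chi> : Spec D \<rightarrow> Spec C\<close> of a
  covering through the composite \<open>Spec D \<rightarrow> Spec C \<rightarrow> Spec A\<close>.
\<close>

definition plus_presheaf :: "'a covers \<Rightarrow> ('a, 'b) presheaf \<Rightarrow> ('a, ('a, 'b) plus_el) presheaf" where
  "plus_presheaf K F =
     \<lparr> sec = (\<lambda>A.
         \<lparr> carrier = local_families K F A // plus_rel K F A,
           monoid.mult = plus_op K F monoid.mult A,
           one = plus_unit K F A \<one>\<^bsub>sec F A\<^esub>,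
           ring.zero = plus_unit K F A \<zero>\<^bsub>sec F A\<^esub>,
           add = plus_op K F ring.add A \<rparr>),
       res = (\<lambda>A C \<psi> U.
         {z \<in> local_families K F C. \<exists>x \<in> U. \<exists>Q \<in> K C. \<forall>(D, \<chi>) \<in> Q. \<exists>t.
            has_value F A x (D, compose (carrier A) \<chi> \<psi>) t \<and> has_value F C z (D, \<chi>) t}) \<rparr>"

definition plus_map ::
  "'a covers \<Rightarrow> ('a, 'b) presheaf \<Rightarrow> ('a, 'c) presheaf \<Rightarrow> ('a ring \<Rightarrow> 'b \<Rightarrow> 'c) \<Rightarrow>
   'a ring \<Rightarrow> ('a, 'b) plus_el \<Rightarrow> ('a, 'c) plus_el" where
  "plus_map K F G h A U =
     (\<Union>(S, s) \<in> U. plus_rel K G A `` {(S, \<lambda>(B, \<phi>) \<in> S. h B (s (B, \<phi>)))})"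

definition sheafify ::
  "'a covers \<Rightarrow> ('a, 'b) presheaf \<Rightarrow> ('a, ('a, ('a, 'b) plus_el) plus_el) presheaf" where
  "sheafify K F = plus_presheaf K (plus_presheaf K F)"

definition sheafify_map ::
  "'a covers \<Rightarrow> ('a, 'b) presheaf \<Rightarrow> ('a, 'c) presheaf \<Rightarrow> ('a ring \<Rightarrow> 'b \<Rightarrow> 'c) \<Rightarrow>
   'a ring \<Rightarrow> ('a, ('a, 'b) plus_el) plus_el \<Rightarrow> ('a, ('a, 'c) plus_el) plus_el" where
  "sheafify_map K F G h = plus_map K (plus_presheaf K F) (plus_presheaf K G) (plus_map K F G h)"


section \<open>Witt vectors\<close>

text \<open>A power series is given by its sequence of coefficients.\<close>

definition ps_mult :: "'a ring \<Rightarrow> (nat \<Rightarrow> 'a) \<Rightarrow> (nat \<Rightarrow> 'a) \<Rightarrow> nat \<Rightarrow> 'a" where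
  "ps_mult A f g = (\<lambda>n. \<Oplus>\<^bsub>A\<^esub>i\<in>{..n}. f i \<otimes>\<^bsub>A\<^esub> g (n - i))"

definition witt_carrier :: "'a ring \<Rightarrow> (nat \<Rightarrow> 'a) set" where
  "witt_carrier A = {f. f 0 = \<one>\<^bsub>A\<^esub> \<and> (\<forall>n. f n \<in> carrier A)}"

text \<open>\<open>teich A a\<close> is the series \<open>1 - a T\<close>.\<close>

definition teich :: "'a ring \<Rightarrow> 'a \<Rightarrow> nat \<Rightarrow> 'a" where
  "teich A a = (\<lambda>n. if n = 0 then \<one>\<^bsub>A\<^esub> else if n = 1 then \<ominus>\<^bsub>A\<^esub> a else \<zero>\<^bsub>A\<^esub>)"

definition witt_ring_with ::
  "('a ring \<Rightarrow> (nat \<Rightarrow> 'a) \<Rightarrow> (nat \<Rightarrow> 'a) \<Rightarrow> nat \<Rightarrow> 'a) \<Rightarrow> 'a ring \<Rightarrow> (nat \<Rightarrow> 'a) ring" where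
  "witt_ring_with m A =
     \<lparr> carrier = witt_carrier A,
       monoid.mult = m A,
       one = teich A \<one>\<^bsub>A\<^esub>,
       ring.zero = (\<lambda>n. if n = 0 then \<one>\<^bsub>A\<^esub> else \<zero>\<^bsub>A\<^esub>),
       add = ps_mult A \<rparr>"

text \<open>
  The functorial, \<open>T\<close>-adically continuous multiplications with
  \<open>(1 - a T) \<cdot> (1 - b T) = 1 - a b T\<close>. For infinite \<open>'a\<close> there is exactly one, up to its values
  outside the carriers; because of these values it is picked by \<open>SOME\<close> and not by \<open>THE\<close>.
\<close>

definition is_witt_mult ::
  "('a ring \<Rightarrow> (nat \<Rightarrow> 'a) \<Rightarrow> (nat \<Rightarrow> 'a) \<Rightarrow> nat \<Rightarrow> 'a) \<Rightarrow> bool" where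
  "is_witt_mult m \<longleftrightarrow>
     (\<forall>A. cring A \<longrightarrow> cring (witt_ring_with m A)) \<and>
     (\<forall>A. cring A \<longrightarrow> (\<forall>a \<in> carrier A. \<forall>b \<in> carrier A.
        m A (teich A a) (teich A b) = teich A (a \<otimes>\<^bsub>A\<^esub> b))) \<and>
     (\<forall>A B \<phi>. cring A \<longrightarrow> cring B \<longrightarrow> \<phi> \<in> ring_hom A B \<longrightarrow>
        (\<forall>f \<in> witt_carrier A. \<forall>g \<in> witt_carrier A. \<phi> \<circ> m A f g = m B (\<phi> \<circ> f) (\<phi> \<circ> g))) \<and>
     (\<forall>A. cring A \<longrightarrow> (\<forall>f \<in> witt_carrier A. \<forall>g \<in> witt_carrier A. \<forall>n. \<exists>k.
        \<forall>f' \<in> witt_carrier A. \<forall>g' \<in> witt_carrier A.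
          (\<forall>i<k. f' i = f i \<and> g' i = g i) \<longrightarrow> (\<forall>i<n. m A f' g' i = m A f g i)))"

definition witt_mult :: "'a ring \<Rightarrow> (nat \<Rightarrow> 'a) \<Rightarrow> (nat \<Rightarrow> 'a) \<Rightarrow> nat \<Rightarrow> 'a" where
  "witt_mult = (SOME m. is_witt_mult m)"

definition Witt :: "'a ring \<Rightarrow> (nat \<Rightarrow> 'a) ring" where
  "Witt = witt_ring_with witt_mult"

text \<open>\<open>f = P / Q\<close> is expressed as \<open>f Q = P\<close>; \<open>Q\<close> is a unit of \<open>A[[T]]\<close> because \<open>Q(0) = 1\<close>.\<close>

definition Witt_rat :: "'a ring \<Rightarrow> (nat \<Rightarrow> 'a) ring" where
  "Witt_rat A = (Witt A)\<lparr>carrier :=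
     {f \<in> carrier (Witt A). \<exists>P \<in> up A. \<exists>Q \<in> up A.
        P 0 = \<one>\<^bsub>A\<^esub> \<and> Q 0 = \<one>\<^bsub>A\<^esub> \<and> ps_mult A f Q = P}\<rparr>"

definition leibniz_det :: "'a ring \<Rightarrow> nat \<Rightarrow> (nat \<Rightarrow> nat \<Rightarrow> 'a) \<Rightarrow> 'a" where
  "leibniz_det A n M =
     (\<Oplus>\<^bsub>A\<^esub>p\<in>{p. p permutes {..<n}}. [sign p] \<cdot>\<^bsub>A\<^esub> (\<Otimes>\<^bsub>A\<^esub>i\<in>{..<n}. M i (p i)))"

definition hankel :: "(nat \<Rightarrow> 'a) \<Rightarrow> nat \<Rightarrow> nat \<Rightarrow> 'a" where
  "hankel f i j = f (i + j)"

definition minors_vanish :: "'a ring \<Rightarrow> nat \<Rightarrow> (nat \<Rightarrow> nat \<Rightarrow> 'a) \<Rightarrow> bool" where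
  "minors_vanish A n M \<longleftrightarrow>
     (\<forall>r c. strict_mono_on {..<n} r \<and> strict_mono_on {..<n} c \<longrightarrow>
        leibniz_det A n (\<lambda>i j. M (r i) (c j)) = \<zero>\<^bsub>A\<^esub>)"

definition Witt_J :: "'a ring \<Rightarrow> (nat \<Rightarrow> 'a) ring" where
  "Witt_J A = (Witt A)\<lparr>carrier :=
     {f \<in> carrier (Witt A). \<exists>n\<ge>1. minors_vanish A (n + 1) (hankel f)}\<rparr>"


section \<open>The reduced monoid ring and the map \<open>\<omega>\<close>\<close>

definition monoid_ring :: "'a ring \<Rightarrow> ('a \<Rightarrow> int) ring" where
  "monoid_ring A =
     \<lparr> carrier = {x. finite {a. x a \<noteq> 0} \<and> {a. x a \<noteq> 0} \<subseteq> carrier A},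
       monoid.mult = (\<lambda>x y c. \<Sum>(a, b) \<in> {(a, b). x a \<noteq> 0 \<and> y b \<noteq> 0 \<and> a \<otimes>\<^bsub>A\<^esub> b = c}. x a * y b),
       one = (\<lambda>a. if a = \<one>\<^bsub>A\<^esub> then 1 else 0),
       ring.zero = (\<lambda>_. 0),
       add = (\<lambda>x y a. x a + y a) \<rparr>"

definition zero_multiples :: "'a ring \<Rightarrow> ('a \<Rightarrow> int) set" where
  "zero_multiples A = range (\<lambda>(k::int) a. if a = \<zero>\<^bsub>A\<^esub> then k else 0)"

definition reduced_monoid_ring :: "'a ring \<Rightarrow> ('a \<Rightarrow> int) set ring" where
  "reduced_monoid_ring A = monoid_ring A Quot zero_multiples A"

definition monoid_ring_map :: "('a \<Rightarrow> 'a) \<Rightarrow> ('a \<Rightarrow> int) \<Rightarrow> 'a \<Rightarrow> int" where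
  "monoid_ring_map \<phi> x = (\<lambda>b. \<Sum>a \<in> {a. x a \<noteq> 0 \<and> \<phi> a = b}. x a)"

text \<open>The map \<open>ZA \<rightarrow> W(A)\<close>, \<open>\<Sum> n\<^sub>a (a) \<mapsto> \<Sum> n\<^sub>a [a]\<close>, and the map \<open>\<omega>\<close> it induces on the quotient.\<close>

definition omega_lift :: "'a ring \<Rightarrow> ('a \<Rightarrow> int) \<Rightarrow> nat \<Rightarrow> 'a" where
  "omega_lift A x = (\<Oplus>\<^bsub>Witt A\<^esub>a\<in>{a. x a \<noteq> 0}. [x a] \<cdot>\<^bsub>Witt A\<^esub> teich A a)"

definition omega :: "'a ring \<Rightarrow> ('a \<Rightarrow> int) set \<Rightarrow> nat \<Rightarrow> 'a" where
  "omega A U = the_elem (omega_lift A ` U)"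


section \<open>The four presheaves\<close>

definition Z_pre :: "('a, ('a \<Rightarrow> int) set) presheaf" where
  "Z_pre =
     \<lparr> sec = reduced_monoid_ring,
       res = (\<lambda>A B \<phi> U. \<Union>x \<in> U. zero_multiples B +>\<^bsub>monoid_ring B\<^esub> monoid_ring_map \<phi> x) \<rparr>"

definition W_pre :: "('a, nat \<Rightarrow> 'a) presheaf" where
  "W_pre = \<lparr> sec = Witt, res = (\<lambda>A B \<phi> f. \<phi> \<circ> f) \<rparr>"

definition W_rat_pre :: "('a, nat \<Rightarrow> 'a) presheaf" where
  "W_rat_pre = \<lparr> sec = Witt_rat, res = (\<lambda>A B \<phi> f. \<phi> \<circ> f) \<rparr>"

definition W_J_pre :: "('a, nat \<Rightarrow> 'a) presheaf" where
  "W_J_pre = \<lparr> sec = Witt_J, res = (\<lambda>A B \<phi> f. \<phi> \<circ> f) \<rparr>"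

definition incl :: "'a ring \<Rightarrow> (nat \<Rightarrow> 'a) \<Rightarrow> nat \<Rightarrow> 'a" where
  "incl A f = f"

end

theory Submission
 imports "Jordan_Normal_Form.Determinant" "HOL-Library.Poly_Mapping"
  "HOL-Computational_Algebra.Formal_Power_Series" Defs
begin

text \<open>
By the Noetherian hypothesis \<open>Spec A\<close> is covered by finitely many closed integral subschemes, and
functions vanishing on all of them are nilpotent of bounded order. Over a Noetherian domain a
bounded rank of the Hankel matrix gives a linear recurrence, so that \<open>W\<^sub>r\<^sub>a\<^sub>t\<close> and \<open>W\<^sub>J\<close> agree there.
Conversely, if \<open>f\<close> is rational on every component, then modulo the nilpotents the rows of \<open>H(f)\<close> are
combinations of finitely many of them, so the large minors of \<open>H(f)\<close> vanish. Hence membership in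
\<open>W\<^sub>J\<close> means rationality on the components.

For \<open>\<omega>\<close>: adjoining the roots of a reversed polynomial is a finite covering, over which a rational
series becomes a quotient of products of factors \<open>1 - x T\<close>; over a domain the nonzero \<open>x\<close> in such a
product are determined with their multiplicities.
\<close>

section \<open>Sheafification\<close>

text \<open>Both isomorphisms are reduced to presheaves: a morphism that is injective and surjective
  up to a covering becomes an isomorphism after sheafification. Fibre products are guaranteed only
  for members of coverings, so sections of the plus construction are never computed by base change
  of families; they are handled through their values along arbitrary morphisms. \<open>W_J\<close>
  is not visibly closed under the Witt operations; its description by rationality on the integral
  components supplies the subring property and also makes the inclusion of the rational vectors
  locally surjective. Common denominators lift from the components, so nilpotents are the only
  obstruction to rationality on the whole scheme. The bound for the vanishing minors comes from the
  length of a product of primes inside the zero ideal. \<open>witt_mult\<close> is known by its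
  axioms alone, so the Witt product of polynomials is computed by distributivity in a ring where
  both split into linear factors. The infinite type gives such rings, free of finite rank over the
  base, carriers in \<open>'a\<close>.\<close>

abbreviation hcomp :: "'a ring => ('a => 'a) => ('a => 'a) => 'a => 'a" where
 "hcomp A psi phi == compose (carrier A) psi phi"

lemma homs_ring_hom: "phi \<in> homs A B ==> phi \<in> ring_hom A B"
 by (simp add: homs_def)

lemma homs_closed: "phi \<in> homs A B ==> a \<in> carrier A ==> phi a \<in> carrier B"
 by (auto simp: homs_def intro: ring_hom_closed)

lemma homs_funcset: "phi \<in> homs A B ==> phi \<in> carrier A \<rightarrow> carrier B"
 by (auto intro: homs_closed)

lemma restrict_ring_hom: "phi \<in> ring_hom A B ==> restrict phi (carrier A) \<in> ring_hom A B" if "cring A"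
proof -
 interpret cring A by fact
 assume "phi \<in> ring_hom A B"
 then show ?thesis by (auto simp: ring_hom_def)
qed

lemma homs_compose:
 assumes "cring A" "phi \<in> homs A B" "psi \<in> homs B C"
 shows "hcomp A psi phi \<in> homs A C"
proof -
 interpret cring A by fact
 show ?thesis
  using assms(2,3) by (auto simp: homs_def compose_def ring_hom_def Pi_def)
qed

lemma id_hom_homs: "cring A ==> id_hom A \<in> homs A A"
proof -
 assume "cring A"
 then interpret cring A .
 show ?thesis by (auto simp: homs_def id_hom_def ring_hom_def)
qed

lemma compose_id_hom: "phi \<in> homs A B ==> hcomp A phi (id_hom A) = phi"
 by (auto simp: homs_def id_hom_def compose_def extensional_def fun_eq_iff)

lemma id_hom_compose: "phi \<in> homs A B ==> hcomp A (id_hom B) phi = phi"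
 using homs_closed[of phi A B]
 by (auto simp: homs_def id_hom_def compose_def extensional_def fun_eq_iff)

lemma homs_compose_assoc:
 "phi \<in> homs A B ==>
  hcomp A chi (hcomp A psi phi) = hcomp A (hcomp B chi psi) phi"
 by (rule compose_assoc[OF homs_funcset])

lemma noeth_cring: "A \<in> noeth ==> cring A"
 by (simp add: noeth_def)

section \<open>Properties that hold after passing to a covering\<close>

locale site =
 fixes K :: "'a covers"
 assumes pretopology: "pretopology K"
begin

lemmas pretopologyD = pretopology[unfolded pretopology_def]

lemma cover_subset: "A \<in> noeth ==> S \<in> K A ==> S \<subseteq> arrows_into A"
 using conjunct1[OF pretopologyD] by blast

lemma cover_arrow:
 assumes "A \<in> noeth" "S \<in> K A" "(B, phi) \<in> S"
 shows "B \<in> noeth" "phi \<in> homs A B"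
 using cover_subset[OF assms(1,2)] assms(3) by (auto simp: arrows_into_def)

lemma cover_id: "A \<in> noeth ==> {(A, id_hom A)} \<in> K A"
 using conjunct1[OF conjunct2[OF pretopologyD]] by blast

lemma fibre_product_exists:
 assumes "A \<in> noeth" "S \<in> K A" "C \<in> noeth" "psi \<in> homs A C" "(B, phi) \<in> S"
 shows "\<exists>P p q. is_fibre_product A B phi C psi P p q"
 using conjunct1[OF conjunct2[OF conjunct2[OF pretopologyD]]] assms by fast

lemma cover_base_change:
 assumes "A \<in> noeth" "S \<in> K A" "C \<in> noeth" "psi \<in> homs A C"
 shows "\<exists>T \<in> K C. \<forall>(D, chi) \<in> T. \<exists>(B, phi) \<in> S. \<exists>rho \<in> homs B D.
     hcomp A chi psi = hcomp A rho phi"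
proof -
 have "\<forall>s \<in> S. \<exists>Pq. \<exists>p. is_fibre_product A (fst s) (snd s) C psi (fst Pq) p (snd Pq)"
  using fibre_product_exists[OF assms] by fastforce
 then obtain Pq where Pq: "!!s. s \<in> S ==> \<exists>p. is_fibre_product A (fst s) (snd s) C psi (fst (Pq s)) p (snd (Pq s))"
  by metis
 have base: "!!P q. (\<forall>(B, phi) \<in> S. \<exists>p. is_fibre_product A B phi C psi (P (B, phi)) p (q (B, phi))) ==>
    (\<lambda>s. (P s, q s)) ` S \<in> K C"
  using conjunct1[OF conjunct2[OF conjunct2[OF conjunct2[OF pretopologyD]]]] assms by blast
 let ?T = "(\<lambda>s. ((fst \<circ> Pq) s, (snd \<circ> Pq) s)) ` S"
 have T: "?T \<in> K C"
  by (rule base) (use Pq in fastforce)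
 show ?thesis
 proof (rule bexI[OF _ T], clarify)
  fix B phi assume s: "(B, phi) \<in> S"
  obtain p where p: "is_fibre_product A B phi C psi (fst (Pq (B, phi))) p (snd (Pq (B, phi)))"
   using Pq[OF s] by auto
  show "\<exists>(B', phi') \<in> S. \<exists>rho \<in> homs B' ((fst \<circ> Pq) (B, phi)).
   hcomp A ((snd \<circ> Pq) (B, phi)) psi = hcomp A rho phi'"
   by (rule bexI[OF _ s]) (use p in \<open>auto simp: is_fibre_product_def intro!: bexI[of _ p]\<close>)
 qed
qed

lemma cover_compose:
 assumes "A \<in> noeth" "S \<in> K A" "!!B phi. (B, phi) \<in> S ==> R B phi \<in> K B"
 shows "{(D, hcomp A chi phi) | B phi D chi. (B, phi) \<in> S \<and> (D, chi) \<in> R B phi} \<in> K A"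
proof -
 have "!!R. (\<forall>(B, phi) \<in> S. R (B, phi) \<in> K B) ==>
    {(D, hcomp A chi phi) | B phi D chi. (B, phi) \<in> S \<and> (D, chi) \<in> R (B, phi)} \<in> K A"
  using conjunct2[OF conjunct2[OF conjunct2[OF conjunct2[OF pretopologyD]]]] assms(1,2) by blast
 from this[of "\<lambda>(B, phi). R B phi"] show ?thesis using assms(3) by auto
qed

text \<open>Predicates on arrows replace families indexed by a covering. Arguments about common
  refinements then become logical rules: \<open>locally_pull\<close> for base change,
  \<open>locally_conj\<close> for common refinement, \<open>locally_locally\<close> for composition
  of coverings.\<close>

definition locally :: "'a ring => ('a ring => ('a => 'a) => bool) => bool" where
 "locally A Pr \<longleftrightarrow> (\<exists>Q \<in> K A. \<forall>(D, chi) \<in> Q. Pr D chi)"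

text \<open>A common refinement consists of composites with members of the given coverings, so
  combining two local statements requires that they survive restriction along a further
  morphism.\<close>

definition stable :: "'a ring => ('a ring => ('a => 'a) => bool) => bool" where
 "stable A Pr \<longleftrightarrow> (\<forall>D \<in> noeth. \<forall>chi \<in> homs A D. \<forall>E \<in> noeth. \<forall>rho \<in> homs D E.
  Pr D chi --> Pr E (hcomp A rho chi))"

lemma stableI:
 "(!!D chi E rho. D \<in> noeth ==> chi \<in> homs A D ==> E \<in> noeth ==> rho \<in> homs D E ==> Pr D chi ==>
  Pr E (hcomp A rho chi)) ==> stable A Pr"
 unfolding stable_def by blast

lemma stableD:
 "stable A Pr ==> D \<in> noeth ==> chi \<in> homs A D ==> E \<in> noeth ==> rho \<in> homs D E ==> Pr D chi ==>
  Pr E (hcomp A rho chi)"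
 unfolding stable_def by blast

lemma locally_mono:
 assumes "locally A Pr" "A \<in> noeth"
  "!!D chi. D \<in> noeth ==> chi \<in> homs A D ==> Pr D chi ==> Pr' D chi"
 shows "locally A Pr'"
proof -
 obtain Q where Q: "Q \<in> K A" "\<forall>(D, chi) \<in> Q. Pr D chi"
  using assms(1) unfolding locally_def by blast
 have "\<forall>(D, chi) \<in> Q. Pr' D chi"
  using Q cover_arrow[OF assms(2) Q(1)] assms(3) by blast
 then show ?thesis using Q unfolding locally_def by blast
qed

lemma locally_I: "A \<in> noeth ==> Pr A (id_hom A) ==> locally A Pr"
 unfolding locally_def by (rule bexI[OF _ cover_id]) auto

lemma locally_all:
 assumes "A \<in> noeth" "!!D chi. D \<in> noeth ==> chi \<in> homs A D ==> Pr D chi"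
 shows "locally A Pr"
 by (rule locally_I) (use assms id_hom_homs noeth_cring in blast)+

lemma locally_pull:
 assumes "locally A Pr" "stable A Pr" "A \<in> noeth" "C \<in> noeth" "psi \<in> homs A C"
 shows "locally C (\<lambda>D chi. Pr D (hcomp A chi psi))"
proof -
 obtain Q where Q: "Q \<in> K A" "\<forall>(D, chi) \<in> Q. Pr D chi"
  using assms(1) unfolding locally_def by blast
 obtain T where T: "T \<in> K C" "\<forall>(D, chi) \<in> T. \<exists>(B, phi) \<in> Q. \<exists>rho \<in> homs B D.
     hcomp A chi psi = hcomp A rho phi"
  using cover_base_change[OF assms(3) Q(1) assms(4,5)] by blast
 have "\<forall>(D, chi) \<in> T. Pr D (hcomp A chi psi)"
 proof clarify
  fix D chi assume DT: "(D, chi) \<in> T"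
  then obtain B phi rho where *: "(B, phi) \<in> Q" "rho \<in> homs B D"
   "hcomp A chi psi = hcomp A rho phi"
   using T(2) by blast
  have "Pr D (hcomp A rho phi)"
   by (rule stableD[OF assms(2), of B phi D rho])
    (use * Q cover_arrow[OF assms(3) Q(1)] cover_arrow[OF assms(4) T(1) DT] in blast)+
  then show "Pr D (hcomp A chi psi)" using * by simp
 qed
 then show ?thesis using T(1) unfolding locally_def by blast
qed

lemma locally_locally:
 assumes "locally A (\<lambda>B phi. locally B (\<lambda>D chi. Pr D (hcomp A chi phi)))" "A \<in> noeth"
 shows "locally A Pr"
proof -
 obtain Q where Q: "Q \<in> K A" "\<forall>(B, phi) \<in> Q. locally B (\<lambda>D chi. Pr D (hcomp A chi phi))"
  using assms(1) unfolding locally_def by blast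
 then have "\<forall>c \<in> Q. \<exists>R. R \<in> K (fst c) \<and> (\<forall>(D, chi) \<in> R. Pr D (hcomp A chi (snd c)))"
  unfolding locally_def by fastforce
 then obtain R where R: "!!c. c \<in> Q ==> R c \<in> K (fst c) \<and> (\<forall>(D, chi) \<in> R c. Pr D (hcomp A chi (snd c)))"
  by metis
 show ?thesis unfolding locally_def
  by (rule bexI[OF _ cover_compose[OF assms(2) Q(1), of "\<lambda>B phi. R (B, phi)"]]) (use R in fastforce)+
qed

lemma locally_cover:
 assumes "S \<in> K A" "A \<in> noeth"
  "!!B phi. (B, phi) \<in> S ==> locally B (\<lambda>D chi. Pr D (hcomp A chi phi))"
 shows "locally A Pr"
 by (rule locally_locally[OF _ assms(2)]) (use assms in \<open>auto simp: locally_def\<close>)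

lemma stable_conj: "stable A P1 ==> stable A P2 ==> stable A (\<lambda>D chi. P1 D chi \<and> P2 D chi)"
 unfolding stable_def by blast

text \<open>On each member of a covering for \<open>P1\<close> a covering for \<open>P2\<close> is
  pulled back and composed with it; stability carries \<open>P1\<close> to the composites.\<close>

lemma locally_conj:
 assumes "locally A P1" "stable A P1" "locally A P2" "stable A P2" "A \<in> noeth"
 shows "locally A (\<lambda>D chi. P1 D chi \<and> P2 D chi)"
proof (rule locally_locally[OF _ assms(5)], rule locally_mono[OF assms(1,5)])
 fix D chi assume D: "D \<in> noeth" "chi \<in> homs A D" "P1 D chi"
 show "locally D (\<lambda>E rho. P1 E (hcomp A rho chi) \<and> P2 E (hcomp A rho chi))"
  by (rule locally_mono[OF locally_pull[OF assms(3,4,5) D(1,2)]])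
   (use D stableD[OF assms(2)] in auto)
qed

end

section \<open>Local families and their values along morphisms\<close>

locale site_presheaf = site K for K :: "'a covers" +
 fixes F :: "('a, 'b) presheaf"
 assumes presheaf: "presheaf_of_rings F"
begin

lemma sec_cring: "A \<in> noeth ==> cring (sec F A)"
 using presheaf unfolding presheaf_of_rings_def by blast

lemma res_hom: "A \<in> noeth ==> B \<in> noeth ==> phi \<in> homs A B ==> res F A B phi \<in> ring_hom (sec F A) (sec F B)"
 using presheaf unfolding presheaf_of_rings_def by blast

lemma res_closed:
 "A \<in> noeth ==> B \<in> noeth ==> phi \<in> homs A B ==> x \<in> carrier (sec F A) ==> res F A B phi x \<in> carrier (sec F B)"
 using res_hom ring_hom_closed by metis

lemma res_id: "A \<in> noeth ==> x \<in> carrier (sec F A) ==> res F A A (id_hom A) x = x"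
 using presheaf unfolding presheaf_of_rings_def by blast

lemma res_comp: "A \<in> noeth ==> B \<in> noeth ==> C \<in> noeth ==> phi \<in> homs A B ==> psi \<in> homs B C ==>
 x \<in> carrier (sec F A) ==> res F A C (hcomp A psi phi) x = res F B C psi (res F A B phi x)"
 using presheaf unfolding presheaf_of_rings_def by blast

text \<open>Compatible families are constrained only on fibre products. Any two morphisms
  \<open>u\<close>, \<open>v\<close> that agree over \<open>A\<close> factor through a fibre product
  by its universal property, and restriction along the factorization gives the equality.\<close>

lemma compatibleD:
 assumes "A \<in> noeth" "S \<in> K A" "s \<in> compatible_families F A S" "(B, phi) \<in> S" "(C, psi) \<in> S"
  "D \<in> noeth" "u \<in> homs B D" "v \<in> homs C D" "hcomp A u phi = hcomp A v psi"
 shows "res F B D u (s (B, phi)) = res F C D v (s (C, psi))"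
proof -
 note B = cover_arrow[OF assms(1,2,4)] and C = cover_arrow[OF assms(1,2,5)]
 obtain P p q where P: "is_fibre_product A B phi C psi P p q"
  using fibre_product_exists[OF assms(1,2) C assms(4)] by blast
 then have pq: "P \<in> noeth" "p \<in> homs B P" "q \<in> homs C P" unfolding is_fibre_product_def by auto
 obtain w where w: "w \<in> homs P D" "hcomp B w p = u" "hcomp C w q = v"
  using P assms(6-9) unfolding is_fibre_product_def by metis
 have s: "s (B, phi) \<in> carrier (sec F B)" "s (C, psi) \<in> carrier (sec F C)"
  using assms(3,4,5) unfolding compatible_families_def PiE_def Pi_def by fastforce+
 have "res F B P p (s (B, phi)) = res F C P q (s (C, psi))"
  using assms(3,4,5) P unfolding compatible_families_def by fastforce
 then have "res F P D w (res F B P p (s (B, phi))) = res F P D w (res F C P q (s (C, psi)))" by simp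
 then show ?thesis using w pq B C s assms(6)
  by (metis res_comp)
qed

lemma compatibleI:
 assumes "s \<in> extensional S" "!!B phi. (B, phi) \<in> S ==> s (B, phi) \<in> carrier (sec F B)"
  "!!B phi C psi D u v. (B, phi) \<in> S ==> (C, psi) \<in> S ==> D \<in> noeth ==> u \<in> homs B D ==> v \<in> homs C D ==>
   hcomp A u phi = hcomp A v psi ==>
   res F B D u (s (B, phi)) = res F C D v (s (C, psi))"
 shows "s \<in> compatible_families F A S"
proof -
 have "s \<in> (\<Pi>\<^sub>E (B, phi) \<in> S. carrier (sec F B))"
  using assms(1,2) by (auto simp: PiE_def)
 moreover have "res F B P p (s (B, phi)) = res F C P q (s (C, psi))"
  if "(B, phi) \<in> S" "(C, psi) \<in> S" "is_fibre_product A B phi C psi P p q" for B phi C psi P p q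
  using that(3) by (intro assms(3)[OF that(1,2)]) (simp_all add: is_fibre_product_def)
 ultimately show ?thesis unfolding compatible_families_def by blast
qed

abbreviation (input) "LF \<equiv> local_families K F"
abbreviation (input) "hv \<equiv> has_value F"

lemma has_value_iff:
 "hv A (S, s) (D, chi) t \<longleftrightarrow>
  (\<exists>B phi rho. (B, phi) \<in> S \<and> rho \<in> homs B D \<and> chi = hcomp A rho phi \<and> t = res F B D rho (s (B, phi)))"
 unfolding has_value_def by fastforce

lemma local_family_val:
 assumes "(S, s) \<in> LF A" "(B, phi) \<in> S"
 shows "s (B, phi) \<in> carrier (sec F B)"
 using assms unfolding local_families_def compatible_families_def PiE_def Pi_def by fastforce

lemma has_value_closed:
 assumes "A \<in> noeth" "x \<in> LF A" "D \<in> noeth" "hv A x (D, chi) t"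
 shows "t \<in> carrier (sec F D)" "chi \<in> homs A D"
proof -
 obtain S s where x: "x = (S, s)" by force
 have S: "S \<in> K A" using assms(2) unfolding x local_families_def by auto
 obtain B phi rho where *: "(B, phi) \<in> S" "rho \<in> homs B D" "chi = hcomp A rho phi" "t = res F B D rho (s (B, phi))"
  using assms(4) unfolding x has_value_iff by blast
 note B = cover_arrow[OF assms(1) S *(1)]
 show "t \<in> carrier (sec F D)"
  using * B local_family_val[OF assms(2)[unfolded x] *(1)] assms res_closed by blast
 show "chi \<in> homs A D" using * B assms(1) by (simp add: homs_compose noeth_cring)
qed

lemma has_value_unique:
 assumes "A \<in> noeth" "x \<in> LF A" "D \<in> noeth" "hv A x (D, chi) t" "hv A x (D, chi) t'"
 shows "t = t'"
proof -
 obtain S s where x: "x = (S, s)" by force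
 have S: "S \<in> K A" "s \<in> compatible_families F A S" using assms(2) unfolding x local_families_def by auto
 show ?thesis using assms(4,5) compatibleD[OF assms(1) S _ _ assms(3)] unfolding x has_value_iff by metis
qed

lemma has_value_res:
 assumes "A \<in> noeth" "x \<in> LF A" "D \<in> noeth" "hv A x (D, chi) t" "E \<in> noeth" "sigma \<in> homs D E"
 shows "hv A x (E, hcomp A sigma chi) (res F D E sigma t)"
proof -
 obtain S s where x: "x = (S, s)" by force
 have S: "S \<in> K A" using assms(2) unfolding x local_families_def by auto
 obtain B phi rho where *: "(B, phi) \<in> S" "rho \<in> homs B D" "chi = hcomp A rho phi" "t = res F B D rho (s (B, phi))"
  using assms(4) unfolding x has_value_iff by blast
 note B = cover_arrow[OF assms(1) S *(1)]
 have "res F D E sigma t = res F B E (hcomp B sigma rho) (s (B, phi))"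
  using * B assms local_family_val[OF assms(2)[unfolded x] *(1)] by (simp add: res_comp)
 moreover have "hcomp A sigma chi = hcomp A (hcomp B sigma rho) phi"
  using * B by (simp add: homs_compose_assoc)
 moreover have "hcomp B sigma rho \<in> homs B E"
  using * B assms by (simp add: homs_compose noeth_cring)
 ultimately show ?thesis using * unfolding x has_value_iff by blast
qed

lemma has_value_member:
 assumes "A \<in> noeth" "(S, s) \<in> LF A" "(B, phi) \<in> S"
 shows "hv A (S, s) (B, phi) (s (B, phi))"
proof -
 have S: "S \<in> K A" using assms(2) unfolding local_families_def by auto
 note B = cover_arrow[OF assms(1) S assms(3)]
 show ?thesis unfolding has_value_iff
  using assms(3) B local_family_val[OF assms(2,3)]
  by (intro exI[of _ B] exI[of _ phi] exI[of _ "id_hom B"])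
   (simp add: id_hom_homs noeth_cring id_hom_compose res_id)
qed

lemma locally_has_value:
 assumes "A \<in> noeth" "x \<in> LF A"
 shows "locally A (\<lambda>D chi. \<exists>t. hv A x (D, chi) t)"
proof -
 obtain S s where x: "x = (S, s)" by force
 have S: "S \<in> K A" using assms(2) unfolding x local_families_def by auto
 show ?thesis unfolding locally_def
  by (rule bexI[OF _ S]) (use has_value_member[OF assms(1) assms(2)[unfolded x]] x in blast)
qed

text \<open>\<open>germ A x D chi t\<close>: the restriction along \<open>chi\<close> of the section of \<open>F\<^sup>+\<close> given by \<open>x\<close> is the image
 of \<open>t\<close>. Two local families define the same section iff they have the same germs.\<close>

definition germ :: "'a ring => ('a, 'b) local_family => 'a ring => ('a => 'a) => 'b => bool" where
 "germ A x D chi t \<longleftrightarrow> D \<in> noeth \<and> chi \<in> homs A D \<and> t \<in> carrier (sec F D) \<and>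
  locally D (\<lambda>E rho. hv A x (E, hcomp A rho chi) (res F D E rho t))"

lemma germD: "germ A x D chi t ==> D \<in> noeth \<and> chi \<in> homs A D \<and> t \<in> carrier (sec F D)"
 unfolding germ_def by blast

lemma has_value_germ:
 assumes "A \<in> noeth" "x \<in> LF A" "D \<in> noeth" "hv A x (D, chi) t"
 shows "germ A x D chi t"
 unfolding germ_def
 using assms has_value_closed[OF assms] has_value_res[OF assms] by (auto intro!: locally_all)

lemma stable_hv_res:
 assumes "A \<in> noeth" "x \<in> LF A" "D \<in> noeth" "chi \<in> homs A D" "t \<in> carrier (sec F D)"
 shows "stable D (\<lambda>E rho. hv A x (E, hcomp A rho chi) (res F D E rho t))"
proof (rule stableI)
 fix E rho E' sigma assume *: "E \<in> noeth" "rho \<in> homs D E" "E' \<in> noeth" "sigma \<in> homs E E'"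
  "hv A x (E, hcomp A rho chi) (res F D E rho t)"
 from has_value_res[OF assms(1,2) *(1,5,3,4)]
 show "hv A x (E', hcomp A (hcomp D sigma rho) chi) (res F D E' (hcomp D sigma rho) t)"
  using assms * by (simp add: res_comp homs_compose_assoc)
qed

lemma germ_res:
 assumes "A \<in> noeth" "x \<in> LF A" "germ A x D chi t" "E \<in> noeth" "sigma \<in> homs D E"
 shows "germ A x E (hcomp A sigma chi) (res F D E sigma t)"
proof -
 have D: "D \<in> noeth" "chi \<in> homs A D" "t \<in> carrier (sec F D)" using assms germD by auto
 have "locally E (\<lambda>E' rho. hv A x (E', hcomp A (hcomp D rho sigma) chi) (res F D E' (hcomp D rho sigma) t))"
  using assms(3) unfolding germ_def
  by (intro locally_pull[OF _ stable_hv_res[OF assms(1,2) D] D(1) assms(4,5)]) auto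
 then have "locally E (\<lambda>E' rho. hv A x (E', hcomp A rho (hcomp A sigma chi)) (res F E E' rho (res F D E sigma t)))"
  by (rule locally_mono[OF _ assms(4)]) (use assms D in \<open>simp add: res_comp homs_compose_assoc\<close>)
 then show ?thesis unfolding germ_def using assms D
  by (simp add: homs_compose noeth_cring res_closed)
qed

lemma germ_unique:
 assumes "A \<in> noeth" "x \<in> LF A" "germ A x D chi t" "germ A x D chi t'"
 shows "locally D (\<lambda>E rho. res F D E rho t = res F D E rho t')"
proof -
 have D: "D \<in> noeth" "chi \<in> homs A D" "t \<in> carrier (sec F D)" "t' \<in> carrier (sec F D)" using assms germD by auto
 have "locally D (\<lambda>E rho. hv A x (E, hcomp A rho chi) (res F D E rho t) \<and>
   hv A x (E, hcomp A rho chi) (res F D E rho t'))"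
  using assms(3,4) unfolding germ_def
  by (intro locally_conj stable_hv_res assms(1,2) D) auto
 then show ?thesis
  by (rule locally_mono[OF _ D(1)]) (use has_value_unique[OF assms(1,2)] in blast)
qed

lemma germ_local:
 assumes "A \<in> noeth" "x \<in> LF A" "D \<in> noeth" "chi \<in> homs A D" "t \<in> carrier (sec F D)"
  "locally D (\<lambda>E rho. germ A x E (hcomp A rho chi) (res F D E rho t))"
 shows "germ A x D chi t"
proof -
 have "locally D (\<lambda>E rho. hv A x (E, hcomp A rho chi) (res F D E rho t))"
 proof (rule locally_locally[OF _ assms(3)], rule locally_mono[OF assms(6,3)])
  fix E rho assume E: "E \<in> noeth" "rho \<in> homs D E" "germ A x E (hcomp A rho chi) (res F D E rho t)"
  show "locally E (\<lambda>E' sigma. hv A x (E', hcomp A (hcomp D sigma rho) chi)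
     (res F D E' (hcomp D sigma rho) t))"
   by (rule locally_mono[of E, OF conjunct2[OF conjunct2[OF conjunct2[OF E(3)[unfolded germ_def]]]] E(1)])
    (use assms E in \<open>simp add: res_comp homs_compose_assoc\<close>)
 qed
 then show ?thesis using assms unfolding germ_def by auto
qed

lemma germ_cong:
 assumes "A \<in> noeth" "x \<in> LF A" "germ A x D chi t" "t' \<in> carrier (sec F D)"
  "locally D (\<lambda>E rho. res F D E rho t = res F D E rho t')"
 shows "germ A x D chi t'"
proof -
 have D: "D \<in> noeth" "chi \<in> homs A D" "t \<in> carrier (sec F D)" using assms germD by auto
 show ?thesis
  by (rule germ_local[OF assms(1,2) D(1,2) assms(4)], rule locally_mono[OF assms(5) D(1)])
   (metis germ_res assms(1,2,3))
qed

lemma locally_germ: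
 assumes "A \<in> noeth" "x \<in> LF A"
 shows "locally A (\<lambda>D chi. \<exists>t. germ A x D chi t)"
 by (rule locally_mono[OF locally_has_value[OF assms] assms(1)]) (metis has_value_germ assms)

lemma stable_germ:
 assumes "A \<in> noeth" "x \<in> LF A"
 shows "stable A (\<lambda>D chi. \<exists>t. germ A x D chi t)"
 by (rule stableI) (use germ_res[OF assms] in blast)

text \<open>Agreement on one covering spreads to all germs. Pulled back to \<open>D\<close>, the
  given germ \<open>u\<close> of \<open>x\<close> and the common germ are two germs of the same
  section, hence locally equal by \<open>germ_unique\<close>, so \<open>u\<close> is locally a germ
  of \<open>y\<close> too; and being a germ is a local property.\<close>

lemma germ_eqI:
 assumes "A \<in> noeth" "x \<in> LF A" "y \<in> LF A" "locally A (\<lambda>D chi. \<exists>t. germ A x D chi t \<and> germ A y D chi t)"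
  "germ A x D chi u"
 shows "germ A y D chi u"
proof -
 have D: "D \<in> noeth" "chi \<in> homs A D" "u \<in> carrier (sec F D)" using assms germD by auto
 have st: "stable A (\<lambda>D chi. \<exists>t. germ A x D chi t \<and> germ A y D chi t)"
  by (rule stableI) (use germ_res[OF assms(1,2)] germ_res[OF assms(1,3)] in blast)
 have "locally D (\<lambda>E rho. \<exists>t. germ A x E (hcomp A rho chi) t \<and> germ A y E (hcomp A rho chi) t)"
  by (rule locally_pull[OF assms(4) st assms(1) D(1,2)])
 then have "locally D (\<lambda>E rho. germ A y E (hcomp A rho chi) (res F D E rho u))"
 proof (rule locally_mono[OF _ D(1)])
  fix E rho assume E: "E \<in> noeth" "rho \<in> homs D E"
   "\<exists>t. germ A x E (hcomp A rho chi) t \<and> germ A y E (hcomp A rho chi) t"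
  then obtain t where t: "germ A x E (hcomp A rho chi) t" "germ A y E (hcomp A rho chi) t" by blast
  have g: "germ A x E (hcomp A rho chi) (res F D E rho u)" by (rule germ_res[OF assms(1,2,5) E(1,2)])
  show "germ A y E (hcomp A rho chi) (res F D E rho u)"
   by (rule germ_cong[OF assms(1,3) t(2) _ germ_unique[OF assms(1,2) t(1) g]]) (use germD[OF g] in blast)
 qed
 then show ?thesis by (rule germ_local[OF assms(1,3) D])
qed

text \<open>Values exist only along morphisms that factor through a member of the representing
  covering, which makes transitivity awkward. Germs are insensitive to refinement; conversely a germ
  becomes a value on one further covering.\<close>

lemma plus_rel_iff:
 assumes "A \<in> noeth" "x \<in> LF A" "y \<in> LF A"
 shows "(x, y) \<in> plus_rel K F A \<longleftrightarrow> locally A (\<lambda>D chi. \<exists>t. germ A x D chi t \<and> germ A y D chi t)"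
  (is "?L \<longleftrightarrow> ?R")
proof
 assume ?L
 then have "locally A (\<lambda>D chi. \<exists>t. hv A x (D, chi) t \<and> hv A y (D, chi) t)"
  unfolding plus_rel_def locally_def by fastforce
 then show ?R
 proof (rule locally_mono[OF _ assms(1)])
  fix D chi assume D: "D \<in> noeth" "\<exists>t. hv A x (D, chi) t \<and> hv A y (D, chi) t"
  then obtain t where "hv A x (D, chi) t" "hv A y (D, chi) t" by blast
  then show "\<exists>t. germ A x D chi t \<and> germ A y D chi t"
   using has_value_germ[OF assms(1,2) D(1)] has_value_germ[OF assms(1,3) D(1)] by blast
 qed
next
 assume ?R
 then have "locally A (\<lambda>D chi. \<exists>t. hv A x (D, chi) t \<and> hv A y (D, chi) t)"
 proof (rule locally_locally[OF locally_mono[OF _ assms(1)] assms(1)])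
  fix D chi assume D: "D \<in> noeth" "chi \<in> homs A D" "\<exists>t. germ A x D chi t \<and> germ A y D chi t"
  then obtain t where t: "germ A x D chi t" "germ A y D chi t" by blast
  then have "locally D (\<lambda>E rho. hv A x (E, hcomp A rho chi) (res F D E rho t) \<and>
   hv A y (E, hcomp A rho chi) (res F D E rho t))"
   unfolding germ_def by (intro locally_conj stable_hv_res assms) auto
  then show "locally D (\<lambda>E rho. \<exists>t. hv A x (E, hcomp A rho chi) t \<and> hv A y (E, hcomp A rho chi) t)"
   by (rule locally_mono[OF _ D(1)]) auto
 qed
 then show ?L using assms unfolding plus_rel_def locally_def by fastforce
qed

text \<open>In this form the relation is an equivalence for purely formal reasons, which is how
  \<open>plus_rel_equiv\<close> obtains it.\<close>

lemma plus_rel_iff':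
 assumes "A \<in> noeth" "x \<in> LF A" "y \<in> LF A"
 shows "(x, y) \<in> plus_rel K F A \<longleftrightarrow> (\<forall>D chi t. germ A x D chi t \<longleftrightarrow> germ A y D chi t)"
  (is "?L \<longleftrightarrow> ?R")
proof
 assume ?L
 then have *: "locally A (\<lambda>D chi. \<exists>t. germ A x D chi t \<and> germ A y D chi t)"
  using plus_rel_iff[OF assms] by blast
 have **: "locally A (\<lambda>D chi. \<exists>t. germ A y D chi t \<and> germ A x D chi t)"
  by (rule locally_mono[OF * assms(1)]) blast
 show ?R using germ_eqI[OF assms *] germ_eqI[OF assms(1,3,2) **] by blast
next
 assume R: ?R
 have "locally A (\<lambda>D chi. \<exists>t. germ A x D chi t \<and> germ A y D chi t)"
  by (rule locally_mono[OF locally_germ[OF assms(1,2)] assms(1)]) (use R in blast)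
 then show ?L using plus_rel_iff[OF assms] by blast
qed

lemma plus_rel_subset: "plus_rel K F A \<subseteq> LF A \<times> LF A"
 unfolding plus_rel_def by auto

lemma plus_rel_equiv:
 assumes "A \<in> noeth"
 shows "equiv (LF A) (plus_rel K F A)"
proof (rule equivI)
 show "refl_on (LF A) (plus_rel K F A)"
  using plus_rel_iff'[OF assms] by (auto simp: refl_on_def)
 show "sym (plus_rel K F A)"
 proof (rule symI)
  fix x y assume xy: "(x, y) \<in> plus_rel K F A"
  then have "x \<in> LF A" "y \<in> LF A" using plus_rel_subset by blast+
  then show "(y, x) \<in> plus_rel K F A" using xy by (simp add: plus_rel_iff'[OF assms])
 qed
 show "trans (plus_rel K F A)"
 proof (rule transI)
  fix x y z assume xyz: "(x, y) \<in> plus_rel K F A" "(y, z) \<in> plus_rel K F A"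
  then have "x \<in> LF A" "y \<in> LF A" "z \<in> LF A" using plus_rel_subset by blast+
  then show "(x, z) \<in> plus_rel K F A" using xyz by (simp add: plus_rel_iff'[OF assms])
 qed
qed (use plus_rel_subset in auto)

section \<open>Sections of the plus construction seen through their germs\<close>

abbreviation (input) "PC A \<equiv> LF A // plus_rel K F A"

definition pgerm :: "'a ring => ('a, 'b) plus_el => 'a ring => ('a => 'a) => 'b => bool" where
 "pgerm A U D chi t \<longleftrightarrow> (\<exists>x \<in> U. germ A x D chi t)"

lemma plus_class:
 assumes "A \<in> noeth" "U \<in> PC A"
 obtains x where "x \<in> LF A" "U = plus_rel K F A `` {x}" "x \<in> U" "!!D chi t. pgerm A U D chi t \<longleftrightarrow> germ A x D chi t"
proof -
 obtain x where x: "x \<in> LF A" "U = plus_rel K F A `` {x}" using assms(2) by (rule quotientE)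
 have xU: "x \<in> U" using x equiv_class_self[OF plus_rel_equiv[OF assms(1)]] by simp
 have "pgerm A U D chi t \<longleftrightarrow> germ A x D chi t" for D chi t
 proof
  assume "pgerm A U D chi t"
  then obtain y where y: "(x, y) \<in> plus_rel K F A" "germ A y D chi t" unfolding pgerm_def x(2) by blast
  then show "germ A x D chi t" using plus_rel_iff'[OF assms(1) x(1)] plus_rel_subset by blast
 qed (use xU pgerm_def in blast)
 then show thesis using that x xU by blast
qed

lemma pgerm_eq_germ:
 assumes "A \<in> noeth" "U \<in> PC A"
 shows "\<exists>x \<in> LF A. pgerm A U = germ A x"
 by (rule plus_class[OF assms]) (auto intro!: bexI ext)

lemma plus_class_mem:
 assumes "A \<in> noeth" "U \<in> PC A" "z \<in> U"
 shows "z \<in> LF A" "pgerm A U D chi t \<longleftrightarrow> germ A z D chi t"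
proof -
 obtain x where x: "x \<in> LF A" "U = plus_rel K F A `` {x}" "!!D chi t. pgerm A U D chi t \<longleftrightarrow> germ A x D chi t"
  by (rule plus_class[OF assms(1,2)]) blast
 have *: "(x, z) \<in> plus_rel K F A" using assms(3) x by auto
 then show "z \<in> LF A" using plus_rel_subset by blast
 then show "pgerm A U D chi t \<longleftrightarrow> germ A z D chi t" using plus_rel_iff'[OF assms(1) x(1)] * x(3) by blast
qed

lemma pgermD: "A \<in> noeth ==> U \<in> PC A ==> pgerm A U D chi t ==> D \<in> noeth \<and> chi \<in> homs A D \<and> t \<in> carrier (sec F D)"
 unfolding pgerm_def using germD by blast

lemma pgerm_res:
 assumes "A \<in> noeth" "U \<in> PC A" "pgerm A U D chi t" "E \<in> noeth" "sigma \<in> homs D E"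
 shows "pgerm A U E (hcomp A sigma chi) (res F D E sigma t)"
 using pgerm_eq_germ[OF assms(1,2)] germ_res[OF assms(1) _ _ assms(4,5)] assms(3) by auto

lemma pgerm_unique:
 assumes "A \<in> noeth" "U \<in> PC A" "pgerm A U D chi t" "pgerm A U D chi t'"
 shows "locally D (\<lambda>E rho. res F D E rho t = res F D E rho t')"
 using pgerm_eq_germ[OF assms(1,2)] germ_unique[OF assms(1)] assms(3,4) by auto

lemma locally_pgerm:
 assumes "A \<in> noeth" "U \<in> PC A"
 shows "locally A (\<lambda>D chi. \<exists>t. pgerm A U D chi t)"
 using pgerm_eq_germ[OF assms] locally_germ[OF assms(1)] by auto

lemma stable_pgerm:
 assumes "A \<in> noeth" "U \<in> PC A"
 shows "stable A (\<lambda>D chi. \<exists>t. pgerm A U D chi t)"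
 by (rule stableI) (use pgerm_res[OF assms] in blast)

lemma plus_eqI:
 assumes "A \<in> noeth" "U \<in> PC A" "V \<in> PC A" "locally A (\<lambda>D chi. \<exists>t. pgerm A U D chi t \<and> pgerm A V D chi t)"
 shows "U = V"
proof -
 obtain x where x: "x \<in> LF A" "U = plus_rel K F A `` {x}" "!!D chi t. pgerm A U D chi t \<longleftrightarrow> germ A x D chi t"
  by (rule plus_class[OF assms(1,2)]) blast
 obtain y where y: "y \<in> LF A" "V = plus_rel K F A `` {y}" "!!D chi t. pgerm A V D chi t \<longleftrightarrow> germ A y D chi t"
  by (rule plus_class[OF assms(1,3)]) blast
 have "(x, y) \<in> plus_rel K F A"
  using plus_rel_iff[OF assms(1) x(1) y(1)] assms(4) unfolding x(3) y(3) by simp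
 then show ?thesis using x(2) y(2) equiv_class_eq[OF plus_rel_equiv[OF assms(1)]] by blast
qed

text \<open>The operations and restrictions of the plus construction are defined as sets of families
  that satisfy a local condition. As soon as one family \<open>z0\<close> realizes the condition
  \<open>Pr\<close>, the set is the class of \<open>z0\<close>; since \<open>Pr\<close> mentions no
  representatives, well-definedness is included.\<close>

lemma plus_classI:
 assumes "A \<in> noeth" "z0 \<in> LF A" "U \<subseteq> LF A"
  "!!z. z \<in> LF A ==> z \<in> U \<longleftrightarrow> locally A (\<lambda>D chi. \<exists>t. Pr D chi t \<and> germ A z D chi t)"
  "!!D chi t. D \<in> noeth ==> chi \<in> homs A D ==> Pr D chi t ==> germ A z0 D chi t"
  "locally A (\<lambda>D chi. \<exists>t. Pr D chi t)"
 shows "U \<in> PC A" "D \<in> noeth ==> chi \<in> homs A D ==> Pr D chi t ==> pgerm A U D chi t"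
proof -
 have z0: "z0 \<in> U" unfolding assms(4)[OF assms(2)]
  by (rule locally_mono[OF assms(6,1)]) (use assms(5) in blast)
 have mem: "z \<in> U \<longleftrightarrow> (z0, z) \<in> plus_rel K F A" if z: "z \<in> LF A" for z
 proof
  assume "z \<in> U"
  then have "locally A (\<lambda>D chi. \<exists>t. Pr D chi t \<and> germ A z D chi t)" using assms(4)[OF z] by blast
  then show "(z0, z) \<in> plus_rel K F A" unfolding plus_rel_iff[OF assms(1,2) z]
   by (rule locally_mono[OF _ assms(1)]) (use assms(5) in blast)
 next
  assume *: "(z0, z) \<in> plus_rel K F A"
  show "z \<in> U" unfolding assms(4)[OF z]
   by (rule locally_mono[OF assms(6,1)])
    (use assms(5) *[unfolded plus_rel_iff'[OF assms(1,2) z]] in blast)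
 qed
 then have "U = plus_rel K F A `` {z0}" using assms(3) plus_rel_subset by blast
 then show "U \<in> PC A" using assms(2) by (simp add: quotientI)
 show "pgerm A U D chi t" if "D \<in> noeth" "chi \<in> homs A D" "Pr D chi t"
  using that assms(5) z0 unfolding pgerm_def by blast
qed

text \<open>All sections of the plus construction that have to be built come from here. A partial
  assignment that is single-valued, stable under restriction and defined on some covering is a local
  family: choose its values on that covering, and single-valuedness makes the choices
  compatible.\<close>

lemma glue_family:
 assumes A: "A \<in> noeth"
  and carr: "!!D chi t. D \<in> noeth ==> chi \<in> homs A D ==> Pr D chi t ==> t \<in> carrier (sec F D)"
  and stab: "!!D chi t E rho. D \<in> noeth ==> chi \<in> homs A D ==> Pr D chi t ==> E \<in> noeth ==> rho \<in> homs D E ==>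
    Pr E (hcomp A rho chi) (res F D E rho t)"
  and uniq: "!!D chi t t'. D \<in> noeth ==> chi \<in> homs A D ==> Pr D chi t ==> Pr D chi t' ==> t = t'"
  and ex: "locally A (\<lambda>D chi. \<exists>t. Pr D chi t)"
 shows "\<exists>z \<in> LF A. \<forall>D \<in> noeth. \<forall>chi \<in> homs A D. \<forall>t. Pr D chi t --> germ A z D chi t"
proof -
 obtain Q where Q: "Q \<in> K A" "\<forall>(D, chi) \<in> Q. \<exists>t. Pr D chi t"
  using ex unfolding locally_def by blast
 define s where "s = (\<lambda>c \<in> Q. SOME t. Pr (fst c) (snd c) t)"
 have s: "Pr D chi (s (D, chi))" if "(D, chi) \<in> Q" for D chi
 proof -
  have "\<exists>t. Pr D chi t" using Q(2) that by blast
  then show ?thesis using that by (simp add: s_def someI_ex)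
 qed
 note arr = cover_arrow[OF A Q(1)]
 have z: "(Q, s) \<in> LF A"
  unfolding local_families_def using Q(1)
 proof (auto, intro compatibleI)
  show "s \<in> extensional Q" by (simp add: s_def)
  show "s (B, phi) \<in> carrier (sec F B)" if "(B, phi) \<in> Q" for B phi
   using s[OF that] arr[OF that] carr by blast
  fix B phi C psi D u v
  assume *: "(B, phi) \<in> Q" "(C, psi) \<in> Q" "D \<in> noeth" "u \<in> homs B D" "v \<in> homs C D"
   "hcomp A u phi = hcomp A v psi"
  have "Pr D (hcomp A u phi) (res F B D u (s (B, phi)))"
   by (intro stab s) (use * arr in auto)
  moreover have "Pr D (hcomp A v psi) (res F C D v (s (C, psi)))"
   by (intro stab s) (use * arr in auto)
  moreover have "hcomp A u phi \<in> homs A D"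
   by (rule homs_compose[OF noeth_cring[OF A]]) (use * arr in auto)
  ultimately show "res F B D u (s (B, phi)) = res F C D v (s (C, psi))"
   using uniq[OF *(3)] *(6) by simp
 qed
 have hvPr: "Pr D chi t" if D: "D \<in> noeth" and hvt: "hv A (Q, s) (D, chi) t" for D chi t
 proof -
  obtain B phi rho where *: "(B, phi) \<in> Q" "rho \<in> homs B D" "chi = hcomp A rho phi" "t = res F B D rho (s (B, phi))"
   using hvt unfolding has_value_iff by blast
  show ?thesis unfolding * by (intro stab s) (use * D arr in auto)
 qed
 have "germ A (Q, s) D chi t" if D: "D \<in> noeth" "chi \<in> homs A D" "Pr D chi t" for D chi t
  unfolding germ_def
 proof (intro conjI D carr[OF D])
  have "locally D (\<lambda>E rho. \<exists>t. hv A (Q, s) (E, hcomp A rho chi) t)"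
   by (rule locally_pull[OF locally_has_value[OF A z] _ A D(1,2)])
    (rule stableI, use has_value_res[OF A z] in blast)
  then show "locally D (\<lambda>E rho. hv A (Q, s) (E, hcomp A rho chi) (res F D E rho t))"
  proof (rule locally_mono[OF _ D(1)])
   fix E rho assume E: "E \<in> noeth" "rho \<in> homs D E" "\<exists>t. hv A (Q, s) (E, hcomp A rho chi) t"
   then obtain t' where t': "hv A (Q, s) (E, hcomp A rho chi) t'" by blast
   have "t' = res F D E rho t"
    by (rule uniq[OF E(1) _ hvPr[OF E(1) t'] stab[OF D E(1,2)]])
     (use A D E in \<open>simp add: homs_compose noeth_cring\<close>)
   then show "hv A (Q, s) (E, hcomp A rho chi) (res F D E rho t)" using t' by simp
  qed
 qed
 then show ?thesis using z by blast
qed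

lemma plus_op_aux:
 assumes A: "A \<in> noeth" and U: "U \<in> PC A" and V: "V \<in> PC A"
  and clo: "!!D a b. D \<in> noeth ==> a \<in> carrier (sec F D) ==> b \<in> carrier (sec F D) ==> f (sec F D) a b \<in> carrier (sec F D)"
  and nat: "!!D E rho a b. D \<in> noeth ==> E \<in> noeth ==> rho \<in> homs D E ==> a \<in> carrier (sec F D) ==> b \<in> carrier (sec F D) ==>
   res F D E rho (f (sec F D) a b) = f (sec F E) (res F D E rho a) (res F D E rho b)"
 shows plus_op_closed: "plus_op K F f A U V \<in> PC A"
  and pgerm_plus_op: "pgerm A U D chi a ==> pgerm A V D chi b ==> pgerm A (plus_op K F f A U V) D chi (f (sec F D) a b)"
proof -
 obtain x where x: "x \<in> LF A" "x \<in> U" "!!D chi t. pgerm A U D chi t \<longleftrightarrow> germ A x D chi t"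
  by (rule plus_class[OF A U]) blast
 obtain y where y: "y \<in> LF A" "y \<in> V" "!!D chi t. pgerm A V D chi t \<longleftrightarrow> germ A y D chi t"
  by (rule plus_class[OF A V]) blast
 \<comment> \<open>The representative is glued from values of \<open>x\<close> and \<open>y\<close>.
   Values are unique, whereas germs in a presheaf that need not be separated are unique only
   locally, so \<open>glue_family\<close> does not apply to them.\<close>
 define Ph where "Ph = (\<lambda>D chi t. \<exists>a b. hv A x (D, chi) a \<and> hv A y (D, chi) b \<and> t = f (sec F D) a b)"
 have "\<exists>z \<in> LF A. \<forall>D \<in> noeth. \<forall>chi \<in> homs A D. \<forall>t. Ph D chi t --> germ A z D chi t"
 proof (rule glue_family[OF A])
  fix D chi t assume D: "D \<in> noeth" "chi \<in> homs A D" "Ph D chi t"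
  then obtain a b where ab: "hv A x (D, chi) a" "hv A y (D, chi) b" "t = f (sec F D) a b" unfolding Ph_def by blast
  note cl = has_value_closed(1)[OF A x(1) D(1) ab(1)] has_value_closed(1)[OF A y(1) D(1) ab(2)]
  show "t \<in> carrier (sec F D)" unfolding ab(3) by (rule clo[OF D(1) cl])
  show "Ph E (hcomp A rho chi) (res F D E rho t)" if "E \<in> noeth" "rho \<in> homs D E" for E rho
   unfolding Ph_def ab(3) nat[OF D(1) that cl]
   using has_value_res[OF A x(1) D(1) ab(1) that] has_value_res[OF A y(1) D(1) ab(2) that] by blast
  show "t = t'" if "Ph D chi t'" for t'
   using that ab has_value_unique[OF A x(1) D(1) ab(1)] has_value_unique[OF A y(1) D(1) ab(2)]
   unfolding Ph_def by blast
 next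
  have sx: "stable A (\<lambda>D chi. \<exists>t. hv A x (D, chi) t)" and sy: "stable A (\<lambda>D chi. \<exists>t. hv A y (D, chi) t)"
   by (rule stableI, use has_value_res[OF A x(1)] has_value_res[OF A y(1)] in blast)+
  show "locally A (\<lambda>D chi. \<exists>t. Ph D chi t)"
   by (rule locally_mono[OF locally_conj[OF locally_has_value[OF A x(1)] sx locally_has_value[OF A y(1)] sy A] A])
    (unfold Ph_def, blast)
 qed
 then obtain z0 where z0: "z0 \<in> LF A" "!!D chi t. D \<in> noeth ==> chi \<in> homs A D ==> Ph D chi t ==> germ A z0 D chi t"
  by blast
 \<comment> \<open>The same condition with germs in place of values. It no longer depends on the
   representatives \<open>x\<close> and \<open>y\<close>, and a germ is locally a value, so
   \<open>z0\<close> realizes it as well.\<close>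
 define Pr where "Pr = (\<lambda>D chi t. \<exists>a b. germ A x D chi a \<and> germ A y D chi b \<and> t = f (sec F D) a b)"
 have Prz0: "germ A z0 D chi t" if D: "D \<in> noeth" "chi \<in> homs A D" "Pr D chi t" for D chi t
 proof -
  obtain a b where ab: "germ A x D chi a" "germ A y D chi b" "t = f (sec F D) a b" using D(3) unfolding Pr_def by blast
  have cl: "a \<in> carrier (sec F D)" "b \<in> carrier (sec F D)" using germD ab by auto
  have "locally D (\<lambda>E rho. hv A x (E, hcomp A rho chi) (res F D E rho a) \<and>
   hv A y (E, hcomp A rho chi) (res F D E rho b))"
   using ab(1,2) unfolding germ_def by (intro locally_conj stable_hv_res A x(1) y(1)) auto
  then have "locally D (\<lambda>E rho. germ A z0 E (hcomp A rho chi) (res F D E rho t))"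
  proof (rule locally_mono[OF _ D(1)])
   fix E rho assume E: "E \<in> noeth" "rho \<in> homs D E" and
    h: "hv A x (E, hcomp A rho chi) (res F D E rho a) \<and> hv A y (E, hcomp A rho chi) (res F D E rho b)"
   show "germ A z0 E (hcomp A rho chi) (res F D E rho t)"
   proof (rule z0(2)[OF E(1)])
    show "hcomp A rho chi \<in> homs A E" using E D A by (simp add: homs_compose noeth_cring)
    show "Ph E (hcomp A rho chi) (res F D E rho t)"
     unfolding Ph_def ab(3) nat[OF D(1) E cl] using h by blast
   qed
  qed
  moreover have "t \<in> carrier (sec F D)" unfolding ab(3) by (rule clo[OF D(1) cl])
  ultimately show ?thesis using germ_local[OF A z0(1) D(1,2)] by blast
 qed
 have st: "stable A (\<lambda>D chi. \<exists>t. germ A x D chi t)" "stable A (\<lambda>D chi. \<exists>t. germ A y D chi t)"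
  by (rule stable_germ[OF A x(1)], rule stable_germ[OF A y(1)])
 have Prex: "locally A (\<lambda>D chi. \<exists>t. Pr D chi t)"
  by (rule locally_mono[OF locally_conj[OF locally_germ[OF A x(1)] st(1) locally_germ[OF A y(1)] st(2) A] A])
    (unfold Pr_def, blast)
 let ?P = "plus_op K F f A U V"
 have sub: "?P \<subseteq> LF A" unfolding plus_op_def by blast
 have mem: "z \<in> ?P \<longleftrightarrow> locally A (\<lambda>D chi. \<exists>t. Pr D chi t \<and> germ A z D chi t)" if z: "z \<in> LF A" for z
 proof
  assume "z \<in> ?P"
  then obtain x' y' Q where *: "x' \<in> U" "y' \<in> V" "Q \<in> K A" "\<forall>c \<in> Q. \<exists>a b.
    hv A x' c a \<and> hv A y' c b \<and> hv A z c (f (sec F (fst c)) a b)" unfolding plus_op_def by blast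
  have x': "x' \<in> LF A" "!!D chi t. germ A x D chi t \<longleftrightarrow> germ A x' D chi t"
   using plus_class_mem[OF A U *(1)] x(3) by auto
  have y': "y' \<in> LF A" "!!D chi t. germ A y D chi t \<longleftrightarrow> germ A y' D chi t"
   using plus_class_mem[OF A V *(2)] y(3) by auto
  have "locally A (\<lambda>D chi. \<exists>a b. hv A x' (D, chi) a \<and> hv A y' (D, chi) b \<and> hv A z (D, chi) (f (sec F D) a b))"
   unfolding locally_def using *(3,4) by fastforce
  then show "locally A (\<lambda>D chi. \<exists>t. Pr D chi t \<and> germ A z D chi t)"
  proof (rule locally_mono[OF _ A])
   fix D chi assume D: "D \<in> noeth" and "\<exists>a b. hv A x' (D, chi) a \<and> hv A y' (D, chi) b \<and> hv A z (D, chi) (f (sec F D) a b)"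
   then obtain a b where "hv A x' (D, chi) a" "hv A y' (D, chi) b" "hv A z (D, chi) (f (sec F D) a b)" by blast
   from this[THEN has_value_germ[OF A _ D, rotated]] x'(1) y'(1) z
   show "\<exists>t. Pr D chi t \<and> germ A z D chi t" unfolding Pr_def x'(2) y'(2) by blast
  qed
 next
  assume "locally A (\<lambda>D chi. \<exists>t. Pr D chi t \<and> germ A z D chi t)"
  then have "locally A (\<lambda>D chi. \<exists>a b. hv A x (D, chi) a \<and> hv A y (D, chi) b \<and> hv A z (D, chi) (f (sec F D) a b))"
  proof (rule locally_locally[OF locally_mono[OF _ A] A])
   fix D chi assume D: "D \<in> noeth" "chi \<in> homs A D" "\<exists>t. Pr D chi t \<and> germ A z D chi t"
   then obtain a b where ab: "germ A x D chi a" "germ A y D chi b" "germ A z D chi (f (sec F D) a b)"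
    unfolding Pr_def by blast
   have cl: "a \<in> carrier (sec F D)" "b \<in> carrier (sec F D)" using germD ab by auto
   have "locally D (\<lambda>E rho. hv A x (E, hcomp A rho chi) (res F D E rho a) \<and>
    hv A y (E, hcomp A rho chi) (res F D E rho b))"
    using ab(1,2) unfolding germ_def by (intro locally_conj stable_hv_res A x(1) y(1)) auto
   then have "locally D (\<lambda>E rho. (hv A x (E, hcomp A rho chi) (res F D E rho a) \<and>
    hv A y (E, hcomp A rho chi) (res F D E rho b)) \<and>
    hv A z (E, hcomp A rho chi) (res F D E rho (f (sec F D) a b)))"
    using ab(3) unfolding germ_def
    by (intro locally_conj[OF _ stable_conj[OF stable_hv_res[OF A x(1) D(1,2) cl(1)] stable_hv_res[OF A y(1) D(1,2) cl(2)]] _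
       stable_hv_res[OF A z D(1,2)] D(1)]) auto
   then show "locally D (\<lambda>E rho. \<exists>a b. hv A x (E, hcomp A rho chi) a \<and>
     hv A y (E, hcomp A rho chi) b \<and> hv A z (E, hcomp A rho chi) (f (sec F E) a b))"
    by (rule locally_mono[OF _ D(1)]) (use nat[OF D(1) _ _ cl] in auto)
  qed
  then show "z \<in> ?P" unfolding plus_op_def locally_def using z x(2) y(2) by fastforce
 qed
 note res = plus_classI[of A z0 ?P Pr, OF A z0(1) sub mem Prz0 Prex]
 show "?P \<in> PC A" by (rule res(1))
 show "pgerm A ?P D chi (f (sec F D) a b)" if ab: "pgerm A U D chi a" "pgerm A V D chi b"
  by (rule res(2)) (use pgermD[OF A U ab(1)] ab x(3) y(3) in \<open>auto simp: Pr_def\<close>)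
qed

lemma plus_unit_aux:
 assumes A: "A \<in> noeth" and a: "a \<in> carrier (sec F A)"
 shows plus_unit_closed: "plus_unit K F A a \<in> PC A"
  and pgerm_plus_unit: "D \<in> noeth ==> chi \<in> homs A D ==> pgerm A (plus_unit K F A a) D chi (res F A D chi a)"
proof -
 let ?s = "\<lambda>_ \<in> {(A, id_hom A)}. a"
 let ?z = "({(A, id_hom A)}, ?s)"
 have z: "?z \<in> LF A"
  unfolding local_families_def using cover_id[OF A]
 proof (auto, intro compatibleI)
  fix B phi C psi D u v
  assume *: "(B, phi) \<in> {(A, id_hom A)}" "(C, psi) \<in> {(A, id_hom A)}" "D \<in> noeth" "u \<in> homs B D" "v \<in> homs C D"
   "hcomp A u phi = hcomp A v psi"
  then have "u = v" using compose_id_hom[of u A D] compose_id_hom[of v A D] by auto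
  then show "res F B D u (?s (B, phi)) = res F C D v (?s (C, psi))" using * by auto
 qed (use a in auto)
 show P: "plus_unit K F A a \<in> PC A" unfolding plus_unit_def using z by (rule quotientI)
 have zP: "?z \<in> plus_unit K F A a"
  unfolding plus_unit_def by (rule equiv_class_self[OF plus_rel_equiv[OF A] z])
 show "pgerm A (plus_unit K F A a) D chi (res F A D chi a)" if D: "D \<in> noeth" "chi \<in> homs A D"
 proof -
  have "hv A ?z (D, chi) (res F A D chi a)"
   unfolding has_value_iff using D compose_id_hom[of chi A D] by auto
  then show ?thesis using has_value_germ[OF A z D(1)] zP unfolding pgerm_def by blast
 qed
qed

lemma plus_res_aux:
 assumes A: "A \<in> noeth" and U: "U \<in> PC A" and C: "C \<in> noeth" "psi \<in> homs A C"
 shows plus_res_closed: "res (plus_presheaf K F) A C psi U \<in> PC C"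
  and pgerm_plus_res: "chi \<in> homs C D ==> pgerm A U D (hcomp A chi psi) t ==> pgerm C (res (plus_presheaf K F) A C psi U) D chi t"
proof -
 obtain x where x: "x \<in> LF A" "x \<in> U" "!!D chi t. pgerm A U D chi t \<longleftrightarrow> germ A x D chi t"
  by (rule plus_class[OF A U]) blast
 let ?P = "res (plus_presheaf K F) A C psi U"
 have P: "?P = {z \<in> LF C. \<exists>x \<in> U. locally C (\<lambda>D chi. \<exists>t. hv A x (D, hcomp A chi psi) t \<and> hv C z (D, chi) t)}"
  unfolding plus_presheaf_def locally_def by simp
 have comp: "hcomp A chi psi \<in> homs A D" if "chi \<in> homs C D" for D chi
  using homs_compose[OF noeth_cring[OF A] C(2) that] .
 have assoc: "hcomp A rho (hcomp A chi psi) = hcomp A (hcomp C rho chi) psi" for rho chi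
  by (rule homs_compose_assoc[OF C(2)])
 define Ph where "Ph = (\<lambda>D chi t. hv A x (D, hcomp A chi psi) t)"
 have Phex: "locally C (\<lambda>D chi. \<exists>t. Ph D chi t)" unfolding Ph_def
  by (rule locally_pull[OF locally_has_value[OF A x(1)] _ A C])
    (rule stableI, use has_value_res[OF A x(1)] in blast)
 have "\<exists>z \<in> LF C. \<forall>D \<in> noeth. \<forall>chi \<in> homs C D. \<forall>t. Ph D chi t --> germ C z D chi t"
 proof (rule glue_family[OF C(1) _ _ _ Phex])
  fix D chi t assume D: "D \<in> noeth" "chi \<in> homs C D" "Ph D chi t"
  show "t \<in> carrier (sec F D)" using D(3) has_value_closed(1)[OF A x(1) D(1)] unfolding Ph_def by blast
  show "Ph E (hcomp C rho chi) (res F D E rho t)" if "E \<in> noeth" "rho \<in> homs D E" for E rho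
   using has_value_res[OF A x(1) D(1) D(3)[unfolded Ph_def] that] unfolding Ph_def assoc .
  show "t = t'" if "Ph D chi t'" for t'
   using that D(3) has_value_unique[OF A x(1) D(1)] unfolding Ph_def by blast
 qed
 then obtain z0 where z0: "z0 \<in> LF C" "!!D chi t. D \<in> noeth ==> chi \<in> homs C D ==> Ph D chi t ==> germ C z0 D chi t"
  by blast
 define Pr where "Pr = (\<lambda>D chi t. germ A x D (hcomp A chi psi) t)"
 have Prz0: "germ C z0 D chi t" if D: "D \<in> noeth" "chi \<in> homs C D" "Pr D chi t" for D chi t
 proof (rule germ_local[OF C(1) z0(1) D(1,2)])
  note g = D(3)[unfolded Pr_def germ_def assoc]
  show "t \<in> carrier (sec F D)" using g by blast
  have "locally D (\<lambda>E rho. hv A x (E, hcomp A (hcomp C rho chi) psi) (res F D E rho t))" using g by blast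
  then show "locally D (\<lambda>E rho. germ C z0 E (hcomp C rho chi) (res F D E rho t))"
  proof (rule locally_mono[OF _ D(1)])
   fix E rho assume E: "E \<in> noeth" "rho \<in> homs D E" "hv A x (E, hcomp A (hcomp C rho chi) psi) (res F D E rho t)"
   have c: "hcomp C rho chi \<in> homs C E" by (rule homs_compose[OF noeth_cring[OF C(1)] D(2) E(2)])
   have "Ph E (hcomp C rho chi) (res F D E rho t)" using E(3) by (simp only: Ph_def)
   then show "germ C z0 E (hcomp C rho chi) (res F D E rho t)" by (rule z0(2)[OF E(1) c])
  qed
 qed
 have Prex: "locally C (\<lambda>D chi. \<exists>t. Pr D chi t)"
  unfolding Pr_def by (rule locally_pull[OF locally_germ[OF A x(1)] stable_germ[OF A x(1)] A C])
 have sub: "?P \<subseteq> LF C" unfolding P by blast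
 have mem: "z \<in> ?P \<longleftrightarrow> locally C (\<lambda>D chi. \<exists>t. Pr D chi t \<and> germ C z D chi t)" if z: "z \<in> LF C" for z
 proof
  assume "z \<in> ?P"
  then obtain x' where *: "x' \<in> U" "locally C (\<lambda>D chi. \<exists>t. hv A x' (D, hcomp A chi psi) t \<and> hv C z (D, chi) t)"
   unfolding P by blast
  have x': "x' \<in> LF A" "!!D chi t. germ A x D chi t \<longleftrightarrow> germ A x' D chi t"
   using plus_class_mem[OF A U *(1)] x(3) by auto
  show "locally C (\<lambda>D chi. \<exists>t. Pr D chi t \<and> germ C z D chi t)"
   by (rule locally_mono[OF *(2) C(1)])
   (use has_value_germ[OF A x'(1)] has_value_germ[OF C(1) z] in \<open>unfold Pr_def x'(2), blast\<close>)
 next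
  assume "locally C (\<lambda>D chi. \<exists>t. Pr D chi t \<and> germ C z D chi t)"
  then have "locally C (\<lambda>D chi. \<exists>t. hv A x (D, hcomp A chi psi) t \<and> hv C z (D, chi) t)"
  proof (rule locally_locally[OF locally_mono[OF _ C(1)] C(1)])
   fix D chi assume D: "D \<in> noeth" "chi \<in> homs C D" "\<exists>t. Pr D chi t \<and> germ C z D chi t"
   then obtain t where t: "germ A x D (hcomp A chi psi) t" "germ C z D chi t"
    unfolding Pr_def by blast
   then have "locally D (\<lambda>E rho. hv A x (E, hcomp A rho (hcomp A chi psi)) (res F D E rho t) \<and>
    hv C z (E, hcomp C rho chi) (res F D E rho t))"
    unfolding germ_def by (intro locally_conj stable_hv_res A x(1) C z) auto
   then show "locally D (\<lambda>E rho. \<exists>t. hv A x (E, hcomp A (hcomp C rho chi) psi) t \<and>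
     hv C z (E, hcomp C rho chi) t)"
    by (rule locally_mono[OF _ D(1)]) (unfold assoc, blast)
  qed
  then show "z \<in> ?P" unfolding P using z x(2) by blast
 qed
 note r = plus_classI[of C z0 ?P Pr, OF C(1) z0(1) sub mem Prz0 Prex]
 show "?P \<in> PC C" by (rule r(1))
 show "pgerm C ?P D chi t" if ab: "chi \<in> homs C D" "pgerm A U D (hcomp A chi psi) t"
  by (rule r(2)) (use pgermD[OF A U ab(2)] ab x(3) in \<open>auto simp: Pr_def\<close>)
qed

lemma glue_plus:
 assumes A: "A \<in> noeth"
  and "!!D chi t. D \<in> noeth ==> chi \<in> homs A D ==> Pr D chi t ==> t \<in> carrier (sec F D)"
  and "!!D chi t E rho. D \<in> noeth ==> chi \<in> homs A D ==> Pr D chi t ==> E \<in> noeth ==> rho \<in> homs D E ==>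
    Pr E (hcomp A rho chi) (res F D E rho t)"
  and "!!D chi t t'. D \<in> noeth ==> chi \<in> homs A D ==> Pr D chi t ==> Pr D chi t' ==> t = t'"
  and "locally A (\<lambda>D chi. \<exists>t. Pr D chi t)"
 shows "\<exists>U \<in> PC A. \<forall>D \<in> noeth. \<forall>chi \<in> homs A D. \<forall>t. Pr D chi t --> pgerm A U D chi t"
proof -
 have "\<exists>z \<in> LF A. \<forall>D \<in> noeth. \<forall>chi \<in> homs A D. \<forall>t. Pr D chi t --> germ A z D chi t"
  by (rule glue_family[where Pr = Pr]; fact assms)
 then obtain z where z: "z \<in> LF A" "\<forall>D \<in> noeth. \<forall>chi \<in> homs A D. \<forall>t. Pr D chi t --> germ A z D chi t"
  by blast
 have "z \<in> plus_rel K F A `` {z}" by (rule equiv_class_self[OF plus_rel_equiv[OF A] z(1)])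
 then have "germ A z D chi t ==> pgerm A (plus_rel K F A `` {z}) D chi t" for D chi t
  unfolding pgerm_def by blast
 then show ?thesis using z quotientI[OF z(1)] by blast
qed

end

section \<open>Functoriality of the plus construction\<close>

locale site_map = F: site_presheaf K F + G: site_presheaf K G
 for K :: "'a covers" and F :: "('a, 'b) presheaf" and G :: "('a, 'c) presheaf" +
 fixes h :: "'a ring => 'b => 'c"
 assumes map_closed: "!!A x. A \<in> noeth ==> x \<in> carrier (sec F A) ==> h A x \<in> carrier (sec G A)"
  and map_res: "!!A B phi x. A \<in> noeth ==> B \<in> noeth ==> phi \<in> homs A B ==> x \<in> carrier (sec F A) ==>
    h B (res F A B phi x) = res G A B phi (h A x)"
begin

abbreviation (input) "h_family S s \<equiv> (S, \<lambda>(B, phi) \<in> S. h B (s (B, phi)))"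

lemma h_family_closed:
 assumes A: "A \<in> noeth" and x: "(S, s) \<in> local_families K F A"
 shows "h_family S s \<in> local_families K G A"
proof -
 have S: "S \<in> K A" "s \<in> compatible_families F A S" using x unfolding local_families_def by auto
 show ?thesis
  unfolding local_families_def using S(1)
 proof (auto, intro G.compatibleI)
  show "(\<lambda>(B, phi) \<in> S. h B (s (B, phi))) (B, phi) \<in> carrier (sec G B)" if "(B, phi) \<in> S" for B phi
   using that F.cover_arrow[OF A S(1) that] F.local_family_val[OF x that] map_closed by simp
  fix B phi C psi D u v
  assume *: "(B, phi) \<in> S" "(C, psi) \<in> S" "D \<in> noeth" "u \<in> homs B D" "v \<in> homs C D"
   "hcomp A u phi = hcomp A v psi"
  have "h D (res F B D u (s (B, phi))) = h D (res F C D v (s (C, psi)))"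
   using F.compatibleD[OF A S *] by simp
  then show "res G B D u ((\<lambda>(B, phi) \<in> S. h B (s (B, phi))) (B, phi)) = res G C D v ((\<lambda>(B, phi) \<in> S. h B (s (B, phi))) (C, psi))"
   using * F.cover_arrow[OF A S(1)] F.local_family_val[OF x] by (simp add: map_res)
 qed auto
qed

lemma has_value_map:
 assumes A: "A \<in> noeth" and x: "(S, s) \<in> local_families K F A" and D: "D \<in> noeth"
  and t: "has_value F A (S, s) (D, chi) t"
 shows "has_value G A (h_family S s) (D, chi) (h D t)"
proof -
 have S: "S \<in> K A" using x unfolding local_families_def by auto
 obtain B phi rho where *: "(B, phi) \<in> S" "rho \<in> homs B D" "chi = hcomp A rho phi" "t = res F B D rho (s (B, phi))"
  using t unfolding F.has_value_iff by blast
 have "h D t = res G B D rho ((\<lambda>(B, phi) \<in> S. h B (s (B, phi))) (B, phi))"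
  using * D F.cover_arrow[OF A S *(1)] F.local_family_val[OF x *(1)] by (simp add: map_res)
 then show ?thesis unfolding G.has_value_iff using * by blast
qed

lemma germ_map:
 assumes A: "A \<in> noeth" and x: "(S, s) \<in> local_families K F A" and t: "F.germ A (S, s) D chi t"
 shows "G.germ A (h_family S s) D chi (h D t)"
proof -
 have D: "D \<in> noeth" "chi \<in> homs A D" "t \<in> carrier (sec F D)" using F.germD[OF t] by auto
 have "F.locally D (\<lambda>E rho. has_value F A (S, s) (E, hcomp A rho chi) (res F D E rho t))"
  using t unfolding F.germ_def by blast
 then have "F.locally D (\<lambda>E rho. has_value G A (h_family S s) (E, hcomp A rho chi) (res G D E rho (h D t)))"
  by (rule F.locally_mono[OF _ D(1)])
   (use has_value_map[OF A x] D in \<open>simp add: map_res[symmetric]\<close>)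
 then show ?thesis unfolding G.germ_def using D map_closed by blast
qed

lemma plus_map_aux:
 assumes A: "A \<in> noeth" and U: "U \<in> local_families K F A // plus_rel K F A"
 shows plus_map_closed: "plus_map K F G h A U \<in> local_families K G A // plus_rel K G A"
  and pgerm_plus_map: "F.pgerm A U D chi t ==> G.pgerm A (plus_map K F G h A U) D chi (h D t)"
proof -
 obtain x where x: "x \<in> local_families K F A" "x \<in> U" "!!D chi t. F.pgerm A U D chi t \<longleftrightarrow> F.germ A x D chi t"
  by (rule F.plus_class[OF A U]) blast
 obtain S s where Ss: "x = (S, s)" by force
 have hx: "h_family S s \<in> local_families K G A" using h_family_closed[OF A] x Ss by blast
 have eq: "plus_rel K G A `` {h_family S' s'} = plus_rel K G A `` {h_family S s}" if y: "(S', s') \<in> U" for S' s'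
 proof (rule equiv_class_eq[OF G.plus_rel_equiv[OF A]])
  have y': "(S', s') \<in> local_families K F A" "!!D chi t. F.germ A (S, s) D chi t \<longleftrightarrow> F.germ A (S', s') D chi t"
   using F.plus_class_mem[OF A U y] x(3) Ss by auto
  show "(h_family S' s', h_family S s) \<in> plus_rel K G A"
   unfolding G.plus_rel_iff[OF A h_family_closed[OF A y'(1)] hx]
   by (rule F.locally_mono[OF F.locally_germ[OF A y'(1)] A])
    (use germ_map[OF A y'(1)] germ_map[OF A x(1)[unfolded Ss]] y'(2) in blast)
 qed
 have P: "plus_map K F G h A U = plus_rel K G A `` {h_family S s}"
 proof -
  have "plus_map K F G h A U = (\<Union>y \<in> U. plus_rel K G A `` {h_family S s})"
   unfolding plus_map_def using eq by (intro SUP_cong) (auto simp del: Image_singleton_iff)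
  also have "\<dots> = plus_rel K G A `` {h_family S s}" using x(2) by blast
  finally show ?thesis .
 qed
 show "plus_map K F G h A U \<in> local_families K G A // plus_rel K G A"
  unfolding P using hx by (rule quotientI)
 have mem: "h_family S s \<in> plus_map K F G h A U"
  unfolding P by (rule equiv_class_self[OF G.plus_rel_equiv[OF A] hx])
 show "G.pgerm A (plus_map K F G h A U) D chi (h D t)" if "F.pgerm A U D chi t"
  using germ_map[OF A x(1)[unfolded Ss]] that x(3) mem Ss unfolding G.pgerm_def by blast
qed

end

section \<open>Ring structure, separatedness and gluing\<close>

definition separated :: "'a covers => ('a, 'b) presheaf => bool" where
 "separated K F \<longleftrightarrow> (\<forall>A \<in> noeth. \<forall>x \<in> carrier (sec F A). \<forall>y \<in> carrier (sec F A).
  site.locally K A (\<lambda>D chi. res F A D chi x = res F A D chi y) --> x = y)"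

context site_presheaf
begin

abbreviation (input) "PF \<equiv> plus_presheaf K F"

lemma plus_presheaf_simps:
 "carrier (sec PF A) = PC A"
 "monoid.mult (sec PF A) = plus_op K F monoid.mult A"
 "one (sec PF A) = plus_unit K F A \<one>\<^bsub>sec F A\<^esub>"
 "ring.zero (sec PF A) = plus_unit K F A \<zero>\<^bsub>sec F A\<^esub>"
 "ring.add (sec PF A) = plus_op K F ring.add A"
 by (simp_all add: plus_presheaf_def)

lemma sec_laws:
 assumes "D \<in> noeth" "a \<in> carrier (sec F D)" "b \<in> carrier (sec F D)"
 shows "a \<otimes>\<^bsub>sec F D\<^esub> b \<in> carrier (sec F D)" "a \<oplus>\<^bsub>sec F D\<^esub> b \<in> carrier (sec F D)"
  "\<one>\<^bsub>sec F D\<^esub> \<in> carrier (sec F D)" "\<zero>\<^bsub>sec F D\<^esub> \<in> carrier (sec F D)"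
  "\<ominus>\<^bsub>sec F D\<^esub> a \<in> carrier (sec F D)"
proof -
 interpret cring "sec F D" by (rule sec_cring[OF assms(1)])
 show "a \<otimes>\<^bsub>sec F D\<^esub> b \<in> carrier (sec F D)" "a \<oplus>\<^bsub>sec F D\<^esub> b \<in> carrier (sec F D)"
  "\<one>\<^bsub>sec F D\<^esub> \<in> carrier (sec F D)" "\<zero>\<^bsub>sec F D\<^esub> \<in> carrier (sec F D)"
  "\<ominus>\<^bsub>sec F D\<^esub> a \<in> carrier (sec F D)" using assms by auto
qed

lemma res_zero: "D \<in> noeth ==> E \<in> noeth ==> rho \<in> homs D E ==> res F D E rho \<zero>\<^bsub>sec F D\<^esub> = \<zero>\<^bsub>sec F E\<^esub>"
 using ring_hom_zero[OF res_hom] sec_cring by (metis cring.axioms(1))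

lemma res_one: "D \<in> noeth ==> E \<in> noeth ==> rho \<in> homs D E ==> res F D E rho \<one>\<^bsub>sec F D\<^esub> = \<one>\<^bsub>sec F E\<^esub>"
 by (rule ring_hom_one[OF res_hom])

lemma res_uminus:
 assumes "D \<in> noeth" "E \<in> noeth" "rho \<in> homs D E" "x \<in> carrier (sec F D)"
 shows "res F D E rho (\<ominus>\<^bsub>sec F D\<^esub> x) = \<ominus>\<^bsub>sec F E\<^esub> (res F D E rho x)"
proof -
 interpret ring_hom_cring "sec F D" "sec F E" "res F D E rho"
  using assms sec_cring res_hom by (intro ring_hom_cringI) auto
 show ?thesis using assms by simp
qed

lemma plus_mult:
 assumes "A \<in> noeth" "U \<in> PC A" "V \<in> PC A"
 shows "plus_op K F monoid.mult A U V \<in> PC A"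
  "pgerm A U D chi a ==> pgerm A V D chi b ==> pgerm A (plus_op K F monoid.mult A U V) D chi (a \<otimes>\<^bsub>sec F D\<^esub> b)"
 by (rule plus_op_closed[OF assms], use sec_laws ring_hom_mult[OF res_hom] in blast, use ring_hom_mult[OF res_hom] in blast)
  (rule pgerm_plus_op[OF assms], use sec_laws ring_hom_mult[OF res_hom] in blast, use ring_hom_mult[OF res_hom] in blast)

lemma plus_add:
 assumes "A \<in> noeth" "U \<in> PC A" "V \<in> PC A"
 shows "plus_op K F ring.add A U V \<in> PC A"
  "pgerm A U D chi a ==> pgerm A V D chi b ==> pgerm A (plus_op K F ring.add A U V) D chi (a \<oplus>\<^bsub>sec F D\<^esub> b)"
 by (rule plus_op_closed[OF assms], use sec_laws ring_hom_add[OF res_hom] in blast, use ring_hom_add[OF res_hom] in blast)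
  (rule pgerm_plus_op[OF assms], use sec_laws ring_hom_add[OF res_hom] in blast, use ring_hom_add[OF res_hom] in blast)

lemma plus_zero:
 assumes "A \<in> noeth"
 shows "plus_unit K F A \<zero>\<^bsub>sec F A\<^esub> \<in> PC A"
  "D \<in> noeth ==> chi \<in> homs A D ==> pgerm A (plus_unit K F A \<zero>\<^bsub>sec F A\<^esub>) D chi \<zero>\<^bsub>sec F D\<^esub>"
 using plus_unit_aux[of A "\<zero>\<^bsub>sec F A\<^esub>"] assms res_zero cring.axioms(1)[OF sec_cring, THEN ring.ring_simprules(2)] by metis+

lemma plus_one:
 assumes "A \<in> noeth"
 shows "plus_unit K F A \<one>\<^bsub>sec F A\<^esub> \<in> PC A"
  "D \<in> noeth ==> chi \<in> homs A D ==> pgerm A (plus_unit K F A \<one>\<^bsub>sec F A\<^esub>) D chi \<one>\<^bsub>sec F D\<^esub>"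
 using plus_unit_aux[of A "\<one>\<^bsub>sec F A\<^esub>"] assms res_one cring.axioms(1)[OF sec_cring, THEN ring.ring_simprules(6)] by metis+

lemma plus_uminus:
 assumes A: "A \<in> noeth" "U \<in> PC A"
 shows "\<exists>V \<in> PC A. \<forall>D chi a. pgerm A U D chi a --> pgerm A V D chi (\<ominus>\<^bsub>sec F D\<^esub> a)"
proof -
 \<comment> \<open>Negation is natural but not a ring homomorphism; \<open>site_map\<close> asks
   only for a natural map of carriers, so it induces a map of the plus construction.\<close>
 interpret site_map K F F "\<lambda>A. a_inv (sec F A)"
  by unfold_locales (use sec_laws res_uminus in auto)
 show ?thesis using plus_map_aux[OF A] by blast
qed

text \<open>This and its variants with two and three arguments turn an identity between operations
  of the plus construction into the same identity between germs, where it is an axiom of the rings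
  of sections of \<open>F\<close>.\<close>

lemma plus_eq1:
 assumes "A \<in> noeth" "U \<in> PC A" "X1 \<in> PC A" "X2 \<in> PC A"
  "!!D chi a. D \<in> noeth ==> chi \<in> homs A D ==> a \<in> carrier (sec F D) ==> pgerm A U D chi a ==>
   \<exists>t. pgerm A X1 D chi t \<and> pgerm A X2 D chi t"
 shows "X1 = X2"
 by (rule plus_eqI[OF assms(1,3,4)], rule locally_mono[OF locally_pgerm[OF assms(1,2)] assms(1)])
  (use assms(5) pgermD[OF assms(1,2)] in blast)

lemma locally_pgerm2:
 assumes "A \<in> noeth" "U \<in> PC A" "V \<in> PC A"
 shows "locally A (\<lambda>D chi. (\<exists>a. pgerm A U D chi a) \<and> (\<exists>b. pgerm A V D chi b))"
  "stable A (\<lambda>D chi. (\<exists>a. pgerm A U D chi a) \<and> (\<exists>b. pgerm A V D chi b))"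
 using assms by (auto intro!: locally_conj stable_conj locally_pgerm stable_pgerm)

lemma plus_eq2:
 assumes "A \<in> noeth" "U \<in> PC A" "V \<in> PC A" "X1 \<in> PC A" "X2 \<in> PC A"
  "!!D chi a b. D \<in> noeth ==> chi \<in> homs A D ==> a \<in> carrier (sec F D) ==> b \<in> carrier (sec F D) ==>
   pgerm A U D chi a ==> pgerm A V D chi b ==> \<exists>t. pgerm A X1 D chi t \<and> pgerm A X2 D chi t"
 shows "X1 = X2"
 by (rule plus_eqI[OF assms(1,4,5)], rule locally_mono[OF locally_pgerm2(1)[OF assms(1,2,3)] assms(1)])
  (use assms(6) pgermD[OF assms(1,2)] pgermD[OF assms(1,3)] in blast)

lemma plus_eq3:
 assumes "A \<in> noeth" "U \<in> PC A" "V \<in> PC A" "W \<in> PC A" "X1 \<in> PC A" "X2 \<in> PC A"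
  "!!D chi a b c. D \<in> noeth ==> chi \<in> homs A D ==> a \<in> carrier (sec F D) ==> b \<in> carrier (sec F D) ==> c \<in> carrier (sec F D) ==>
   pgerm A U D chi a ==> pgerm A V D chi b ==> pgerm A W D chi c ==> \<exists>t. pgerm A X1 D chi t \<and> pgerm A X2 D chi t"
 shows "X1 = X2"
proof (rule plus_eqI[OF assms(1,5,6)], rule locally_mono[OF _ assms(1)])
 show "locally A (\<lambda>D chi. ((\<exists>a. pgerm A U D chi a) \<and> (\<exists>b. pgerm A V D chi b)) \<and> (\<exists>c. pgerm A W D chi c))"
  using assms by (auto intro!: locally_conj stable_conj locally_pgerm stable_pgerm)
qed (use assms(7) pgermD[OF assms(1,2)] pgermD[OF assms(1,3)] pgermD[OF assms(1,4)] in blast)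

lemma plus_cring:
 assumes A: "A \<in> noeth"
 shows "cring (sec PF A)"
proof (rule cringI[OF abelian_groupI comm_monoidI], unfold plus_presheaf_simps)
 note cl = plus_add(1)[OF A] plus_mult(1)[OF A] plus_zero(1)[OF A] plus_one(1)[OF A]
 note pg = plus_add(2)[OF A] plus_mult(2)[OF A]
 have ring: "D \<in> noeth ==> cring (sec F D)" for D by (rule sec_cring)
 show "plus_op K F ring.add A x y \<in> PC A" "plus_op K F monoid.mult A x y \<in> PC A" if "x \<in> PC A" "y \<in> PC A" for x y
  using cl that by auto
 show "plus_unit K F A \<zero>\<^bsub>sec F A\<^esub> \<in> PC A" "plus_unit K F A \<one>\<^bsub>sec F A\<^esub> \<in> PC A" using cl by auto
 fix x y z assume xyz: "x \<in> PC A" "y \<in> PC A" "z \<in> PC A"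
 show "plus_op K F ring.add A (plus_op K F ring.add A x y) z = plus_op K F ring.add A x (plus_op K F ring.add A y z)"
 proof (rule plus_eq3[OF A xyz])
  fix D chi a b c assume D: "D \<in> noeth" "chi \<in> homs A D" "a \<in> carrier (sec F D)" "b \<in> carrier (sec F D)" "c \<in> carrier (sec F D)"
   and g: "pgerm A x D chi a" "pgerm A y D chi b" "pgerm A z D chi c"
  interpret cring "sec F D" by (rule ring[OF D(1)])
  show "\<exists>t. pgerm A (plus_op K F ring.add A (plus_op K F ring.add A x y) z) D chi t \<and>
   pgerm A (plus_op K F ring.add A x (plus_op K F ring.add A y z)) D chi t"
   using pg(1)[OF cl(1)[OF xyz(1,2)] xyz(3) pg(1)[OF xyz(1,2) g(1,2)] g(3)]
    pg(1)[OF xyz(1) cl(1)[OF xyz(2,3)] g(1) pg(1)[OF xyz(2,3) g(2,3)]] a_assoc[OF D(3-5)] by auto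
 qed (use cl xyz in auto)
 show "plus_op K F monoid.mult A (plus_op K F monoid.mult A x y) z = plus_op K F monoid.mult A x (plus_op K F monoid.mult A y z)"
 proof (rule plus_eq3[OF A xyz])
  fix D chi a b c assume D: "D \<in> noeth" "chi \<in> homs A D" "a \<in> carrier (sec F D)" "b \<in> carrier (sec F D)" "c \<in> carrier (sec F D)"
   and g: "pgerm A x D chi a" "pgerm A y D chi b" "pgerm A z D chi c"
  interpret cring "sec F D" by (rule ring[OF D(1)])
  show "\<exists>t. pgerm A (plus_op K F monoid.mult A (plus_op K F monoid.mult A x y) z) D chi t \<and>
   pgerm A (plus_op K F monoid.mult A x (plus_op K F monoid.mult A y z)) D chi t"
   using pg(2)[OF cl(2)[OF xyz(1,2)] xyz(3) pg(2)[OF xyz(1,2) g(1,2)] g(3)]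
    pg(2)[OF xyz(1) cl(2)[OF xyz(2,3)] g(1) pg(2)[OF xyz(2,3) g(2,3)]] m_assoc[OF D(3-5)] by auto
 qed (use cl xyz in auto)
 show "plus_op K F monoid.mult A (plus_op K F ring.add A x y) z =
  plus_op K F ring.add A (plus_op K F monoid.mult A x z) (plus_op K F monoid.mult A y z)"
 proof (rule plus_eq3[OF A xyz])
  fix D chi a b c assume D: "D \<in> noeth" "chi \<in> homs A D" "a \<in> carrier (sec F D)" "b \<in> carrier (sec F D)" "c \<in> carrier (sec F D)"
   and g: "pgerm A x D chi a" "pgerm A y D chi b" "pgerm A z D chi c"
  interpret cring "sec F D" by (rule ring[OF D(1)])
  show "\<exists>t. pgerm A (plus_op K F monoid.mult A (plus_op K F ring.add A x y) z) D chi t \<and>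
   pgerm A (plus_op K F ring.add A (plus_op K F monoid.mult A x z) (plus_op K F monoid.mult A y z)) D chi t"
   using pg(2)[OF cl(1)[OF xyz(1,2)] xyz(3) pg(1)[OF xyz(1,2) g(1,2)] g(3)]
    pg(1)[OF cl(2)[OF xyz(1,3)] cl(2)[OF xyz(2,3)] pg(2)[OF xyz(1,3) g(1,3)] pg(2)[OF xyz(2,3) g(2,3)]]
    l_distr[OF D(3-5)] by auto
 qed (use cl xyz in auto)
 show "plus_op K F ring.add A x y = plus_op K F ring.add A y x"
 proof (rule plus_eq2[OF A xyz(1,2)])
  fix D chi a b assume D: "D \<in> noeth" "chi \<in> homs A D" "a \<in> carrier (sec F D)" "b \<in> carrier (sec F D)"
   and g: "pgerm A x D chi a" "pgerm A y D chi b"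
  interpret cring "sec F D" by (rule ring[OF D(1)])
  show "\<exists>t. pgerm A (plus_op K F ring.add A x y) D chi t \<and> pgerm A (plus_op K F ring.add A y x) D chi t"
   using pg(1)[OF xyz(1,2) g] pg(1)[OF xyz(2,1) g(2,1)] a_comm[OF D(3,4)] by auto
 qed (use cl xyz in auto)
 show "plus_op K F monoid.mult A x y = plus_op K F monoid.mult A y x"
 proof (rule plus_eq2[OF A xyz(1,2)])
  fix D chi a b assume D: "D \<in> noeth" "chi \<in> homs A D" "a \<in> carrier (sec F D)" "b \<in> carrier (sec F D)"
   and g: "pgerm A x D chi a" "pgerm A y D chi b"
  interpret cring "sec F D" by (rule ring[OF D(1)])
  show "\<exists>t. pgerm A (plus_op K F monoid.mult A x y) D chi t \<and> pgerm A (plus_op K F monoid.mult A y x) D chi t"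
   using pg(2)[OF xyz(1,2) g] pg(2)[OF xyz(2,1) g(2,1)] m_comm[OF D(3,4)] by auto
 qed (use cl xyz in auto)
 show "plus_op K F ring.add A (plus_unit K F A \<zero>\<^bsub>sec F A\<^esub>) x = x"
 proof (rule plus_eq1[OF A xyz(1)])
  fix D chi a assume D: "D \<in> noeth" "chi \<in> homs A D" "a \<in> carrier (sec F D)" and g: "pgerm A x D chi a"
  interpret cring "sec F D" by (rule ring[OF D(1)])
  show "\<exists>t. pgerm A (plus_op K F ring.add A (plus_unit K F A \<zero>\<^bsub>sec F A\<^esub>) x) D chi t \<and> pgerm A x D chi t"
   using pg(1)[OF cl(3) xyz(1) plus_zero(2)[OF A D(1,2)] g] g l_zero[OF D(3)] by auto
 qed (use cl xyz in auto)
 show "plus_op K F monoid.mult A (plus_unit K F A \<one>\<^bsub>sec F A\<^esub>) x = x"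
 proof (rule plus_eq1[OF A xyz(1)])
  fix D chi a assume D: "D \<in> noeth" "chi \<in> homs A D" "a \<in> carrier (sec F D)" and g: "pgerm A x D chi a"
  interpret cring "sec F D" by (rule ring[OF D(1)])
  show "\<exists>t. pgerm A (plus_op K F monoid.mult A (plus_unit K F A \<one>\<^bsub>sec F A\<^esub>) x) D chi t \<and> pgerm A x D chi t"
   using pg(2)[OF cl(4) xyz(1) plus_one(2)[OF A D(1,2)] g] g l_one[OF D(3)] by auto
 qed (use cl xyz in auto)
 obtain v where v: "v \<in> PC A" "!!D chi a. pgerm A x D chi a ==> pgerm A v D chi (\<ominus>\<^bsub>sec F D\<^esub> a)"
  using plus_uminus[OF A xyz(1)] by blast
 show "\<exists>y \<in> PC A. plus_op K F ring.add A y x = plus_unit K F A \<zero>\<^bsub>sec F A\<^esub>"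
 proof (rule bexI[OF _ v(1)], rule plus_eq1[OF A xyz(1)])
  fix D chi a assume D: "D \<in> noeth" "chi \<in> homs A D" "a \<in> carrier (sec F D)" and g: "pgerm A x D chi a"
  interpret cring "sec F D" by (rule ring[OF D(1)])
  show "\<exists>t. pgerm A (plus_op K F ring.add A v x) D chi t \<and> pgerm A (plus_unit K F A \<zero>\<^bsub>sec F A\<^esub>) D chi t"
   using pg(1)[OF v(1) xyz(1) v(2)[OF g] g] plus_zero(2)[OF A D(1,2)] l_neg[OF D(3)] by auto
 qed (use cl xyz v in auto)
qed

lemma plus_res_eq2:
 assumes A: "A \<in> noeth" "C \<in> noeth" "psi \<in> homs A C" "U \<in> PC A" "V \<in> PC A" "X1 \<in> PC C" "X2 \<in> PC C"
  and h: "!!D chi a b. D \<in> noeth ==> chi \<in> homs C D ==> hcomp A chi psi \<in> homs A D ==>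
   pgerm A U D (hcomp A chi psi) a ==> pgerm A V D (hcomp A chi psi) b ==>
   \<exists>t. pgerm C X1 D chi t \<and> pgerm C X2 D chi t"
 shows "X1 = X2"
proof (rule plus_eqI[OF A(2,6,7)],
  rule locally_mono[OF locally_pull[OF locally_pgerm2(1)[OF A(1,4,5)] locally_pgerm2(2)[OF A(1,4,5)] A(1-3)] A(2)])
 fix D chi assume "D \<in> noeth" "chi \<in> homs C D" "(\<exists>a. pgerm A U D (hcomp A chi psi) a) \<and>
  (\<exists>b. pgerm A V D (hcomp A chi psi) b)"
 then show "\<exists>t. pgerm C X1 D chi t \<and> pgerm C X2 D chi t"
  using h homs_compose[OF noeth_cring[OF A(1)] A(3)] by blast
qed

lemma plus_presheaf_of_rings: "presheaf_of_rings PF"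
 unfolding presheaf_of_rings_def plus_presheaf_simps
proof (intro conjI ballI)
 show "cring (sec PF A)" if "A \<in> noeth" for A by (rule plus_cring[OF that])
next
 fix A B :: "'a ring" and phi :: "'a => 'a" assume A: "A \<in> noeth" and B: "B \<in> noeth" "phi \<in> homs A B"
 note cl = plus_res_closed[OF A _ B] and pg = pgerm_plus_res[OF A _ B]
 show "res PF A B phi \<in> ring_hom (sec PF A) (sec PF B)"
 proof (rule ring_hom_memI, unfold plus_presheaf_simps)
  fix x y assume x: "x \<in> PC A" and y: "y \<in> PC A"
  show "res PF A B phi x \<in> PC B" using cl x by blast
  show "res PF A B phi (plus_op K F monoid.mult A x y) = plus_op K F monoid.mult B (res PF A B phi x) (res PF A B phi y)"
  proof (rule plus_res_eq2[OF A B x y])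
   show "res PF A B phi (plus_op K F monoid.mult A x y) \<in> PC B" by (rule cl[OF plus_mult(1)[OF A x y]])
   show "plus_op K F monoid.mult B (res PF A B phi x) (res PF A B phi y) \<in> PC B"
    by (rule plus_mult(1)[OF B(1) cl[OF x] cl[OF y]])
   fix D chi a b assume *: "chi \<in> homs B D" "pgerm A x D (hcomp A chi phi) a"
    "pgerm A y D (hcomp A chi phi) b"
   show "\<exists>t. pgerm B (res PF A B phi (plus_op K F monoid.mult A x y)) D chi t \<and>
     pgerm B (plus_op K F monoid.mult B (res PF A B phi x) (res PF A B phi y)) D chi t"
    using pg[OF plus_mult(1)[OF A x y] *(1) plus_mult(2)[OF A x y *(2,3)]]
     plus_mult(2)[OF B(1) cl[OF x] cl[OF y] pg[OF x *(1,2)] pg[OF y *(1,3)]] by blast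
  qed
  show "res PF A B phi (plus_op K F ring.add A x y) = plus_op K F ring.add B (res PF A B phi x) (res PF A B phi y)"
  proof (rule plus_res_eq2[OF A B x y])
   show "res PF A B phi (plus_op K F ring.add A x y) \<in> PC B" by (rule cl[OF plus_add(1)[OF A x y]])
   show "plus_op K F ring.add B (res PF A B phi x) (res PF A B phi y) \<in> PC B"
    by (rule plus_add(1)[OF B(1) cl[OF x] cl[OF y]])
   fix D chi a b assume *: "chi \<in> homs B D" "pgerm A x D (hcomp A chi phi) a"
    "pgerm A y D (hcomp A chi phi) b"
   show "\<exists>t. pgerm B (res PF A B phi (plus_op K F ring.add A x y)) D chi t \<and>
     pgerm B (plus_op K F ring.add B (res PF A B phi x) (res PF A B phi y)) D chi t"
    using pg[OF plus_add(1)[OF A x y] *(1) plus_add(2)[OF A x y *(2,3)]]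
     plus_add(2)[OF B(1) cl[OF x] cl[OF y] pg[OF x *(1,2)] pg[OF y *(1,3)]] by blast
  qed
 next
  show "res PF A B phi (plus_unit K F A \<one>\<^bsub>sec F A\<^esub>) = plus_unit K F B \<one>\<^bsub>sec F B\<^esub>"
  proof (rule plus_eqI[OF B(1)], rule cl[OF plus_one(1)[OF A]], rule plus_one(1)[OF B(1)], rule locally_all[OF B(1)])
   fix D chi assume D: "D \<in> noeth" "chi \<in> homs B D"
   show "\<exists>t. pgerm B (res PF A B phi (plus_unit K F A \<one>\<^bsub>sec F A\<^esub>)) D chi t \<and> pgerm B (plus_unit K F B \<one>\<^bsub>sec F B\<^esub>) D chi t"
    using pg[OF plus_one(1)[OF A] D(2) plus_one(2)[OF A D(1) homs_compose[OF noeth_cring[OF A] B(2) D(2)]]]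
     plus_one(2)[OF B(1) D] by blast
  qed
 qed
next
 fix A :: "'a ring" and x assume A: "A \<in> noeth" and x: "x \<in> PC A"
 note id = id_hom_homs[OF noeth_cring[OF A]]
 show "res PF A A (id_hom A) x = x"
 proof (rule plus_eq1[OF A x plus_res_closed[OF A x A id] x])
  fix D chi a assume D: "D \<in> noeth" "chi \<in> homs A D" "pgerm A x D chi a"
  show "\<exists>t. pgerm A (res PF A A (id_hom A) x) D chi t \<and> pgerm A x D chi t"
   using pgerm_plus_res[OF A x A id D(2)] D(3) compose_id_hom[OF D(2)] by metis
 qed
next
 fix A B C :: "'a ring" and phi psi :: "'a => 'a" and x
 assume A: "A \<in> noeth" and B: "B \<in> noeth" and C: "C \<in> noeth" and phi: "phi \<in> homs A B" and psi: "psi \<in> homs B C"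
  and x: "x \<in> PC A"
 have c: "hcomp A psi phi \<in> homs A C" by (rule homs_compose[OF noeth_cring[OF A] phi psi])
 note cl = plus_res_closed[OF A x C c] plus_res_closed[OF B plus_res_closed[OF A x B phi] C psi]
 show "res PF A C (hcomp A psi phi) x = res PF B C psi (res PF A B phi x)"
 proof (rule plus_res_eq2[OF A C c x x cl])
  fix D chi a assume D: "chi \<in> homs C D" "pgerm A x D (hcomp A chi (hcomp A psi phi)) a"
  have chipsi: "hcomp B chi psi \<in> homs B D" by (rule homs_compose[OF noeth_cring[OF B] psi D(1)])
  have "pgerm C (res PF B C psi (res PF A B phi x)) D chi a"
   by (rule pgerm_plus_res[OF B plus_res_closed[OF A x B phi] C psi D(1)], rule pgerm_plus_res[OF A x B phi chipsi])
    (use D(2) in \<open>simp add: homs_compose_assoc[OF phi]\<close>)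
  then show "\<exists>t. pgerm C (res PF A C (hcomp A psi phi) x) D chi t \<and>
   pgerm C (res PF B C psi (res PF A B phi x)) D chi t"
   using pgerm_plus_res[OF A x C c D] by blast
 qed
qed

text \<open>Along a morphism on which \<open>U\<close> has a germ, the section comes from the
  presheaf itself. This converts the compatibility of a family of sections of the plus construction
  into equations between images of sections of \<open>F\<close>.\<close>

lemma plus_res_unit:
 assumes A: "A \<in> noeth" and U: "U \<in> PC A" and g: "pgerm A U D chi t"
 shows "res PF A D chi U = plus_unit K F D t"
proof -
 have D: "D \<in> noeth" "chi \<in> homs A D" "t \<in> carrier (sec F D)" using pgermD[OF A U g] by auto
 show ?thesis
 proof (rule plus_eqI[OF D(1) plus_res_closed[OF A U D(1,2)] plus_unit_closed[OF D(1,3)]], rule locally_all[OF D(1)])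
  fix E rho assume E: "E \<in> noeth" "rho \<in> homs D E"
  show "\<exists>t'. pgerm D (res PF A D chi U) E rho t' \<and> pgerm D (plus_unit K F D t) E rho t'"
   using pgerm_plus_res[OF A U D(1,2) E(2) pgerm_res[OF A U g E]] pgerm_plus_unit[OF D(1,3) E] by blast
 qed
qed

text \<open>After refining, two sections that agree on a covering have germs \<open>a\<close> and
  \<open>b\<close> which are germs of one and the same restricted section, and such germs agree
  locally. Hence a single plus step already separates an arbitrary presheaf.\<close>

lemma plus_separated: "separated K PF"
 unfolding separated_def plus_presheaf_simps
proof (intro ballI impI)
 fix A :: "'a ring" and U V assume A: "A \<in> noeth" and U: "U \<in> PC A" and V: "V \<in> PC A"
  and l: "locally A (\<lambda>D chi. res PF A D chi U = res PF A D chi V)"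
 show "U = V"
 proof (rule plus_eqI[OF A U V], rule locally_locally[OF locally_mono[OF l A] A])
  fix D chi assume D: "D \<in> noeth" "chi \<in> homs A D" and eq: "res PF A D chi U = res PF A D chi V"
  have "locally D (\<lambda>E rho. (\<exists>a. pgerm A U E (hcomp A rho chi) a) \<and> (\<exists>b. pgerm A V E (hcomp A rho chi) b))"
   by (rule locally_pull[OF locally_pgerm2[OF A U V] A D])
  then show "locally D (\<lambda>E rho. \<exists>t. pgerm A U E (hcomp A rho chi) t \<and> pgerm A V E (hcomp A rho chi) t)"
  proof (rule locally_locally[OF locally_mono[OF _ D(1)] D(1)])
   fix E rho assume E: "E \<in> noeth" "rho \<in> homs D E" and
   "(\<exists>a. pgerm A U E (hcomp A rho chi) a) \<and> (\<exists>b. pgerm A V E (hcomp A rho chi) b)"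
   then obtain a b where ab: "pgerm A U E (hcomp A rho chi) a" "pgerm A V E (hcomp A rho chi) b" by blast
   have clD: "res PF A D chi U \<in> PC D" by (rule plus_res_closed[OF A U D])
   have "pgerm D (res PF A D chi U) E rho a" by (rule pgerm_plus_res[OF A U D E(2) ab(1)])
   moreover have "pgerm D (res PF A D chi U) E rho b" unfolding eq by (rule pgerm_plus_res[OF A V D E(2) ab(2)])
   ultimately have "locally E (\<lambda>E' sigma. res F E E' sigma a = res F E E' sigma b)" by (rule pgerm_unique[OF D(1) clD])
   then show "locally E (\<lambda>E' sigma. \<exists>t. pgerm A U E' (hcomp A (hcomp D sigma rho) chi) t \<and>
     pgerm A V E' (hcomp A (hcomp D sigma rho) chi) t)"
   proof (rule locally_mono[OF _ E(1)])
    fix E' sigma assume E': "E' \<in> noeth" "sigma \<in> homs E E'" and eq': "res F E E' sigma a = res F E E' sigma b"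
    show "\<exists>t. pgerm A U E' (hcomp A (hcomp D sigma rho) chi) t \<and>
     pgerm A V E' (hcomp A (hcomp D sigma rho) chi) t"
     using pgerm_res[OF A U ab(1) E'] pgerm_res[OF A V ab(2) E'] eq'
     unfolding homs_compose_assoc[OF D(2)] by metis
   qed
  qed
 qed
qed

text \<open>The germs of the members of a compatible family are glued into one section. For this the
  assignment \<open>Pr\<close> must be single-valued: two germs along the same morphism have the
  same image in the plus construction, so they agree locally, and separatedness of \<open>F\<close>
  makes them equal.\<close>

lemma plus_sheaf:
 assumes sep: "separated K F"
 shows "sheaf_of_rings K PF"
 unfolding sheaf_of_rings_def
proof (intro conjI ballI plus_presheaf_of_rings)
 interpret P: site_presheaf K PF by unfold_locales (rule plus_presheaf_of_rings)
 fix A :: "'a ring" and S s assume A: "A \<in> noeth" and S: "S \<in> K A" and s: "s \<in> compatible_families PF A S"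
 have sP: "s (B, phi) \<in> PC B" if "(B, phi) \<in> S" for B phi
  using s that unfolding compatible_families_def PiE_def Pi_def plus_presheaf_simps by fastforce
 note arr = cover_arrow[OF A S]
 define Pr where "Pr = (\<lambda>D chi t. \<exists>B phi rho. (B, phi) \<in> S \<and> rho \<in> homs B D \<and> chi = hcomp A rho phi \<and> pgerm B (s (B, phi)) D rho t)"
 have "\<exists>U \<in> PC A. \<forall>D \<in> noeth. \<forall>chi \<in> homs A D. \<forall>t. Pr D chi t --> pgerm A U D chi t"
 proof (rule glue_plus[OF A])
  fix D chi t assume D: "D \<in> noeth" "chi \<in> homs A D" "Pr D chi t"
  then obtain B phi rho where *: "(B, phi) \<in> S" "rho \<in> homs B D" "chi = hcomp A rho phi" "pgerm B (s (B, phi)) D rho t"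
   unfolding Pr_def by blast
  note B = arr[OF *(1)] sP[OF *(1)]
  show t: "t \<in> carrier (sec F D)" using pgermD[OF B(1,3) *(4)] by blast
  show "Pr E (hcomp A sigma chi) (res F D E sigma t)" if E: "E \<in> noeth" "sigma \<in> homs D E" for E sigma
   unfolding Pr_def
   by (intro exI[of _ B] exI[of _ phi] exI[of _ "hcomp B sigma rho"] conjI *(1)
     homs_compose[OF noeth_cring[OF B(1)] *(2) E(2)] pgerm_res[OF B(1,3) *(4) E])
    (simp add: *(3) homs_compose_assoc[OF B(2)])
  show "t = t'" if Pr': "Pr D chi t'" for t'
  proof -
   obtain B' phi' rho' where **: "(B', phi') \<in> S" "rho' \<in> homs B' D" "chi = hcomp A rho' phi'" "pgerm B' (s (B', phi')) D rho' t'"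
    using Pr' unfolding Pr_def by blast
   note B' = arr[OF **(1)] sP[OF **(1)]
   have t': "t' \<in> carrier (sec F D)" using pgermD[OF B'(1,3) **(4)] by blast
   have "res PF B D rho (s (B, phi)) = res PF B' D rho' (s (B', phi'))"
    by (rule P.compatibleD[OF A S s *(1) **(1) D(1) *(2) **(2)]) (use * ** in simp)
   then have eq: "plus_unit K F D t = plus_unit K F D t'"
    using plus_res_unit[OF B(1,3) *(4)] plus_res_unit[OF B'(1,3) **(4)] by simp
   note id = id_hom_homs[OF noeth_cring[OF D(1)]]
   have "pgerm D (plus_unit K F D t) D (id_hom D) t" "pgerm D (plus_unit K F D t) D (id_hom D) t'"
    using pgerm_plus_unit[OF D(1) t D(1) id] pgerm_plus_unit[OF D(1) t' D(1) id] eq res_id[OF D(1)] t t' by auto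
   then have "locally D (\<lambda>E rho. res F D E rho t = res F D E rho t')"
    by (rule pgerm_unique[OF D(1) plus_unit_closed[OF D(1) t]])
   then show "t = t'" using sep D(1) t t' unfolding separated_def by blast
  qed
 next
  show "locally A (\<lambda>D chi. \<exists>t. Pr D chi t)"
  proof (rule locally_cover[OF S A])
   fix B phi assume B: "(B, phi) \<in> S"
   show "locally B (\<lambda>D chi. \<exists>t. Pr D (hcomp A chi phi) t)"
    by (rule locally_mono[OF locally_pgerm[OF arr(1)[OF B] sP[OF B]] arr(1)[OF B]]) (use B Pr_def in blast)
  qed
 qed
 then obtain U where U: "U \<in> PC A" "!!D chi t. D \<in> noeth ==> chi \<in> homs A D ==> Pr D chi t ==> pgerm A U D chi t" by blast
 have resU: "res PF A B phi U = s (B, phi)" if B: "(B, phi) \<in> S" for B phi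
 proof (rule plus_eq1[OF arr(1)[OF B] sP[OF B] plus_res_closed[OF A U(1) arr[OF B]] sP[OF B]])
  fix D chi a assume D: "D \<in> noeth" "chi \<in> homs B D" "pgerm B (s (B, phi)) D chi a"
  have "pgerm A U D (hcomp A chi phi) a"
   by (rule U(2)[OF D(1) homs_compose[OF noeth_cring[OF A] arr(2)[OF B] D(2)]]) (use B D Pr_def in blast)
  then show "\<exists>t. pgerm B (res PF A B phi U) D chi t \<and> pgerm B (s (B, phi)) D chi t"
   using pgerm_plus_res[OF A U(1) arr[OF B] D(2)] D(3) by blast
 qed
 show "\<exists>!x. x \<in> carrier (sec PF A) \<and> (\<forall>(B, phi) \<in> S. res PF A B phi x = s (B, phi))"
  unfolding plus_presheaf_simps
 proof (rule ex1I[of _ U])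
  show "U \<in> PC A \<and> (\<forall>(B, phi) \<in> S. res PF A B phi U = s (B, phi))" using U(1) resU by blast
  fix V assume V: "V \<in> PC A \<and> (\<forall>(B, phi) \<in> S. res PF A B phi V = s (B, phi))"
  have "locally A (\<lambda>D chi. res PF A D chi V = res PF A D chi U)"
   unfolding locally_def by (rule bexI[OF _ S]) (use V resU in auto)
  then show "V = U" using plus_separated A U(1) V unfolding separated_def plus_presheaf_simps by blast
 qed
qed

end

theorem sheafify_sheaf:
 assumes "pretopology K" "presheaf_of_rings F"
 shows "sheaf_of_rings K (sheafify K F)"
proof -
 interpret site_presheaf K F by unfold_locales fact+
 interpret P: site_presheaf K "plus_presheaf K F" by unfold_locales (rule plus_presheaf_of_rings)
 show ?thesis unfolding sheafify_def by (rule P.plus_sheaf[OF plus_separated])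
qed

section \<open>Local injectivity and local surjectivity\<close>

locale site_morphism = F: site_presheaf K F + G: site_presheaf K G
 for K :: "'a covers" and F :: "('a, 'b) presheaf" and G :: "('a, 'c) presheaf" +
 fixes h :: "'a ring => 'b => 'c"
 assumes morphism: "presheaf_morphism F G h"
begin

lemma map_hom: "A \<in> noeth ==> h A \<in> ring_hom (sec F A) (sec G A)"
 using morphism unfolding presheaf_morphism_def by blast

sublocale site_map K F G h
proof
 show "h A x \<in> carrier (sec G A)" if "A \<in> noeth" "x \<in> carrier (sec F A)" for A x
  using map_hom[OF that(1)] that(2) ring_hom_closed by metis
 show "h B (res F A B phi x) = res G A B phi (h A x)"
  if "A \<in> noeth" "B \<in> noeth" "phi \<in> homs A B" "x \<in> carrier (sec F A)" for A B phi x
  using morphism that unfolding presheaf_morphism_def by blast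
qed

abbreviation (input) "hp \<equiv> plus_map K F G h"
abbreviation (input) "FC A \<equiv> local_families K F A // plus_rel K F A"

lemma plus_map_morphism: "presheaf_morphism (plus_presheaf K F) (plus_presheaf K G) hp"
 unfolding presheaf_morphism_def F.plus_presheaf_simps
proof (intro conjI ballI)
 fix A :: "'a ring" assume A: "A \<in> noeth"
 note cl = plus_map_closed[OF A] and pg = pgerm_plus_map[OF A]
 show "hp A \<in> ring_hom (sec (plus_presheaf K F) A) (sec (plus_presheaf K G) A)"
 proof (rule ring_hom_memI, unfold F.plus_presheaf_simps G.plus_presheaf_simps)
  fix x y assume x: "x \<in> FC A" and y: "y \<in> FC A"
  show "hp A x \<in> local_families K G A // plus_rel K G A" by (rule cl[OF x])
  have "\<exists>t. G.pgerm A (hp A (plus_op K F monoid.mult A x y)) D chi t \<and>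
    G.pgerm A (plus_op K G monoid.mult A (hp A x) (hp A y)) D chi t" if D: "D \<in> noeth" "F.pgerm A x D chi a" "F.pgerm A y D chi b" for D chi a b
  proof -
   have ab: "a \<in> carrier (sec F D)" "b \<in> carrier (sec F D)" using F.pgermD[OF A] x y D by blast+
   show ?thesis using pg[OF F.plus_mult(1)[OF A x y] F.plus_mult(2)[OF A x y D(2,3)]]
     G.plus_mult(2)[OF A cl[OF x] cl[OF y] pg[OF x D(2)] pg[OF y D(3)]] ring_hom_mult[OF map_hom[OF D(1)] ab] by metis
  qed
  then show "hp A (plus_op K F monoid.mult A x y) = plus_op K G monoid.mult A (hp A x) (hp A y)"
   by (intro G.plus_eqI[OF A cl[OF F.plus_mult(1)[OF A x y]] G.plus_mult(1)[OF A cl[OF x] cl[OF y]]]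
     F.locally_mono[OF F.locally_pgerm2(1)[OF A x y] A]) blast
  have "\<exists>t. G.pgerm A (hp A (plus_op K F ring.add A x y)) D chi t \<and>
    G.pgerm A (plus_op K G ring.add A (hp A x) (hp A y)) D chi t" if D: "D \<in> noeth" "F.pgerm A x D chi a" "F.pgerm A y D chi b" for D chi a b
  proof -
   have ab: "a \<in> carrier (sec F D)" "b \<in> carrier (sec F D)" using F.pgermD[OF A] x y D by blast+
   show ?thesis using pg[OF F.plus_add(1)[OF A x y] F.plus_add(2)[OF A x y D(2,3)]]
     G.plus_add(2)[OF A cl[OF x] cl[OF y] pg[OF x D(2)] pg[OF y D(3)]] ring_hom_add[OF map_hom[OF D(1)] ab] by metis
  qed
  then show "hp A (plus_op K F ring.add A x y) = plus_op K G ring.add A (hp A x) (hp A y)"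
   by (intro G.plus_eqI[OF A cl[OF F.plus_add(1)[OF A x y]] G.plus_add(1)[OF A cl[OF x] cl[OF y]]]
     F.locally_mono[OF F.locally_pgerm2(1)[OF A x y] A]) blast
 next
  show "hp A (plus_unit K F A \<one>\<^bsub>sec F A\<^esub>) = plus_unit K G A \<one>\<^bsub>sec G A\<^esub>"
  proof (rule G.plus_eqI[OF A cl[OF F.plus_one(1)[OF A]] G.plus_one(1)[OF A]], rule F.locally_all[OF A])
   fix D chi assume D: "D \<in> noeth" "chi \<in> homs A D"
   show "\<exists>t. G.pgerm A (hp A (plus_unit K F A \<one>\<^bsub>sec F A\<^esub>)) D chi t \<and> G.pgerm A (plus_unit K G A \<one>\<^bsub>sec G A\<^esub>) D chi t"
    using pg[OF F.plus_one(1)[OF A] F.plus_one(2)[OF A D]] G.plus_one(2)[OF A D] ring_hom_one[OF map_hom[OF D(1)]] by metis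
  qed
 qed
next
 fix A B :: "'a ring" and phi :: "'a => 'a" and x assume A: "A \<in> noeth" and B: "B \<in> noeth" "phi \<in> homs A B" and x: "x \<in> FC A"
 note rx = F.plus_res_closed[OF A x B]
 show "hp B (res (plus_presheaf K F) A B phi x) = res (plus_presheaf K G) A B phi (hp A x)"
 proof (rule G.plus_eqI[OF B(1) plus_map_closed[OF B(1) rx] G.plus_res_closed[OF A plus_map_closed[OF A x] B]],
   rule F.locally_mono[OF F.locally_pull[OF F.locally_pgerm[OF A x] F.stable_pgerm[OF A x] A B] B(1)])
  fix D chi assume D: "chi \<in> homs B D" "\<exists>t. F.pgerm A x D (hcomp A chi phi) t"
  then obtain t where t: "F.pgerm A x D (hcomp A chi phi) t" by blast
  show "\<exists>t. G.pgerm B (hp B (res (plus_presheaf K F) A B phi x)) D chi t \<and>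
    G.pgerm B (res (plus_presheaf K G) A B phi (hp A x)) D chi t"
   using pgerm_plus_map[OF B(1) rx F.pgerm_plus_res[OF A x B D(1) t]]
    G.pgerm_plus_res[OF A plus_map_closed[OF A x] B D(1) pgerm_plus_map[OF A x t]] by blast
 qed
qed

lemma plus_map_unit:
 assumes A: "A \<in> noeth" and t: "t \<in> carrier (sec F A)"
 shows "hp A (plus_unit K F A t) = plus_unit K G A (h A t)"
proof (rule G.plus_eqI[OF A plus_map_closed[OF A F.plus_unit_closed[OF A t]] G.plus_unit_closed[OF A map_closed[OF A t]]],
  rule F.locally_all[OF A])
 fix D chi assume D: "D \<in> noeth" "chi \<in> homs A D"
 show "\<exists>u. G.pgerm A (hp A (plus_unit K F A t)) D chi u \<and> G.pgerm A (plus_unit K G A (h A t)) D chi u"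
  using pgerm_plus_map[OF A F.plus_unit_closed[OF A t] F.pgerm_plus_unit[OF A t D]]
   G.pgerm_plus_unit[OF A map_closed[OF A t] D] map_res[OF A D t] by metis
qed

definition locally_injective :: bool where
 "locally_injective \<longleftrightarrow> (\<forall>A \<in> noeth. \<forall>x \<in> carrier (sec F A). \<forall>y \<in> carrier (sec F A).
  h A x = h A y --> F.locally A (\<lambda>D chi. res F A D chi x = res F A D chi y))"

definition locally_surjective :: bool where
 "locally_surjective \<longleftrightarrow> (\<forall>A \<in> noeth. \<forall>y \<in> carrier (sec G A).
  F.locally A (\<lambda>D chi. \<exists>x \<in> carrier (sec F D). h D x = res G A D chi y))"

text \<open>If the images coincide, the images of two germs \<open>a\<close> and \<open>b\<close>
  agree on a covering; local injectivity then costs one more covering on which \<open>a\<close> and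
  \<open>b\<close> themselves agree.\<close>

lemma plus_map_inj:
 assumes li: locally_injective and A: "A \<in> noeth"
 shows "inj_on (hp A) (FC A)"
proof (rule inj_onI)
 fix U V assume U: "U \<in> FC A" and V: "V \<in> FC A" and eq: "hp A U = hp A V"
 show "U = V"
 proof (rule F.plus_eqI[OF A U V], rule F.locally_locally[OF F.locally_mono[OF F.locally_pgerm2(1)[OF A U V] A] A])
  fix D chi assume D: "D \<in> noeth" "chi \<in> homs A D" "(\<exists>a. F.pgerm A U D chi a) \<and> (\<exists>b. F.pgerm A V D chi b)"
  then obtain a b where ab: "F.pgerm A U D chi a" "F.pgerm A V D chi b" by blast
  have cl: "a \<in> carrier (sec F D)" "b \<in> carrier (sec F D)" using F.pgermD[OF A] U V ab by blast+
  have "F.locally D (\<lambda>E rho. res G D E rho (h D a) = res G D E rho (h D b))"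
   by (rule G.pgerm_unique[OF A plus_map_closed[OF A U] pgerm_plus_map[OF A U ab(1)]])
    (unfold eq, rule pgerm_plus_map[OF A V ab(2)])
  then show "F.locally D (\<lambda>E rho. \<exists>t. F.pgerm A U E (hcomp A rho chi) t \<and> F.pgerm A V E (hcomp A rho chi) t)"
  proof (rule F.locally_locally[OF F.locally_mono[OF _ D(1)] D(1)])
   fix E rho assume E: "E \<in> noeth" "rho \<in> homs D E" "res G D E rho (h D a) = res G D E rho (h D b)"
   have "h E (res F D E rho a) = h E (res F D E rho b)" using E D cl by (simp add: map_res)
   then have "F.locally E (\<lambda>E' sigma. res F E E' sigma (res F D E rho a) = res F E E' sigma (res F D E rho b))"
    using li E D cl F.res_closed unfolding locally_injective_def by blast
   then show "F.locally E (\<lambda>E' sigma. \<exists>t. F.pgerm A U E' (hcomp A (hcomp D sigma rho) chi) t \<and>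
    F.pgerm A V E' (hcomp A (hcomp D sigma rho) chi) t)"
   proof (rule F.locally_mono[OF _ E(1)])
    fix E' sigma assume E': "E' \<in> noeth" "sigma \<in> homs E E'" "res F E E' sigma (res F D E rho a) = res F E E' sigma (res F D E rho b)"
    show "\<exists>t. F.pgerm A U E' (hcomp A (hcomp D sigma rho) chi) t \<and>
    F.pgerm A V E' (hcomp A (hcomp D sigma rho) chi) t"
     using F.pgerm_res[OF A U F.pgerm_res[OF A U ab(1) E(1,2)] E'(1,2)]
      F.pgerm_res[OF A V F.pgerm_res[OF A V ab(2) E(1,2)] E'(1,2)] E'(3)
     unfolding homs_compose_assoc[OF D(2)] by metis
   qed
  qed
 qed
qed

lemma plus_map_locally_surjective:
 assumes ls: locally_surjective and A: "A \<in> noeth" and y: "y \<in> carrier (sec (plus_presheaf K G) A)"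
 shows "F.locally A (\<lambda>D chi. \<exists>x \<in> carrier (sec (plus_presheaf K F) D). hp D x = res (plus_presheaf K G) A D chi y)"
proof -
 note y = y[unfolded G.plus_presheaf_simps]
 show ?thesis unfolding F.plus_presheaf_simps
 proof (rule F.locally_locally[OF F.locally_mono[OF G.locally_pgerm[OF A y] A] A])
  fix D chi assume D: "D \<in> noeth" "chi \<in> homs A D" "\<exists>t. G.pgerm A y D chi t"
  then obtain t where t: "G.pgerm A y D chi t" by blast
  have "t \<in> carrier (sec G D)" using G.pgermD[OF A y t] by blast
  then have "F.locally D (\<lambda>E rho. \<exists>x \<in> carrier (sec F E). h E x = res G D E rho t)"
   using ls D unfolding locally_surjective_def by blast
  then show "F.locally D (\<lambda>E rho. \<exists>x \<in> FC E. hp E x = res (plus_presheaf K G) A E (hcomp A rho chi) y)"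
  proof (rule F.locally_mono[OF _ D(1)])
   fix E rho assume E: "E \<in> noeth" "rho \<in> homs D E" "\<exists>x \<in> carrier (sec F E). h E x = res G D E rho t"
   then obtain x where x: "x \<in> carrier (sec F E)" "h E x = res G D E rho t" by blast
   have "hp E (plus_unit K F E x) = res (plus_presheaf K G) A E (hcomp A rho chi) y"
    unfolding plus_map_unit[OF E(1) x(1)] G.plus_res_unit[OF A y G.pgerm_res[OF A y t E(1,2)]] x(2) ..
   then show "\<exists>x \<in> FC E. hp E x = res (plus_presheaf K G) A E (hcomp A rho chi) y"
    using F.plus_unit_closed[OF E(1) x(1)] by blast
  qed
 qed
qed

text \<open>Local preimages can be glued only if they are unique. Injectivity of \<open>h\<close>
  makes two preimages of the same germ locally equal, and separatedness of \<open>F\<close> makes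
  them equal.\<close>

lemma plus_map_surj:
 assumes ls: locally_surjective and inj: "!!A. A \<in> noeth ==> inj_on (h A) (carrier (sec F A))"
  and sep: "separated K F" and A: "A \<in> noeth" and V: "V \<in> local_families K G A // plus_rel K G A"
 shows "V \<in> hp A ` FC A"
proof -
 define Pr where "Pr = (\<lambda>D chi t. t \<in> carrier (sec F D) \<and> G.pgerm A V D chi (h D t))"
 have ex: "F.locally A (\<lambda>D chi. \<exists>t. Pr D chi t)"
 proof (rule F.locally_locally[OF F.locally_mono[OF G.locally_pgerm[OF A V] A] A])
  fix D chi assume D: "D \<in> noeth" "chi \<in> homs A D" "\<exists>t. G.pgerm A V D chi t"
  then obtain t where t: "G.pgerm A V D chi t" by blast
  have "t \<in> carrier (sec G D)" using G.pgermD[OF A V t] by blast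
  then have "F.locally D (\<lambda>E rho. \<exists>x \<in> carrier (sec F E). h E x = res G D E rho t)"
   using ls D unfolding locally_surjective_def by blast
  then show "F.locally D (\<lambda>E rho. \<exists>t. Pr E (hcomp A rho chi) t)"
   by (rule F.locally_mono[OF _ D(1)]) (use G.pgerm_res[OF A V t] in \<open>unfold Pr_def, metis\<close>)
 qed
 have "\<exists>U \<in> FC A. \<forall>D \<in> noeth. \<forall>chi \<in> homs A D. \<forall>t. Pr D chi t --> F.pgerm A U D chi t"
 proof (rule F.glue_plus[OF A _ _ _ ex])
  fix D chi t assume D: "D \<in> noeth" "chi \<in> homs A D" and P: "Pr D chi t"
  show t: "t \<in> carrier (sec F D)" using P unfolding Pr_def by blast
  have g: "G.pgerm A V D chi (h D t)" using P unfolding Pr_def by blast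
  show "Pr E (hcomp A rho chi) (res F D E rho t)" if E: "E \<in> noeth" "rho \<in> homs D E" for E rho
   unfolding Pr_def map_res[OF D(1) E t] using G.pgerm_res[OF A V g E] F.res_closed[OF D(1) E t] by blast
  show "t = t'" if P': "Pr D chi t'" for t'
  proof -
   have t': "t' \<in> carrier (sec F D)" and g': "G.pgerm A V D chi (h D t')" using P' unfolding Pr_def by blast+
   have "F.locally D (\<lambda>E rho. res G D E rho (h D t) = res G D E rho (h D t'))"
    by (rule G.pgerm_unique[OF A V g g'])
   then have "F.locally D (\<lambda>E rho. res F D E rho t = res F D E rho t')"
   proof (rule F.locally_mono[OF _ D(1)])
    fix E rho assume E: "E \<in> noeth" "rho \<in> homs D E" "res G D E rho (h D t) = res G D E rho (h D t')"
    then have "h E (res F D E rho t) = h E (res F D E rho t')" using D t t' by (simp add: map_res)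
    then show "res F D E rho t = res F D E rho t'"
     using inj_onD[OF inj[OF E(1)]] F.res_closed[OF D(1) E(1,2)] t t' by blast
   qed
   then show ?thesis using sep D(1) t t' unfolding separated_def by blast
  qed
 qed
 then obtain U where U: "U \<in> FC A" "!!D chi t. D \<in> noeth ==> chi \<in> homs A D ==> Pr D chi t ==> F.pgerm A U D chi t" by blast
 have "V = hp A U"
  by (rule G.plus_eqI[OF A V plus_map_closed[OF A U(1)]], rule F.locally_mono[OF ex A])
   (use U pgerm_plus_map[OF A U(1)] Pr_def in blast)
 then show ?thesis using U(1) by blast
qed

lemma plus_site_morphism: "site_morphism K (plus_presheaf K F) (plus_presheaf K G) hp"
 by unfold_locales (rule F.plus_presheaf_of_rings G.plus_presheaf_of_rings plus_map_morphism)+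

lemma sheafify_map_morphism: "presheaf_morphism (sheafify K F) (sheafify K G) (sheafify_map K F G h)"
proof -
 interpret P: site_morphism K "plus_presheaf K F" "plus_presheaf K G" hp by (rule plus_site_morphism)
 show ?thesis unfolding sheafify_def sheafify_map_def by (rule P.plus_map_morphism)
qed

lemma sheafify_map_inj:
 assumes li: locally_injective and A: "A \<in> noeth"
 shows "inj_on (sheafify_map K F G h A) (carrier (sec (sheafify K F) A))"
proof -
 interpret P: site_morphism K "plus_presheaf K F" "plus_presheaf K G" hp by (rule plus_site_morphism)
 have "P.locally_injective" unfolding P.locally_injective_def
 proof (intro ballI impI)
  fix A :: "'a ring" and x y assume A: "A \<in> noeth" and xy: "x \<in> carrier (sec (plus_presheaf K F) A)" "y \<in> carrier (sec (plus_presheaf K F) A)"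
   "hp A x = hp A y"
  have "x = y" using inj_onD[OF plus_map_inj[OF li A]] xy unfolding F.plus_presheaf_simps by blast
  then show "F.locally A (\<lambda>D chi. res (plus_presheaf K F) A D chi x = res (plus_presheaf K F) A D chi y)"
   using F.locally_all[OF A] by simp
 qed
 then show ?thesis unfolding sheafify_def sheafify_map_def P.F.plus_presheaf_simps by (rule P.plus_map_inj[OF _ A])
qed

theorem sheafify_mono:
 assumes locally_injective
 shows "sheaf_mono K (sheafify K F) (sheafify K G) (sheafify_map K F G h)"
 unfolding sheaf_mono_def
 using sheafify_sheaf[OF F.pretopology F.presheaf] sheafify_sheaf[OF F.pretopology G.presheaf] sheafify_map_morphism
  sheafify_map_inj[OF assms] by blast

text \<open>The two plus steps play different parts. The first turns local injectivity into
  injectivity and keeps local surjectivity; the second starts from a separated presheaf, so that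
  \<open>plus_map_surj\<close> applies and gives surjectivity on sections.\<close>

theorem sheafify_iso:
 assumes li: locally_injective and ls: locally_surjective
 shows "sheaf_iso K (sheafify K F) (sheafify K G) (sheafify_map K F G h)"
 unfolding sheaf_iso_def
proof (intro conjI ballI sheafify_sheaf F.pretopology F.presheaf G.presheaf sheafify_map_morphism)
 interpret P: site_morphism K "plus_presheaf K F" "plus_presheaf K G" hp by (rule plus_site_morphism)
 fix A :: "'a ring" assume A: "A \<in> noeth"
 have h: "sheafify_map K F G h A \<in> ring_hom (sec (sheafify K F) A) (sec (sheafify K G) A)"
  using sheafify_map_morphism A unfolding presheaf_morphism_def by blast
 have "P.locally_surjective" unfolding P.locally_surjective_def
  using plus_map_locally_surjective[OF ls] by blast
 moreover have "!!A. A \<in> noeth ==> inj_on (hp A) (carrier (sec (plus_presheaf K F) A))"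
  using plus_map_inj[OF li] unfolding F.plus_presheaf_simps by blast
 ultimately have "carrier (sec (sheafify K G) A) \<subseteq> sheafify_map K F G h A ` carrier (sec (sheafify K F) A)"
  using P.plus_map_surj[OF _ _ F.plus_separated A]
  unfolding sheafify_def sheafify_map_def P.F.plus_presheaf_simps P.G.plus_presheaf_simps by blast
 then have "bij_betw (sheafify_map K F G h A) (carrier (sec (sheafify K F) A)) (carrier (sec (sheafify K G) A))"
  using sheafify_map_inj[OF li A] ring_hom_closed[OF h] unfolding bij_betw_def by blast
 then show "sheafify_map K F G h A \<in> ring_iso (sec (sheafify K F) A) (sec (sheafify K G) A)"
  using h unfolding ring_iso_def by blast
qed

end

lemma plus_map_comp:
 assumes "site_map K F G h" "site_map K G H k" "site_map K F H l"
  and l: "!!A x. A \<in> noeth ==> x \<in> carrier (sec F A) ==> k A (h A x) = l A x"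
  and A: "A \<in> noeth" and U: "U \<in> carrier (sec (plus_presheaf K F) A)"
 shows "plus_map K G H k A (plus_map K F G h A U) = plus_map K F H l A U"
proof -
 interpret h: site_map K F G h by fact
 interpret k: site_map K G H k by fact
 interpret l: site_map K F H l by fact
 note U = U[unfolded h.F.plus_presheaf_simps]
 show ?thesis
 proof (rule k.G.plus_eqI[OF A k.plus_map_closed[OF A h.plus_map_closed[OF A U]] l.plus_map_closed[OF A U]],
   rule h.F.locally_mono[OF h.F.locally_pgerm[OF A U] A])
  fix D chi assume D: "D \<in> noeth" "\<exists>t. h.F.pgerm A U D chi t"
  then obtain t where t: "h.F.pgerm A U D chi t" by blast
  have "t \<in> carrier (sec F D)" using h.F.pgermD[OF A U t] by blast
  then show "\<exists>t. k.G.pgerm A (plus_map K G H k A (plus_map K F G h A U)) D chi t \<and> k.G.pgerm A (plus_map K F H l A U) D chi t"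
   using k.pgerm_plus_map[OF A h.plus_map_closed[OF A U] h.pgerm_plus_map[OF A U t]] l.pgerm_plus_map[OF A U t] l[OF D(1)] by metis
 qed
qed

theorem sheafify_map_comp:
 assumes h: "site_morphism K F G h" and k: "site_morphism K G H k" and l: "site_morphism K F H l"
  and eq: "!!A x. A \<in> noeth ==> x \<in> carrier (sec F A) ==> k A (h A x) = l A x"
  and A: "A \<in> noeth" and x: "x \<in> carrier (sec (sheafify K F) A)"
 shows "sheafify_map K G H k A (sheafify_map K F G h A x) = sheafify_map K F H l A x"
proof -
 interpret h: site_morphism K F G h by fact
 interpret k: site_morphism K G H k by fact
 interpret l: site_morphism K F H l by fact
 interpret h': site_morphism K "plus_presheaf K F" "plus_presheaf K G" "plus_map K F G h" by (rule h.plus_site_morphism)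
 interpret k': site_morphism K "plus_presheaf K G" "plus_presheaf K H" "plus_map K G H k" by (rule k.plus_site_morphism)
 interpret l': site_morphism K "plus_presheaf K F" "plus_presheaf K H" "plus_map K F H l" by (rule l.plus_site_morphism)
 show ?thesis unfolding sheafify_map_def
 proof (rule plus_map_comp[OF h'.site_map_axioms k'.site_map_axioms l'.site_map_axioms _ A])
  show "x \<in> carrier (sec (plus_presheaf K (plus_presheaf K F)) A)" using x unfolding sheafify_def .
  fix A :: "'a ring" and y assume "A \<in> noeth" "y \<in> carrier (sec (plus_presheaf K F) A)"
  then show "plus_map K G H k A (plus_map K F G h A y) = plus_map K F H l A y"
   by (intro plus_map_comp[OF h.site_map_axioms k.site_map_axioms l.site_map_axioms] eq)
 qed
qed

section \<open>The multiplication of Witt vectors\<close>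

no_notation vec_index (infixl "$" 100)
unbundle fps_syntax

section \<open>Integral polynomials in countably many variables\<close>

type_synonym upoly = "(nat \<Rightarrow>\<^sub>0 nat) \<Rightarrow>\<^sub>0 int"

definition Var :: "nat => upoly" where
 "Var i = Poly_Mapping.single (Poly_Mapping.single i 1) 1"

text \<open>The bridge between two styles of algebra: identities are proved with type classes over
  \<open>upoly\<close> and carried to a ring with a carrier set by homomorphisms out of
  \<open>univ_ring\<close>.\<close>

definition univ_ring :: "'b::comm_ring_1 ring" where
 "univ_ring = \<lparr>carrier = UNIV, monoid.mult = (*), one = 1, ring.zero = 0, add = (+)\<rparr>"

lemma univ_ring_simps [simp]:
 "carrier univ_ring = UNIV" "x \<otimes>\<^bsub>univ_ring\<^esub> y = x * y" "\<one>\<^bsub>univ_ring\<^esub> = 1" "\<zero>\<^bsub>univ_ring\<^esub> = 0"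
 "x \<oplus>\<^bsub>univ_ring\<^esub> y = x + y"
 by (simp_all add: univ_ring_def)

lemma univ_ring_cring: "cring (univ_ring :: 'b::comm_ring_1 ring)"
proof (rule cringI[OF abelian_groupI comm_monoidI])
 fix x :: 'b
 show "\<exists>y \<in> carrier univ_ring. y \<oplus>\<^bsub>univ_ring\<^esub> x = \<zero>\<^bsub>univ_ring\<^esub>"
  by (rule bexI[of _ "- x"]) auto
qed (auto simp: algebra_simps)

interpretation univ: cring univ_ring by (rule univ_ring_cring)

lemma univ_ring_uminus [simp]: "\<ominus>\<^bsub>univ_ring\<^esub> x = - x"
proof -
 have "x \<oplus>\<^bsub>univ_ring\<^esub> (- x) = \<zero>\<^bsub>univ_ring\<^esub>" by simp
 then show ?thesis by (intro univ.minus_equality) (simp_all add: add.commute)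
qed

lemma univ_ring_finsum [simp]: "finsum univ_ring f A = sum f A"
proof (cases "finite A")
 case True
 then show ?thesis by (induction A) (auto simp: univ.finsum_insert)
next
 case False
 then show ?thesis by (simp add: finsum_def finprod_def)
qed

lemma univ_ring_finprod [simp]: "finprod univ_ring f A = prod f A"
proof (cases "finite A")
 case True
 then show ?thesis by (induction A) (auto simp: univ.finprod_insert)
next
 case False
 then show ?thesis by (simp add: finprod_def)
qed

definition mon_eval :: "('a, 'b) ring_scheme => (nat => 'a) => (nat \<Rightarrow>\<^sub>0 nat) => 'a" where
 "mon_eval A sigma m = (\<Otimes>\<^bsub>A\<^esub>v\<in>Poly_Mapping.keys m. sigma v [^]\<^bsub>A\<^esub> Poly_Mapping.lookup m v)"

definition ueval :: "('a, 'b) ring_scheme => (nat => 'a) => upoly => 'a" where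
 "ueval A sigma p = (\<Oplus>\<^bsub>A\<^esub>m\<in>Poly_Mapping.keys p. [Poly_Mapping.lookup p m] \<cdot>\<^bsub>A\<^esub> mon_eval A sigma m)"

context cring
begin

context
 fixes sigma :: "nat => 'a"
 assumes sigma: "!!v. sigma v \<in> carrier R"
begin

lemma mon_eval_closed: "mon_eval R sigma m \<in> carrier R"
 unfolding mon_eval_def by (rule finprod_closed) (use sigma in auto)

lemma mon_eval_superset:
 "finite S ==> Poly_Mapping.keys m \<subseteq> S ==> mon_eval R sigma m = (\<Otimes>v\<in>S. sigma v [^] Poly_Mapping.lookup m v)"
 unfolding mon_eval_def
 by (rule finprod_mono_neutral_cong_left) (use sigma in \<open>auto simp: in_keys_iff\<close>)

lemma mon_eval_add: "mon_eval R sigma (m + n) = mon_eval R sigma m \<otimes> mon_eval R sigma n"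
proof -
 let ?S = "Poly_Mapping.keys m \<union> Poly_Mapping.keys n"
 have S: "finite ?S" by simp
 have "mon_eval R sigma (m + n) = (\<Otimes>v\<in>?S. sigma v [^] (Poly_Mapping.lookup m v + Poly_Mapping.lookup n v))"
  using mon_eval_superset[OF S Poly_Mapping.keys_add] by (simp add: lookup_add)
 also have "\<dots> = (\<Otimes>v\<in>?S. sigma v [^] Poly_Mapping.lookup m v \<otimes> sigma v [^] Poly_Mapping.lookup n v)"
  by (rule finprod_cong) (use sigma in \<open>auto simp: nat_pow_mult simp_implies_def\<close>)
 also have "\<dots> = (\<Otimes>v\<in>?S. sigma v [^] Poly_Mapping.lookup m v) \<otimes> (\<Otimes>v\<in>?S. sigma v [^] Poly_Mapping.lookup n v)"
  by (rule finprod_multf) (use sigma in auto)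
 also have "\<dots> = mon_eval R sigma m \<otimes> mon_eval R sigma n"
  by (simp add: mon_eval_superset[OF S, symmetric])
 finally show ?thesis .
qed

lemma mon_eval_0: "mon_eval R sigma 0 = \<one>"
 by (simp add: mon_eval_def)

lemma mon_eval_single: "mon_eval R sigma (Poly_Mapping.single v 1) = sigma v"
 using sigma by (simp add: mon_eval_def)

lemma ueval_closed: "ueval R sigma p \<in> carrier R"
 unfolding ueval_def by (rule finsum_closed) (use mon_eval_closed in auto)

lemma add_pow_int_0: "add_pow R (0::int) x = \<zero>"
 by (simp add: add_pow_def)

lemma ueval_superset:
 "finite S ==> Poly_Mapping.keys p \<subseteq> S ==> ueval R sigma p = (\<Oplus>m\<in>S. add_pow R (Poly_Mapping.lookup p m) (mon_eval R sigma m))"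
 unfolding ueval_def
 by (rule add.finprod_mono_neutral_cong_left) (use mon_eval_closed in \<open>auto simp: in_keys_iff add_pow_int_0\<close>)

lemma ueval_add: "ueval R sigma (p + q) = ueval R sigma p \<oplus> ueval R sigma q"
proof -
 let ?S = "Poly_Mapping.keys p \<union> Poly_Mapping.keys q"
 have S: "finite ?S" by simp
 have "ueval R sigma (p + q) = (\<Oplus>m\<in>?S. add_pow R (Poly_Mapping.lookup p m + Poly_Mapping.lookup q m) (mon_eval R sigma m))"
  using ueval_superset[OF S Poly_Mapping.keys_add] by (simp add: lookup_add)
 also have "\<dots> = (\<Oplus>m\<in>?S. add_pow R (Poly_Mapping.lookup p m) (mon_eval R sigma m) \<oplus> add_pow R (Poly_Mapping.lookup q m) (mon_eval R sigma m))"
  by (rule finsum_cong) (use mon_eval_closed in \<open>auto simp: add.int_pow_mult simp_implies_def\<close>)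
 also have "\<dots> = (\<Oplus>m\<in>?S. add_pow R (Poly_Mapping.lookup p m) (mon_eval R sigma m)) \<oplus> (\<Oplus>m\<in>?S. add_pow R (Poly_Mapping.lookup q m) (mon_eval R sigma m))"
  by (rule finsum_addf) (use mon_eval_closed in auto)
 also have "\<dots> = ueval R sigma p \<oplus> ueval R sigma q"
  by (simp add: ueval_superset[OF S, symmetric])
 finally show ?thesis .
qed

lemma ueval_0: "ueval R sigma 0 = \<zero>"
 by (simp add: ueval_def)

lemma ueval_single: "ueval R sigma (Poly_Mapping.single m c) = add_pow R (c) (mon_eval R sigma m)"
 using mon_eval_closed by (cases "c = 0") (simp_all add: ueval_def add_pow_int_0)

lemma upoly_induct:
 assumes "P (0::upoly)" "!!p m c. P p ==> P (p + Poly_Mapping.single m c)"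
 shows "P p"
proof (induction p rule: Poly_Mapping.update_induct)
 case const
 show ?case by fact
next
 case (update f a b)
 have "Poly_Mapping.update a b f = f + Poly_Mapping.single a b"
  using update(1) by (intro poly_mapping_eqI) (auto simp: lookup_update lookup_add lookup_single when_def in_keys_iff)
 then show ?case using assms(2)[OF update(3)] by simp
qed

lemma ueval_mult: "ueval R sigma (p * q) = ueval R sigma p \<otimes> ueval R sigma q"
proof (induction p rule: upoly_induct)
 case 1
 show ?case using ueval_closed by (simp add: ueval_0)
next
 case (2 p m c)
 have "ueval R sigma (Poly_Mapping.single m c * q) = ueval R sigma (Poly_Mapping.single m c) \<otimes> ueval R sigma q"
 proof (induction q rule: upoly_induct)
  case 1
  show ?case using ueval_closed by (simp add: ueval_0)
 next
  case (2 q n d)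
  have cl: "mon_eval R sigma m \<in> carrier R" "mon_eval R sigma n \<in> carrier R" by (rule mon_eval_closed)+
  have "add_pow R (c * d) (mon_eval R sigma m \<otimes> mon_eval R sigma n) = add_pow R (c) (mon_eval R sigma m) \<otimes> add_pow R (d) (mon_eval R sigma n)"
  proof -
   have "add_pow R (c) (mon_eval R sigma m) \<otimes> add_pow R (d) (mon_eval R sigma n) = add_pow R d (add_pow R (c) (mon_eval R sigma m) \<otimes> mon_eval R sigma n)"
    using cl by (simp add: add_pow_rdistr_int)
   also have "\<dots> = add_pow R d (add_pow R c (mon_eval R sigma m \<otimes> mon_eval R sigma n))"
    using cl by (simp add: add_pow_ldistr_int)
   also have "\<dots> = add_pow R (c * d) (mon_eval R sigma m \<otimes> mon_eval R sigma n)"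
    using cl by (simp add: add.int_pow_pow)
   finally show ?thesis by simp
  qed
  then have "ueval R sigma (Poly_Mapping.single m c * Poly_Mapping.single n d) = ueval R sigma (Poly_Mapping.single m c) \<otimes> ueval R sigma (Poly_Mapping.single n d)"
   by (simp add: mult_single ueval_single mon_eval_add)
  then show ?case using 2 ueval_closed by (simp add: distrib_left ueval_add r_distr)
 qed
 then show ?case using 2 ueval_closed by (simp add: distrib_right ueval_add l_distr)
qed

lemma ueval_1: "ueval R sigma 1 = \<one>"
proof -
 have "ueval R sigma (Poly_Mapping.single 0 1) = \<one>"
  by (subst ueval_single) (simp add: mon_eval_0)
 then show ?thesis by simp
qed

lemma ueval_Var: "ueval R sigma (Var i) = sigma i"
 unfolding Var_def by (subst ueval_single) (use sigma in \<open>simp add: mon_eval_single del: One_nat_def\<close>)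

lemma ueval_hom: "ueval R sigma \<in> ring_hom univ_ring R"
 by (rule ring_hom_memI) (simp_all add: ueval_closed ueval_add ueval_mult ueval_1)

end

lemma ring_hom_ueval:
 fixes S :: "('c, 'd) ring_scheme" and sigma :: "nat => 'a"
 assumes S: "cring S" and phi: "phi \<in> ring_hom R S" and sigma: "!!v. sigma v \<in> carrier R"
 shows "phi (ueval R sigma p) = ueval S (phi \<circ> sigma) p"
proof -
 interpret S: cring S by fact
 interpret h: ring_hom_cring R S phi using phi by (intro ring_hom_cringI) (auto intro: is_cring S)
 interpret g: group_hom "add_monoid R" "add_monoid S" phi
  by unfold_locales (auto simp: hom_def)
 have mon: "phi (mon_eval R sigma m) = mon_eval S (phi \<circ> sigma) m" for m
 proof -
  have pow: "phi (x [^] (k::nat)) = phi x [^]\<^bsub>S\<^esub> k" if "x \<in> carrier R" for x k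
   using that by (induction k) auto
  show ?thesis unfolding mon_eval_def
   by (subst h.hom_finprod) (use sigma pow in \<open>auto intro!: S.finprod_cong simp: simp_implies_def\<close>)
 qed
 have pow: "phi (add_pow R k x) = add_pow S k (phi x)" if "x \<in> carrier R" for x and k :: int
  using g.hom_int_pow[of x k] that unfolding add_pow_def by simp
 show ?thesis unfolding ueval_def
  by (subst h.hom_finsum) (use sigma pow mon mon_eval_closed[of sigma, OF sigma] S.mon_eval_closed[of "phi \<circ> sigma"] in \<open>auto intro!: S.finsum_cong simp: simp_implies_def\<close>)
qed

lemma ueval_cong:
 fixes sigma \<tau> :: "nat => 'a"
 assumes "!!v. v \<in> (\<Union>m \<in> Poly_Mapping.keys p. Poly_Mapping.keys m) ==> sigma v = \<tau> v"
  "!!v. sigma v \<in> carrier R" "!!v. \<tau> v \<in> carrier R"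
 shows "ueval R sigma p = ueval R \<tau> p"
proof -
 have "mon_eval R sigma m = mon_eval R \<tau> m" if "m \<in> Poly_Mapping.keys p" for m
  unfolding mon_eval_def
 proof (rule finprod_cong')
  fix v assume "v \<in> Poly_Mapping.keys m"
  then have "sigma v = \<tau> v" using assms(1)[of v] that by blast
  then show "sigma v [^] Poly_Mapping.lookup m v = \<tau> v [^] Poly_Mapping.lookup m v" by simp
 qed (use assms in auto)
 then show ?thesis unfolding ueval_def
  by (intro finsum_cong') (use mon_eval_closed assms in auto)
qed

end

text \<open>Existence half of the universal property of Z[x_0, x_1, ...]. The homomorphism is
  evaluation at the sequence \<open>a\<close>.\<close>

lemma upoly_lift:
 assumes "cring A" "!!i. a i \<in> carrier A"
 shows "\<exists>phi \<in> ring_hom (univ_ring :: upoly ring) A. \<forall>i. phi (Var i) = a i"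
proof -
 interpret cring A by fact
 show ?thesis using ueval_hom[of a] ueval_Var[of a] assms(2) by blast
qed

lemma upoly_torsion_free: "of_nat n * (p::upoly) = 0 ==> n > 0 ==> p = 0"
 by simp

text \<open>Multiplication of series becomes addition of ghosts, and Witt multiplication is defined so as to become
 the termwise multiplication of ghosts.\<close>

definition ghost :: "'b::comm_ring_1 fps => 'b fps" where
 "ghost f = - (fps_X * fps_deriv f * fps_right_inverse f 1)"

lemma ghost_mult_self: "f $ 0 = 1 ==> ghost f * f = - (fps_X * fps_deriv f)"
proof -
 assume "f $ 0 = 1"
 then have "f * fps_right_inverse f 1 = 1" by (intro fps_right_inverse) simp
 then have "fps_X * fps_deriv f * (f * fps_right_inverse f 1) = fps_X * fps_deriv f" by simp
 then show ?thesis unfolding ghost_def by (simp add: algebra_simps)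
qed

lemma ghost_eqI:
 assumes "f $ 0 = 1" "w * f = - (fps_X * fps_deriv f)"
 shows "ghost f = w"
proof -
 have inv: "f * fps_right_inverse f 1 = 1" using assms(1) by (intro fps_right_inverse) simp
 have "w = w * (f * fps_right_inverse f 1)" using inv by simp
 also have "\<dots> = (w * f) * fps_right_inverse f 1" by (simp only: mult.assoc)
 also have "\<dots> = ghost f" unfolding assms(2) ghost_def by simp
 finally show ?thesis by simp
qed

lemma ghost_mult: "f $ 0 = 1 ==> g $ 0 = 1 ==> ghost (f * g) = ghost f + ghost g"
proof (rule ghost_eqI)
 assume fg: "f $ 0 = 1" "g $ 0 = 1"
 have "(ghost f + ghost g) * (f * g) = (ghost f * f) * g + (ghost g * g) * f" by (simp add: algebra_simps)
 also have "\<dots> = - (fps_X * fps_deriv (f * g))" unfolding ghost_mult_self[OF fg(1)] ghost_mult_self[OF fg(2)]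
  by (simp add: algebra_simps)
 finally show "(ghost f + ghost g) * (f * g) = - (fps_X * fps_deriv (f * g))" .
qed simp

lemma ghost_1 [simp]: "ghost 1 = 0"
 by (rule ghost_eqI) auto

lemma ghost_power: "f $ 0 = 1 ==> ghost (f ^ k) = of_nat k * ghost f"
 by (induction k) (simp_all add: ghost_mult fps_power_zeroth_eq_one algebra_simps)

lemma ghost_power_nth: "f $ 0 = 1 ==> ghost (f ^ k) $ i = of_nat k * ghost f $ i"
 by (simp add: ghost_power flip: fps_of_nat)

lemma ghost_recurrence:
 assumes "f $ 0 = 1"
 shows "of_nat n * f $ n = - (\<Sum>i=0..n. ghost f $ i * f $ (n - i))"
proof -
 have "(ghost f * f) $ n = (- (fps_X * fps_deriv f)) $ n" by (simp only: ghost_mult_self[OF assms])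
 also have "\<dots> = - (of_nat n * f $ n)" by (cases n) auto
 finally show ?thesis by (simp add: fps_mult_nth)
qed

lemma ghost_nth_0: "f $ 0 = 1 ==> ghost f $ 0 = 0"
 using ghost_recurrence[of f 0] by simp

lemma ghost_nth_rec:
 assumes "f $ 0 = 1"
 shows "ghost f $ n = - (of_nat n * f $ n) - (\<Sum>i<n. ghost f $ i * f $ (n - i))"
proof -
 have "{0..n} = insert n {..<n}" by auto
 then have "of_nat n * f $ n = - (ghost f $ n + (\<Sum>i<n. ghost f $ i * f $ (n - i)))"
  using ghost_recurrence[OF assms, of n] assms by simp
 then show ?thesis by (simp only:) simp
qed

lemma ghost_cong:
 assumes "f $ 0 = 1" "g $ 0 = 1" "!!i. i \<le> N ==> f $ i = g $ i" "i \<le> N"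
 shows "ghost f $ i = ghost g $ i"
 using assms(4)
proof (induction i rule: less_induct)
 case (less i)
 then show ?case
  by (subst (1 2) ghost_nth_rec) (use assms in auto)
qed

text \<open>By \<open>ghost_recurrence\<close>, \<open>i\<close> times the coefficient of degree
  \<open>i\<close> is determined by the ghosts and the lower coefficients. The factor
  \<open>i\<close> can be cancelled because \<open>upoly\<close> is torsion-free, and this is why
  the generic computation takes place over the integers.\<close>

lemma ghost_inj:
 fixes f g :: "upoly fps"
 assumes "f $ 0 = 1" "g $ 0 = 1" "!!i. i \<le> N ==> ghost f $ i = ghost g $ i" "i \<le> N"
 shows "f $ i = g $ i"
 using assms(4)
proof (induction i rule: less_induct)
 case (less i)
 show ?case
 proof (cases "i = 0")
  case False
  have eq: "(\<Sum>j=0..i. ghost f $ j * f $ (i - j)) = (\<Sum>j=0..i. ghost g $ j * g $ (i - j))"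
  proof (rule sum.cong)
   fix j assume "j \<in> {0..i}"
   then show "ghost f $ j * f $ (i - j) = ghost g $ j * g $ (i - j)"
    using less assms(3)[of j] ghost_nth_0[OF assms(1)] ghost_nth_0[OF assms(2)] by (cases "j = 0") auto
  qed simp
  have "of_nat i * (f $ i - g $ i) = 0"
   unfolding right_diff_distrib ghost_recurrence[OF assms(1), of i] ghost_recurrence[OF assms(2), of i] eq by simp
  then show ?thesis using upoly_torsion_free False by auto
 qed (use assms in auto)
qed

text \<open>The ghost is minus T times the logarithmic derivative, here m a T^m / (1 - a T^m), and
  the right-hand side is its geometric series. For m = 1 the components are the powers of
  \<open>a\<close>.\<close>

lemma ghost_binomial:
 fixes a :: "'b::comm_ring_1"
 assumes m: "m > 0"
 shows "ghost (1 - fps_const a * fps_X ^ m) = Abs_fps (\<lambda>k. if m dvd k \<and> k > 0 then of_nat m * a ^ (k div m) else 0)"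
  (is "_ = ?w")
proof (rule ghost_eqI)
 show "(1 - fps_const a * fps_X ^ m) $ 0 = 1" using m by simp
 show "?w * (1 - fps_const a * fps_X ^ m) = - (fps_X * fps_deriv (1 - fps_const a * fps_X ^ m))"
 proof (rule fps_ext)
  fix n
  have L: "(?w * (1 - fps_const a * fps_X ^ m)) $ n = ?w $ n - a * (if n < m then 0 else ?w $ (n - m))"
  proof -
   have "?w * (1 - fps_const a * fps_X ^ m) = ?w - fps_const a * (?w * fps_X ^ m)" by (simp add: algebra_simps)
   then show ?thesis by (simp add: fps_X_power_mult_right_nth)
  qed
  have R: "(- (fps_X * fps_deriv (1 - fps_const a * fps_X ^ m))) $ n = (if n = m then of_nat m * a else 0)"
   using m by (cases n) (auto simp: fps_X_power_nth)
  have "?w $ n - a * (if n < m then 0 else ?w $ (n - m)) = (if n = m then of_nat m * a else 0)"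
  proof (cases "m dvd n \<and> n > m")
   case True
   then obtain q where q: "n = m * q" by auto
   with True m have "q > 1" by (cases q) auto
   then obtain r where r: "q = Suc (Suc r)" by (metis One_nat_def less_imp_Suc_add add_Suc)
   have "n - m = m * Suc r" unfolding q r by simp
   then show ?thesis using True m q r by simp
  next
   case False
   have "m dvd n - m ==> n > m ==> m dvd n" using dvd_diffD[of m n m] by simp
   then show ?thesis using False m by (auto simp: dvd_imp_le)
  qed
  then show "(?w * (1 - fps_const a * fps_X ^ m)) $ n = (- (fps_X * fps_deriv (1 - fps_const a * fps_X ^ m))) $ n"
   unfolding L R .
 qed
qed

text \<open>\<open>(1 - a T\<^sup>m) \<cdot> (1 - b T\<^sup>n) = (1 - a\<^sup>n\<^sup>/\<^sup>d b\<^sup>m\<^sup>/\<^sup>d T\<^sup>l)\<^sup>d\<close> with \<open>d = gcd m n\<close> and \<open>l = lcm m n\<close>.\<close>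

lemma ghost_binomial_product:
 fixes a b :: "'b::comm_ring_1"
 assumes m: "m > 0" and n: "n > 0"
 shows "\<exists>h. h $ 0 = 1 \<and> (\<forall>i. ghost h $ i = ghost (1 - fps_const a * fps_X ^ m) $ i * ghost (1 - fps_const b * fps_X ^ n) $ i)"
proof -
 define d l where "d = gcd m n" and "l = lcm m n"
 define c where "c = a ^ (n div d) * b ^ (m div d)"
 have d: "d > 0" and l: "l > 0" using m n by (auto simp: d_def l_def lcm_pos_nat)
 have ld: "d * l = m * n" unfolding d_def l_def by (rule prod_gcd_lcm_nat[symmetric])
 have lm: "l = m * (n div d)"
 proof -
  obtain n' where n': "n = d * n'" unfolding d_def by (meson dvdE gcd_dvd2)
  have "d * l = d * (m * n')" unfolding ld by (subst n') (rule mult.left_commute)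
  then show ?thesis using d n' by simp
 qed
 have ln: "l = n * (m div d)"
 proof -
  obtain m' where m': "m = d * m'" unfolding d_def by (meson dvdE gcd_dvd1)
  have "d * l = d * (n * m')" unfolding ld by (subst m') simp
  then show ?thesis using d m' by simp
 qed
 let ?g = "1 - fps_const c * fps_X ^ l"
 have g0: "?g $ 0 = 1" using l by simp
 have "ghost (?g ^ d) $ i = ghost (1 - fps_const a * fps_X ^ m) $ i * ghost (1 - fps_const b * fps_X ^ n) $ i" for i
 proof (cases "l dvd i \<and> i > 0")
  case True
  then obtain q where q: "i = l * q" by auto
  have 1: "m dvd i" "n dvd i" using True unfolding l_def by auto
  have 2: "i div m = (n div d) * q" unfolding q lm using m by simp
  have 3: "i div n = (m div d) * q" unfolding q ln using n by simp
  have 4: "i div l = q" unfolding q using l by simp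
  \<comment> \<open>The exponent \<open>d\<close> adjusts the leading factor: the ghost of
    \<open>?g\<close> contributes \<open>l\<close>, its \<open>d\<close>-th power
    \<open>d * l\<close>, and this equals the product \<open>m * n\<close> of the two factors on the
    other side.\<close>
  have "ghost (?g ^ d) $ i = of_nat d * (of_nat l * c ^ q)"
   unfolding ghost_power_nth[OF g0] ghost_binomial[OF l] using True 4 by simp
  also have "\<dots> = of_nat (m * n) * c ^ q" unfolding ld[symmetric] by simp
  also have "c ^ q = a ^ (i div m) * b ^ (i div n)" unfolding c_def 2 3 by (simp add: power_mult_distrib power_mult)
  finally show ?thesis unfolding ghost_binomial[OF m] ghost_binomial[OF n] using True 1 by simp
 next
  case False
  then have "\<not> (m dvd i \<and> n dvd i \<and> i > 0)" unfolding l_def by auto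
  moreover have "ghost (?g ^ d) $ i = 0"
   unfolding ghost_power_nth[OF g0] ghost_binomial[OF l] using False by auto
  ultimately show ?thesis unfolding ghost_binomial[OF m] ghost_binomial[OF n] by auto
 qed
 then show ?thesis using g0 by (intro exI[of _ "?g ^ d"]) (simp add: fps_power_zeroth_eq_one)
qed

inductive_set binomial_products :: "'b::comm_ring_1 fps set" where
 one: "1 \<in> binomial_products"
| mult: "f \<in> binomial_products ==> m > 0 ==> f * (1 - fps_const a * fps_X ^ m) \<in> binomial_products"

lemma binomial_products_0: "f \<in> binomial_products ==> f $ 0 = 1"
 by (induction rule: binomial_products.induct) auto

text \<open>Every series with constant term 1 is an infinite product of factors 1 - a T^m, found
  degree by degree: \<open>a\<close> is the discrepancy in degree \<open>Suc N\<close>, and the new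
  factor does not disturb lower degrees. Finite partial products suffice, since each ghost component
  depends on finitely many coefficients.\<close>

lemma binomial_products_approx:
 fixes f :: "'b::comm_ring_1 fps"
 assumes "f $ 0 = 1"
 shows "\<exists>g \<in> binomial_products. \<forall>i \<le> N. f $ i = g $ i"
proof (induction N)
 case 0
 show ?case using assms binomial_products.one by (intro bexI[of _ 1]) auto
next
 case (Suc N)
 then obtain g where g: "g \<in> binomial_products" "\<forall>i \<le> N. f $ i = g $ i" by blast
 define a where "a = g $ Suc N - f $ Suc N"
 let ?g = "g * (1 - fps_const a * fps_X ^ Suc N)"
 have "f $ i = ?g $ i" if "i \<le> Suc N" for i
 proof -
  have "?g = g - fps_const a * (g * fps_X ^ Suc N)" by (simp add: algebra_simps)
  then have "?g $ i = g $ i - a * (if i < Suc N then 0 else g $ (i - Suc N))"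
   by (simp add: fps_X_power_mult_right_nth del: power_Suc)
  then show ?thesis using that g binomial_products_0[OF g(1)] by (cases "i = Suc N") (auto simp: a_def)
 qed
 then show ?case using binomial_products.mult[OF g(1), of "Suc N" a] by blast
qed

lemma ghost_product_aux:
 fixes f g :: "'b::comm_ring_1 fps"
 assumes "f \<in> binomial_products" "g \<in> binomial_products"
 shows "\<exists>h. h $ 0 = 1 \<and> (\<forall>i. ghost h $ i = ghost f $ i * ghost g $ i)"
 using assms
proof (induction f rule: binomial_products.induct)
 case one
 show ?case by (intro exI[of _ 1]) auto
next
 case (mult f m a)
 let ?f = "1 - fps_const a * fps_X ^ m"
 have f0: "f $ 0 = 1" "?f $ 0 = 1" using binomial_products_0[OF mult(1)] mult(2) by auto
 have "\<exists>h. h $ 0 = 1 \<and> (\<forall>i. ghost h $ i = ghost ?f $ i * ghost g $ i)"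
  using mult(4)
 proof (induction g rule: binomial_products.induct)
  case one
  show ?case by (intro exI[of _ 1]) auto
 next
  case (mult g n b)
  let ?g = "1 - fps_const b * fps_X ^ n"
  have g0: "g $ 0 = 1" "?g $ 0 = 1" using binomial_products_0[OF mult(1)] mult(2) by auto
  obtain h1 where h1: "h1 $ 0 = 1" "\<forall>i. ghost h1 $ i = ghost ?f $ i * ghost g $ i" using mult by blast
  obtain h2 where h2: "h2 $ 0 = 1" "\<forall>i. ghost h2 $ i = ghost ?f $ i * ghost ?g $ i"
   using ghost_binomial_product \<open>m > 0\<close> \<open>n > 0\<close> by blast
  show ?case
   by (intro exI[of _ "h1 * h2"]) (use h1 h2 in \<open>simp add: ghost_mult[OF h1(1) h2(1)] ghost_mult[OF g0] distrib_left\<close>)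
 qed
 then obtain h2 where h2: "h2 $ 0 = 1" "\<forall>i. ghost h2 $ i = ghost ?f $ i * ghost g $ i" by blast
 obtain h1 where h1: "h1 $ 0 = 1" "\<forall>i. ghost h1 $ i = ghost f $ i * ghost g $ i" using mult by blast
 show ?case
  by (intro exI[of _ "h1 * h2"]) (use h1 h2 in \<open>simp add: ghost_mult[OF h1(1) h2(1)] ghost_mult[OF f0] distrib_right\<close>)
qed

text \<open>The integrality statement behind the Witt polynomials: the termwise product of two
  ghosts is, up to any degree, again a ghost, without dividing. It is bilinear in the factors of the
  two series, so it is enough to have explicit solutions for the binomials 1 - a T^m.\<close>

lemma ghost_product:
 fixes f g :: "'b::comm_ring_1 fps"
 assumes "f $ 0 = 1" "g $ 0 = 1"
 shows "\<exists>h. h $ 0 = 1 \<and> (\<forall>i\<le>N. ghost h $ i = ghost f $ i * ghost g $ i)"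
proof -
 obtain f' where f': "f' \<in> binomial_products" "\<forall>i \<le> N. f $ i = f' $ i" using binomial_products_approx[OF assms(1)] by blast
 obtain g' where g': "g' \<in> binomial_products" "\<forall>i \<le> N. g $ i = g' $ i" using binomial_products_approx[OF assms(2)] by blast
 obtain h where h: "h $ 0 = 1" "\<forall>i. ghost h $ i = ghost f' $ i * ghost g' $ i" using ghost_product_aux[OF f'(1) g'(1)] by blast
 have "ghost f $ i = ghost f' $ i" "ghost g $ i = ghost g' $ i" if "i \<le> N" for i
  using ghost_cong[OF assms(1) binomial_products_0[OF f'(1)], of N i] ghost_cong[OF assms(2) binomial_products_0[OF g'(1)], of N i]
   f'(2) g'(2) that by auto
 then show ?thesis using h by auto
qed

section \<open>The universal Witt product\<close>

definition gen_series :: "nat => upoly fps" where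
 "gen_series k = Abs_fps (\<lambda>i. if i = 0 then 1 else Var (prod_encode (k, i)))"

lemma gen_series_0 [simp]: "gen_series k $ 0 = 1"
 by (simp add: gen_series_def)

text \<open>\<open>ghost_product\<close> solves the equation only up to a given degree. For every
  \<open>n\<close> a solution up to degree \<open>n\<close> is chosen and its last coefficient kept;
  by \<open>ghost_inj\<close> the solutions for different \<open>n\<close> agree where both are
  valid.\<close>

definition witt_poly :: "nat => upoly" where
 "witt_poly n = (SOME h. h $ 0 = 1 \<and> (\<forall>i\<le>n. ghost h $ i = ghost (gen_series 0) $ i * ghost (gen_series 1) $ i)) $ n"

lemma witt_poly_ghost:
 "witt_poly 0 = 1" "ghost (Abs_fps witt_poly) $ i = ghost (gen_series 0) $ i * ghost (gen_series 1) $ i"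
proof -
 define H where "H n = (SOME h. h $ 0 = 1 \<and> (\<forall>i\<le>n. ghost h $ i = ghost (gen_series 0) $ i * ghost (gen_series 1) $ i))" for n
 have H: "H n $ 0 = 1 \<and> (\<forall>i\<le>n. ghost (H n) $ i = ghost (gen_series 0) $ i * ghost (gen_series 1) $ i)" for n
  unfolding H_def by (rule someI_ex, rule ghost_product) simp_all
 have W: "witt_poly n = H n $ n" for n by (simp add: witt_poly_def H_def)
 show 0: "witt_poly 0 = 1" using H W by simp
 have "H i $ j = H j $ j" if "j \<le> i" for j
  by (rule ghost_inj[of _ _ j]) (use H that in auto)
 then have "ghost (Abs_fps witt_poly) $ i = ghost (H i) $ i"
  by (intro ghost_cong[of _ _ i]) (use H 0 W in auto)
 then show "ghost (Abs_fps witt_poly) $ i = ghost (gen_series 0) $ i * ghost (gen_series 1) $ i" using H by simp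
qed

definition coeff_assignment :: "'a ring => (nat => nat => 'a) => nat => 'a" where
 "coeff_assignment A f v = (let (k, i) = prod_decode v in f k i)"

definition witt_prod :: "'a ring => (nat => 'a) => (nat => 'a) => nat => 'a" where
 "witt_prod A f g n = ueval A (coeff_assignment A (\<lambda>k. if k = 0 then f else g)) (witt_poly n)"

lemma coeff_assignment_closed:
 "(!!k. f k \<in> witt_carrier A) ==> coeff_assignment A f v \<in> carrier A"
 by (auto simp: coeff_assignment_def witt_carrier_def split: prod.splits)

lemma witt_carrier_hom: "phi \<in> ring_hom A B ==> f \<in> witt_carrier A ==> phi \<circ> f \<in> witt_carrier B"
 by (auto simp: witt_carrier_def ring_hom_one intro: ring_hom_closed)

lemma ueval_gen_series:
 assumes "cring A" "!!k. f k \<in> witt_carrier A"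
 shows "ueval A (coeff_assignment A f) \<circ> fps_nth (gen_series k) = f k"
proof -
 interpret cring A by fact
 note cl = coeff_assignment_closed[of f, OF assms(2)]
 have "f k 0 = \<one>\<^bsub>A\<^esub>" using assms(2) by (auto simp: witt_carrier_def)
 then show ?thesis
  by (auto simp: fun_eq_iff gen_series_def ueval_1[OF cl] ueval_Var[OF cl]) (simp add: coeff_assignment_def)
qed

lemma gen_series_lift:
 assumes "cring A" "!!k. f k \<in> witt_carrier A"
 shows "\<exists>phi \<in> ring_hom univ_ring A. \<forall>k. phi \<circ> fps_nth (gen_series k) = f k"
proof -
 interpret cring A by fact
 show ?thesis
  using ueval_gen_series[of A f, OF assms]
  by (intro bexI[OF _ ueval_hom[OF coeff_assignment_closed[of f, OF assms(2)]]] allI)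
qed

lemma witt_prod_hom:
 assumes "cring A" "cring B" "phi \<in> ring_hom A B" "f \<in> witt_carrier A" "g \<in> witt_carrier A"
 shows "phi \<circ> witt_prod A f g = witt_prod B (phi \<circ> f) (phi \<circ> g)"
proof -
 interpret cring A by fact
 have "coeff_assignment A (\<lambda>k. if k = 0 then f else g) v \<in> carrier A" for v
  by (rule coeff_assignment_closed) (use assms in auto)
 moreover have "phi \<circ> coeff_assignment A (\<lambda>k. if k = 0 then f else g) = coeff_assignment B (\<lambda>k. if k = 0 then phi \<circ> f else phi \<circ> g)"
  by (rule ext) (simp add: coeff_assignment_def split: prod.split)
 ultimately show ?thesis
  using ring_hom_ueval[OF assms(2,3)] by (intro ext) (simp only: comp_apply witt_prod_def)
qed

lemma ps_mult_hom:
 assumes "cring A" "cring B" "phi \<in> ring_hom A B" "!!n. f n \<in> carrier A" "!!n. g n \<in> carrier A"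
 shows "phi \<circ> ps_mult A f g = ps_mult B (phi \<circ> f) (phi \<circ> g)"
proof -
 interpret A: cring A by fact
 interpret B: cring B by fact
 interpret h: ring_hom_cring A B phi using assms by (intro ring_hom_cringI) auto
 have "phi (f i \<otimes>\<^bsub>A\<^esub> g j) = phi (f i) \<otimes>\<^bsub>B\<^esub> phi (g j)" for i j using assms by simp
 then show ?thesis
  using assms(4,5) by (auto simp: fun_eq_iff ps_mult_def Pi_def comp_def)
qed

lemma ps_mult_univ: "ps_mult univ_ring (fps_nth f) (fps_nth g) = fps_nth (f * g)"
 by (auto simp: fun_eq_iff ps_mult_def fps_mult_nth atLeast0AtMost)

lemma teich_hom: "cring A ==> cring B ==> phi \<in> ring_hom A B ==> a \<in> carrier A ==> phi \<circ> teich A a = teich B (phi a)"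
proof -
 assume "cring A" "cring B" "phi \<in> ring_hom A B" "a \<in> carrier A"
 then interpret h: ring_hom_cring A B phi by (intro ring_hom_cringI) auto
 show ?thesis using \<open>a \<in> carrier A\<close> by (auto simp: teich_def fun_eq_iff)
qed

lemma teich_univ: "teich univ_ring a = fps_nth (1 - fps_const a * fps_X)"
 by (auto simp: teich_def fun_eq_iff fps_X_def)

lemma witt_prod_ghost:
 fixes f g :: "upoly fps"
 assumes "f $ 0 = 1" "g $ 0 = 1"
 shows "witt_prod univ_ring (fps_nth f) (fps_nth g) 0 = 1"
  "ghost (Abs_fps (witt_prod univ_ring (fps_nth f) (fps_nth g))) $ i = ghost f $ i * ghost g $ i"
proof -
 let ?c = "\<lambda>k. if k = 0 then fps_nth f else fps_nth g"
 let ?phi = "ueval univ_ring (coeff_assignment univ_ring ?c)"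
 have c: "?c k \<in> witt_carrier univ_ring" for k using assms by (auto simp: witt_carrier_def)
 note cl = coeff_assignment_closed[of ?c, OF c]
 have hom: "?phi (p + q) = ?phi p + ?phi q" "?phi (p * q) = ?phi p * ?phi q" "?phi 1 = 1" "?phi 0 = 0" for p q
  using univ.ueval_add[OF cl] univ.ueval_mult[OF cl] univ.ueval_1[OF cl] univ.ueval_0 by auto
 have minus: "?phi (- p) = - ?phi p" for p
  using hom(1)[of p "- p"] by (simp add: hom(4) eq_neg_iff_add_eq_0 add.commute)
 have sum: "?phi (sum h S) = (\<Sum>x\<in>S. ?phi (h x))" if "finite S" for h :: "nat => upoly" and S
  using that by (induction S) (auto simp: hom)
 have nat: "?phi (of_nat n) = of_nat n" for n by (induction n) (auto simp: hom)
 \<comment> \<open>Coefficientwise evaluation. It commutes with \<open>ghost\<close> because the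
   ghost is determined by the equation in \<open>ghost_eqI\<close>, whose ingredients are preserved
   by ring homomorphisms.\<close>
 define F where "F h = Abs_fps (\<lambda>n. ?phi (h $ n))" for h :: "upoly fps"
 have Fg: "ghost (F h) = F (ghost h)" if h: "h $ 0 = 1" for h
 proof (rule ghost_eqI)
  show "F h $ 0 = 1" using h by (simp add: F_def hom)
  have "F (ghost h) * F h = F (ghost h * h)"
   by (rule fps_ext) (simp add: F_def fps_mult_nth sum hom)
  also have "\<dots> = - (fps_X * fps_deriv (F h))"
   unfolding ghost_mult_self[OF h]
  proof (rule fps_ext)
   fix n show "F (- (fps_X * fps_deriv h)) $ n = (- (fps_X * fps_deriv (F h))) $ n"
    by (cases n) (simp_all add: F_def hom minus nat del: of_nat_Suc)
  qed
  finally show "F (ghost h) * F h = - (fps_X * fps_deriv (F h))" .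
 qed
 have W: "Abs_fps (witt_prod univ_ring (fps_nth f) (fps_nth g)) = F (Abs_fps witt_poly)"
  by (rule fps_ext) (simp add: F_def witt_prod_def)
 have "F (gen_series k) = Abs_fps (?c k)" for k
  using fun_cong[OF ueval_gen_series[of univ_ring ?c, OF univ_ring_cring c, of k]] unfolding F_def by (intro fps_ext) simp
 from this[of 0] this[of 1] have X: "F (gen_series 0) = f" "F (gen_series 1) = g" by (simp_all add: fps_nth_inverse)
 show "witt_prod univ_ring (fps_nth f) (fps_nth g) 0 = 1"
  by (simp add: witt_prod_def witt_poly_ghost hom)
 have "ghost (F (Abs_fps witt_poly)) $ i = ?phi (ghost (gen_series 0) $ i * ghost (gen_series 1) $ i)"
  by (subst Fg) (simp_all add: F_def witt_poly_ghost)
 also have "\<dots> = F (ghost (gen_series 0)) $ i * F (ghost (gen_series 1)) $ i"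
  by (simp add: F_def hom)
 also have "\<dots> = ghost f $ i * ghost g $ i"
  unfolding Fg[symmetric, OF gen_series_0] X ..
 finally show "ghost (Abs_fps (witt_prod univ_ring (fps_nth f) (fps_nth g))) $ i = ghost f $ i * ghost g $ i"
  unfolding W .
qed

text \<open>Identities between \<open>witt_prod\<close> and \<open>ps_mult\<close> hold over every ring because, over the ring of integer
 polynomials, they can be checked on ghost components, and every family of elements is a specialization
 of the generic one.\<close>

definition uprod :: "upoly fps => upoly fps => upoly fps" where
 "uprod f g = Abs_fps (witt_prod univ_ring (fps_nth f) (fps_nth g))"

lemma uprod_nth: "witt_prod univ_ring (fps_nth f) (fps_nth g) = fps_nth (uprod f g)"
 by (simp add: uprod_def fun_eq_iff)

lemma uprod_0: "f $ 0 = 1 ==> g $ 0 = 1 ==> uprod f g $ 0 = 1"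
 by (simp add: uprod_def witt_prod_ghost)

lemma ghost_uprod: "f $ 0 = 1 ==> g $ 0 = 1 ==> ghost (uprod f g) $ i = ghost f $ i * ghost g $ i"
 unfolding uprod_def by (rule witt_prod_ghost)

lemma ghost_inj': "f $ 0 = 1 ==> g $ 0 = 1 ==> (!!i. ghost f $ i = ghost g $ i) ==> f = (g :: upoly fps)"
 by (rule fps_ext) (rule ghost_inj, auto)

lemma uprod_commute: "f $ 0 = 1 ==> g $ 0 = 1 ==> uprod f g = uprod g f"
 by (rule ghost_inj') (auto simp: uprod_0 ghost_uprod)

lemma uprod_assoc: "f $ 0 = 1 ==> g $ 0 = 1 ==> h $ 0 = 1 ==> uprod (uprod f g) h = uprod f (uprod g h)"
 by (rule ghost_inj') (auto simp: uprod_0 ghost_uprod)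

lemma uprod_distrib: "f $ 0 = 1 ==> g $ 0 = 1 ==> h $ 0 = 1 ==> uprod (f * g) h = uprod f h * uprod g h"
 by (rule ghost_inj') (auto simp: uprod_0 ghost_uprod ghost_mult distrib_right)

lemma uprod_one: "f $ 0 = 1 ==> uprod (1 - fps_const 1 * fps_X) f = f"
proof (rule ghost_inj')
 assume f: "f $ 0 = 1"
 have *: "ghost (1 - fps_const 1 * fps_X :: upoly fps) $ i = (if i > 0 then 1 else 0)" for i
  using ghost_binomial[of 1 "1::upoly"] by simp
 show "ghost (uprod (1 - fps_const 1 * fps_X) f) $ i = ghost f $ i" for i
  by (subst ghost_uprod) (use f in \<open>auto simp: * ghost_nth_0[OF f] simp del: fps_const_1_eq_1\<close>)
qed (auto simp: uprod_0)

lemma uprod_teich: "uprod (1 - fps_const a * fps_X) (1 - fps_const b * fps_X) = 1 - fps_const (a * b) * fps_X"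
proof (rule ghost_inj')
 have *: "ghost (1 - fps_const c * fps_X) $ i = (if i > 0 then c ^ i else 0)" for i and c :: upoly
  using ghost_binomial[of 1 c] by simp
 have 0: "(1 - fps_const c * fps_X) $ 0 = 1" for c :: upoly by simp
 show "ghost (uprod (1 - fps_const a * fps_X) (1 - fps_const b * fps_X)) $ i = ghost (1 - fps_const (a * b) * fps_X) $ i" for i
  unfolding ghost_uprod[OF 0 0] * by (simp add: power_mult_distrib)
qed (auto simp: uprod_0)

lemma witt_prod_closed:
 assumes "cring A" "f \<in> witt_carrier A" "g \<in> witt_carrier A"
 shows "witt_prod A f g \<in> witt_carrier A"
proof -
 interpret cring A by fact
 have cl: "coeff_assignment A (\<lambda>k. if k = 0 then f else g) v \<in> carrier A" for v
  by (rule coeff_assignment_closed) (use assms in auto)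
 show ?thesis unfolding witt_carrier_def
  by (simp add: witt_prod_def ueval_closed[OF cl] witt_poly_ghost ueval_1[OF cl])
qed

lemma ps_mult_closed:
 assumes "cring A" "f \<in> witt_carrier A" "g \<in> witt_carrier A"
 shows "ps_mult A f g \<in> witt_carrier A"
proof -
 interpret cring A by fact
 show ?thesis using assms by (auto simp: witt_carrier_def ps_mult_def)
qed

lemma teich_closed: "cring A ==> a \<in> carrier A ==> teich A a \<in> witt_carrier A"
proof -
 assume "cring A" "a \<in> carrier A"
 then interpret cring A by simp
 show ?thesis using \<open>a \<in> carrier A\<close> by (auto simp: witt_carrier_def teich_def)
qed

lemma witt_carrier_univ: "f $ 0 = 1 ==> fps_nth f \<in> witt_carrier univ_ring"
 by (simp add: witt_carrier_def)

lemma witt_ring_laws: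
 fixes A (structure)
 assumes A: "cring A" and f: "f \<in> witt_carrier A" and g: "g \<in> witt_carrier A" and h: "h \<in> witt_carrier A"
 shows "ps_mult A f g = ps_mult A g f"
  "ps_mult A (ps_mult A f g) h = ps_mult A f (ps_mult A g h)"
  "ps_mult A (\<lambda>n. if n = 0 then \<one> else \<zero>) f = f"
  "\<exists>f' \<in> witt_carrier A. ps_mult A f' f = (\<lambda>n. if n = 0 then \<one> else \<zero>)"
  "witt_prod A f g = witt_prod A g f"
  "witt_prod A (witt_prod A f g) h = witt_prod A f (witt_prod A g h)"
  "witt_prod A (teich A \<one>) f = f"
  "witt_prod A (ps_mult A f g) h = ps_mult A (witt_prod A f h) (witt_prod A g h)"
proof -
 define c where "c = (\<lambda>k::nat. if k = 0 then f else if k = 1 then g else h)"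
 have "c k \<in> witt_carrier A" for k using f g h by (simp add: c_def)
 then obtain phi where phi: "phi \<in> ring_hom univ_ring A" "!!k. phi \<circ> fps_nth (gen_series k) = c k"
  using gen_series_lift[OF A, of c] by blast
 define X0 X1 X2 where "X0 = gen_series 0" "X1 = gen_series 1" "X2 = gen_series 2"
 have X: "f = phi \<circ> fps_nth X0" "g = phi \<circ> fps_nth X1" "h = phi \<circ> fps_nth X2"
  using phi(2)[of 0] phi(2)[of 1] phi(2)[of 2] by (auto simp: c_def X0_X1_X2_def)
 have X0: "X0 $ 0 = 1" "X1 $ 0 = 1" "X2 $ 0 = 1" by (auto simp: X0_X1_X2_def)
 interpret h: ring_hom_cring univ_ring A phi using A phi(1) by (intro ring_hom_cringI) (auto intro: univ_ring_cring)
 have pm: "ps_mult A (phi \<circ> fps_nth u) (phi \<circ> fps_nth v) = phi \<circ> fps_nth (u * v)" for u v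
  using ps_mult_hom[OF univ_ring_cring A phi(1), of "fps_nth u" "fps_nth v"] by (simp add: ps_mult_univ)
 have wp: "witt_prod A (phi \<circ> fps_nth u) (phi \<circ> fps_nth v) = phi \<circ> fps_nth (uprod u v)" if "u $ 0 = 1" "v $ 0 = 1" for u v
  using witt_prod_hom[OF univ_ring_cring A phi(1) witt_carrier_univ witt_carrier_univ, of u v] that by (simp add: uprod_nth)
 have one: "(\<lambda>n. if n = 0 then \<one> else \<zero>) = phi \<circ> fps_nth 1"
  using h.hom_one h.hom_zero by (auto simp: fun_eq_iff)
 have tei: "teich A \<one> = phi \<circ> fps_nth (1 - fps_const 1 * fps_X)"
  using teich_hom[OF univ_ring_cring A phi(1), of 1] h.hom_one unfolding teich_univ by simp
 note m0 = uprod_0 X0 fps_mult_nth_0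
 show "ps_mult A f g = ps_mult A g f" unfolding X pm by (simp add: mult.commute)
 show "ps_mult A (ps_mult A f g) h = ps_mult A f (ps_mult A g h)" unfolding X pm by (simp add: mult.assoc)
 show "ps_mult A (\<lambda>n. if n = 0 then \<one> else \<zero>) f = f" unfolding X one pm by simp
 show "\<exists>f' \<in> witt_carrier A. ps_mult A f' f = (\<lambda>n. if n = 0 then \<one> else \<zero>)"
 proof (rule bexI)
  let ?i = "fps_right_inverse X0 1"
  have i: "?i * X0 = 1" using fps_right_inverse[of X0 1] X0 by (simp add: mult.commute)
  show "ps_mult A (phi \<circ> fps_nth ?i) f = (\<lambda>n. if n = 0 then \<one> else \<zero>)" unfolding X one pm i ..
  show "phi \<circ> fps_nth ?i \<in> witt_carrier A" by (rule witt_carrier_hom[OF phi(1) witt_carrier_univ]) simp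
 qed
 show "witt_prod A f g = witt_prod A g f" unfolding X by (simp add: wp m0 uprod_commute[OF X0(1,2)])
 show "witt_prod A (witt_prod A f g) h = witt_prod A f (witt_prod A g h)" unfolding X by (simp add: wp m0 uprod_assoc)
 show "witt_prod A (teich A \<one>) f = f" unfolding X tei by (subst wp) (simp_all only: m0 uprod_one, simp)
 show "witt_prod A (ps_mult A f g) h = ps_mult A (witt_prod A f h) (witt_prod A g h)"
  unfolding X by (simp add: wp pm m0 uprod_distrib)
qed

lemma witt_prod_teich:
 assumes A: "cring A" and a: "a \<in> carrier A" "b \<in> carrier A"
 shows "witt_prod A (teich A a) (teich A b) = teich A (a \<otimes>\<^bsub>A\<^esub> b)"
proof -
 obtain phi where phi: "phi \<in> ring_hom (univ_ring :: upoly ring) A" "!!i. phi (Var i) = (if i = 0 then a else b)"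
  using upoly_lift[of A "\<lambda>i. if i = 0 then a else b"] A a by (metis (full_types))
 let ?T = "\<lambda>c. 1 - fps_const c * fps_X :: upoly fps"
 have T: "?T c $ 0 = 1" for c by simp
 have t: "teich A (phi c) = phi \<circ> fps_nth (?T c)" for c
  using teich_hom[OF univ_ring_cring A phi(1), of c] unfolding teich_univ by simp
 have "witt_prod A (teich A (phi (Var 0))) (teich A (phi (Var 1))) = teich A (phi (Var 0 * Var 1))"
  unfolding t using witt_prod_hom[OF univ_ring_cring A phi(1) witt_carrier_univ[OF T] witt_carrier_univ[OF T], of "Var 0" "Var 1"]
  unfolding uprod_nth uprod_teich by simp
 then show ?thesis using ring_hom_mult[OF phi(1), of "Var 0" "Var 1"] phi(2) by simp
qed

lemma witt_prod_ring:
 fixes A (structure)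
 assumes A: "cring A"
 shows "cring (witt_ring_with witt_prod A)"
proof -
 interpret cring A by fact
 let ?R = "witt_ring_with witt_prod A"
 have zero: "(\<lambda>n. if n = 0 then \<one> else \<zero>) \<in> witt_carrier A" by (auto simp: witt_carrier_def)
 have sel: "carrier ?R = witt_carrier A" "monoid.mult ?R = witt_prod A" "monoid.one ?R = teich A \<one>"
  "ring.zero ?R = (\<lambda>n. if n = 0 then \<one> else \<zero>)" "ring.add ?R = ps_mult A"
  by (simp_all add: witt_ring_with_def)
 note laws = witt_ring_laws[OF A] ps_mult_closed[OF A] witt_prod_closed[OF A] zero teich_closed[OF A one_closed]
 show ?thesis
 proof (rule cringI[OF abelian_groupI comm_monoidI], unfold sel)
  fix x y z assume xyz: "x \<in> witt_carrier A" "y \<in> witt_carrier A" "z \<in> witt_carrier A"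
  show "ps_mult A x y \<in> witt_carrier A" "witt_prod A x y \<in> witt_carrier A"
   "ps_mult A (ps_mult A x y) z = ps_mult A x (ps_mult A y z)" "ps_mult A x y = ps_mult A y x"
   "ps_mult A (\<lambda>n. if n = 0 then \<one> else \<zero>) x = x"
   "\<exists>y \<in> witt_carrier A. ps_mult A y x = (\<lambda>n. if n = 0 then \<one> else \<zero>)"
   "witt_prod A (witt_prod A x y) z = witt_prod A x (witt_prod A y z)" "witt_prod A x y = witt_prod A y x"
   "witt_prod A (teich A \<one>) x = x"
   "witt_prod A (ps_mult A x y) z = ps_mult A (witt_prod A x z) (witt_prod A y z)"
   by (fact laws(9)[OF xyz(1,2)] laws(10)[OF xyz(1,2)] laws(1-8)[OF xyz])+
 qed (fact laws)+
qed

text \<open>A coefficient of the product is a polynomial in finitely many variables;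
  \<open>k\<close> exceeds the degrees of all coefficients that occur in the first \<open>n\<close>
  polynomials.\<close>

lemma witt_prod_continuous:
 assumes A: "cring A" and f: "f \<in> witt_carrier A" and g: "g \<in> witt_carrier A"
 shows "\<exists>k. \<forall>f' \<in> witt_carrier A. \<forall>g' \<in> witt_carrier A.
     (\<forall>i<k. f' i = f i \<and> g' i = g i) --> (\<forall>i<n. witt_prod A f' g' i = witt_prod A f g i)"
proof -
 interpret cring A by fact
 define V where "V = (\<Union>i<n. \<Union>m \<in> Poly_Mapping.keys (witt_poly i). Poly_Mapping.keys m)"
 have "finite (snd ` prod_decode ` V)" by (simp add: V_def)
 then obtain k where k: "!!v. v \<in> V ==> snd (prod_decode v) < k"
  using finite_nat_bounded[of "snd ` prod_decode ` V"] by auto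
 show ?thesis
 proof (intro exI[of _ k] ballI impI allI)
  fix f' g' i assume *: "f' \<in> witt_carrier A" "g' \<in> witt_carrier A" "\<forall>i<k. f' i = f i \<and> g' i = g i" "i < n"
  show "witt_prod A f' g' i = witt_prod A f g i"
   unfolding witt_prod_def
  proof (rule ueval_cong)
   fix v assume "v \<in> (\<Union>m \<in> Poly_Mapping.keys (witt_poly i). Poly_Mapping.keys m)"
   then have "v \<in> V" unfolding V_def using *(4) by blast
   then show "coeff_assignment A (\<lambda>k. if k = 0 then f' else g') v = coeff_assignment A (\<lambda>k. if k = 0 then f else g) v"
    using k[of v] *(3) by (auto simp: coeff_assignment_def split: prod.splits)
  qed (rule coeff_assignment_closed, use * f g in simp)+
 qed
qed

lemma is_witt_mult_witt_prod: "is_witt_mult witt_prod"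
 unfolding is_witt_mult_def
proof (intro conjI allI impI ballI)
 fix A :: "'a ring" and f g n assume "cring A" "f \<in> witt_carrier A" "g \<in> witt_carrier A"
 then show "\<exists>k. \<forall>f' \<in> witt_carrier A. \<forall>g' \<in> witt_carrier A.
     (\<forall>i<k. f' i = f i \<and> g' i = g i) --> (\<forall>i<n. witt_prod A f' g' i = witt_prod A f g i)"
  by (rule witt_prod_continuous)
qed (simp_all add: witt_prod_ring witt_prod_teich witt_prod_hom)

text \<open>The explicit product is the witness that makes the choice by \<open>SOME\<close>
  meaningful. The choice may return another function, so from here on \<open>witt_mult\<close> is
  used through the properties in \<open>is_witt_mult\<close>.\<close>

lemma is_witt_mult_witt_mult: "is_witt_mult witt_mult"
 unfolding witt_mult_def by (rule someI[of is_witt_mult, OF is_witt_mult_witt_prod])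

section \<open>Noetherian rings\<close>

lemma transport_ring:
 fixes R :: "('b, 'm) ring_scheme" and i :: "'b => 'a"
 assumes R: "cring R" and i: "inj_on i (carrier R)"
 shows "\<exists>B :: 'a ring. cring B \<and> carrier B = i ` carrier R \<and> i \<in> ring_hom R B"
proof -
 interpret cring R by fact
 define g where "g = inv_into (carrier R) i"
 have g: "g (i x) = x" if "x \<in> carrier R" for x using i that by (simp add: g_def)
 define B :: "'a ring" where "B = \<lparr>carrier = i ` carrier R, monoid.mult = (\<lambda>x y. i (g x \<otimes>\<^bsub>R\<^esub> g y)), one = i \<one>\<^bsub>R\<^esub>,
  ring.zero = i \<zero>\<^bsub>R\<^esub>, add = (\<lambda>x y. i (g x \<oplus>\<^bsub>R\<^esub> g y))\<rparr>"
 have "cring B"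
 proof (rule cringI[OF abelian_groupI comm_monoidI])
  fix x assume "x \<in> carrier B"
  then obtain x' where x': "x = i x'" "x' \<in> carrier R" by (auto simp: B_def)
  show "\<exists>y \<in> carrier B. y \<oplus>\<^bsub>B\<^esub> x = \<zero>\<^bsub>B\<^esub>"
   by (rule bexI[of _ "i (\<ominus>\<^bsub>R\<^esub> x')"]) (use x' in \<open>auto simp: B_def g l_neg\<close>)
 qed (auto simp: B_def g a_ac m_ac l_distr r_distr)
 moreover have "i \<in> ring_hom R B" by (rule ring_hom_memI) (auto simp: B_def g)
 moreover have "carrier B = i ` carrier R" by (simp add: B_def)
 ultimately show ?thesis by blast
qed

lemma quot_carrier: "carrier (R Quot J) = (+>\<^bsub>R\<^esub>) J ` carrier R"
 unfolding FactRing_def A_RCOSETS_def' by auto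

text \<open>The elements of \<open>R Quot J\<close> are cosets, while an object of the site has its
  carrier in \<open>'a\<close>; an injection of the cosets into \<open>'a\<close> provides an
  isomorphic copy. The projection \<open>h\<close> is characterized by surjectivity and
  kernel.\<close>

lemma realize_quotient:
 fixes R :: "('b, 'm) ring_scheme" and i :: "'b set => 'a"
 assumes R: "cring R" and J: "ideal J R" and i: "inj_on i (carrier (R Quot J))"
 shows "\<exists>(B :: 'a ring) h. cring B \<and> h \<in> ring_hom R B \<and> h ` carrier R = carrier B \<and>
  (\<forall>x \<in> carrier R. h x = \<zero>\<^bsub>B\<^esub> \<longleftrightarrow> x \<in> J)"
proof -
 interpret cring R by fact
 interpret J: ideal J R by fact
 have Q: "cring (R Quot J)" by (rule J.quotient_is_cring[OF R])
 obtain B :: "'a ring" where B: "cring B" "carrier B = i ` carrier (R Quot J)" "i \<in> ring_hom (R Quot J) B"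
  using transport_ring[OF Q i] by blast
 let ?h = "\<lambda>x. i (J +>\<^bsub>R\<^esub> x)"
 have q: "(+>\<^bsub>R\<^esub>) J \<in> ring_hom R (R Quot J)" by (rule J.rcos_ring_hom)
 note car = quot_carrier[of R J]
 have h: "?h \<in> ring_hom R B" using ring_hom_trans[OF q B(3)] by (simp add: comp_def)
 have z: "\<zero>\<^bsub>B\<^esub> = i J"
  using ring_hom_zero[OF B(3) cring.axioms(1)[OF Q] cring.axioms(1)[OF B(1)]] by (simp add: FactRing_def)
 have "?h x = \<zero>\<^bsub>B\<^esub> \<longleftrightarrow> x \<in> J" if x: "x \<in> carrier R" for x
 proof -
  have JJ: "J \<in> carrier (R Quot J)" "J +>\<^bsub>R\<^esub> x \<in> carrier (R Quot J)"
   using ring.ring_simprules(2)[OF cring.axioms(1)[OF Q]] ring_hom_closed[OF q x] by (auto simp: FactRing_def)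
  have "?h x = \<zero>\<^bsub>B\<^esub> \<longleftrightarrow> J +>\<^bsub>R\<^esub> x = J" unfolding z using inj_on_eq_iff[OF i JJ(2,1)] .
  also have "\<dots> \<longleftrightarrow> x \<in> J" using J.rcos_const_imp_mem[OF x] a_rcos_zero[OF J] x by blast
  finally show ?thesis .
 qed
 then show ?thesis
  by (intro exI[of _ B] exI[of _ ?h]) (use B h car in auto)
qed

lemma restrict_homs: "cring A ==> phi \<in> ring_hom A B ==> restrict phi (carrier A) \<in> homs A B"
 by (simp add: homs_def restrict_ring_hom)

section \<open>Finite generation of modules of sequences\<close>

inductive_set seq_span :: "'a ring => (nat => 'a) set => (nat => 'a) set" for A S where
 zero: "(\<lambda>_. \<zero>\<^bsub>A\<^esub>) \<in> seq_span A S"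
| add: "f \<in> seq_span A S ==> a \<in> carrier A ==> s \<in> S ==> (\<lambda>i. a \<otimes>\<^bsub>A\<^esub> s i \<oplus>\<^bsub>A\<^esub> f i) \<in> seq_span A S"

text \<open>Submodules of the module of all sequences cover both cases that occur: coefficient
  vectors, which are zero from some index on, and the module spanned by the rows of an infinite
  Hankel matrix.\<close>

definition seq_module :: "'a ring => (nat => 'a) set => bool" where
 "seq_module A N \<longleftrightarrow> (\<forall>f \<in> N. \<forall>i. f i \<in> carrier A) \<and> (\<lambda>_. \<zero>\<^bsub>A\<^esub>) \<in> N \<and>
  (\<forall>f \<in> N. \<forall>g \<in> N. (\<lambda>i. f i \<oplus>\<^bsub>A\<^esub> g i) \<in> N) \<and> (\<forall>a \<in> carrier A. \<forall>f \<in> N. (\<lambda>i. a \<otimes>\<^bsub>A\<^esub> f i) \<in> N)"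

lemma seq_moduleD:
 assumes "seq_module A N"
 shows "f \<in> N ==> f i \<in> carrier A" "(\<lambda>_. \<zero>\<^bsub>A\<^esub>) \<in> N" "f \<in> N ==> g \<in> N ==> (\<lambda>i. f i \<oplus>\<^bsub>A\<^esub> g i) \<in> N"
  "a \<in> carrier A ==> f \<in> N ==> (\<lambda>i. a \<otimes>\<^bsub>A\<^esub> f i) \<in> N"
 using assms unfolding seq_module_def by blast+

lemma seq_span_subset: "seq_module A N ==> S \<subseteq> N ==> seq_span A S \<subseteq> N"
proof
 fix f assume N: "seq_module A N" "S \<subseteq> N" and "f \<in> seq_span A S"
 show "f \<in> N" using \<open>f \<in> seq_span A S\<close>
 proof induction
  case zero
  show ?case using seq_moduleD[OF N(1)] by blast
 next
  case (add f a s)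
  then show ?case using seq_moduleD(3)[OF N(1) seq_moduleD(4)[OF N(1)]] N(2) by blast
 qed
qed

lemma seq_span_module:
 fixes A (structure)
 assumes A: "cring A" and S: "!!s i. s \<in> S ==> s i \<in> carrier A"
 shows "seq_module A (seq_span A S)"
proof -
 interpret cring A by fact
 have cl: "f i \<in> carrier A" if "f \<in> seq_span A S" for f i
  using that by (induction arbitrary: i) (use S in auto)
 have ad: "(\<lambda>i. f i \<oplus> g i) \<in> seq_span A S" if "f \<in> seq_span A S" "g \<in> seq_span A S" for f g
  using that(1)
 proof induction
  case zero
  have "(\<lambda>i. \<zero> \<oplus> g i) = g" using cl[OF that(2)] by auto
  then show ?case using that(2) by simp
 next
  case (add f a s)
  have "(\<lambda>i. a \<otimes> s i \<oplus> f i \<oplus> g i) = (\<lambda>i. a \<otimes> s i \<oplus> (f i \<oplus> g i))"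
   using cl[OF that(2)] cl[OF add(1)] add S by (auto simp: a_assoc)
  then show ?case using seq_span.add[OF add(4,2,3)] by simp
 qed
 have sm: "(\<lambda>i. a \<otimes> f i) \<in> seq_span A S" if a: "a \<in> carrier A" and "f \<in> seq_span A S" for a f
  using that(2)
 proof induction
  case zero
  show ?case using a seq_span.zero by simp
 next
  case (add f b s)
  have "(\<lambda>i. a \<otimes> (b \<otimes> s i \<oplus> f i)) = (\<lambda>i. (a \<otimes> b) \<otimes> s i \<oplus> (a \<otimes> f i))"
   using cl[OF add(1)] add S a by (auto simp: r_distr m_assoc)
  then show ?case using seq_span.add[OF add(4) _ add(3), of "a \<otimes> b"] a add by simp
 qed
 show ?thesis unfolding seq_module_def using cl ad sm seq_span.zero by blast
qed

lemma seq_span_mono: "S \<subseteq> T ==> seq_span A S \<subseteq> seq_span A T"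
proof
 fix f assume "S \<subseteq> T" "f \<in> seq_span A S"
 from this(2) show "f \<in> seq_span A T" by induction (use \<open>S \<subseteq> T\<close> in \<open>auto intro: seq_span.intros\<close>)
qed

lemma seq_span_self:
 fixes A (structure)
 assumes "cring A" "s \<in> S" "!!i. s i \<in> carrier A"
 shows "s \<in> seq_span A S"
proof -
 interpret cring A by fact
 have "(\<lambda>i. \<one> \<otimes> s i \<oplus> \<zero>) = s" using assms by auto
 then show ?thesis using seq_span.add[OF seq_span.zero one_closed assms(2)] by simp
qed

lemma coordinate_ideal:
 fixes A (structure)
 assumes A: "cring A" and N: "seq_module A N"
 shows "ideal {x k |x. x \<in> N} A"
proof -
 interpret cring A by fact
 note N' = seq_moduleD[OF N]
 show ?thesis
 proof (rule idealI[OF ring_axioms])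
  show "subgroup {x k |x. x \<in> N} (add_monoid A)"
  proof (rule group.subgroupI[OF a_group])
   show "{x k |x. x \<in> N} \<subseteq> carrier (add_monoid A)" using N'(1) by auto
   show "{x k |x. x \<in> N} \<noteq> {}" using N'(2) by blast
   fix a assume "a \<in> {x k |x. x \<in> N}"
   then obtain x where x: "a = x k" "x \<in> N" by blast
   have "inv\<^bsub>add_monoid A\<^esub> a = (\<ominus> \<one>) \<otimes> x k"
    using N'(1)[OF x(2), of k] l_minus[OF one_closed, of "x k"] unfolding x(1) by (simp add: a_inv_def)
   moreover have "(\<lambda>i. (\<ominus> \<one>) \<otimes> x i) \<in> N" by (rule N'(4)) (use x in auto)
   ultimately show "inv\<^bsub>add_monoid A\<^esub> a \<in> {x k |x. x \<in> N}" by auto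
   fix b assume "b \<in> {x k |x. x \<in> N}"
   then obtain y where y: "b = y k" "y \<in> N" by blast
   show "a \<otimes>\<^bsub>add_monoid A\<^esub> b \<in> {x k |x. x \<in> N}"
    using N'(3)[OF x(2) y(2)] unfolding x(1) y(1) by auto
  qed
 next
  fix a r assume a: "a \<in> {x k |x. x \<in> N}" and r: "r \<in> carrier A"
  then obtain x where x: "a = x k" "x \<in> N" by blast
  show 1: "r \<otimes> a \<in> {x k |x. x \<in> N}" using N'(4)[OF r x(2)] x by force
  show "a \<otimes> r \<in> {x k |x. x \<in> N}" using 1 r x N'(1) by (simp add: m_comm)
 qed
qed

text \<open>\<open>det\<close> says that the coordinates in \<open>F\<close> embed the module into a
  finite free module, although its elements are infinite sequences. The induction is the usual one:
  lift generators of the ideal of \<open>k\<close>-th coordinates, and apply the hypothesis to the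
  submodule where this coordinate vanishes, which is determined by the remaining ones.\<close>

lemma noetherian_seq_module:
 fixes A (structure)
 assumes A: "cring A" "noetherian_ring A" and "finite F" and N: "seq_module A N"
  and det: "!!x. x \<in> N ==> (!!i. i \<in> F ==> x i = \<zero>) ==> x = (\<lambda>_. \<zero>)"
 shows "\<exists>S. finite S \<and> S \<subseteq> N \<and> N \<subseteq> seq_span A S"
 using assms(3) N det
proof (induction F arbitrary: N)
 case empty
 then have "N \<subseteq> {\<lambda>_. \<zero>}" by auto
 then show ?case using seq_span.zero[of A "{}"] by (intro exI[of _ "{}"]) auto
next
 case (insert k F)
 interpret cring A by fact
 note N' = seq_moduleD[OF insert(4)]
 let ?I = "{x k |x. x \<in> N}"
 have I: "ideal ?I A" by (rule coordinate_ideal[OF A(1) insert(4)])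
 obtain T where T: "T \<subseteq> carrier A" "finite T" "?I = Idl T"
  using noetherian_ring.finetely_gen[OF A(2) I] by blast
 have "T \<subseteq> ?I" unfolding T(3) by (rule genideal_self[OF T(1)])
 then have "\<forall>t \<in> T. \<exists>x. x \<in> N \<and> x k = t" by auto
 then obtain g where g: "!!t. t \<in> T ==> g t \<in> N \<and> g t k = t" by metis
 let ?S1 = "g ` T"
 have S1: "?S1 \<subseteq> N" using g by blast
 let ?N1 = "{x \<in> N. x k = \<zero>}"
 have N1: "seq_module A ?N1" unfolding seq_module_def using N' by auto
 have "!!x. x \<in> ?N1 ==> (!!i. i \<in> F ==> x i = \<zero>) ==> x = (\<lambda>_. \<zero>)"
  using insert(5) by blast
 then obtain S2 where S2: "finite S2" "S2 \<subseteq> ?N1" "?N1 \<subseteq> seq_span A S2" using insert.IH[OF N1] by blast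
 have S1m: "seq_module A (seq_span A ?S1)" by (rule seq_span_module[OF A(1)]) (use S1 N'(1) in blast)
 have Sm: "seq_module A (seq_span A (?S1 \<union> S2))" by (rule seq_span_module[OF A(1)]) (use S1 S2 N'(1) in blast)
 have "T \<subseteq> {x k |x. x \<in> seq_span A ?S1}"
 proof
  fix t assume t: "t \<in> T"
  have "g t \<in> seq_span A ?S1" by (rule seq_span_self[OF A(1)]) (use t g N'(1) in auto)
  then show "t \<in> {x k |x. x \<in> seq_span A ?S1}" using g[OF t] by (intro CollectI exI[of _ "g t"]) simp
 qed
 then have sub: "?I \<subseteq> {x k |x. x \<in> seq_span A ?S1}"
  unfolding T(3) by (rule genideal_minimal[OF coordinate_ideal[OF A(1) S1m]])
 have "N \<subseteq> seq_span A (?S1 \<union> S2)"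
 proof
  fix x assume x: "x \<in> N"
  obtain y where y: "y \<in> seq_span A ?S1" "x k = y k" using sub x by blast
  have yN: "y \<in> N" using seq_span_subset[OF insert(4) S1] y(1) by blast
  let ?z = "\<lambda>i. x i \<oplus> (\<ominus> \<one>) \<otimes> y i"
  have "?z \<in> N" by (rule N'(3)[OF x N'(4)[OF _ yN]]) simp
  moreover have "?z k = \<zero>" using y(2) N'(1)[OF yN, of k] by (simp add: l_minus r_neg)
  ultimately have z: "?z \<in> seq_span A (?S1 \<union> S2)" using S2(3) seq_span_mono[of S2 "?S1 \<union> S2"] by blast
  have y': "y \<in> seq_span A (?S1 \<union> S2)" using y(1) seq_span_mono[of ?S1 "?S1 \<union> S2"] by blast
  have "(\<lambda>i. ?z i \<oplus> y i) = x"
   using N'(1)[OF x] N'(1)[OF yN] by (auto simp: l_minus a_assoc l_neg)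
  then show "x \<in> seq_span A (?S1 \<union> S2)" using seq_moduleD(3)[OF Sm z y'] by simp
 qed
 then show ?case using S1 S2 T(2) by (intro exI[of _ "?S1 \<union> S2"]) auto
qed

text \<open>An ideal of \<open>B\<close> is pulled back along \<open>psi\<close> to a module of
  coefficient vectors supported below \<open>d\<close>. This module is finitely generated over
  \<open>A\<close>, and the images of its generators generate the ideal.\<close>

lemma noetherian_finite_algebra:
 fixes A :: "'a ring" (structure) and B :: "'a ring" and y :: "nat => 'a"
 assumes A: "cring A" "noetherian_ring A" and B: "cring B" and phi: "phi \<in> ring_hom A B" and y: "!!i. y i \<in> carrier B"
  and gen: "!!b. b \<in> carrier B ==> \<exists>c. (\<forall>i. c i \<in> carrier A) \<and> b = (\<Oplus>\<^bsub>B\<^esub>i\<in>{..<d}. phi (c i) \<otimes>\<^bsub>B\<^esub> y i)"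
 shows "noetherian_ring B"
proof -
 interpret A: cring A by fact
 interpret B: cring B by fact
 interpret h: ring_hom_cring A B phi using phi by (intro ring_hom_cringI) (auto intro: A B)
 show ?thesis
 proof (rule B.noetherian_ringI)
  fix I assume I: "ideal I B"
  interpret I: ideal I B by fact
  define psi where "psi c = (\<Oplus>\<^bsub>B\<^esub>i\<in>{..<d}. phi (c i) \<otimes>\<^bsub>B\<^esub> y i)" for c
  have psi_add: "psi (\<lambda>i. f i \<oplus> g i) = psi f \<oplus>\<^bsub>B\<^esub> psi g" if "!!i. f i \<in> carrier A" "!!i. g i \<in> carrier A" for f g
  proof -
   have "psi (\<lambda>i. f i \<oplus> g i) = (\<Oplus>\<^bsub>B\<^esub>i\<in>{..<d}. phi (f i) \<otimes>\<^bsub>B\<^esub> y i \<oplus>\<^bsub>B\<^esub> phi (g i) \<otimes>\<^bsub>B\<^esub> y i)"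
    unfolding psi_def using that y by (intro B.finsum_cong') (auto simp: B.l_distr)
   then show ?thesis unfolding psi_def using that y by (simp add: B.finsum_addf Pi_def)
  qed
  have psi_smult: "psi (\<lambda>i. a \<otimes> f i) = phi a \<otimes>\<^bsub>B\<^esub> psi f" if "a \<in> carrier A" "!!i. f i \<in> carrier A" for a f
  proof -
   have "phi a \<otimes>\<^bsub>B\<^esub> psi f = (\<Oplus>\<^bsub>B\<^esub>i\<in>{..<d}. phi a \<otimes>\<^bsub>B\<^esub> (phi (f i) \<otimes>\<^bsub>B\<^esub> y i))"
    unfolding psi_def using that y by (intro B.finsum_rdistr) auto
   also have "\<dots> = psi (\<lambda>i. a \<otimes> f i)"
    unfolding psi_def using that y by (intro B.finsum_cong') (auto simp: B.m_assoc)
   finally show ?thesis by simp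
  qed
  have psi_0: "psi (\<lambda>_. \<zero>) = \<zero>\<^bsub>B\<^esub>" unfolding psi_def using y by (simp add: B.finsum_zero)
  define N where "N = {c. (\<forall>i. c i \<in> carrier A) \<and> (\<forall>i\<ge>d. c i = \<zero>) \<and> psi c \<in> I}"
  have N: "seq_module A N"
   unfolding seq_module_def
  proof (intro conjI ballI allI)
   show "(\<lambda>_. \<zero>) \<in> N" using psi_0 I.zero_closed by (simp add: N_def)
   show "f i \<in> carrier A" if "f \<in> N" for f i using that by (simp add: N_def)
   show "(\<lambda>i. f i \<oplus> g i) \<in> N" if "f \<in> N" "g \<in> N" for f g
    using that psi_add[of f g] I.a_closed by (simp add: N_def)
   show "(\<lambda>i. a \<otimes> f i) \<in> N" if "a \<in> carrier A" "f \<in> N" for a f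
    using that psi_smult[of a f] I.I_l_closed[of "psi f" "phi a"] by (simp add: N_def)
  qed
  have det: "x = (\<lambda>_. \<zero>)" if "x \<in> N" "!!i. i \<in> {..<d} ==> x i = \<zero>" for x
  proof
   show "x i = \<zero>" for i using that by (cases "i < d") (auto simp: N_def)
  qed
  obtain S where S: "finite S" "S \<subseteq> N" "N \<subseteq> seq_span A S"
   using noetherian_seq_module[OF A finite_lessThan N det] by blast
  have SI: "psi ` S \<subseteq> I" using S(2) by (auto simp: N_def)
  then have Sc: "psi ` S \<subseteq> carrier B" using I.Icarr by blast
  interpret G: ideal "Idl\<^bsub>B\<^esub> (psi ` S)" B by (rule B.genideal_ideal[OF Sc])
  have span: "psi c \<in> Idl\<^bsub>B\<^esub> (psi ` S)" if "c \<in> seq_span A S" for c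
   using that
  proof induction
   case zero
   show ?case using psi_0 G.zero_closed by simp
  next
   case (add f a s)
   have f: "f i \<in> carrier A" for i using seq_moduleD(1)[OF N] seq_span_subset[OF N S(2)] add(1) by blast
   have s: "s i \<in> carrier A" for i using seq_moduleD(1)[OF N] S(2) add(3) by blast
   have "psi (\<lambda>i. a \<otimes> s i \<oplus> f i) = phi a \<otimes>\<^bsub>B\<^esub> psi s \<oplus>\<^bsub>B\<^esub> psi f"
    using f s add by (simp add: psi_add psi_smult)
   moreover have "psi s \<in> Idl\<^bsub>B\<^esub> (psi ` S)" using B.genideal_self[OF Sc] add(3) by blast
   ultimately show ?case using add G.I_l_closed G.a_closed by simp
  qed
  have "I \<subseteq> Idl\<^bsub>B\<^esub> (psi ` S)"
  proof
   fix b assume b: "b \<in> I"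
   obtain c where c: "\<forall>i. c i \<in> carrier A" "b = (\<Oplus>\<^bsub>B\<^esub>i\<in>{..<d}. phi (c i) \<otimes>\<^bsub>B\<^esub> y i)"
    using gen[OF I.Icarr[OF b]] by blast
   let ?c = "\<lambda>i. if i < d then c i else \<zero>"
   have "b = psi ?c" unfolding c(2) psi_def using c(1) y by (intro B.finsum_cong') auto
   then have "?c \<in> N" using c(1) b by (auto simp: N_def)
   then show "b \<in> Idl\<^bsub>B\<^esub> (psi ` S)" using span S(3) \<open>b = psi ?c\<close> by blast
  qed
  then have "I = Idl\<^bsub>B\<^esub> (psi ` S)" using B.genideal_minimal[OF I SI] by blast
  then show "\<exists>T \<subseteq> carrier B. finite T \<and> I = Idl\<^bsub>B\<^esub> T" using Sc S(1) by blast
 qed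
qed

lemma noetherian_surj:
 fixes A B :: "'a ring"
 assumes A: "cring A" "noetherian_ring A" and B: "cring B" and phi: "phi \<in> ring_hom A B" and surj: "phi ` carrier A = carrier B"
 shows "noetherian_ring B"
proof (rule noetherian_finite_algebra[OF A B phi, of "\<lambda>_. \<one>\<^bsub>B\<^esub>" 1])
 interpret B: cring B by fact
 show "\<one>\<^bsub>B\<^esub> \<in> carrier B" by simp
 fix b assume "b \<in> carrier B"
 then obtain a where a: "a \<in> carrier A" "b = phi a" using surj by blast
 have "{..<1::nat} = {0}" by auto
 then show "\<exists>c. (\<forall>i. c i \<in> carrier A) \<and> b = (\<Oplus>\<^bsub>B\<^esub>i\<in>{..<1::nat}. phi (c i) \<otimes>\<^bsub>B\<^esub> \<one>\<^bsub>B\<^esub>)"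
  using a ring_hom_closed[OF phi a(1)] by (intro exI[of _ "\<lambda>_. a"]) auto
qed

lemma noetherian_maximal:
 assumes A: "noetherian_ring A" and F: "F \<noteq> {}" "!!I. I \<in> F ==> ideal I A"
 shows "\<exists>M \<in> F. \<forall>X1 \<in> F. M \<subseteq> X1 --> X1 = M"
proof (rule subset_Zorn)
 fix C assume C: "subset.chain F C"
 show "\<exists>U \<in> F. \<forall>X1 \<in> C. X1 \<subseteq> U"
 proof (cases "C = {}")
  case True
  then show ?thesis using F(1) by blast
 next
  case False
  have "subset.chain {I. ideal I A} C" using C F(2) unfolding pred_on.chain_def by blast
  then have "\<Union>C \<in> C" using noetherian_ring.ideal_chain_is_trivial[OF A False] by blast
  then have "\<Union>C \<in> F" using C unfolding pred_on.chain_def by blast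
  then show ?thesis by blast
 qed
qed

section \<open>Products of primes and integral components\<close>

definition ideal_adjoin :: "'a ring => 'a set => 'a => 'a set" where
 "ideal_adjoin A I a = {x \<oplus>\<^bsub>A\<^esub> r \<otimes>\<^bsub>A\<^esub> a |x r. x \<in> I \<and> r \<in> carrier A}"

lemma ideal_adjoin:
 fixes A (structure)
 assumes A: "cring A" and I: "ideal I A" and a: "a \<in> carrier A"
 shows "ideal (ideal_adjoin A I a) A" "I \<subseteq> ideal_adjoin A I a" "a \<in> ideal_adjoin A I a"
proof -
 interpret cring A by fact
 interpret I: ideal I A by fact
 have eq: "ideal_adjoin A I a = I <+> (PIdl a)"
  unfolding ideal_adjoin_def cgenideal_def set_add_def' by blast
 show "ideal (ideal_adjoin A I a) A" unfolding eq by (rule add_ideals[OF I cgenideal_ideal[OF a]])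
 show "I \<subseteq> ideal_adjoin A I a"
 proof
  fix x assume "x \<in> I"
  then show "x \<in> ideal_adjoin A I a"
   unfolding ideal_adjoin_def using a I.Icarr by (intro CollectI exI[of _ x] exI[of _ "\<zero>"]) simp
 qed
 show "a \<in> ideal_adjoin A I a"
  unfolding ideal_adjoin_def using a by (intro CollectI exI[of _ "\<zero>"] exI[of _ "\<one>"]) simp
qed

lemma ideal_adjoin_mult:
 fixes A (structure)
 assumes A: "cring A" and I: "ideal I A" and ab: "a \<in> carrier A" "b \<in> carrier A" "a \<otimes> b \<in> I"
  and x: "x \<in> ideal_adjoin A I a" and y: "y \<in> ideal_adjoin A I b"
 shows "x \<otimes> y \<in> I"
proof -
 interpret cring A by fact
 interpret I: ideal I A by fact
 obtain u r where u: "x = u \<oplus> r \<otimes> a" "u \<in> I" "r \<in> carrier A" using x unfolding ideal_adjoin_def by blast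
 obtain v s where v: "y = v \<oplus> s \<otimes> b" "v \<in> I" "s \<in> carrier A" using y unfolding ideal_adjoin_def by blast
 note c = I.Icarr[OF u(2)] I.Icarr[OF v(2)] u(3) v(3) ab(1,2)
 have "x \<otimes> y = u \<otimes> y \<oplus> ((r \<otimes> a) \<otimes> v \<oplus> (r \<otimes> s) \<otimes> (a \<otimes> b))"
  unfolding u(1) v(1) using c by algebra
 moreover have "u \<otimes> y \<in> I" using v c by (intro I.I_r_closed[OF u(2)]) simp
 moreover have "(r \<otimes> a) \<otimes> v \<in> I" using c by (intro I.I_l_closed[OF v(2)]) simp
 moreover have "(r \<otimes> s) \<otimes> (a \<otimes> b) \<in> I" using c by (intro I.I_l_closed[OF ab(3)]) simp
 ultimately show ?thesis using I.a_closed by simp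
qed

text \<open>Lists and not sets, because both the primes in a product and the factors taken from them
  may repeat.\<close>

definition lprod :: "'a ring => 'a list => 'a" where
 "lprod A xs = foldr (\<otimes>\<^bsub>A\<^esub>) xs \<one>\<^bsub>A\<^esub>"

lemma lprod_simps [simp]: "lprod A [] = \<one>\<^bsub>A\<^esub>" "lprod A (x # xs) = x \<otimes>\<^bsub>A\<^esub> lprod A xs"
 by (simp_all add: lprod_def)

lemma lprod_closed: "cring A ==> set xs \<subseteq> carrier A ==> lprod A xs \<in> carrier A"
proof (induction xs)
 case Nil
 then interpret cring A by simp
 show ?case by simp
next
 case (Cons x xs)
 then interpret cring A by simp
 show ?case using Cons by auto
qed

lemma lprod_append: "cring A ==> set xs \<subseteq> carrier A ==> set ys \<subseteq> carrier A ==> lprod A (xs @ ys) = lprod A xs \<otimes>\<^bsub>A\<^esub> lprod A ys"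
proof (induction xs)
 case Nil
 then interpret cring A by simp
 show ?case using lprod_closed[OF Nil(1,3)] by simp
next
 case (Cons x xs)
 then interpret cring A by simp
 show ?case using Cons lprod_closed[OF Cons(2), of xs] lprod_closed[OF Cons(2), of ys] by (auto simp: m_assoc)
qed

text \<open>Inclusion of a product of prime ideals in \<open>I\<close>, stated on the elementary
  products that generate it; this is also the form in which it yields vanishing products of
  nilpotents.\<close>

definition contains_prime_product :: "'a ring => 'a set => bool" where
 "contains_prime_product A I \<longleftrightarrow> (\<exists>ps. (\<forall>P \<in> set ps. primeideal P A) \<and>
  (\<forall>xs. list_all2 (\<in>) xs ps --> lprod A xs \<in> I))"

lemma list_all2_prime_carrier:
 assumes "\<forall>P \<in> set ps. primeideal P A" "list_all2 (\<in>) xs ps"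
 shows "set xs \<subseteq> carrier A"
 using assms(2,1)
proof (induction rule: list_all2_induct)
 case (Cons x xs y ys)
 then have "primeideal y A" by simp
 then have "x \<in> carrier A" by (rule ideal.Icarr[OF primeideal.axioms(1) Cons(1)])
 then show ?case using Cons by simp
qed simp

text \<open>Noetherian induction. A maximal counterexample \<open>M\<close> is proper, as the unit
  ideal contains the empty product, and it is prime: if \<open>a\<close> and \<open>b\<close> lie
  outside \<open>M\<close> and their product inside, then adjoining \<open>a\<close> and adjoining
  \<open>b\<close> gives two larger ideals, each containing a product of primes, and the
  concatenated product lies in \<open>M\<close>.\<close>

lemma noetherian_contains_prime_product:
 assumes A: "cring A" "noetherian_ring A" and I: "ideal I A"
 shows "contains_prime_product A I"
proof (rule ccontr)
 interpret cring A by fact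
 assume n: "\<not> contains_prime_product A I"
 let ?F = "{J. ideal J A \<and> \<not> contains_prime_product A J}"
 obtain M where M: "ideal M A" "\<not> contains_prime_product A M"
  and max: "!!X1. ideal X1 A ==> \<not> contains_prime_product A X1 ==> M \<subseteq> X1 ==> X1 = M"
  using noetherian_maximal[OF A(2), of ?F] I n by blast
 interpret M: ideal M A by fact
 have "primeideal M A"
 proof (rule primeidealI[OF M(1) A(1)])
  show "carrier A \<noteq> M"
  proof
   assume "carrier A = M"
   then have "contains_prime_product A M" unfolding contains_prime_product_def by (intro exI[of _ "[]"]) auto
   then show False using M(2) by blast
  qed
  fix a b assume ab: "a \<in> carrier A" "b \<in> carrier A" "a \<otimes>\<^bsub>A\<^esub> b \<in> M"
  show "a \<in> M \<or> b \<in> M"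
  proof (rule ccontr)
   assume "\<not> (a \<in> M \<or> b \<in> M)"
   note ia = ideal_adjoin[OF A(1) M(1) ab(1)] and ib = ideal_adjoin[OF A(1) M(1) ab(2)]
   have "contains_prime_product A (ideal_adjoin A M a)" "contains_prime_product A (ideal_adjoin A M b)"
    using max[OF ia(1) _ ia(2)] max[OF ib(1) _ ib(2)] ia(3) ib(3) \<open>\<not> (a \<in> M \<or> b \<in> M)\<close> by blast+
   then obtain ps qs where ps: "\<forall>P \<in> set ps. primeideal P A" "!!xs. list_all2 (\<in>) xs ps ==> lprod A xs \<in> ideal_adjoin A M a"
    and qs: "\<forall>P \<in> set qs. primeideal P A" "!!xs. list_all2 (\<in>) xs qs ==> lprod A xs \<in> ideal_adjoin A M b"
    unfolding contains_prime_product_def by blast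
   have "lprod A xs \<in> M" if "list_all2 (\<in>) xs (ps @ qs)" for xs
   proof -
    define us vs where "us = take (length ps) xs" and "vs = drop (length ps) xs"
    have uv: "xs = us @ vs" "list_all2 (\<in>) us ps" "list_all2 (\<in>) vs qs"
     using list_all2_takeI[OF that, of "length ps"] list_all2_dropI[OF that, of "length ps"] by (simp_all add: us_def vs_def)
    show ?thesis
     unfolding uv(1) lprod_append[OF A(1) list_all2_prime_carrier[OF ps(1) uv(2)] list_all2_prime_carrier[OF qs(1) uv(3)]]
     by (rule ideal_adjoin_mult[OF A(1) M(1) ab ps(2)[OF uv(2)] qs(2)[OF uv(3)]])
   qed
   then have "contains_prime_product A M"
    unfolding contains_prime_product_def using ps(1) qs(1) by (intro exI[of _ "ps @ qs"]) auto
   then show False using M(2) by blast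
  qed
 qed
 then have "contains_prime_product A M"
  unfolding contains_prime_product_def
 proof (intro exI[of _ "[M]"] conjI allI impI)
  fix xs assume "list_all2 (\<in>) xs [M]"
  then obtain x where "xs = [x]" "x \<in> M" by (auto simp: list_all2_Cons2)
  then show "lprod A xs \<in> M" using M.Icarr by simp
 qed simp
 then show False using M(2) by blast
qed

lemma prime_quotient:
 fixes A :: "'a ring" (structure)
 assumes A: "A \<in> noeth" and P: "primeideal P A"
 shows "\<exists>B phi. (B, phi) \<in> arrows_into A \<and> closed_immersion A B phi \<and> domain B \<and> (\<forall>a \<in> carrier A. phi a = \<zero>\<^bsub>B\<^esub> \<longleftrightarrow> a \<in> P)"
proof -
 have cA: "cring A" "noetherian_ring A" using A by (auto simp: noeth_def)
 interpret A: cring A by fact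
 interpret P: primeideal P A by fact
 \<comment> \<open>A coset is itself a set of elements of \<open>'a\<close>, so choosing a member of
   each coset injects the quotient into \<open>'a\<close>.\<close>
 define i where "i c = (SOME x. x \<in> c)" for c :: "'a set"
 have i: "i c \<in> c \<and> c = P +> i c" if c: "c \<in> carrier (A Quot P)" for c
 proof -
  obtain x where x: "c = P +> x" "x \<in> carrier A" using c[unfolded quot_carrier] by (rule imageE)
  have "x \<in> c" unfolding x(1) by (rule P.a_rcos_self[OF x(2)])
  then have ic: "i c \<in> c" unfolding i_def by (rule someI)
  then obtain u where u: "u \<in> P" "i c = u \<oplus> x" unfolding x(1) a_r_coset_def' by blast
  then have "i c \<ominus> x = u" using x(2) P.Icarr[OF u(1)] by (simp add: a_minus_def A.a_assoc A.r_neg)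
  then have "P +> i c = P +> x"
   using A.quotient_eq_iff_same_a_r_cos[OF P.is_ideal, of "i c" x] u x(2) P.Icarr[OF u(1)] by simp
  then show ?thesis using ic x(1) by simp
 qed
 have "inj_on i (carrier (A Quot P))" by (rule inj_onI) (metis i)
 then obtain B :: "'a ring" and h where B: "cring B" "h \<in> ring_hom A B" "h ` carrier A = carrier B"
  "!!x. x \<in> carrier A ==> h x = \<zero>\<^bsub>B\<^esub> \<longleftrightarrow> x \<in> P"
  using realize_quotient[OF cA(1) P.is_ideal, of i] by blast
 interpret B: cring B by fact
 interpret h: ring_hom_cring A B h using B by (intro ring_hom_cringI) (auto intro: cA)
 have nB: "B \<in> noeth" using noetherian_surj[OF cA B(1-3)] B(1) by (simp add: noeth_def)
 have "domain B"
 proof (rule domainI[OF B(1)])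
  show "\<one>\<^bsub>B\<^esub> \<noteq> \<zero>\<^bsub>B\<^esub>" using B(4)[OF A.one_closed] P.one_imp_carrier P.I_notcarr by auto
  fix a b assume ab: "a \<otimes>\<^bsub>B\<^esub> b = \<zero>\<^bsub>B\<^esub>" "a \<in> carrier B" "b \<in> carrier B"
  then obtain x y where xy: "x \<in> carrier A" "a = h x" "y \<in> carrier A" "b = h y" using B(3) by (metis imageE)
  then have "x \<otimes> y \<in> P" using B(4)[of "x \<otimes> y"] ab(1) by simp
  then show "a = \<zero>\<^bsub>B\<^esub> \<or> b = \<zero>\<^bsub>B\<^esub>" using P.I_prime xy B(4) by blast
 qed
 then show ?thesis
  by (intro exI[of _ B] exI[of _ "restrict h (carrier A)"])
   (use nB B restrict_homs[OF cA(1) B(2)] in \<open>auto simp: arrows_into_def closed_immersion_def\<close>)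
qed

lemma surj_prime_image:
 fixes A :: "'a ring" (structure) and B :: "'a ring"
 assumes A: "cring A" and B: "cring B" and phi: "phi \<in> ring_hom A B" and surj: "phi ` carrier A = carrier B"
  and I: "primeideal I A" and ker: "!!a. a \<in> carrier A ==> phi a = \<zero>\<^bsub>B\<^esub> ==> a \<in> I"
 shows "primeideal (phi ` I) B" "I = {a \<in> carrier A. phi a \<in> phi ` I}"
proof -
 interpret A: cring A by fact
 interpret B: cring B by fact
 interpret I: primeideal I A by fact
 interpret h: ring_hom_cring A B phi using phi by (intro ring_hom_cringI) (auto intro: A B)
 show eq: "I = {a \<in> carrier A. phi a \<in> phi ` I}"
 proof (rule equalityI[OF subsetI subsetI])
  fix a assume "a \<in> {a \<in> carrier A. phi a \<in> phi ` I}"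
  then obtain b where b: "a \<in> carrier A" "b \<in> I" "phi a = phi b" by auto
  then have "phi (a \<ominus> b) = \<zero>\<^bsub>B\<^esub>" using I.Icarr by (simp add: A.minus_eq B.r_neg)
  then have d: "a \<ominus> b \<in> I" using b(1) I.Icarr[OF b(2)] by (intro ker) simp_all
  have "(a \<ominus> b) \<oplus> b = a" using b(1) I.Icarr[OF b(2)] by algebra
  then show "a \<in> I" using I.a_closed[OF d b(2)] by simp
 qed (use I.Icarr in auto)
 have "ideal (phi ` I) B"
 proof (rule idealI[OF B.ring_axioms])
  show "subgroup (phi ` I) (add_monoid B)"
  proof (rule group.subgroupI[OF B.a_group])
   show "phi ` I \<subseteq> carrier (add_monoid B)" using I.Icarr by auto
   show "phi ` I \<noteq> {}" using I.zero_closed by blast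
   fix a assume "a \<in> phi ` I"
   then obtain x where x: "a = phi x" "x \<in> I" by blast
   have "inv\<^bsub>add_monoid B\<^esub> a = phi (\<ominus> x)" using x I.Icarr by (simp add: a_inv_def[of B])
   then show "inv\<^bsub>add_monoid B\<^esub> a \<in> phi ` I" using I.a_inv_closed[OF x(2)] by simp
   fix b assume "b \<in> phi ` I"
   then obtain y where y: "b = phi y" "y \<in> I" by blast
   have "a \<otimes>\<^bsub>add_monoid B\<^esub> b = phi (x \<oplus> y)" using x y I.Icarr by simp
   then show "a \<otimes>\<^bsub>add_monoid B\<^esub> b \<in> phi ` I" using I.a_closed[OF x(2) y(2)] by simp
  qed
 next
  fix a x assume a: "a \<in> phi ` I" and x: "x \<in> carrier B"
  then obtain a' x' where *: "a = phi a'" "a' \<in> I" "x = phi x'" "x' \<in> carrier A" using surj by (metis imageE)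
  show "x \<otimes>\<^bsub>B\<^esub> a \<in> phi ` I" "a \<otimes>\<^bsub>B\<^esub> x \<in> phi ` I"
   using * I.I_l_closed[of a' x'] I.I_r_closed[of a' x'] I.Icarr by (metis h.hom_mult image_eqI)+
 qed
 then show "primeideal (phi ` I) B"
 proof (rule primeidealI[OF _ B])
  show "carrier B \<noteq> phi ` I"
  proof
   assume "carrier B = phi ` I"
   then have "carrier A \<subseteq> I" using eq by auto
   then show False using I.I_notcarr I.Icarr by auto
  qed
  fix a b assume ab: "a \<in> carrier B" "b \<in> carrier B" "a \<otimes>\<^bsub>B\<^esub> b \<in> phi ` I"
  then obtain a' b' where *: "a = phi a'" "a' \<in> carrier A" "b = phi b'" "b' \<in> carrier A" using surj by (metis imageE)
  then have "a' \<otimes> b' \<in> {a \<in> carrier A. phi a \<in> phi ` I}" using ab(3) by simp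
  then have "a' \<otimes> b' \<in> I" by (simp only: eq[symmetric])
  then show "a \<in> phi ` I \<or> b \<in> phi ` I" using I.I_prime * by blast
 qed
qed

text \<open>Take a product of \<open>k\<close> primes inside the zero ideal; they need be neither
  minimal nor distinct. Every prime of \<open>A\<close> contains one of them, which gives joint
  surjectivity of the quotients. An element that vanishes on all components lies in each of the
  primes, so any \<open>k\<close> such elements multiply to zero.\<close>

lemma component_covering:
 fixes A :: "'a ring" (structure)
 assumes A: "A \<in> noeth"
 shows "\<exists>S k. S \<subseteq> arrows_into A \<and> finite S \<and> (\<forall>(B, phi) \<in> S. closed_immersion A B phi \<and> domain B) \<and>
  jointly_surjective A S \<and>
  (\<forall>xs. set xs \<subseteq> carrier A \<and> length xs = k \<and> (\<forall>x \<in> set xs. \<forall>(B, phi) \<in> S. phi x = \<zero>\<^bsub>B\<^esub>) --> lprod A xs = \<zero>)"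
proof -
 have cA: "cring A" "noetherian_ring A" using A by (auto simp: noeth_def)
 interpret A: cring A by fact
 obtain ps where ps: "\<forall>P \<in> set ps. primeideal P A" "!!xs. list_all2 (\<in>) xs ps ==> lprod A xs = \<zero>"
  using noetherian_contains_prime_product[OF cA A.zeroideal] unfolding contains_prime_product_def by auto
 have "\<forall>P \<in> set ps. \<exists>c. c \<in> arrows_into A \<and> closed_immersion A (fst c) (snd c) \<and> domain (fst c) \<and>
   (\<forall>a \<in> carrier A. snd c a = \<zero>\<^bsub>fst c\<^esub> \<longleftrightarrow> a \<in> P)"
  using prime_quotient[OF A] ps(1) by fastforce
 then obtain q where q: "!!P. P \<in> set ps ==> q P \<in> arrows_into A \<and> closed_immersion A (fst (q P)) (snd (q P)) \<and> domain (fst (q P)) \<and>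
   (\<forall>a \<in> carrier A. snd (q P) a = \<zero>\<^bsub>fst (q P)\<^esub> \<longleftrightarrow> a \<in> P)" by metis
 let ?S = "q ` set ps"
 have js: "jointly_surjective A ?S"
  unfolding jointly_surjective_def
 proof (intro allI impI)
  fix I assume I: "primeideal I A"
  interpret I: primeideal I A by fact
  have "\<exists>P \<in> set ps. P \<subseteq> I"
  proof (rule ccontr)
   assume "\<not> (\<exists>P \<in> set ps. P \<subseteq> I)"
   then have "\<forall>P \<in> set ps. \<exists>x. x \<in> P \<and> x \<notin> I" by blast
   then obtain g where g: "!!P. P \<in> set ps ==> g P \<in> P \<and> g P \<notin> I" by metis
   have "list_all2 (\<in>) (map g ps) ps" using g by (simp add: list_all2_conv_all_nth)
   then have z: "lprod A (map g ps) = \<zero>" by (rule ps(2))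
   have "lprod A (map g qs) \<notin> I \<and> lprod A (map g qs) \<in> carrier A" if "set qs \<subseteq> set ps" for qs
    using that
   proof (induction qs)
    case Nil
    then show ?case using I.one_imp_carrier I.I_notcarr by auto
   next
    case (Cons P qs)
    have "primeideal P A" "g P \<in> P" using g[of P] Cons(2) ps(1) by auto
    then have "g P \<in> carrier A" by (rule ideal.Icarr[OF primeideal.axioms(1)])
    then show ?case using Cons g[of P] I.I_prime[of "g P" "lprod A (map g qs)"] by auto
   qed
   from this[of ps] show False using z I.zero_closed by simp
  qed
  then obtain P where P: "P \<in> set ps" "P \<subseteq> I" by blast
  obtain B phi where B: "q P = (B, phi)" by force
  have BB: "B \<in> noeth" "phi \<in> homs A B" "phi ` carrier A = carrier B" "!!a. a \<in> carrier A ==> phi a = \<zero>\<^bsub>B\<^esub> \<longleftrightarrow> a \<in> P"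
   using q[OF P(1)] unfolding B arrows_into_def closed_immersion_def by auto
  note pr = surj_prime_image[OF cA(1) noeth_cring[OF BB(1)] homs_ring_hom[OF BB(2)] BB(3) I]
  have "primeideal (phi ` I) B" "I = {a \<in> carrier A. phi a \<in> phi ` I}"
   by (rule pr; use BB(4) P(2) in blast)+
  then show "\<exists>(B, phi) \<in> ?S. \<exists>J. primeideal J B \<and> I = {a \<in> carrier A. phi a \<in> J}"
   using B by (intro bexI[OF _ imageI[OF P(1), of q]]) auto
 qed
 have "lprod A xs = \<zero>" if "set xs \<subseteq> carrier A" "length xs = length ps" "\<forall>x \<in> set xs. \<forall>(B, phi) \<in> ?S. phi x = \<zero>\<^bsub>B\<^esub>" for xs
 proof (rule ps(2), unfold list_all2_conv_all_nth, intro conjI allI impI that(2))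
  fix i assume i: "i < length xs"
  have "xs ! i \<in> set xs" "ps ! i \<in> set ps" using i that(2) by auto
  then show "xs ! i \<in> ps ! i" using q[of "ps ! i"] that(1,3) by (cases "q (ps ! i)") force
 qed
 then show ?thesis
  by (intro exI[of _ ?S] exI[of _ "length ps"]) (use q js in \<open>auto dest: q\<close>)
qed

lemma closed_immersion_finite:
 assumes A: "A \<in> noeth" and B: "(B, phi) \<in> arrows_into A" and c: "closed_immersion A B phi"
 shows "finite_morphism A B phi"
proof -
 have B: "cring B" "phi \<in> homs A B" using B by (auto simp: arrows_into_def noeth_cring)
 interpret B: cring B by fact
 show ?thesis unfolding finite_morphism_def
 proof (intro exI[of _ "{\<one>\<^bsub>B\<^esub>}"] conjI ballI)
  fix b assume "b \<in> carrier B"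
  then obtain a where a: "a \<in> carrier A" "b = phi a" using c by (auto simp: closed_immersion_def)
  then show "\<exists>c \<in> {\<one>\<^bsub>B\<^esub>} \<rightarrow> carrier A. b = (\<Oplus>\<^bsub>B\<^esub>x\<in>{\<one>\<^bsub>B\<^esub>}. phi (c x) \<otimes>\<^bsub>B\<^esub> x)"
   using homs_closed[OF B(2) a(1)] by (intro bexI[of _ "\<lambda>_. a"]) auto
 qed auto
qed

section \<open>Adjoining a root\<close>

lemma finsum_in_ideal:
 assumes A: "cring A" and I: "ideal I A" and "!!i. i \<in> S ==> f i \<in> I"
 shows "finsum A f S \<in> I"
proof -
 interpret cring A by fact
 interpret I: ideal I A by fact
 show ?thesis using assms(3)
 proof (induction S rule: infinite_finite_induct)
  case (insert x F)
  then have "finsum A f (insert x F) = f x \<oplus>\<^bsub>A\<^esub> finsum A f F"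
   using I.Icarr by (intro finsum_insert) auto
  then show ?case using insert I.a_closed by simp
 qed (use I.zero_closed in simp_all)
qed

text \<open>An infinite type is in bijection with its square, and iterating this encodes tuples.
  Tuples of length \<open>d\<close> appear as sequences that are constantly \<open>z\<close> from
  \<open>d\<close> on, which is the shape of a remainder of degree below \<open>d\<close>.\<close>

lemma tuple_injection:
 assumes inf: "infinite (UNIV :: 'a set)"
 shows "\<exists>e :: (nat => 'a) => 'a. inj_on e {f. \<forall>n\<ge>d. f n = z}"
proof -
 have "\<exists>p. bij_betw p (UNIV \<times> UNIV :: ('a \<times> 'a) set) (UNIV :: 'a set)"
  unfolding card_of_ordIso by (rule card_of_Times_same_infinite[OF inf])
 then obtain p :: "'a \<times> 'a => 'a" where p: "bij_betw p (UNIV \<times> UNIV) UNIV" ..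
 have "inj p" using bij_betw_imp_inj_on[OF p] by simp
 then have pinj: "p x = p y ==> x = y" for x y by (rule injD)
 show ?thesis
 proof (induction d)
  case 0
  have "{f :: nat => 'a. \<forall>n\<ge>0. f n = z} = {\<lambda>_. z}" by (auto simp: fun_eq_iff)
  then show ?case by simp
 next
  case (Suc d)
  then obtain e :: "(nat => 'a) => 'a" where e: "inj_on e {f. \<forall>n\<ge>d. f n = z}" by blast
  have "inj_on (\<lambda>f. p (f d, e (f(d := z)))) {f. \<forall>n\<ge>Suc d. f n = z}"
  proof (rule inj_onI)
   fix f g :: "nat => 'a" assume f: "f \<in> {f. \<forall>n\<ge>Suc d. f n = z}" and g: "g \<in> {f. \<forall>n\<ge>Suc d. f n = z}"
    and "p (f d, e (f(d := z))) = p (g d, e (g(d := z)))"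
   then have *: "f d = g d" "e (f(d := z)) = e (g(d := z))" using pinj by blast+
   have "h(d := z) \<in> {f. \<forall>n\<ge>d. f n = z}" if "h \<in> {f. \<forall>n\<ge>Suc d. f n = z}" for h :: "nat => 'a"
   proof -
    have "(h(d := z)) n = z" if "n \<ge> d" for n
     using that \<open>h \<in> {f. \<forall>n\<ge>Suc d. f n = z}\<close> by (cases "n = d") auto
    then show ?thesis by blast
   qed
   then have "f(d := z) = g(d := z)" using e *(2) f g unfolding inj_on_def by (metis (no_types, lifting))
   then show "f = g" using *(1) by (metis fun_upd_triv fun_upd_upd)
  qed
  then show ?case by blast
 qed
qed

lemma bounded_up: "(!!n. f n \<in> carrier A) ==> (!!n. n > N ==> f n = \<zero>\<^bsub>A\<^esub>) ==> f \<in> up A"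
 by (auto simp: up_def bound_def intro!: exI[of _ N])

lemma up_bounded: "f \<in> up A ==> \<exists>N. \<forall>n>N. f n = \<zero>\<^bsub>A\<^esub>"
 by (auto simp: up_def bound_def)

lemma coeff_UP: "f \<in> up A ==> up_ring.coeff (UP A) f n = f n"
 by (simp add: UP_def)

lemma carrier_UP: "carrier (UP A) = up A"
 by (simp add: UP_def)

text \<open>\<open>A[x] / (x\<^sup>d + p\<^sub>1 x\<^sup>d\<^sup>-\<^sup>1 + \<dots> + p\<^sub>d)\<close>, whose elements are represented in \<open>'a\<close> because
 \<open>'a\<close> is infinite. The last conjunct expresses that the powers \<open>x\<^sup>i\<close>, \<open>i < d\<close>, form a basis.\<close>

lemma adjoin_root:
 fixes A :: "'a ring" (structure) and p :: "nat => 'a"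
 assumes inf: "infinite (UNIV :: 'a set)" and A: "cring A" and p: "!!n. p n \<in> carrier A" "p 0 = \<one>" "!!n. n > d ==> p n = \<zero>"
  and d: "d \<ge> 1"
 shows "\<exists>B phi x. cring B \<and> phi \<in> homs A B \<and> x \<in> carrier B \<and>
  (\<Oplus>\<^bsub>B\<^esub>i\<in>{..d}. phi (p i) \<otimes>\<^bsub>B\<^esub> x [^]\<^bsub>B\<^esub> (d - i)) = \<zero>\<^bsub>B\<^esub> \<and>
  (\<forall>b \<in> carrier B. \<exists>c. (\<forall>i. c i \<in> carrier A) \<and> b = (\<Oplus>\<^bsub>B\<^esub>i\<in>{..<d}. phi (c i) \<otimes>\<^bsub>B\<^esub> x [^]\<^bsub>B\<^esub> i)) \<and>
  (\<forall>I a c. ideal I A --> a \<in> carrier A --> (\<forall>i. c i \<in> I) -->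
   phi a = (\<Oplus>\<^bsub>B\<^esub>i\<in>{..<d}. phi (c i) \<otimes>\<^bsub>B\<^esub> x [^]\<^bsub>B\<^esub> i) --> a \<in> I)"
proof -
 let ?U = "UP A"
 interpret UP_cring A "UP A" by (simp add: UP_cring_def A)
 have Ucr: "cring ?U" by (rule P.is_cring)
 note cU = carrier_UP[of A]
 have coeff: "up_ring.coeff ?U f n = f n" if "f \<in> up A" for f n by (rule coeff_UP[OF that])
 \<comment> \<open>The reversed polynomial of \<open>p\<close>. It is monic of degree
   \<open>d\<close> because \<open>p 0\<close> is 1, and hence division with remainder by it is
   possible over any commutative ring.\<close>
 define g where "g = (\<lambda>n. if n \<le> d then p (d - n) else \<zero>)"
 have g: "g \<in> up A" by (rule bounded_up[of _ _ d]) (use p in \<open>auto simp: g_def\<close>)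
 have gd: "g d = \<one>" using p by (simp add: g_def)
 define J where "J = PIdl\<^bsub>?U\<^esub> g"
 have J: "ideal J ?U" unfolding J_def by (rule P.cgenideal_ideal) (simp add: cU g)
 interpret J: ideal J ?U by fact
 have J0: "\<zero>\<^bsub>?U\<^esub> \<in> J" by (rule J.zero_closed)
 have gU: "g \<in> carrier ?U" using g cU by simp
 have gJ: "q \<otimes>\<^bsub>?U\<^esub> g \<in> J" if "q \<in> carrier ?U" for q
  unfolding J_def cgenideal_def using that by blast
 have division_aux: "\<exists>r \<in> up A. (\<forall>n\<ge>d. r n = \<zero>) \<and> f \<ominus>\<^bsub>?U\<^esub> r \<in> J" if "f \<in> up A" "\<forall>n\<ge>N. f n = \<zero>" for f N
  using that
 proof (induction N arbitrary: f)
  case 0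
  have "f \<in> carrier ?U" using 0(1) cU by simp
  from P.r_neg[OF this] have "f \<ominus>\<^bsub>?U\<^esub> f = \<zero>\<^bsub>?U\<^esub>" by (simp only: a_minus_def)
  then have "f \<ominus>\<^bsub>?U\<^esub> f \<in> J" using J0 by (simp only:)
  moreover have "\<forall>n\<ge>d. f n = \<zero>" using 0(2) by blast
  ultimately show ?case using 0(1) by blast
 next
  case (Suc N)
  have fU: "f \<in> carrier ?U" using Suc(2) cU by simp
  show ?case
  proof (cases "Suc N \<le> d")
   case True
   have "f \<ominus>\<^bsub>?U\<^esub> f = \<zero>\<^bsub>?U\<^esub>" using fU by (simp add: a_minus_def P.r_neg)
   then show ?thesis using Suc True J0 by (intro bexI[of _ f]) auto
  next
   case False
   define c where "c = f N"
   have c: "c \<in> carrier A" using Suc(2) by (auto simp: c_def up_def)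
   define u where "u = up_ring.monom ?U c (N - d) \<otimes>\<^bsub>?U\<^esub> g"
   have uU: "u \<in> carrier ?U" using c gU by (simp add: u_def)
   have uJ: "u \<in> J" unfolding u_def by (rule gJ) (use c in simp)
   have un: "u n = c \<otimes> g (n - (N - d))" if "n \<ge> N - d" for n
    using coeff_monom_mult[OF c gU, of "N - d" "n - (N - d)"] that coeff[of u] coeff[OF g] uU cU unfolding u_def by simp
   let ?f = "f \<ominus>\<^bsub>?U\<^esub> u"
   have f': "?f \<in> carrier ?U" using fU uU by simp
   have "?f n = \<zero>" if n: "n \<ge> N" for n
   proof -
    have "?f n = f n \<ominus> u n"
     using coeff_minus[OF fU uU, of n] coeff[of f] coeff[of u] coeff[of ?f] fU uU f' cU by simp
    moreover have "u n = f n"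
    proof (cases "n = N")
     case True
     have "N - (N - d) = d" using False by simp
     then show ?thesis using un[of N] gd c True by (simp add: c_def)
    next
     case False': False
     then have "n - (N - d) > d" using n False by simp
     then have "g (n - (N - d)) = \<zero>" by (simp add: g_def)
     then show ?thesis using un[of n] c n False' Suc(3) by simp
    qed
    moreover have "f n \<in> carrier A" using Suc(2) by (auto simp: up_def)
    ultimately show ?thesis by (simp add: a_minus_def R.r_neg)
   qed
   then obtain r where r: "r \<in> up A" "\<forall>n\<ge>d. r n = \<zero>" "?f \<ominus>\<^bsub>?U\<^esub> r \<in> J"
    using Suc.IH[of ?f] f' cU by auto
   have rU: "r \<in> carrier ?U" using r(1) cU by simp
   have "(?f \<ominus>\<^bsub>?U\<^esub> r) \<oplus>\<^bsub>?U\<^esub> u \<in> J" by (rule J.a_closed[OF r(3) uJ])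
   moreover have "(?f \<ominus>\<^bsub>?U\<^esub> r) \<oplus>\<^bsub>?U\<^esub> u = f \<ominus>\<^bsub>?U\<^esub> r"
    using fU uU rU by algebra
   ultimately show ?thesis using r by (intro bexI[of _ r]) auto
  qed
 qed
 have division: "\<exists>r \<in> up A. (\<forall>n\<ge>d. r n = \<zero>) \<and> f \<ominus>\<^bsub>?U\<^esub> r \<in> J" if f: "f \<in> up A" for f
 proof -
  obtain N where "\<forall>n>N. f n = \<zero>" using up_bounded[OF f] by blast
  then have "\<forall>n\<ge>Suc N. f n = \<zero>" by auto
  then show ?thesis by (rule division_aux[OF f])
 qed
 \<comment> \<open>Each residue class is coded by a remainder, a tuple of length \<open>d\<close>;
   this injects the quotient, whose classes are sets of polynomials, into \<open>'a\<close>.\<close>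
 obtain e :: "(nat => 'a) => 'a" where e: "inj_on e {f. \<forall>n\<ge>d. f n = \<zero>}" using tuple_injection[OF inf] by blast
 have "\<forall>c \<in> carrier (?U Quot J). \<exists>r. r \<in> up A \<and> (\<forall>n\<ge>d. r n = \<zero>) \<and> c = J +>\<^bsub>?U\<^esub> r"
 proof
  fix c assume c: "c \<in> carrier (?U Quot J)"
  obtain f where f: "c = J +>\<^bsub>?U\<^esub> f" "f \<in> carrier ?U" using c[unfolded quot_carrier] by (rule imageE)
  obtain r where r: "r \<in> up A" "\<forall>n\<ge>d. r n = \<zero>" "f \<ominus>\<^bsub>?U\<^esub> r \<in> J" using division f(2) cU by blast
  have "J +>\<^bsub>?U\<^esub> f = J +>\<^bsub>?U\<^esub> r"
   using P.quotient_eq_iff_same_a_r_cos[OF J f(2), of r] r(1,3) cU by simp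
  then show "\<exists>r. r \<in> up A \<and> (\<forall>n\<ge>d. r n = \<zero>) \<and> c = J +>\<^bsub>?U\<^esub> r" using f(1) r by auto
 qed
 then obtain rp where rp: "!!c. c \<in> carrier (?U Quot J) ==> rp c \<in> up A \<and> (\<forall>n\<ge>d. rp c n = \<zero>) \<and> c = J +>\<^bsub>?U\<^esub> rp c"
  by metis
 have "inj_on (\<lambda>c. e (rp c)) (carrier (?U Quot J))"
 proof (rule inj_onI)
  fix c c' assume c: "c \<in> carrier (?U Quot J)" "c' \<in> carrier (?U Quot J)" and "e (rp c) = e (rp c')"
  then have "rp c = rp c'" using inj_onD[OF e] rp by blast
  then show "c = c'" using rp[OF c(1)] rp[OF c(2)] by simp
 qed
 then obtain B :: "'a ring" and h where B: "cring B" "h \<in> ring_hom ?U B" "h ` carrier ?U = carrier B"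
  "!!f. f \<in> carrier ?U ==> h f = \<zero>\<^bsub>B\<^esub> \<longleftrightarrow> f \<in> J"
  using realize_quotient[OF Ucr J] by metis
 interpret B: cring B by fact
 interpret h: ring_hom_cring ?U B h using B(2) by (intro ring_hom_cringI) (auto intro: Ucr B(1))
 define phi where "phi = restrict (\<lambda>a. h (up_ring.monom ?U a 0)) (carrier A)"
 define x where "x = h (up_ring.monom ?U \<one> 1)"
 have x: "x \<in> carrier B" by (simp add: x_def)
 have "h \<circ> (\<lambda>a. up_ring.monom ?U a 0) \<in> ring_hom A B" by (rule ring_hom_trans[OF const_ring_hom B(2)])
 then have phi: "phi \<in> homs A B" unfolding phi_def comp_def by (rule restrict_homs[OF A])
 note phic = homs_closed[OF phi]
 have mon1: "h (up_ring.monom ?U \<one> n) = x [^]\<^bsub>B\<^esub> n" for n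
 proof (induction n)
  case 0
  show ?case by simp
 next
  case (Suc n)
  have "h (up_ring.monom ?U \<one> (Suc n)) = h (up_ring.monom ?U \<one> n \<otimes>\<^bsub>?U\<^esub> up_ring.monom ?U \<one> 1)"
   by (simp only: monom_one_Suc)
  then show ?case using Suc by (simp add: x_def)
 qed
 have mon: "h (up_ring.monom ?U c n) = phi c \<otimes>\<^bsub>B\<^esub> x [^]\<^bsub>B\<^esub> n" if c: "c \<in> carrier A" for c n
 proof -
  have "up_ring.monom ?U c n = up_ring.monom ?U c 0 \<otimes>\<^bsub>?U\<^esub> up_ring.monom ?U \<one> n"
   using monom_mult[OF c R.one_closed, of 0 n] c by simp
  then show ?thesis using c mon1 by (simp add: phi_def)
 qed
 have hf: "h f = (\<Oplus>\<^bsub>B\<^esub>i\<in>{..N}. phi (f i) \<otimes>\<^bsub>B\<^esub> x [^]\<^bsub>B\<^esub> i)" if f: "f \<in> up A" "!!n. n > N ==> f n = \<zero>" for f N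
 proof -
  have fc: "f i \<in> carrier A" for i using f(1) by (auto simp: up_def)
  have "deg A f \<le> N" by (rule deg_aboveI) (use f in \<open>auto simp: cU coeff\<close>)
  then have "(\<Oplus>\<^bsub>?U\<^esub>i\<in>{..N}. up_ring.monom ?U (up_ring.coeff ?U f i) i) = f" by (rule up_repr_le) (simp add: cU f)
  then have "h f = h (\<Oplus>\<^bsub>?U\<^esub>i\<in>{..N}. up_ring.monom ?U (f i) i)" by (simp add: coeff[OF f(1)])
  also have "\<dots> = (\<Oplus>\<^bsub>B\<^esub>i\<in>{..N}. h (up_ring.monom ?U (f i) i))"
   using fc by (subst h.hom_finsum) (auto simp: comp_def)
  also have "\<dots> = (\<Oplus>\<^bsub>B\<^esub>i\<in>{..N}. phi (f i) \<otimes>\<^bsub>B\<^esub> x [^]\<^bsub>B\<^esub> i)"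
   using fc phic x by (intro B.finsum_cong') (auto simp: mon)
  finally show ?thesis .
 qed
 have d': "{..<d} = {..d - 1}" using d by auto
 have reflect: "(\<lambda>i. d - i) ` {..d} = {..d}"
 proof
  show "{..d} \<subseteq> (\<lambda>i. d - i) ` {..d}"
  proof
   fix i assume "i \<in> {..d}"
   then show "i \<in> (\<lambda>i. d - i) ` {..d}" by (intro image_eqI[of _ _ "d - i"]) auto
  qed
 qed auto
 have root: "(\<Oplus>\<^bsub>B\<^esub>i\<in>{..d}. phi (p i) \<otimes>\<^bsub>B\<^esub> x [^]\<^bsub>B\<^esub> (d - i)) = \<zero>\<^bsub>B\<^esub>"
 proof -
  have "g \<in> J" unfolding J_def by (rule P.cgenideal_self) (simp add: cU g)
  then have "\<zero>\<^bsub>B\<^esub> = h g" using B(4)[of g] g cU by simp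
  also have "h g = (\<Oplus>\<^bsub>B\<^esub>i\<in>{..d}. phi (g i) \<otimes>\<^bsub>B\<^esub> x [^]\<^bsub>B\<^esub> i)"
   by (rule hf[OF g]) (simp add: g_def)
  also have "\<dots> = (\<Oplus>\<^bsub>B\<^esub>i\<in>(\<lambda>i. d - i) ` {..d}. phi (g i) \<otimes>\<^bsub>B\<^esub> x [^]\<^bsub>B\<^esub> i)"
   by (simp only: reflect)
  also have "\<dots> = (\<Oplus>\<^bsub>B\<^esub>i\<in>{..d}. phi (g (d - i)) \<otimes>\<^bsub>B\<^esub> x [^]\<^bsub>B\<^esub> (d - i))"
   using x phic p by (intro B.add.finprod_reindex) (auto simp: inj_on_def g_def)
  also have "\<dots> = (\<Oplus>\<^bsub>B\<^esub>i\<in>{..d}. phi (p i) \<otimes>\<^bsub>B\<^esub> x [^]\<^bsub>B\<^esub> (d - i))"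
   using x phic p by (intro B.finsum_cong') (auto simp: g_def)
  finally show ?thesis by simp
 qed
 have gen: "\<exists>c. (\<forall>i. c i \<in> carrier A) \<and> b = (\<Oplus>\<^bsub>B\<^esub>i\<in>{..<d}. phi (c i) \<otimes>\<^bsub>B\<^esub> x [^]\<^bsub>B\<^esub> i)" if b: "b \<in> carrier B" for b
 proof -
  obtain f where f: "f \<in> carrier ?U" "b = h f" using b B(3) by (metis imageE)
  obtain r where r: "r \<in> up A" "\<forall>n\<ge>d. r n = \<zero>" "f \<ominus>\<^bsub>?U\<^esub> r \<in> J" using division f(1) cU by blast
  have rU: "r \<in> carrier ?U" using r(1) cU by simp
  have "f \<ominus>\<^bsub>?U\<^esub> r \<in> carrier ?U" using f(1) rU by simp
  then have "h (f \<ominus>\<^bsub>?U\<^esub> r) = \<zero>\<^bsub>B\<^esub>" using B(4) r(3) by blast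
  moreover have "h (f \<ominus>\<^bsub>?U\<^esub> r) = h f \<ominus>\<^bsub>B\<^esub> h r" using f(1) rU by (simp add: a_minus_def)
  ultimately have "h f = h r" using f(1) rU B.r_right_minus_eq[of "h f" "h r"] h.hom_closed by (simp only:)
  also have "h r = (\<Oplus>\<^bsub>B\<^esub>i\<in>{..<d}. phi (r i) \<otimes>\<^bsub>B\<^esub> x [^]\<^bsub>B\<^esub> i)"
   unfolding d' by (rule hf[OF r(1)]) (use r(2) d in auto)
  finally show ?thesis using f(2) r(1) by (intro exI[of _ r]) (auto simp: up_def)
 qed
 have basis: "a \<in> I" if I: "ideal I A" and a: "a \<in> carrier A" and c: "\<forall>i. c i \<in> I"
  and eq: "phi a = (\<Oplus>\<^bsub>B\<^esub>i\<in>{..<d}. phi (c i) \<otimes>\<^bsub>B\<^esub> x [^]\<^bsub>B\<^esub> i)" for I a c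
 proof -
  interpret I: ideal I A by fact
  have cc: "c i \<in> carrier A" for i using c I.Icarr by blast
  define f where "f = (\<lambda>n. if n < d then c n else \<zero>)"
  have f: "f \<in> up A" by (rule bounded_up[of _ _ d]) (use cc in \<open>auto simp: f_def\<close>)
  have fU: "f \<in> carrier ?U" using f cU by simp
  have "h f = (\<Oplus>\<^bsub>B\<^esub>i\<in>{..<d}. phi (f i) \<otimes>\<^bsub>B\<^esub> x [^]\<^bsub>B\<^esub> i)"
   unfolding d' by (rule hf[OF f]) (use d in \<open>auto simp: f_def\<close>)
  also have "\<dots> = phi a" unfolding eq using cc phic x by (intro B.finsum_cong') (auto simp: f_def)
  also have "\<dots> = h (up_ring.monom ?U a 0)" using a by (simp add: phi_def)
  finally have hfa: "h (up_ring.monom ?U a 0) = h f" by simp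
  have mU: "up_ring.monom ?U a 0 \<in> carrier ?U" using a by simp
  have "h (up_ring.monom ?U a 0 \<ominus>\<^bsub>?U\<^esub> f) = h (up_ring.monom ?U a 0) \<ominus>\<^bsub>B\<^esub> h f" using fU mU by (simp add: a_minus_def)
  also have "\<dots> = \<zero>\<^bsub>B\<^esub>" unfolding hfa using fU by (simp add: a_minus_def B.r_neg)
  finally have "h (up_ring.monom ?U a 0 \<ominus>\<^bsub>?U\<^esub> f) = \<zero>\<^bsub>B\<^esub>" .
  moreover have "up_ring.monom ?U a 0 \<ominus>\<^bsub>?U\<^esub> f \<in> carrier ?U" using fU mU by simp
  ultimately have "up_ring.monom ?U a 0 \<ominus>\<^bsub>?U\<^esub> f \<in> J" using B(4) by blast
  then obtain q where q: "q \<in> up A" "up_ring.monom ?U a 0 \<ominus>\<^bsub>?U\<^esub> f = q \<otimes>\<^bsub>?U\<^esub> g" unfolding J_def cgenideal_def cU by blast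
  have qc: "q i \<in> carrier A" and gc: "g i \<in> carrier A" for i using q(1) g by (auto simp: up_def)
  have mul: "(\<Oplus>i\<in>{..n}. q i \<otimes> g (n - i)) = (if n = 0 then a else \<zero>) \<ominus> f n" for n
  proof -
   have "up_ring.coeff ?U (q \<otimes>\<^bsub>?U\<^esub> g) n = up_ring.coeff ?U (up_ring.monom ?U a 0 \<ominus>\<^bsub>?U\<^esub> f) n" using q(2) by simp
   also have "\<dots> = (if n = 0 then a else \<zero>) \<ominus> f n"
    using coeff_minus[OF mU fU, of n] coeff_monom[OF a, of 0 n] by (simp add: coeff[OF f])
   finally show ?thesis using q(1) g by (simp add: cU coeff[OF q(1)] coeff[OF g])
  qed
  have fI: "f n \<in> I" for n using c I.zero_closed by (simp add: f_def)
  \<comment> \<open>Let \<open>m\<close> be the largest index with \<open>q m\<close> outside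
    \<open>I\<close>. As \<open>g\<close> is monic of degree \<open>d\<close>, the coefficient of q
    g in degree m + d is \<open>q m\<close> modulo \<open>I\<close>; on the other side it is minus a
    coefficient of \<open>f\<close>, because \<open>d\<close> is at least 1 and \<open>a\<close>
    sits in degree 0. So \<open>q m\<close> lies in \<open>I\<close> after all.\<close>
  have qI: "q k \<in> I" for k
  proof (rule ccontr)
   assume "q k \<notin> I"
   let ?S = "{k. q k \<notin> I}"
   obtain N where N: "\<forall>n>N. q n = \<zero>" using up_bounded[OF q(1)] by blast
   have "?S \<subseteq> {..N}" using N I.zero_closed by (auto simp: not_less[symmetric])
   then have fin: "finite ?S" by (rule finite_subset) simp
   define m where "m = Max ?S"
   have m: "q m \<notin> I" using Max_in[OF fin] \<open>q k \<notin> I\<close> by (auto simp: m_def)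
   have gt: "q i \<in> I" if "i > m" for i using Max_ge[OF fin, of i] that by (fastforce simp: m_def)
   let ?t = "\<lambda>i. q i \<otimes> g (m + d - i)"
   have tc: "?t i \<in> carrier A" for i using qc gc by simp
   have tI: "?t i \<in> I" if "i \<in> {..m + d} - {m}" for i
   proof (cases "i < m")
    case True
    then have "\<not> m + d - i \<le> d" by linarith
    then have "g (m + d - i) = \<zero>" by (simp add: g_def)
    then show ?thesis using qc I.zero_closed by simp
   next
    case False
    then have "q i \<in> I" using that gt by auto
    then show ?thesis using gc by (rule I.I_r_closed)
   qed
   have "{..m + d} = insert m ({..m + d} - {m})" by auto
   then have "finsum A ?t {..m + d} = finsum A ?t (insert m ({..m + d} - {m}))" by simp
   also have "\<dots> = ?t m \<oplus> finsum A ?t ({..m + d} - {m})"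
    by (rule R.finsum_insert) (use tc tc[of m] in auto)
   finally have s: "finsum A ?t {..m + d} = q m \<oplus> finsum A ?t ({..m + d} - {m})" using gd qc[of m] by simp
   have r: "finsum A ?t ({..m + d} - {m}) \<in> I" by (rule finsum_in_ideal[OF A I tI])
   have "finsum A ?t {..m + d} = \<ominus> f (m + d)" using mul[of "m + d"] d I.Icarr[OF fI] by (simp add: a_minus_def)
   then have "finsum A ?t {..m + d} \<in> I" using I.a_inv_closed[OF fI] by simp
   then have u: "finsum A ?t {..m + d} \<ominus> finsum A ?t ({..m + d} - {m}) \<in> I"
    unfolding a_minus_def by (rule I.a_closed[OF _ I.a_inv_closed[OF r]])
   have "q m = finsum A ?t {..m + d} \<ominus> finsum A ?t ({..m + d} - {m})"
    unfolding s using qc[of m] I.Icarr[OF r] by (simp add: a_minus_def R.a_assoc R.r_neg)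
   then show False using u m by simp
  qed
  have "q 0 \<otimes> g 0 = a \<ominus> f 0" using mul[of 0] qc gc by simp
  then have "a \<ominus> f 0 \<in> I" using I.I_r_closed[OF qI gc] by metis
  then have "a \<ominus> f 0 \<oplus> f 0 \<in> I" using I.a_closed fI by blast
  moreover have "a \<ominus> f 0 \<oplus> f 0 = a" using a I.Icarr[OF fI] by (simp add: a_minus_def R.a_assoc R.l_neg)
  ultimately show ?thesis by simp
 qed
 show ?thesis
  by (intro exI[of _ B] exI[of _ phi] exI[of _ x] conjI B(1) phi x root ballI allI impI) (use gen basis in blast)+
qed

text \<open>\<open>T\<close> is the extension of \<open>I\<close> to \<open>B\<close>, and
  \<open>contr\<close> says that it contracts into \<open>I\<close>. An ideal that is maximal among
  those containing \<open>T\<close> and contracting into \<open>I\<close> is prime, and its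
  contraction is exactly \<open>I\<close>; the Noetherian property of \<open>B\<close> provides
  it.\<close>

lemma lying_over:
 fixes A :: "'a ring" (structure) and B :: "'a ring" and y :: "nat => 'a"
 assumes A: "cring A" and B: "cring B" "noetherian_ring B" and phi: "phi \<in> ring_hom A B" and y: "!!i. y i \<in> carrier B"
  and gen: "!!b. b \<in> carrier B ==> \<exists>c. (\<forall>i. c i \<in> carrier A) \<and> b = (\<Oplus>\<^bsub>B\<^esub>i\<in>{..<d}. phi (c i) \<otimes>\<^bsub>B\<^esub> y i)"
  and I: "primeideal I A"
  and contr: "!!a c. a \<in> carrier A ==> \<forall>i. c i \<in> I ==> phi a = (\<Oplus>\<^bsub>B\<^esub>i\<in>{..<d}. phi (c i) \<otimes>\<^bsub>B\<^esub> y i) ==> a \<in> I"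
 shows "\<exists>J. primeideal J B \<and> I = {a \<in> carrier A. phi a \<in> J}"
proof -
 interpret A: cring A by fact
 interpret B: cring B by fact
 interpret I: primeideal I A by fact
 interpret h: ring_hom_cring A B phi using phi by (intro ring_hom_cringI) (auto intro: A B)
 define psi where "psi c = (\<Oplus>\<^bsub>B\<^esub>i\<in>{..<d}. phi (c i) \<otimes>\<^bsub>B\<^esub> y i)" for c
 have psi_closed: "psi c \<in> carrier B" if "!!i. c i \<in> carrier A" for c
  unfolding psi_def using that y by (intro B.finsum_closed) auto
 have psi_add: "psi (\<lambda>i. f i \<oplus> g i) = psi f \<oplus>\<^bsub>B\<^esub> psi g" if "!!i. f i \<in> carrier A" "!!i. g i \<in> carrier A" for f g
 proof -
  have "psi (\<lambda>i. f i \<oplus> g i) = (\<Oplus>\<^bsub>B\<^esub>i\<in>{..<d}. phi (f i) \<otimes>\<^bsub>B\<^esub> y i \<oplus>\<^bsub>B\<^esub> phi (g i) \<otimes>\<^bsub>B\<^esub> y i)"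
   unfolding psi_def using that y by (intro B.finsum_cong') (auto simp: B.l_distr)
  then show ?thesis unfolding psi_def using that y by (simp add: B.finsum_addf Pi_def)
 qed
 have psi_smult: "psi (\<lambda>i. a \<otimes> f i) = phi a \<otimes>\<^bsub>B\<^esub> psi f" if "a \<in> carrier A" "!!i. f i \<in> carrier A" for a f
 proof -
  have "phi a \<otimes>\<^bsub>B\<^esub> psi f = (\<Oplus>\<^bsub>B\<^esub>i\<in>{..<d}. phi a \<otimes>\<^bsub>B\<^esub> (phi (f i) \<otimes>\<^bsub>B\<^esub> y i))"
   unfolding psi_def using that y by (intro B.finsum_rdistr) auto
  also have "\<dots> = psi (\<lambda>i. a \<otimes> f i)"
   unfolding psi_def using that y by (intro B.finsum_cong') (auto simp: B.m_assoc)
  finally show ?thesis by simp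
 qed
 define T where "T = psi ` {c. \<forall>i. c i \<in> I}"
 have Tc: "T \<subseteq> carrier B" unfolding T_def using psi_closed I.Icarr by auto
 have T0: "\<zero>\<^bsub>B\<^esub> \<in> T"
 proof -
  have "psi (\<lambda>_. \<zero>) = \<zero>\<^bsub>B\<^esub>" unfolding psi_def using y by (simp add: B.finsum_zero)
  then show ?thesis unfolding T_def using I.zero_closed by (intro image_eqI[of _ _ "\<lambda>_. \<zero>"]) simp_all
 qed
 have Tadd: "a \<oplus>\<^bsub>B\<^esub> b \<in> T" if ab: "a \<in> T" "b \<in> T" for a b
 proof -
  obtain f g where fg: "a = psi f" "\<forall>i. f i \<in> I" "b = psi g" "\<forall>i. g i \<in> I" using ab unfolding T_def by blast
  have "a \<oplus>\<^bsub>B\<^esub> b = psi (\<lambda>i. f i \<oplus> g i)" using fg I.Icarr psi_add[of f g] by simp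
  moreover have "\<forall>i. f i \<oplus> g i \<in> I" using fg I.a_closed by simp
  ultimately show ?thesis unfolding T_def by blast
 qed
 have Tgen: "phi a \<otimes>\<^bsub>B\<^esub> b \<in> T" if ab: "a \<in> I" "b \<in> carrier B" for a b
 proof -
  obtain c where c: "\<forall>i. c i \<in> carrier A" "b = psi c" using gen[OF ab(2)] unfolding psi_def by blast
  have "phi a \<otimes>\<^bsub>B\<^esub> b = psi (\<lambda>i. a \<otimes> c i)" using c ab(1) I.Icarr psi_smult[of a c] by simp
  moreover have "\<forall>i. a \<otimes> c i \<in> I" using c ab(1) I.I_r_closed by simp
  ultimately show ?thesis unfolding T_def by blast
 qed
 have Tsum: "finsum B f S \<in> T" if "finite S" "!!i. i \<in> S ==> f i \<in> T" for f and S :: "nat set"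
  using that
 proof (induction S rule: finite_induct)
  case (insert i S)
  have "f j \<in> carrier B" if "j \<in> insert i S" for j
   using insert(4)[OF that] Tc by blast
  then have "finsum B f (insert i S) = f i \<oplus>\<^bsub>B\<^esub> finsum B f S" using insert by (intro B.finsum_insert) auto
  then show ?case using insert Tadd by simp
 qed (use T0 in simp)
 have Tmul: "t \<otimes>\<^bsub>B\<^esub> b \<in> T" if tb: "t \<in> T" "b \<in> carrier B" for t b
 proof -
  obtain f where f: "t = psi f" "\<forall>i. f i \<in> I" using tb unfolding T_def by blast
  have "t \<otimes>\<^bsub>B\<^esub> b = (\<Oplus>\<^bsub>B\<^esub>i\<in>{..<d}. phi (f i) \<otimes>\<^bsub>B\<^esub> y i \<otimes>\<^bsub>B\<^esub> b)"
   unfolding f(1) psi_def using f(2) tb(2) y I.Icarr by (intro B.finsum_ldistr) auto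
  also have "\<dots> \<in> T"
  proof (rule Tsum)
   fix i assume "i \<in> {..<d}"
   have "phi (f i) \<otimes>\<^bsub>B\<^esub> y i \<otimes>\<^bsub>B\<^esub> b = phi (f i) \<otimes>\<^bsub>B\<^esub> (y i \<otimes>\<^bsub>B\<^esub> b)"
    using f(2) I.Icarr y tb(2) by (simp add: B.m_assoc)
   then show "phi (f i) \<otimes>\<^bsub>B\<^esub> y i \<otimes>\<^bsub>B\<^esub> b \<in> T" using Tgen[of "f i" "y i \<otimes>\<^bsub>B\<^esub> b"] f(2) y tb(2) by simp
  qed simp
  finally show ?thesis .
 qed
 have Tid: "ideal T B"
 proof (rule idealI[OF B.ring_axioms])
  show "subgroup T (add_monoid B)"
  proof (rule group.subgroupI[OF B.a_group])
   show "T \<subseteq> carrier (add_monoid B)" using Tc by simp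
   show "T \<noteq> {}" using T0 by blast
   fix a assume a: "a \<in> T"
   have ac: "a \<in> carrier B" using a Tc by blast
   have "inv\<^bsub>add_monoid B\<^esub> a = \<ominus>\<^bsub>B\<^esub> a" by (simp add: a_inv_def)
   also have "\<dots> = a \<otimes>\<^bsub>B\<^esub> (\<ominus>\<^bsub>B\<^esub> \<one>\<^bsub>B\<^esub>)" using ac by (simp add: B.r_minus)
   finally show "inv\<^bsub>add_monoid B\<^esub> a \<in> T" using Tmul[OF a] by simp
   show "a \<otimes>\<^bsub>add_monoid B\<^esub> b \<in> T" if "b \<in> T" for b using Tadd[OF a that] by simp
  qed
  fix a x assume ax: "a \<in> T" "x \<in> carrier B"
  show 1: "a \<otimes>\<^bsub>B\<^esub> x \<in> T" by (rule Tmul[OF ax])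
  have "a \<in> carrier B" using ax(1) Tc by blast
  then show "x \<otimes>\<^bsub>B\<^esub> a \<in> T" using 1 ax(2) B.m_comm by simp
 qed
 let ?F = "{J. ideal J B \<and> T \<subseteq> J \<and> (\<forall>a \<in> carrier A. phi a \<in> J --> a \<in> I)}"
 have "T \<in> ?F"
 proof -
  have "a \<in> I" if a: "a \<in> carrier A" "phi a \<in> T" for a
  proof -
   obtain c where "phi a = psi c" "\<forall>i. c i \<in> I" using a(2) unfolding T_def by blast
   then show ?thesis using contr[OF a(1), of c] by (simp add: psi_def)
  qed
  then show ?thesis using Tid by blast
 qed
 then have "?F \<noteq> {}" by force
 have "ideal J B" if "J \<in> ?F" for J using that by simp
 then have "\<exists>M \<in> ?F. \<forall>J' \<in> ?F. M \<subseteq> J' --> J' = M" by (rule noetherian_maximal[OF B(2) \<open>?F \<noteq> {}\<close>])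
 then obtain J where JF: "J \<in> ?F" and Jm: "\<forall>J' \<in> ?F. J \<subseteq> J' --> J' = J" by (rule bexE)
 have J: "ideal J B" "T \<subseteq> J" "a \<in> carrier A ==> phi a \<in> J ==> a \<in> I" for a
  using JF by simp_all
 have max: "J' = J" if "J' \<in> ?F" "J \<subseteq> J'" for J'
  by (rule mp[OF bspec[OF Jm that(1)] that(2)])
 interpret J: ideal J B by fact
 have J1: "\<one>\<^bsub>B\<^esub> \<notin> J"
 proof
  assume "\<one>\<^bsub>B\<^esub> \<in> J"
  then have "\<one> \<in> I" using J(3)[OF A.one_closed] by simp
  then show False using I.one_imp_carrier I.I_notcarr by simp
 qed
 have "primeideal J B"
 proof (rule primeidealI[OF J(1) B(1)])
  show "carrier B \<noteq> J" using J1 by auto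
  fix a b assume ab: "a \<in> carrier B" "b \<in> carrier B" "a \<otimes>\<^bsub>B\<^esub> b \<in> J"
  show "a \<in> J \<or> b \<in> J"
  proof (rule ccontr)
   assume n: "\<not> (a \<in> J \<or> b \<in> J)"
   \<comment> \<open>By maximality, enlarging \<open>J\<close> by an element \<open>z\<close>
     outside it must bring in the image of some element outside \<open>I\<close>. Two such elements
     would have a product outside \<open>I\<close> whose image lies in \<open>J\<close>.\<close>
   have ex: "\<exists>s \<in> carrier A. s \<notin> I \<and> phi s \<in> ideal_adjoin B J z" if z: "z \<in> carrier B" "z \<notin> J" for z
   proof (rule ccontr)
    note ad = ideal_adjoin[OF B(1) J(1) z(1)]
    assume "\<not> (\<exists>s \<in> carrier A. s \<notin> I \<and> phi s \<in> ideal_adjoin B J z)"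
    then have "ideal_adjoin B J z \<in> ?F" using ad(1,2) J(2) by blast
    then have "ideal_adjoin B J z = J" by (rule max[OF _ ad(2)])
    then show False using ad(3) z(2) by simp
   qed
   obtain s where s: "s \<in> carrier A" "s \<notin> I" "phi s \<in> ideal_adjoin B J a" using ex[OF ab(1)] n by blast
   obtain t where t: "t \<in> carrier A" "t \<notin> I" "phi t \<in> ideal_adjoin B J b" using ex[OF ab(2)] n by blast
   have "phi (s \<otimes> t) \<in> J" using ideal_adjoin_mult[OF B(1) J(1) ab s(3) t(3)] s(1) t(1) by simp
   then have "s \<otimes> t \<in> I" using J(3) s(1) t(1) by simp
   then show False using I.I_prime s t by blast
  qed
 qed
 moreover have "I = {a \<in> carrier A. phi a \<in> J}"
 proof (rule equalityI[OF subsetI subsetI])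
  fix a assume a: "a \<in> I"
  have "phi a \<in> T" using Tgen[OF a B.one_closed] I.Icarr[OF a] by simp
  then show "a \<in> {a \<in> carrier A. phi a \<in> J}" using J(2) I.Icarr[OF a] by blast
 qed (use J(3) in blast)
 ultimately show ?thesis by blast
qed

text \<open>\<open>finite_morphism\<close> asks for a set of generators, but in a family such as the
  powers of a root members may coincide. Coefficients that belong to equal generators are added
  up.\<close>

lemma finite_morphismI:
 fixes A :: "'a ring" (structure) and B :: "'a ring" and y :: "nat => 'a"
 assumes A: "cring A" and B: "cring B" and phi: "phi \<in> ring_hom A B" and y: "!!i. y i \<in> carrier B"
  and gen: "!!b. b \<in> carrier B ==> \<exists>c. (\<forall>i. c i \<in> carrier A) \<and> b = (\<Oplus>\<^bsub>B\<^esub>i\<in>{..<d}. phi (c i) \<otimes>\<^bsub>B\<^esub> y i)"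
 shows "finite_morphism A B phi"
proof -
 interpret A: cring A by fact
 interpret B: cring B by fact
 interpret h: ring_hom_cring A B phi using phi by (intro ring_hom_cringI) (auto intro: A B)
 have collect: "\<exists>c' \<in> y ` F \<rightarrow> carrier A. (\<Oplus>\<^bsub>B\<^esub>i\<in>F. phi (c i) \<otimes>\<^bsub>B\<^esub> y i) = (\<Oplus>\<^bsub>B\<^esub>x\<in>y ` F. phi (c' x) \<otimes>\<^bsub>B\<^esub> x)"
  if "finite F" and c: "!!i. c i \<in> carrier A" for F and c
  using that(1)
 proof (induction F rule: finite_induct)
  case empty
  then show ?case by simp
 next
  case (insert i F)
  then obtain c' where c': "c' \<in> y ` F \<rightarrow> carrier A"
   "(\<Oplus>\<^bsub>B\<^esub>i\<in>F. phi (c i) \<otimes>\<^bsub>B\<^esub> y i) = (\<Oplus>\<^bsub>B\<^esub>x\<in>y ` F. phi (c' x) \<otimes>\<^bsub>B\<^esub> x)" by blast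
  define k where "k = (if y i \<in> y ` F then c' (y i) else \<zero>)"
  have k: "k \<in> carrier A" using c'(1) by (auto simp: k_def)
  let ?c = "c'(y i := c i \<oplus> k)"
  let ?t = "\<lambda>x. phi (c' x) \<otimes>\<^bsub>B\<^esub> x"
  let ?G = "y ` F - {y i}"
  have tc: "?t x \<in> carrier B" if "x \<in> y ` F" for x using that c'(1) y by auto
  have "finsum B ?t (y ` F) = phi k \<otimes>\<^bsub>B\<^esub> y i \<oplus>\<^bsub>B\<^esub> finsum B ?t ?G"
  proof (cases "y i \<in> y ` F")
   case True
   then have "y ` F = insert (y i) ?G" by (rule insert_Diff[symmetric])
   then have "finsum B ?t (y ` F) = finsum B ?t (insert (y i) ?G)" by (rule arg_cong)
   also have "\<dots> = ?t (y i) \<oplus>\<^bsub>B\<^esub> finsum B ?t ?G" using tc True insert(1) by (intro B.finsum_insert) auto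
   finally show ?thesis using True by (simp add: k_def)
  next
   case False
   then have "?G = y ` F" by blast
   moreover have "finsum B ?t (y ` F) \<in> carrier B" using tc by (intro B.finsum_closed) auto
   ultimately show ?thesis using False y by (simp add: k_def)
  qed
  note e1 = this
  have G: "finsum B ?t ?G \<in> carrier B" using tc by (intro B.finsum_closed) auto
  have "(\<Oplus>\<^bsub>B\<^esub>i\<in>insert i F. phi (c i) \<otimes>\<^bsub>B\<^esub> y i) = phi (c i) \<otimes>\<^bsub>B\<^esub> y i \<oplus>\<^bsub>B\<^esub> (\<Oplus>\<^bsub>B\<^esub>i\<in>F. phi (c i) \<otimes>\<^bsub>B\<^esub> y i)"
   using insert(1,2) c y by (intro B.finsum_insert) auto
  also have "\<dots> = phi (c i \<oplus> k) \<otimes>\<^bsub>B\<^esub> y i \<oplus>\<^bsub>B\<^esub> finsum B ?t ?G"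
   unfolding c'(2) e1 using c k y G by (simp add: B.l_distr B.a_assoc)
  also have "finsum B ?t ?G = (\<Oplus>\<^bsub>B\<^esub>x\<in>?G. phi (?c x) \<otimes>\<^bsub>B\<^esub> x)"
   using tc by (intro B.finsum_cong') auto
  also have "phi (c i \<oplus> k) \<otimes>\<^bsub>B\<^esub> y i \<oplus>\<^bsub>B\<^esub> (\<Oplus>\<^bsub>B\<^esub>x\<in>?G. phi (?c x) \<otimes>\<^bsub>B\<^esub> x) = (\<Oplus>\<^bsub>B\<^esub>x\<in>insert (y i) ?G. phi (?c x) \<otimes>\<^bsub>B\<^esub> x)"
   using tc c k y insert(1) by (subst B.finsum_insert) auto
  also have "insert (y i) ?G = y ` insert i F" by blast
  finally show ?case using c'(1) c k by (intro bexI[of _ ?c]) auto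
 qed
 show ?thesis unfolding finite_morphism_def
 proof (intro exI[of _ "y ` {..<d}"] conjI ballI)
  fix b assume "b \<in> carrier B"
  then obtain c where c: "\<forall>i. c i \<in> carrier A" "b = (\<Oplus>\<^bsub>B\<^esub>i\<in>{..<d}. phi (c i) \<otimes>\<^bsub>B\<^esub> y i)" using gen by blast
  then show "\<exists>c \<in> y ` {..<d} \<rightarrow> carrier A. b = (\<Oplus>\<^bsub>B\<^esub>x\<in>y ` {..<d}. phi (c x) \<otimes>\<^bsub>B\<^esub> x)"
   using collect[of "{..<d}" c] by simp
 qed (use y in auto)
qed

section \<open>Hankel minors\<close>

lemma sign_cases: "sign p = 1 \<or> sign p = - 1"
 by (simp add: sign_def)

text \<open>Identifies the Leibniz sum over a ring with carrier with the image of the matrix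
  determinant over \<open>upoly\<close>, where the theory of determinants is available.\<close>

lemma leibniz_det_hom:
 fixes A (structure) and M :: "nat => nat => upoly"
 assumes A: "cring A" and phi: "phi \<in> ring_hom univ_ring A"
 shows "leibniz_det A n (\<lambda>i j. phi (M i j)) = phi (det (mat n n (\<lambda>(i, j). M i j)))"
proof -
 interpret cring A by fact
 interpret h: ring_hom_cring univ_ring A phi using phi by (intro ring_hom_cringI) (auto intro: A univ_ring_cring)
 have um: "phi (- x) = \<ominus> phi x" for x using h.hom_a_inv[of x] by simp
 have pr: "(\<Otimes>i\<in>{..<n}. phi (M i (p i))) = phi (\<Prod>i = 0..<n. M i (p i))" for p
  using h.hom_finprod[of "\<lambda>i. M i (p i)" "{..<n}"] by (simp add: comp_def lessThan_atLeast0)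
 have sg: "add_pow A (sign p) (phi x) = phi (signof p * x)" for p :: "nat => nat" and x
 proof -
  consider "sign p = 1" | "sign p = - 1" using sign_cases by blast
  then show ?thesis
  proof cases
   case 1
   have "add_pow A (1::int) (phi x) = phi x" by (simp add: add_pow_def int_pow_def2)
   then show ?thesis using 1 by simp
  next
   case 2
   have "add_pow A (- 1::int) (phi x) = \<ominus> phi x" by (simp add: add_pow_def int_pow_def2 a_inv_def)
   then show ?thesis using 2 um by simp
  qed
 qed
 have "phi (det (mat n n (\<lambda>(i, j). M i j))) = phi (\<Sum>p\<in>{p. p permutes {0..<n}}. signof p * (\<Prod>i = 0..<n. M i (p i)))"
 proof -
  have "(\<Prod>i = 0..<n. mat n n (\<lambda>(i, j). M i j) $$ (i, p i)) = (\<Prod>i = 0..<n. M i (p i))" if "p permutes {0..<n}" for p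
   by (rule prod.cong) (use permutes_in_image[OF that] in auto)
  note pr' = this
  have "det (mat n n (\<lambda>(i, j). M i j)) = (\<Sum>p\<in>{p. p permutes {0..<n}}. signof p * (\<Prod>i = 0..<n. mat n n (\<lambda>(i, j). M i j) $$ (i, p i)))"
   by (simp add: det_def)
  also have "\<dots> = (\<Sum>p\<in>{p. p permutes {0..<n}}. signof p * (\<Prod>i = 0..<n. M i (p i)))"
   by (rule sum.cong) (use pr' in auto)
  finally show ?thesis by (rule arg_cong)
 qed
 also have "\<dots> = (\<Oplus>p\<in>{p. p permutes {0..<n}}. phi (signof p * (\<Prod>i = 0..<n. M i (p i))))"
  using h.hom_finsum[of "\<lambda>p. signof p * (\<Prod>i = 0..<n. M i (p i))" "{p. p permutes {0..<n}}"] by (simp add: comp_def)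
 also have "\<dots> = leibniz_det A n (\<lambda>i j. phi (M i j))"
  unfolding leibniz_det_def pr sg lessThan_atLeast0[symmetric] ..
 finally show ?thesis by simp
qed

lemma leibniz_det_cong:
 fixes A (structure)
 assumes "cring A" "!!i j. i < n ==> j < n ==> M i j = N i j" "!!i j. i < n ==> j < n ==> N i j \<in> carrier A"
 shows "leibniz_det A n M = leibniz_det A n N"
proof -
 interpret cring A by fact
 have mem: "p i < n" if "p permutes {..<n}" "i < n" for p i using permutes_in_image[OF that(1), of i] that(2) by simp
 show ?thesis unfolding leibniz_det_def
 proof (rule finsum_cong')
  fix p assume "p \<in> {p. p permutes {..<n}}"
  then have "(\<Otimes>i\<in>{..<n}. M i (p i)) = (\<Otimes>i\<in>{..<n}. N i (p i))"
   using mem assms(2,3) by (intro finprod_cong') auto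
  then show "add_pow A (sign p) (\<Otimes>i\<in>{..<n}. M i (p i)) = add_pow A (sign p) (\<Otimes>i\<in>{..<n}. N i (p i))" by simp
 next
  show "(\<lambda>p. add_pow A (sign p) (\<Otimes>i\<in>{..<n}. N i (p i))) \<in> {p. p permutes {..<n}} \<rightarrow> carrier A"
   using mem assms(3) by (auto intro!: add.int_pow_closed finprod_closed)
 qed simp
qed

text \<open>Every infinite matrix is a specialization of the generic one, whose entries are distinct
  variables; determinant identities are then proved for the generic matrix.\<close>

lemma matrix_lift:
 fixes M :: "nat => nat => 'a"
 assumes "cring A" "!!i j. M i j \<in> carrier A"
 shows "\<exists>phi \<in> ring_hom (univ_ring :: upoly ring) A. \<exists>V. \<forall>i j. phi (V i j) = M i j"
proof -
 have "(\<lambda>(i, j). M i j) (prod_decode k) \<in> carrier A" for k using assms(2) by (cases "prod_decode k") simp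
 then obtain phi where "phi \<in> ring_hom (univ_ring :: upoly ring) A" "\<forall>k. phi (Var k) = (\<lambda>(i, j). M i j) (prod_decode k)"
  using upoly_lift[of A "\<lambda>k. (\<lambda>(i, j). M i j) (prod_decode k)"] assms(1) by blast
 then show ?thesis by (intro bexI[of _ phi] exI[of _ "\<lambda>i j. Var (prod_encode (i, j))"]) auto
qed

lemma leibniz_det_closed:
 assumes "cring A" "!!i j. M i j \<in> carrier A"
 shows "leibniz_det A n M \<in> carrier A"
proof -
 obtain phi V where phi: "phi \<in> ring_hom (univ_ring :: upoly ring) A" and V: "!!i j. phi (V i j) = M i j"
  using matrix_lift[of A M, OF assms] by blast
 show ?thesis using leibniz_det_hom[OF assms(1) phi, of n V] ring_hom_closed[OF phi] by (simp add: V)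
qed

lemma leibniz_det_0: "cring A ==> leibniz_det A 0 M = \<one>\<^bsub>A\<^esub>"
proof -
 assume A: "cring A"
 interpret cring A by fact
 obtain phi where phi: "phi \<in> ring_hom (univ_ring :: upoly ring) A"
  using upoly_lift[OF A, of "\<lambda>_. \<one>\<^bsub>A\<^esub>"] by auto
 have "leibniz_det A 0 M = leibniz_det A 0 (\<lambda>i j. phi 0)" by (rule leibniz_det_cong[OF A]) auto
 also have "\<dots> = \<one>\<^bsub>A\<^esub>"
  using leibniz_det_hom[OF A phi, of 0 "\<lambda>_ _. 0"] ring_hom_one[OF phi] by simp
 finally show ?thesis .
qed

lemma leibniz_det_transpose:
 assumes "cring A" "!!i j. M i j \<in> carrier A"
 shows "leibniz_det A n (\<lambda>i j. M j i) = leibniz_det A n M"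
proof -
 obtain phi V where phi: "phi \<in> ring_hom (univ_ring :: upoly ring) A" and V: "!!i j. phi (V i j) = M i j"
  using matrix_lift[of A M, OF assms] by blast
 have "(mat n n (\<lambda>(i, j). V i j))\<^sup>T = mat n n (\<lambda>(i, j). V j i)" by (rule eq_matI) auto
 then have "det (mat n n (\<lambda>(i, j). V j i)) = det (mat n n (\<lambda>(i, j). V i j))"
  using det_transpose[of "mat n n (\<lambda>(i, j). V i j)" n] by simp
 then show ?thesis
  using leibniz_det_hom[OF assms(1) phi, of n V] leibniz_det_hom[OF assms(1) phi, of n "\<lambda>i j. V j i"] by (simp add: V)
qed

lemma strict_mono_sort:
 fixes rho :: "nat => nat"
 assumes "inj_on rho {..<n}"
 shows "\<exists>s p. strict_mono_on {..<n} s \<and> p permutes {0..<n} \<and> (\<forall>i<n. rho i = s (p i))"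
proof -
 define xs where "xs = sorted_list_of_set (rho ` {..<n})"
 have xs: "distinct xs" "length xs = n" "set xs = rho ` {..<n}" "sorted_wrt (<) xs"
  using assms by (auto simp: xs_def card_image)
 define s where "s = nth xs"
 have s: "bij_betw s {..<n} (rho ` {..<n})" unfolding s_def by (rule bij_betw_nth) (use xs in auto)
 define p where "p i = (if i < n then inv_into {..<n} s (rho i) else i)" for i
 have "bij_betw (\<lambda>i. inv_into {..<n} s (rho i)) {..<n} {..<n}"
  using bij_betw_trans[OF inj_on_imp_bij_betw[OF assms] bij_betw_inv_into[OF s]] by (simp add: comp_def)
 then have "bij_betw p {..<n} {..<n}" by (rule bij_betw_cong[THEN iffD1, rotated]) (simp add: p_def)
 then have "p permutes {..<n}" by (rule bij_imp_permutes) (simp add: p_def)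
 moreover have "rho i = s (p i)" if "i < n" for i
  using that bij_betw_inv_into_right[OF s, of "rho i"] by (simp add: p_def)
 moreover have "strict_mono_on {..<n} s"
  unfolding s_def by (rule strict_mono_onI) (use xs sorted_wrt_nth_less[OF xs(4)] in auto)
 ultimately show ?thesis by (auto simp: lessThan_atLeast0)
qed

text \<open>\<open>minors_vanish\<close> speaks of increasing index sequences only, while bordering
  a minor appends indices in arbitrary order. Distinct indices are a permutation of increasing ones
  and change the determinant by a sign; a repeated index makes two rows equal.\<close>

lemma minors_vanish_all_rows:
 fixes A (structure) and M :: "nat => nat => 'a" and rho :: "nat => nat"
 assumes A: "cring A" and M: "!!i j. M i j \<in> carrier A"
  and z: "!!s. strict_mono_on {..<n} s ==> leibniz_det A n (\<lambda>i j. M (s i) j) = \<zero>"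
 shows "leibniz_det A n (\<lambda>i j. M (rho i) j) = \<zero>"
proof -
 interpret cring A by fact
 obtain phi V where phi: "phi \<in> ring_hom (univ_ring :: upoly ring) A" and V: "!!i j. phi (V i j) = M i j"
  using matrix_lift[of A M, OF A M] by blast
 interpret h: ring_hom_cring univ_ring A phi using phi by (intro ring_hom_cringI) (auto intro: A univ_ring_cring)
 have det: "leibniz_det A n (\<lambda>i j. M (\<tau> i) j) = phi (det (mat n n (\<lambda>(i, j). V (\<tau> i) j)))" for \<tau>
  using leibniz_det_hom[OF A phi, of n "\<lambda>i j. V (\<tau> i) j"] by (simp add: V)
 show ?thesis
 proof (cases "inj_on rho {..<n}")
  case True
  obtain s p where sp: "strict_mono_on {..<n} s" "p permutes {0..<n}" "\<forall>i<n. rho i = s (p i)"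
   using strict_mono_sort[OF True] by blast
  let ?S = "mat n n (\<lambda>(i, j). V (s i) j)"
  have "mat n n (\<lambda>(i, j). V (rho i) j) = mat n n (\<lambda>(i, j). ?S $$ (p i, j))"
   by (rule eq_matI) (use sp(3) permutes_in_image[OF sp(2)] in auto)
  then have "det (mat n n (\<lambda>(i, j). V (rho i) j)) = signof p * det ?S"
   using det_permute_rows[of ?S n p] sp(2) by simp
  then have "leibniz_det A n (\<lambda>i j. M (rho i) j) = phi (signof p) \<otimes> phi (det ?S)"
   unfolding det using h.hom_mult[of "signof p" "det ?S"] by simp
  also have "phi (det ?S) = \<zero>" using z[OF sp(1)] det[of s] by simp
  finally show ?thesis using h.hom_closed[of "signof p"] by simp
 next
  case False
  then obtain i j where ij: "i < n" "j < n" "i \<noteq> j" "rho i = rho j" by (auto simp: inj_on_def)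
  let ?S = "mat n n (\<lambda>(i, j). V (rho i) j)"
  have "det ?S = 0"
   by (rule det_identical_rows[of _ n i j]) (use ij in \<open>auto intro!: eq_vecI\<close>)
  then show ?thesis unfolding det using h.hom_zero by simp
 qed
qed

lemma minors_vanish_all:
 fixes A (structure) and M :: "nat => nat => 'a" and rho \<gamma> :: "nat => nat"
 assumes A: "cring A" and M: "!!i j. M i j \<in> carrier A" and z: "minors_vanish A n M"
 shows "leibniz_det A n (\<lambda>i j. M (rho i) (\<gamma> j)) = \<zero>"
proof (rule minors_vanish_all_rows[OF A, where M = "\<lambda>i j. M i (\<gamma> j)"])
 fix s :: "nat => nat" assume s: "strict_mono_on {..<n} s"
 have "leibniz_det A n (\<lambda>j i. M (s i) (\<gamma> j)) = \<zero>"
 proof (rule minors_vanish_all_rows[OF A, where M = "\<lambda>j i. M (s i) j"])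
  fix t :: "nat => nat" assume t: "strict_mono_on {..<n} t"
  have "leibniz_det A n (\<lambda>j i. M (s i) (t j)) = leibniz_det A n (\<lambda>i j. M (s i) (t j))"
   by (rule leibniz_det_transpose[OF A]) (rule M)
  then show "leibniz_det A n (\<lambda>j i. M (s i) (t j)) = \<zero>" using z s t unfolding minors_vanish_def by simp
 qed (rule M)
 moreover have "leibniz_det A n (\<lambda>j i. M (s i) (\<gamma> j)) = leibniz_det A n (\<lambda>i j. M (s i) (\<gamma> j))"
  by (rule leibniz_det_transpose[OF A]) (rule M)
 ultimately show "leibniz_det A n (\<lambda>i j. M (s i) (\<gamma> j)) = \<zero>" by simp
qed (rule M)

definition alternate :: "'a ring => nat => 'a => 'a" where
 "alternate A e x = (if even e then x else \<ominus>\<^bsub>A\<^esub> x)"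

text \<open>In the bordered minors only the last row is going to vary, and the cofactors along it do
  not involve that row. This makes the expansion a linear relation with coefficients common to all
  rows.\<close>

lemma leibniz_det_last_row:
 fixes A (structure)
 assumes A: "cring A" and N: "!!i j. N i j \<in> carrier A"
 shows "leibniz_det A (Suc r) N =
  (\<Oplus>k\<in>{..r}. N r k \<otimes> alternate A (r + k) (leibniz_det A r (\<lambda>i j. N i (if j < k then j else Suc j))))"
proof -
 interpret cring A by fact
 obtain phi V where phi: "phi \<in> ring_hom (univ_ring :: upoly ring) A" and V: "!!i j. phi (V i j) = N i j"
  using matrix_lift[of A N, OF A N] by blast
 interpret h: ring_hom_cring univ_ring A phi using phi by (intro ring_hom_cringI) (auto intro: A univ_ring_cring)
 have um: "phi (- x) = \<ominus> phi x" for x using h.hom_a_inv[of x] by simp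
 let ?S = "mat (Suc r) (Suc r) (\<lambda>(i, j). V i j)"
 have cof: "phi (Determinant.cofactor ?S r k) = alternate A (r + k) (leibniz_det A r (\<lambda>i j. N i (if j < k then j else Suc j)))" if "k \<le> r" for k
 proof -
  have "mat_delete ?S r k = mat r r (\<lambda>(i, j). V i (if j < k then j else Suc j))"
   unfolding mat_delete_def by (rule eq_matI) auto
  then have "phi (det (mat_delete ?S r k)) = leibniz_det A r (\<lambda>i j. N i (if j < k then j else Suc j))"
   using leibniz_det_hom[OF A phi, of r "\<lambda>i j. V i (if j < k then j else Suc j)"] by (simp add: V)
  then show ?thesis unfolding Determinant.cofactor_def alternate_def using um by (cases "even (r + k)") auto
 qed
 have "leibniz_det A (Suc r) N = phi (det ?S)" using leibniz_det_hom[OF A phi, of "Suc r" V] by (simp add: V)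
 also have "det ?S = (\<Sum>k<Suc r. ?S $$ (r, k) * Determinant.cofactor ?S r k)"
  by (rule laplace_expansion_row[of _ "Suc r"]) auto
 also have "phi \<dots> = (\<Oplus>k\<in>{..r}. phi (?S $$ (r, k) * Determinant.cofactor ?S r k))"
  using h.hom_finsum[of "\<lambda>k. ?S $$ (r, k) * Determinant.cofactor ?S r k" "{..r}"] by (simp add: comp_def lessThan_Suc_atMost)
 also have "\<dots> = (\<Oplus>k\<in>{..r}. N r k \<otimes> alternate A (r + k) (leibniz_det A r (\<lambda>i j. N i (if j < k then j else Suc j))))"
 proof (rule finsum_cong')
  fix k assume k: "k \<in> {..r}"
  show "phi (?S $$ (r, k) * Determinant.cofactor ?S r k) = N r k \<otimes> alternate A (r + k) (leibniz_det A r (\<lambda>i j. N i (if j < k then j else Suc j)))"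
   using h.hom_mult[of "?S $$ (r, k)" "Determinant.cofactor ?S r k"] cof k by (simp add: V)
 next
  have "leibniz_det A r (\<lambda>i j. N i (if j < k then j else Suc j)) \<in> carrier A" for k
   by (rule leibniz_det_closed[OF A]) (rule N)
  then show "(\<lambda>k. N r k \<otimes> alternate A (r + k) (leibniz_det A r (\<lambda>i j. N i (if j < k then j else Suc j)))) \<in> {..r} \<rightarrow> carrier A"
   using N by (auto simp: alternate_def)
 qed simp
 finally show ?thesis .
qed

section \<open>Linear recurrences and rationality\<close>

definition row_span :: "'a ring => (nat => 'a) => nat set => (nat => 'a) set" where
 "row_span A f S = seq_span A ((\<lambda>i j. f (i + j)) ` S)"

lemma row_span_module: "cring A ==> (!!i. f i \<in> carrier A) ==> seq_module A (row_span A f S)"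
 unfolding row_span_def by (rule seq_span_module) auto

lemma row_span_coeffs:
 fixes A (structure)
 assumes A: "cring A" and f: "!!i. f i \<in> carrier A" and x: "x \<in> row_span A f {..<D}"
 shows "\<exists>c. (\<forall>l. c l \<in> carrier A) \<and> (\<forall>j. x j = (\<Oplus>l\<in>{..<D}. c l \<otimes> f (l + j)))"
proof -
 interpret cring A by fact
 show ?thesis using x unfolding row_span_def
 proof induction
  case zero
  show ?case using f by (intro exI[of _ "\<lambda>_. \<zero>"]) (auto simp: finsum_zero)
 next
  case (add x a s)
  then obtain c i where c: "\<forall>l. c l \<in> carrier A" "\<forall>j. x j = (\<Oplus>l\<in>{..<D}. c l \<otimes> f (l + j))"
   and i: "s = (\<lambda>j. f (i + j))" "i < D" by blast
  let ?c = "\<lambda>l. (if l = i then a else \<zero>) \<oplus> c l"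
  have "a \<otimes> s j \<oplus> x j = (\<Oplus>l\<in>{..<D}. ?c l \<otimes> f (l + j))" for j
  proof -
   have "(\<Oplus>l\<in>{..<D}. ?c l \<otimes> f (l + j)) = (\<Oplus>l\<in>{..<D}. (if l = i then a \<otimes> f (l + j) else \<zero>) \<oplus> c l \<otimes> f (l + j))"
    using add c f by (intro finsum_cong') (auto simp: l_distr)
   also have "\<dots> = (\<Oplus>l\<in>{..<D}. if l = i then a \<otimes> f (l + j) else \<zero>) \<oplus> (\<Oplus>l\<in>{..<D}. c l \<otimes> f (l + j))"
    using add c f by (intro finsum_addf) auto
   also have "(\<Oplus>l\<in>{..<D}. if l = i then a \<otimes> f (l + j) else \<zero>) = a \<otimes> f (i + j)"
    using add.finprod_singleton_swap[of i "{..<D}" "\<lambda>l. a \<otimes> f (l + j)"] i add f by auto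
   finally show ?thesis using c(2) i(1) by simp
  qed
  then show ?case using add c by (intro exI[of _ ?c]) auto
 qed
qed

text \<open>The denominator is the reversed characteristic polynomial 1 - c_{D-1} T - ... - c_0 T^D
  of the recurrence. The coefficient of f Q in degree D + j is the recurrence at \<open>j\<close>,
  so the numerator has degree below \<open>D\<close>.\<close>

lemma rational_of_recurrence:
 fixes A (structure)
 assumes A: "cring A" and f: "f 0 = \<one>" "!!i. f i \<in> carrier A" and c: "!!l. c l \<in> carrier A"
  and rec: "!!j. f (D + j) = (\<Oplus>l\<in>{..<D}. c l \<otimes> f (l + j))"
 shows "\<exists>Q. (\<forall>i. Q i \<in> carrier A) \<and> Q 0 = \<one> \<and> (\<forall>n>D. Q n = \<zero>) \<and> (\<forall>n\<ge>D. ps_mult A f Q n = \<zero>)"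
proof -
 interpret cring A by fact
 define Q where "Q = (\<lambda>n. if n = 0 then \<one> else if n \<le> D then \<ominus> c (D - n) else \<zero>)"
 have Qc: "Q i \<in> carrier A" for i using c by (simp add: Q_def)
 have "ps_mult A f Q n = \<zero>" if n: "n \<ge> D" for n
 proof -
  define j where "j = n - D"
  have nj: "n = D + j" using n by (simp add: j_def)
  let ?t = "\<lambda>i. f i \<otimes> Q (n - i)"
  have tc: "?t i \<in> carrier A" for i using f Qc by simp
  have "(\<lambda>l. l + j) ` {..<D} = {j..<D + j}"
  proof (rule equalityI[OF subsetI subsetI])
   fix x assume "x \<in> {j..<D + j}"
   then show "x \<in> (\<lambda>l. l + j) ` {..<D}" by (intro image_eqI[of _ _ "x - j"]) auto
  qed auto
  then have "{..n} = insert n ((\<lambda>l. l + j) ` {..<D} \<union> {..<j})" by (auto simp: nj)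
  then have "finsum A ?t {..n} = finsum A ?t (insert n ((\<lambda>l. l + j) ` {..<D} \<union> {..<j}))" by (rule arg_cong)
  also have "\<dots> = ?t n \<oplus> finsum A ?t ((\<lambda>l. l + j) ` {..<D} \<union> {..<j})"
   using f Qc by (intro finsum_insert) (auto simp: nj)
  also have "finsum A ?t ((\<lambda>l. l + j) ` {..<D} \<union> {..<j}) = finsum A ?t ((\<lambda>l. l + j) ` {..<D}) \<oplus> finsum A ?t {..<j}"
   using tc by (intro add.finprod_Un_disjoint) auto
  also have "finsum A ?t {..<j} = (\<Oplus>i\<in>{..<j}. \<zero>)"
   using f by (intro finsum_cong') (auto simp: Q_def nj)
  also have "finsum A ?t ((\<lambda>l. l + j) ` {..<D}) = (\<Oplus>l\<in>{..<D}. ?t (l + j))"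
   using tc by (intro add.finprod_reindex) (auto simp: inj_on_def)
  also have "\<dots> = (\<Oplus>l\<in>{..<D}. \<ominus> (c l \<otimes> f (l + j)))"
  proof (rule finsum_cong')
   fix l assume l: "l \<in> {..<D}"
   have "n - (l + j) = D - l" "D - (D - l) = l" "D - l \<noteq> 0" using l nj by auto
   then have "Q (n - (l + j)) = \<ominus> c l" by (simp add: Q_def)
   then show "?t (l + j) = \<ominus> (c l \<otimes> f (l + j))" using c f by (simp add: r_minus m_comm[of "f (l + j)" "c l"])
  qed (use c f in auto)
  also have "\<dots> = \<ominus> f n"
  proof -
   have "f n \<oplus> (\<Oplus>l\<in>{..<D}. \<ominus> (c l \<otimes> f (l + j))) = (\<Oplus>l\<in>{..<D}. c l \<otimes> f (l + j) \<oplus> \<ominus> (c l \<otimes> f (l + j)))"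
    unfolding nj rec using c f by (intro finsum_addf[symmetric]) auto
   also have "\<dots> = (\<Oplus>l\<in>{..<D}. \<zero>)" using c f by (intro finsum_cong') (auto simp: r_neg)
   finally have "f n \<oplus> (\<Oplus>l\<in>{..<D}. \<ominus> (c l \<otimes> f (l + j))) = \<zero>" by (simp add: finsum_zero)
   moreover have "(\<Oplus>l\<in>{..<D}. \<ominus> (c l \<otimes> f (l + j))) \<in> carrier A" using c f by (intro finsum_closed) auto
   ultimately show ?thesis using f by (metis minus_equality minus_minus a_inv_closed)
  qed
  finally show ?thesis unfolding ps_mult_def using f by (simp add: Q_def finsum_zero r_neg)
 qed
 then show ?thesis using Qc by (intro exI[of _ Q]) (auto simp: Q_def)
qed

text \<open>Over a domain, choose a nonzero minor \<open>\<delta>\<close> of maximal size, with columns \<open>\<gamma>\<close>. Bordering it shows that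
 \<open>\<delta> x\<^sub>j\<close> is determined by the \<open>\<gamma>\<close>-coordinates of \<open>x\<close> for every \<open>x\<close> in the row module, which therefore is a
 submodule of a finite free module, hence finitely generated. This gives a linear recurrence.\<close>

lemma domain_Hankel_recurrence:
 fixes A (structure)
 assumes A: "domain A" "noetherian_ring A" and f: "!!i. f i \<in> carrier A" and z: "minors_vanish A n (hankel f)"
 shows "\<exists>D c. (\<forall>l. c l \<in> carrier A) \<and> (\<forall>j. f (D + j) = (\<Oplus>l\<in>{..<D}. c l \<otimes> f (l + j)))"
proof -
 interpret domain A by fact
 have cA: "cring A" by (rule is_cring)
 define van where "van m \<longleftrightarrow> (\<forall>rho \<gamma>. leibniz_det A m (\<lambda>i j. f (rho i + \<gamma> j)) = \<zero>)" for m
 have "van n"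
  unfolding van_def
 proof (intro allI)
  fix rho \<gamma> :: "nat => nat"
  show "leibniz_det A n (\<lambda>i j. f (rho i + \<gamma> j)) = \<zero>"
   using minors_vanish_all[OF cA _ z, of rho \<gamma>] f by (simp add: hankel_def)
 qed
 define m where "m = (LEAST m. van m)"
 have m: "van m" unfolding m_def by (rule LeastI[of van, OF \<open>van n\<close>])
 \<comment> \<open>The empty determinant is 1, which is nonzero in a domain. So \<open>m\<close> is
   positive, and \<open>r\<close> is the rank of the Hankel matrix.\<close>
 have "\<not> van 0" unfolding van_def using leibniz_det_0[OF cA] by simp
 then obtain r where r: "m = Suc r" using m by (cases m) auto
 have "\<not> van r" using not_less_Least[of r van] r unfolding m_def by simp
 then obtain rho \<gamma> where \<delta>0: "leibniz_det A r (\<lambda>i j. f (rho i + \<gamma> j)) \<noteq> \<zero>" unfolding van_def by blast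
 define \<delta> where "\<delta> = leibniz_det A r (\<lambda>i j. f (rho i + \<gamma> j))"
 have \<delta>: "\<delta> \<in> carrier A" "\<delta> \<noteq> \<zero>" using \<delta>0 leibniz_det_closed[OF cA] f unfolding \<delta>_def by auto
 \<comment> \<open>Columns of the bordered minor: those of \<gamma> and then the column
   \<open>j\<close>. The elements \<open>e j k\<close> are the cofactors along the last row; they
   serve for every row, and the one at the new column is \<delta>.\<close>
 define g where "g j b = (if b < r then \<gamma> b else j)" for j b
 define e where "e j k = alternate A (r + k) (leibniz_det A r (\<lambda>a b. f (rho a + g j (if b < k then b else Suc b))))" for j k
 have ec: "e j k \<in> carrier A" for j k
  unfolding e_def alternate_def using leibniz_det_closed[OF cA, of "\<lambda>a b. f (rho a + g j (if b < k then b else Suc b))"] f by simp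
 have er: "e j r = \<delta>" for j
 proof -
  have "leibniz_det A r (\<lambda>a b. f (rho a + g j (if b < r then b else Suc b))) = \<delta>"
   unfolding \<delta>_def by (rule leibniz_det_cong[OF cA]) (auto simp: g_def f)
  then show ?thesis by (simp add: e_def alternate_def)
 qed
 have border: "(\<Oplus>k\<in>{..r}. f (i + g j k) \<otimes> e j k) = \<zero>" for i j
 proof -
  define rho' where "rho' a = (if a < r then rho a else i)" for a
  have "leibniz_det A (Suc r) (\<lambda>a b. f (rho' a + g j b)) = \<zero>" using m r unfolding van_def by blast
  then have "(\<Oplus>k\<in>{..r}. f (rho' r + g j k) \<otimes> alternate A (r + k)
   (leibniz_det A r (\<lambda>a b. f (rho' a + g j (if b < k then b else Suc b))))) = \<zero>"
   using leibniz_det_last_row[OF cA, of "\<lambda>a b. f (rho' a + g j b)" r] f by simp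
  moreover have "leibniz_det A r (\<lambda>a b. f (rho' a + g j (if b < k then b else Suc b))) =
    leibniz_det A r (\<lambda>a b. f (rho a + g j (if b < k then b else Suc b)))" for k
   by (rule leibniz_det_cong[OF cA]) (auto simp: rho'_def f)
  ultimately show ?thesis by (simp add: e_def rho'_def)
 qed
 define N where "N = row_span A f UNIV"
 have N: "seq_module A N" unfolding N_def by (rule row_span_module[OF cA f])
 note Nc = seq_moduleD(1)[OF N]
 have lin: "(\<Oplus>k\<in>{..r}. x (g j k) \<otimes> e j k) = \<zero>" if "x \<in> N" for x j
  using that unfolding N_def row_span_def
 proof induction
  case zero
  show ?case using ec by (simp add: finsum_zero)
 next
  case (add x a s)
  then obtain i where i: "s = (\<lambda>j. f (i + j))" by blast
  have xc: "x l \<in> carrier A" for l using add(1) Nc unfolding N_def row_span_def by blast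
  have "(\<Oplus>k\<in>{..r}. (a \<otimes> s (g j k) \<oplus> x (g j k)) \<otimes> e j k)
   = (\<Oplus>k\<in>{..r}. a \<otimes> (f (i + g j k) \<otimes> e j k) \<oplus> x (g j k) \<otimes> e j k)"
   using add(2) xc f ec unfolding i by (intro finsum_cong') (auto simp: l_distr m_assoc)
  also have "\<dots> = (\<Oplus>k\<in>{..r}. a \<otimes> (f (i + g j k) \<otimes> e j k)) \<oplus> (\<Oplus>k\<in>{..r}. x (g j k) \<otimes> e j k)"
   using add(2) xc f ec by (intro finsum_addf) auto
  also have "(\<Oplus>k\<in>{..r}. a \<otimes> (f (i + g j k) \<otimes> e j k)) = a \<otimes> (\<Oplus>k\<in>{..r}. f (i + g j k) \<otimes> e j k)"
   using add(2) f ec by (intro finsum_rdistr[symmetric]) auto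
  finally show ?case using add border by simp
 qed
 have det: "x = (\<lambda>_. \<zero>)" if x: "x \<in> N" "!!i. i \<in> \<gamma> ` {..<r} ==> x i = \<zero>" for x
 proof
  fix j
  have "{..r} = insert r {..<r}" by auto
  then have "\<zero> = (\<Oplus>k\<in>insert r {..<r}. x (g j k) \<otimes> e j k)" using lin[OF x(1), of j] by simp
  also have "\<dots> = x (g j r) \<otimes> e j r \<oplus> (\<Oplus>k\<in>{..<r}. x (g j k) \<otimes> e j k)"
   using Nc[OF x(1)] ec by (intro finsum_insert) auto
  also have "(\<Oplus>k\<in>{..<r}. x (g j k) \<otimes> e j k) = (\<Oplus>k\<in>{..<r}. \<zero>)"
   using x(2) ec by (intro finsum_cong') (auto simp: g_def)
  finally have "x j \<otimes> \<delta> = \<zero>" using Nc[OF x(1)] \<delta> er by (simp add: g_def finsum_zero)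
  then show "x j = \<zero>" using integral[of "x j" \<delta>] Nc[OF x(1)] \<delta> by blast
 qed
 have "\<exists>S. finite S \<and> S \<subseteq> N \<and> N \<subseteq> seq_span A S"
  by (rule noetherian_seq_module[OF cA A(2) finite_imageI[OF finite_lessThan[of r], of \<gamma>] N]) (rule det)
 then obtain S where S: "finite S" "S \<subseteq> N" "N \<subseteq> seq_span A S" by (elim exE conjE)
 have fin: "\<exists>D. x \<in> row_span A f {..<D}" if "x \<in> N" for x
  using that unfolding N_def row_span_def
 proof induction
  case zero
  show ?case by (intro exI seq_span.zero)
 next
  case (add x a s)
  then obtain D where D: "x \<in> seq_span A ((\<lambda>i j. f (i + j)) ` {..<D})" by (elim exE)
  obtain i where i: "s = (\<lambda>j. f (i + j))" using add(3) by (elim imageE)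
  let ?E = "max D (Suc i)"
  have "(\<lambda>i j. f (i + j)) ` {..<D} \<subseteq> (\<lambda>i j. f (i + j)) ` {..<?E}" by auto
  then have "x \<in> seq_span A ((\<lambda>i j. f (i + j)) ` {..<?E})" by (rule subsetD[OF seq_span_mono D])
  moreover have "s \<in> (\<lambda>i j. f (i + j)) ` {..<?E}" unfolding i by (rule imageI) simp
  ultimately show ?case using add(2) by (intro exI[of _ ?E] seq_span.add)
 qed
 have "\<exists>D. S \<subseteq> row_span A f {..<D}"
  using S(1,2)
 proof (induction S rule: finite_induct)
  case (insert s S)
  then obtain D where D: "S \<subseteq> row_span A f {..<D}" by auto
  obtain E where E: "s \<in> row_span A f {..<E}" using fin[of s] insert(4) by auto
  have "row_span A f {..<D} \<subseteq> row_span A f {..<max D E}" "row_span A f {..<E} \<subseteq> row_span A f {..<max D E}"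
   unfolding row_span_def by (rule seq_span_mono[OF image_mono]; simp)+
  then have "insert s S \<subseteq> row_span A f {..<max D E}" using D E by (meson insert_subset subset_trans subsetD)
  then show ?case by (rule exI)
 qed simp
 then obtain D where D: "S \<subseteq> row_span A f {..<D}" by (elim exE)
 \<comment> \<open>Finitely many generators of the row module involve finitely many rows, so the
   first \<open>D\<close> rows span everything. The row with index \<open>D\<close> is the first one
   outside this list, and writing it as a combination is the recurrence.\<close>
 have "(\<lambda>j. f (D + j)) \<in> N" unfolding N_def row_span_def by (rule seq_span_self[OF cA]) (use f in auto)
 then have "(\<lambda>j. f (D + j)) \<in> row_span A f {..<D}"
  by (rule subsetD[OF subset_trans[OF S(3) seq_span_subset[OF row_span_module[OF cA f] D]]])
 from row_span_coeffs[OF cA f this] show ?thesis by (rule exI)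
qed

lemma finprod_zero_subset:
 fixes A (structure)
 assumes A: "cring A" and S: "finite S" "T \<subseteq> S" and f: "!!i. i \<in> S ==> f i \<in> carrier A" and z: "finprod A f T = \<zero>"
 shows "finprod A f S = \<zero>"
proof -
 interpret cring A by fact
 have "finprod A f S = finprod A f (T \<union> (S - T))" using S(2) by (simp add: Un_absorb1)
 also have "\<dots> = finprod A f T \<otimes> finprod A f (S - T)"
  using S f by (intro finprod_Un_disjoint) (auto intro: finite_subset)
 also have "\<dots> = \<zero>" unfolding z using f by (intro l_null finprod_closed) auto
 finally show ?thesis .
qed

lemma lprod_finprod:
 assumes A: "cring A" and "distinct xs" "!!i. i \<in> set xs ==> f i \<in> carrier A"
 shows "lprod A (map f xs) = finprod A f (set xs)"
proof -
 interpret cring A by fact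
 show ?thesis using assms(2,3) by (induction xs) (auto simp: finprod_insert Pi_def)
qed

text \<open>If \<open>M = C B + E\<close> with \<open>D\<close> inner summands, then \<open>det M\<close> is the determinant of the block matrix with
 rows \<open>(1, -B)\<close> and \<open>(C, E)\<close>. In each term of its Leibniz expansion, all but at most \<open>D\<close> of the lower rows
 contribute an entry of \<open>E\<close>.\<close>

lemma leibniz_det_nilpotent:
 fixes A (structure)
 assumes A: "cring A" and C: "!!i l. C i l \<in> carrier A" and B: "!!l j. B l j \<in> carrier A" and E: "!!i j. E i j \<in> carrier A"
  and nil: "!!xs. length xs = k ==> set xs \<subseteq> {E i j |i j. True} ==> lprod A xs = \<zero>"
 shows "leibniz_det A (D + k) (\<lambda>i j. (\<Oplus>l\<in>{..<D}. C i l \<otimes> B l j) \<oplus> E i j) = \<zero>"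
proof -
 interpret cring A by fact
 define n where "n = D + k"
 \<comment> \<open>One sequence of variables has to serve three matrices; the first component of the
   decoded index tells which matrix an entry belongs to.\<close>
 define T where "T a = (case a of (t, i, j) => if t = 0 then C i j else if t = (1::nat) then B i j else E i j)" for a
 have "T a \<in> carrier A" for a using C B E by (cases a) (auto simp: T_def)
 then obtain phi where phi: "phi \<in> ring_hom (univ_ring :: upoly ring) A"
  and Var: "\<forall>a. phi (Var a) = T (map_prod id prod_decode (prod_decode a))"
  using upoly_lift[of A "\<lambda>a. T (map_prod id prod_decode (prod_decode a))"] A by blast
 interpret h: ring_hom_cring univ_ring A phi using phi by (intro ring_hom_cringI) (auto intro: A univ_ring_cring)
 define V where "V t i j = Var (prod_encode (t, prod_encode (i, j)))" for t i j
 have V: "phi (V 0 i j) = C i j" "phi (V 1 i j) = B i j" "phi (V 2 i j) = E i j" for i j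
  using Var by (auto simp: V_def T_def)
 let ?M = "\<lambda>i j. (\<Sum>l<D. V 0 i l * V 1 l j) + V 2 i j"
 have M: "phi (?M i j) = (\<Oplus>l\<in>{..<D}. C i l \<otimes> B l j) \<oplus> E i j" for i j
 proof -
  have "phi (V 0 i l * V 1 l j) = C i l \<otimes> B l j" for l
   using h.hom_mult[of "V 0 i l" "V 1 l j"] V by simp
  then have "phi (\<Sum>l<D. V 0 i l * V 1 l j) = (\<Oplus>l\<in>{..<D}. C i l \<otimes> B l j)"
   using h.hom_finsum[of "\<lambda>l. V 0 i l * V 1 l j" "{..<D}"] by (simp add: comp_def)
  then show ?thesis using h.hom_add[of "\<Sum>l<D. V 0 i l * V 1 l j" "V 2 i j"] V by simp
 qed
 let ?C = "mat n D (\<lambda>(i, l). V 0 i l)" and ?B = "mat D n (\<lambda>(l, j). - V 1 l j)" and ?E = "mat n n (\<lambda>(i, j). V 2 i j)"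
 let ?N = "mat n n (\<lambda>(i, j). ?M i j)"
 define Big where "Big = four_block_mat (1\<^sub>m D) ?B ?C ?E"
 have BigN: "det Big = det ?N"
 proof -
  \<comment> \<open>\<open>?B\<close> carries a minus sign, so \<open>?N\<close> is the Schur
    complement of the identity block in \<open>Big\<close>. The block matrix then factors into two
    block triangular ones, and its determinant is that of \<open>?N\<close>.\<close>
  have "?C * ?B + ?N = ?E"
   by (rule eq_matI) (auto simp: scalar_prod_def lessThan_atLeast0 sum_negf)
  then have "Big = four_block_mat (1\<^sub>m D) (0\<^sub>m D n) ?C (1\<^sub>m n) * four_block_mat (1\<^sub>m D) ?B (0\<^sub>m n D) ?N"
   unfolding Big_def
   by (subst mult_four_block_mat[of _ D D _ n _ n _ _ D _ n]) auto
  then have "det Big = det (four_block_mat (1\<^sub>m D) (0\<^sub>m D n) ?C (1\<^sub>m n)) * det (four_block_mat (1\<^sub>m D) ?B (0\<^sub>m n D) ?N)"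
   using det_mult[of "four_block_mat (1\<^sub>m D) (0\<^sub>m D n) ?C (1\<^sub>m n)" "D + n" "four_block_mat (1\<^sub>m D) ?B (0\<^sub>m n D) ?N"] by simp
  then show ?thesis
   using det_four_block_mat_upper_right_zero[of "1\<^sub>m D" D "0\<^sub>m D n" n ?C "1\<^sub>m n"]
    det_four_block_mat_lower_left_zero[of "1\<^sub>m D" D ?B n "0\<^sub>m n D" ?N] by simp
 qed
 have Bigmat: "mat (D + n) (D + n) (\<lambda>(i, j). Big $$ (i, j)) = Big"
  by (rule eq_matI) (auto simp: Big_def)
 have "(\<Otimes>i\<in>{..<D + n}. phi (Big $$ (i, p i))) = \<zero>" if p: "p permutes {..<D + n}" for p
 proof -
  \<comment> \<open>The lower rows whose entry lies in the lower right block. A permutation sends at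
    most \<open>D\<close> of the \<open>n\<close> lower rows to the first \<open>D\<close> columns,
    so at least n - D = k remain; this is why the size D + k is chosen.\<close>
  define R where "R = {i \<in> {D..<D + n}. p i \<ge> D}"
  have "card {i \<in> {D..<D + n}. p i < D} \<le> card {..<D}"
   by (rule card_inj_on_le[of p]) (auto simp: permutes_inj_on[OF p])
  moreover have "card {D..<D + n} = card R + card {i \<in> {D..<D + n}. p i < D}"
  proof -
   have "{D..<D + n} = R \<union> {i \<in> {D..<D + n}. p i < D}" by (auto simp: R_def)
   moreover have "card (R \<union> {i \<in> {D..<D + n}. p i < D}) = card R + card {i \<in> {D..<D + n}. p i < D}"
    by (rule card_Un_disjoint) (auto simp: R_def)
   ultimately show ?thesis by (simp only:)
  qed
  ultimately have "card R \<ge> k" by (simp add: n_def)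
  then obtain K where K: "K \<subseteq> R" "card K = k" "finite K" using obtain_subset_with_card_n by blast
  obtain xs where xs: "set xs = K" "distinct xs" using finite_distinct_list[OF K(3)] by blast
  have ent: "phi (Big $$ (i, p i)) = E (i - D) (p i - D)" if "i \<in> K" for i
  proof -
   have "i \<in> R" using that K(1) by blast
   then have "i \<ge> D" "i < D + n" "p i \<ge> D" "p i < D + n"
    using permutes_in_image[OF p, of i] by (auto simp: R_def)
   then have "Big $$ (i, p i) = V 2 (i - D) (p i - D)" unfolding Big_def by auto
   then show ?thesis using V by simp
  qed
  have "lprod A (map (\<lambda>i. phi (Big $$ (i, p i))) xs) = \<zero>"
   by (rule nil) (use xs K(2) ent distinct_card[OF xs(2)] in auto)
  then have K0: "finprod A (\<lambda>i. phi (Big $$ (i, p i))) K = \<zero>"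
   using lprod_finprod[OF A xs(2), of "\<lambda>i. phi (Big $$ (i, p i))"] xs(1) h.hom_closed by simp
  have "K \<subseteq> {..<D + n}" using K(1) by (auto simp: R_def)
  then show ?thesis by (rule finprod_zero_subset[OF A finite_lessThan _ _ K0]) (simp add: h.hom_closed)
 qed
 then have "leibniz_det A (D + n) (\<lambda>i j. phi (Big $$ (i, j))) = (\<Oplus>p\<in>{p. p permutes {..<D + n}}. \<zero>)"
  unfolding leibniz_det_def by (intro finsum_cong') (simp_all add: add.int_pow_one)
 then have "leibniz_det A (D + n) (\<lambda>i j. phi (Big $$ (i, j))) = \<zero>" by (simp add: finsum_zero)
 then have "phi (det Big) = \<zero>"
  using leibniz_det_hom[OF A phi, of "D + n" "\<lambda>i j. Big $$ (i, j)"] unfolding Bigmat by simp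
 then have "phi (det ?N) = \<zero>" using BigN by simp
 then show ?thesis using leibniz_det_hom[OF A phi, of n ?M] unfolding M n_def by simp
qed

section \<open>Rational Witt vectors\<close>

lemma Witt_simps [simp]:
 "carrier (Witt A) = witt_carrier A" "monoid.mult (Witt A) = witt_mult A" "\<one>\<^bsub>Witt A\<^esub> = teich A \<one>\<^bsub>A\<^esub>"
 "\<zero>\<^bsub>Witt A\<^esub> = (\<lambda>n. if n = 0 then \<one>\<^bsub>A\<^esub> else \<zero>\<^bsub>A\<^esub>)" "ring.add (Witt A) = ps_mult A"
 by (simp_all add: Witt_def witt_ring_with_def)

lemma Witt_cring: "cring A ==> cring (Witt A)"
 using is_witt_mult_witt_mult unfolding is_witt_mult_def Witt_def by blast

lemma witt_mult_teich: "cring A ==> a \<in> carrier A ==> b \<in> carrier A ==>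
  witt_mult A (teich A a) (teich A b) = teich A (a \<otimes>\<^bsub>A\<^esub> b)"
 using is_witt_mult_witt_mult unfolding is_witt_mult_def by blast

lemma witt_mult_hom:
 fixes A B :: "'a ring"
 shows "cring A ==> cring B ==> phi \<in> ring_hom A B ==> f \<in> witt_carrier A ==> g \<in> witt_carrier A ==>
  phi \<circ> witt_mult A f g = witt_mult B (phi \<circ> f) (phi \<circ> g)"
 using is_witt_mult_witt_mult unfolding is_witt_mult_def by blast

lemma witt_carrierD: "f \<in> witt_carrier A ==> f n \<in> carrier A" "f \<in> witt_carrier A ==> f 0 = \<one>\<^bsub>A\<^esub>"
 by (auto simp: witt_carrier_def)

lemma Witt_hom:
 fixes A B :: "'a ring"
 assumes "cring A" "cring B" "phi \<in> ring_hom A B"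
 shows "(\<lambda>f. phi \<circ> f) \<in> ring_hom (Witt A) (Witt B)"
proof -
 interpret A: cring A by fact
 show ?thesis
 proof (rule ring_hom_memI)
  fix f assume "f \<in> carrier (Witt A)"
  then show "phi \<circ> f \<in> carrier (Witt B)" using witt_carrier_hom[OF assms(3)] by simp
 next
  fix f g assume fg: "f \<in> carrier (Witt A)" "g \<in> carrier (Witt A)"
  then show "phi \<circ> (f \<otimes>\<^bsub>Witt A\<^esub> g) = (phi \<circ> f) \<otimes>\<^bsub>Witt B\<^esub> (phi \<circ> g)" using witt_mult_hom[OF assms] by simp
  show "phi \<circ> (f \<oplus>\<^bsub>Witt A\<^esub> g) = (phi \<circ> f) \<oplus>\<^bsub>Witt B\<^esub> (phi \<circ> g)"
   using fg ps_mult_hom[OF assms, of f g] by (simp add: witt_carrierD)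
 next
  show "phi \<circ> \<one>\<^bsub>Witt A\<^esub> = \<one>\<^bsub>Witt B\<^esub>" using teich_hom[OF assms A.one_closed] ring_hom_one[OF assms(3)] by simp
 qed
qed

section \<open>Polynomials and products of linear factors\<close>

definition witt_polys :: "'a ring => (nat => 'a) set" where
 "witt_polys A = {f \<in> witt_carrier A. \<exists>N. \<forall>n>N. f n = \<zero>\<^bsub>A\<^esub>}"

lemma witt_polys_carrier: "f \<in> witt_polys A ==> f \<in> witt_carrier A"
 by (simp add: witt_polys_def)

lemma witt_polys_up: "f \<in> witt_polys A \<longleftrightarrow> f \<in> up A \<and> f 0 = \<one>\<^bsub>A\<^esub>"
proof
 assume "f \<in> witt_polys A"
 then show "f \<in> up A \<and> f 0 = \<one>\<^bsub>A\<^esub>" by (auto simp: witt_polys_def witt_carrier_def intro: bounded_up)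
next
 assume "f \<in> up A \<and> f 0 = \<one>\<^bsub>A\<^esub>"
 then show "f \<in> witt_polys A" using up_bounded[of f A] by (auto simp: witt_polys_def witt_carrier_def up_def)
qed

lemma witt_polys_add:
 fixes A (structure)
 assumes A: "cring A" and f: "f \<in> witt_polys A" and g: "g \<in> witt_polys A"
 shows "ps_mult A f g \<in> witt_polys A"
proof -
 interpret cring A by fact
 obtain M N where M: "\<forall>n>M. f n = \<zero>" and N: "\<forall>n>N. g n = \<zero>"
  using f g by (auto simp: witt_polys_def)
 have fg: "f \<in> witt_carrier A" "g \<in> witt_carrier A" using f g by (auto simp: witt_polys_def)
 have "ps_mult A f g n = \<zero>" if "n > M + N" for n
 proof -
  have "f i \<otimes> g (n - i) = \<zero>" if "i \<le> n" for i
  proof (cases "i > M")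
   case True
   then show ?thesis using M witt_carrierD[OF fg(2)] by simp
  next
   case False
   then have "n - i > N" using \<open>n > M + N\<close> by simp
   then show ?thesis using N witt_carrierD[OF fg(1)] by simp
  qed
  then have "ps_mult A f g n = (\<Oplus>i\<in>{..n}. \<zero>)" unfolding ps_mult_def by (intro finsum_cong') auto
  then show ?thesis by (simp add: finsum_zero)
 qed
 then show ?thesis using ps_mult_closed[OF A fg] unfolding witt_polys_def by blast
qed

lemma witt_polys_zero: "cring A ==> \<zero>\<^bsub>Witt A\<^esub> \<in> witt_polys A"
proof -
 assume "cring A"
 then interpret cring A .
 show ?thesis by (auto simp: witt_polys_def witt_carrier_def)
qed

lemma witt_polys_teich:
 assumes "cring A" "a \<in> carrier A"
 shows "teich A a \<in> witt_polys A"
proof -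
 have "\<forall>n>1. teich A a n = \<zero>\<^bsub>A\<^esub>" by (simp add: teich_def)
 then show ?thesis using teich_closed[OF assms] unfolding witt_polys_def by blast
qed

lemma witt_polys_hom:
 assumes "cring A" "cring B" "phi \<in> ring_hom A B" "f \<in> witt_polys A"
 shows "phi \<circ> f \<in> witt_polys B"
 using assms(4) witt_carrier_hom[OF assms(3)] ring_hom_zero[OF assms(3)] assms(1,2)
 by (fastforce simp: witt_polys_def cring_def)

definition teich_prod :: "'a ring => 'a list => nat => 'a" where
 "teich_prod A xs = foldr (\<lambda>x f. ps_mult A (teich A x) f) xs \<zero>\<^bsub>Witt A\<^esub>"

lemma teich_prod_simps: "teich_prod A [] = \<zero>\<^bsub>Witt A\<^esub>" "teich_prod A (x # xs) = ps_mult A (teich A x) (teich_prod A xs)"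
 by (simp_all add: teich_prod_def)

lemma teich_prod_polys: "cring A ==> set xs \<subseteq> carrier A ==> teich_prod A xs \<in> witt_polys A"
 by (induction xs) (simp_all only: teich_prod_simps witt_polys_zero, simp add: witt_polys_add witt_polys_teich)

lemma teich_prod_closed: "cring A ==> set xs \<subseteq> carrier A ==> teich_prod A xs \<in> witt_carrier A"
 by (rule witt_polys_carrier[OF teich_prod_polys])

lemma teich_prod_append:
 assumes A: "cring A" and xs: "set xs \<subseteq> carrier A" and ys: "set ys \<subseteq> carrier A"
 shows "teich_prod A (xs @ ys) = ps_mult A (teich_prod A xs) (teich_prod A ys)"
 using xs
proof (induction xs)
 case Nil
 show ?case using witt_ring_laws(3)[OF A] teich_prod_closed[OF A ys] teich_closed[OF A] by (simp add: teich_prod_simps)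
next
 case (Cons x xs)
 then show ?case
  using witt_ring_laws(2)[OF A teich_closed[OF A] teich_prod_closed[OF A] teich_prod_closed[OF A ys]]
  by (simp add: teich_prod_simps)
qed

lemma teich_prod_hom:
 assumes A: "cring A" and B: "cring B" and phi: "phi \<in> ring_hom A B" and xs: "set xs \<subseteq> carrier A"
 shows "phi \<circ> teich_prod A xs = teich_prod B (map phi xs)"
 using xs
proof (induction xs)
 case Nil
 interpret h: ring_hom_cring A B phi using phi by (intro ring_hom_cringI) (auto intro: A B)
 show ?case by (auto simp: teich_prod_simps)
next
 case (Cons x xs)
 then have "teich A x \<in> witt_carrier A" "teich_prod A xs \<in> witt_carrier A"
  using teich_closed[OF A] teich_prod_closed[OF A] by auto
 then have "phi \<circ> ps_mult A (teich A x) (teich_prod A xs) = ps_mult B (phi \<circ> teich A x) (phi \<circ> teich_prod A xs)"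
  by (intro ps_mult_hom[OF A B phi]) (auto intro: witt_carrierD)
 moreover have "phi \<circ> teich A x = teich B (phi x)" by (rule teich_hom[OF A B phi]) (use Cons(2) in simp)
 moreover have "phi \<circ> teich_prod A xs = teich_prod B (map phi xs)" by (rule Cons(1)) (use Cons(2) in simp)
 ultimately show ?case by (simp only: teich_prod_simps list.map)
qed

lemma teich_prod_witt_mult_aux:
 assumes A: "cring A" and x: "x \<in> carrier A" and ys: "set ys \<subseteq> carrier A"
 shows "witt_mult A (teich A x) (teich_prod A ys) = teich_prod A (map (\<lambda>y. x \<otimes>\<^bsub>A\<^esub> y) ys)"
proof -
 interpret W: cring "Witt A" by (rule Witt_cring[OF A])
 show ?thesis using ys
 proof (induction ys)
  case Nil
  show ?case using W.r_null[of "teich A x"] teich_closed[OF A x] by (simp add: teich_prod_simps)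
 next
  case (Cons y ys)
  then have "teich A x \<in> witt_carrier A" "teich A y \<in> witt_carrier A" "teich_prod A ys \<in> witt_carrier A"
   using teich_closed[OF A] x teich_prod_closed[OF A] by auto
  then show ?case using W.r_distr[of "teich A y" "teich_prod A ys" "teich A x"] Cons witt_mult_teich[OF A x] by (simp add: teich_prod_simps)
 qed
qed

text \<open>The sum of the Witt ring is the product of series, so distributivity reduces the Witt
  product of two products of linear factors to the pairs 1 - x T, 1 - y T, where the axiom gives 1 -
  x y T.\<close>

lemma teich_prod_witt_mult:
 fixes A (structure)
 assumes A: "cring A" and xs: "set xs \<subseteq> carrier A" and ys: "set ys \<subseteq> carrier A"
 shows "\<exists>zs. set zs \<subseteq> carrier A \<and> witt_mult A (teich_prod A xs) (teich_prod A ys) = teich_prod A zs"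
proof -
 interpret A: cring A by fact
 interpret W: cring "Witt A" by (rule Witt_cring[OF A])
 have tys: "teich_prod A ys \<in> witt_carrier A" by (rule teich_prod_closed[OF A ys])
 show ?thesis using xs
 proof (induction xs)
  case Nil
  show ?case using W.l_null[of "teich_prod A ys"] tys by (intro exI[of _ "[]"]) (simp add: teich_prod_simps)
 next
  case (Cons x xs)
  then obtain zs where zs: "set zs \<subseteq> carrier A" "witt_mult A (teich_prod A xs) (teich_prod A ys) = teich_prod A zs"
   by auto
  have x: "x \<in> carrier A" using Cons by simp
  have "teich A x \<in> witt_carrier A" "teich_prod A xs \<in> witt_carrier A"
   using teich_closed[OF A] Cons(2) teich_prod_closed[OF A] by auto
  then have "witt_mult A (teich_prod A (x # xs)) (teich_prod A ys) =
    ps_mult A (teich_prod A (map (\<lambda>y. x \<otimes> y) ys)) (teich_prod A zs)"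
   using W.l_distr[of "teich A x" "teich_prod A xs" "teich_prod A ys"] tys zs(2) teich_prod_witt_mult_aux[OF A x ys]
   by (simp add: teich_prod_simps)
  also have "\<dots> = teich_prod A (map (\<lambda>y. x \<otimes> y) ys @ zs)"
   by (rule teich_prod_append[OF A _ zs(1), symmetric]) (use x ys in auto)
  finally have "witt_mult A (teich_prod A (x # xs)) (teich_prod A ys) = teich_prod A (map (\<lambda>y. x \<otimes> y) ys @ zs)" .
  then show ?case using zs(1) ys x by (intro exI[of _ "map (\<lambda>y. x \<otimes> y) ys @ zs"]) auto
 qed
qed

lemma ps_mult_teich:
 fixes A (structure)
 assumes A: "cring A" and x: "x \<in> carrier A" and f: "!!n. f n \<in> carrier A"
 shows "ps_mult A (teich A x) f 0 = f 0" "ps_mult A (teich A x) f (Suc m) = f (Suc m) \<ominus> x \<otimes> f m"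
proof -
 interpret cring A by fact
 have t: "teich A x n \<in> carrier A" for n using x by (simp add: teich_def)
 show "ps_mult A (teich A x) f 0 = f 0" using f by (simp add: ps_mult_def teich_def)
 let ?t = "\<lambda>i. teich A x i \<otimes> f (Suc m - i)"
 have "ps_mult A (teich A x) f (Suc m) = (\<Oplus>i\<in>{0,1}. ?t i)"
  unfolding ps_mult_def by (rule add.finprod_mono_neutral_cong_right) (use t f in \<open>auto simp: teich_def\<close>)
 also have "\<dots> = f (Suc m) \<ominus> x \<otimes> f m" using x f by (simp add: teich_def a_minus_def l_minus)
 finally show "ps_mult A (teich A x) f (Suc m) = f (Suc m) \<ominus> x \<otimes> f m" .
qed

text \<open>A root \<open>x\<close> of the reversed polynomial splits off the factor \<open>1 - x T\<close>; the cofactor is the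
 truncation of the geometric series \<open>p / (1 - x T)\<close>.\<close>

lemma split_off_root:
 fixes A (structure)
 assumes A: "cring A" and p: "p \<in> witt_carrier A" "\<forall>n>Suc d. p n = \<zero>" and x: "x \<in> carrier A"
  and root: "(\<Oplus>i\<in>{..Suc d}. p i \<otimes> x [^] (Suc d - i)) = \<zero>"
 shows "\<exists>q \<in> witt_carrier A. (\<forall>n>d. q n = \<zero>) \<and> p = ps_mult A (teich A x) q"
proof -
 interpret cring A by fact
 note pc = witt_carrierD(1)[OF p(1)]
 \<comment> \<open>Horner's scheme; \<open>S k\<close> is the coefficient of degree \<open>k\<close>
   of p / (1 - x T). The hypothesis \<open>root\<close> says that the value at \<open>Suc d\<close>
   is zero, so cutting off after \<open>d\<close> loses nothing.\<close>
 define S where "S k = (\<Oplus>i\<in>{..k}. p i \<otimes> x [^] (k - i))" for k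
 have Sc: "S k \<in> carrier A" for k using pc x by (simp add: S_def)
 have SS: "S (Suc k) = p (Suc k) \<oplus> x \<otimes> S k" for k
 proof -
  have e: "{..Suc k} = insert (Suc k) {..k}" by auto
  have "(\<Oplus>i\<in>{..k}. p i \<otimes> x [^] (Suc k - i)) = (\<Oplus>i\<in>{..k}. x \<otimes> (p i \<otimes> x [^] (k - i)))"
   by (rule finsum_cong') (use pc x in \<open>auto simp: Suc_diff_le m_ac\<close>)
  then show ?thesis unfolding S_def e using pc x by (simp add: finsum_rdistr)
 qed
 define q where "q = (\<lambda>k. if k \<le> d then S k else \<zero>)"
 have qc: "q k \<in> carrier A" for k using Sc by (simp add: q_def)
 have "q 0 = \<one>" using witt_carrierD(2)[OF p(1)] by (simp add: q_def S_def)
 then have q: "q \<in> witt_carrier A" using qc by (simp add: witt_carrier_def)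
 have cancel: "a \<oplus> b \<ominus> b = a" if "a \<in> carrier A" "b \<in> carrier A" for a b
  using that by (simp add: a_minus_def a_assoc r_neg)
 have "p n = ps_mult A (teich A x) q n" for n
 proof (cases n)
  case 0
  then show ?thesis using ps_mult_teich(1)[OF A x qc] \<open>q 0 = \<one>\<close> witt_carrierD(2)[OF p(1)] by simp
 next
  case (Suc k)
  have "p (Suc k) = q (Suc k) \<ominus> x \<otimes> q k"
  proof -
   consider "k < d" | "k = d" | "k > d" by linarith
   then show ?thesis
   proof cases
    case 1
    then show ?thesis using cancel pc x Sc by (simp add: q_def SS)
   next
    case 2
    have "S (Suc d) = \<zero>" using root by (simp add: S_def)
    then have "p (Suc d) = \<zero> \<ominus> x \<otimes> S d" using SS[of d] cancel[of "p (Suc d)" "x \<otimes> S d"] pc x Sc by simp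
    then show ?thesis using 2 by (simp add: q_def)
   next
    case 3
    then show ?thesis using p(2) x by (simp add: q_def a_minus_def)
   qed
  qed
  then show ?thesis using Suc ps_mult_teich(2)[OF A x qc] by simp
 qed
 then show ?thesis using q by (intro bexI[OF _ q]) (auto simp: q_def)
qed

lemma adjoin_root_split:
 fixes A :: "'a ring"
 assumes inf: "infinite (UNIV :: 'a set)" and A: "cring A" and p: "p \<in> witt_carrier A" "\<forall>n>Suc d. p n = \<zero>\<^bsub>A\<^esub>"
 shows "\<exists>B phi x q. cring B \<and> phi \<in> homs A B \<and> x \<in> carrier B \<and> q \<in> witt_carrier B \<and> (\<forall>n>d. q n = \<zero>\<^bsub>B\<^esub>) \<and>
  phi \<circ> p = ps_mult B (teich B x) q \<and>
  (\<forall>b \<in> carrier B. \<exists>c. (\<forall>i. c i \<in> carrier A) \<and> b = (\<Oplus>\<^bsub>B\<^esub>i\<in>{..<Suc d}. phi (c i) \<otimes>\<^bsub>B\<^esub> x [^]\<^bsub>B\<^esub> i)) \<and>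
  (\<forall>I a c. ideal I A --> a \<in> carrier A --> (\<forall>i. c i \<in> I) -->
   phi a = (\<Oplus>\<^bsub>B\<^esub>i\<in>{..<Suc d}. phi (c i) \<otimes>\<^bsub>B\<^esub> x [^]\<^bsub>B\<^esub> i) --> a \<in> I)"
proof -
 obtain B phi x where B: "cring B" and phi: "phi \<in> homs A B" and x: "x \<in> carrier B"
  and root: "(\<Oplus>\<^bsub>B\<^esub>i\<in>{..Suc d}. phi (p i) \<otimes>\<^bsub>B\<^esub> x [^]\<^bsub>B\<^esub> (Suc d - i)) = \<zero>\<^bsub>B\<^esub>"
  and rest: "\<forall>b \<in> carrier B. \<exists>c. (\<forall>i. c i \<in> carrier A) \<and> b = (\<Oplus>\<^bsub>B\<^esub>i\<in>{..<Suc d}. phi (c i) \<otimes>\<^bsub>B\<^esub> x [^]\<^bsub>B\<^esub> i)"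
  "\<forall>I a c. ideal I A --> a \<in> carrier A --> (\<forall>i. c i \<in> I) -->
   phi a = (\<Oplus>\<^bsub>B\<^esub>i\<in>{..<Suc d}. phi (c i) \<otimes>\<^bsub>B\<^esub> x [^]\<^bsub>B\<^esub> i) --> a \<in> I"
  by atomize_elim (rule adjoin_root[of A p "Suc d", OF inf A witt_carrierD(1)[OF p(1)] witt_carrierD(2)[OF p(1)]], use p(2) in auto)
 have phih: "phi \<in> ring_hom A B" using phi by (simp add: homs_def)
 interpret h: ring_hom_cring A B phi using phih by (intro ring_hom_cringI) (auto intro: A B)
 have "\<exists>q \<in> witt_carrier B. (\<forall>n>d. q n = \<zero>\<^bsub>B\<^esub>) \<and> phi \<circ> p = ps_mult B (teich B x) q"
  by (rule split_off_root[OF B witt_carrier_hom[OF phih p(1)] _ x]) (use p(2) root in auto)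
 then show ?thesis using B phi x rest by blast
qed

text \<open>Roots are adjoined one after the other, each time for the cofactor of lower degree. The
  resulting ring is a place for computations whose results are read back through the injection; it
  does not have to be an object of the site.\<close>

lemma splitting_extension:
 fixes A :: "'a ring"
 assumes inf: "infinite (UNIV :: 'a set)" and A: "cring A" and p: "p \<in> witt_carrier A" "\<forall>n>d. p n = \<zero>\<^bsub>A\<^esub>"
 shows "\<exists>(B :: 'a ring) phi xs. cring B \<and> phi \<in> ring_hom A B \<and> inj_on phi (carrier A) \<and> set xs \<subseteq> carrier B \<and> phi \<circ> p = teich_prod B xs"
 using A p
proof (induction d arbitrary: A p)
 case 0
 have "(\<lambda>x. x) \<circ> p = teich_prod A []" using 0 witt_carrierD(2)[OF 0(2)] by (auto simp: teich_prod_simps fun_eq_iff)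
 moreover have "(\<lambda>x. x) \<in> ring_hom A A" by (rule ring_hom_memI) auto
 moreover have "inj_on (\<lambda>x. x) (carrier A)" by simp
 ultimately show ?case using 0(1) by (metis empty_set empty_subsetI)
next
 case (Suc d)
 interpret A: cring A by (rule Suc(2))
 obtain B phi x q where B: "cring B" and phi: "phi \<in> homs A B" and x: "x \<in> carrier B" and q: "q \<in> witt_carrier B" "\<forall>n>d. q n = \<zero>\<^bsub>B\<^esub>"
  and pq: "phi \<circ> p = ps_mult B (teich B x) q"
  and gen: "\<forall>b \<in> carrier B. \<exists>c. (\<forall>i. c i \<in> carrier A) \<and> b = (\<Oplus>\<^bsub>B\<^esub>i\<in>{..<Suc d}. phi (c i) \<otimes>\<^bsub>B\<^esub> x [^]\<^bsub>B\<^esub> i)"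
  and basis: "\<forall>I a c. ideal I A --> a \<in> carrier A --> (\<forall>i. c i \<in> I) -->
   phi a = (\<Oplus>\<^bsub>B\<^esub>i\<in>{..<Suc d}. phi (c i) \<otimes>\<^bsub>B\<^esub> x [^]\<^bsub>B\<^esub> i) --> a \<in> I"
  by atomize_elim (rule adjoin_root_split[OF inf Suc(2,3,4)])
 have phih: "phi \<in> ring_hom A B" using phi by (simp add: homs_def)
 interpret B: cring B by fact
 interpret h: ring_hom_cring A B phi using phih by (intro ring_hom_cringI) (auto intro: Suc(2) B)
 \<comment> \<open>The basis property of the powers of \<open>x\<close>, applied to the zero ideal,
   says that an element of \<open>A\<close> which becomes zero in \<open>B\<close> is zero.\<close>
 have inj: "inj_on phi (carrier A)"
 proof (rule inj_onI)
  fix a b assume ab: "a \<in> carrier A" "b \<in> carrier A" "phi a = phi b"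
  have "phi (a \<ominus>\<^bsub>A\<^esub> b) = \<zero>\<^bsub>B\<^esub>" using ab by (simp add: a_minus_def B.r_neg)
  moreover have "(\<Oplus>\<^bsub>B\<^esub>i\<in>{..<Suc d}. phi \<zero>\<^bsub>A\<^esub> \<otimes>\<^bsub>B\<^esub> x [^]\<^bsub>B\<^esub> i) = (\<Oplus>\<^bsub>B\<^esub>i\<in>{..<Suc d}. \<zero>\<^bsub>B\<^esub>)"
   by (rule B.finsum_cong') (use x in auto)
  ultimately have "phi (a \<ominus>\<^bsub>A\<^esub> b) = (\<Oplus>\<^bsub>B\<^esub>i\<in>{..<Suc d}. phi ((\<lambda>_. \<zero>\<^bsub>A\<^esub>) i) \<otimes>\<^bsub>B\<^esub> x [^]\<^bsub>B\<^esub> i)"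
   by (simp only: B.finsum_zero)
  then have "a \<ominus>\<^bsub>A\<^esub> b \<in> {\<zero>\<^bsub>A\<^esub>}"
   by (intro basis[rule_format, of "{\<zero>\<^bsub>A\<^esub>}" "a \<ominus>\<^bsub>A\<^esub> b" "\<lambda>_. \<zero>\<^bsub>A\<^esub>"] A.zeroideal A.minus_closed ab) auto
  then show "a = b" using ab A.r_right_minus_eq by simp
 qed
 obtain C :: "'a ring" and psi xs where C: "cring C" "psi \<in> ring_hom B C" "inj_on psi (carrier B)" "set xs \<subseteq> carrier C" "psi \<circ> q = teich_prod C xs"
  by atomize_elim (rule Suc(1)[of B q, OF B q])
 have "(psi \<circ> phi) \<circ> p = psi \<circ> (phi \<circ> p)" by (simp add: comp_assoc)
 also have "\<dots> = teich_prod C (psi x # xs)" unfolding pq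
  using ps_mult_hom[OF B C(1,2), of "teich B x" q] teich_hom[OF B C(1,2) x] C(5) q(1) teich_closed[OF B x]
  by (simp add: teich_prod_simps witt_carrierD)
 finally have "(psi \<circ> phi) \<circ> p = teich_prod C (psi x # xs)" .
 moreover have "psi \<circ> phi \<in> ring_hom A C" by (rule ring_hom_trans[OF phih C(2)])
 moreover have "inj_on (psi \<circ> phi) (carrier A)"
  by (rule comp_inj_on[OF inj inj_on_subset[OF C(3)]]) auto
 moreover have "set (psi x # xs) \<subseteq> carrier C" using C(4) ring_hom_closed[OF C(2) x] by simp
 ultimately show ?case using C(1) by (intro exI conjI)
qed

section \<open>Rational vectors and vectors of bounded Hankel rank\<close>

definition rat_carrier :: "'a ring => (nat => 'a) set" where
 "rat_carrier A = {f \<in> witt_carrier A. \<exists>Q \<in> witt_polys A. ps_mult A f Q \<in> witt_polys A}"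

definition J_carrier :: "'a ring => (nat => 'a) set" where
 "J_carrier A = {f \<in> witt_carrier A. \<exists>n\<ge>1. minors_vanish A (n + 1) (hankel f)}"

lemma Witt_rat_eq: "Witt_rat A = (Witt A)\<lparr>carrier := rat_carrier A\<rparr>"
proof -
 have "{f \<in> carrier (Witt A). \<exists>P \<in> up A. \<exists>Q \<in> up A. P 0 = \<one>\<^bsub>A\<^esub> \<and> Q 0 = \<one>\<^bsub>A\<^esub> \<and> ps_mult A f Q = P} = rat_carrier A"
  by (auto simp: rat_carrier_def witt_polys_up) blast
 then show ?thesis unfolding Witt_rat_def by (simp only:)
qed

lemma Witt_J_eq: "Witt_J A = (Witt A)\<lparr>carrier := J_carrier A\<rparr>"
 by (simp add: Witt_J_def J_carrier_def)

text \<open>With F = f + p and G = g + q this is f g + (F q + p G) = F G + p q, the product of two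
  differences written without subtraction. In the Witt ring, where the sum is the product of series,
  it exhibits numerator and denominator of a Witt product of fractions.\<close>

lemma (in cring) difference_mult:
 assumes "f \<in> carrier R" "p \<in> carrier R" "g \<in> carrier R" "q \<in> carrier R"
 shows "f \<otimes> g \<oplus> ((f \<oplus> p) \<otimes> q \<oplus> p \<otimes> (g \<oplus> q)) = (f \<oplus> p) \<otimes> (g \<oplus> q) \<oplus> p \<otimes> q"
 using assms by (simp add: l_distr r_distr a_ac)

text \<open>In an extension where both polynomials split, the Witt product is again a finite product
  of linear factors, hence a polynomial. Its coefficients vanish from some degree on there, and by
  injectivity already in \<open>A\<close>.\<close>

lemma witt_polys_mult:
 fixes A :: "'a ring"
 assumes inf: "infinite (UNIV :: 'a set)" and A: "cring A" and f: "f \<in> witt_polys A" and g: "g \<in> witt_polys A"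
 shows "witt_mult A f g \<in> witt_polys A"
proof -
 interpret A: cring A by fact
 interpret W: cring "Witt A" by (rule Witt_cring[OF A])
 have fc: "f \<in> witt_carrier A" "g \<in> witt_carrier A" using f g by (auto simp: witt_polys_def)
 obtain M where M: "\<forall>n>M. f n = \<zero>\<^bsub>A\<^esub>" using f by (auto simp: witt_polys_def)
 obtain B :: "'a ring" and phi xs where B: "cring B" "phi \<in> ring_hom A B" "inj_on phi (carrier A)" "set xs \<subseteq> carrier B" "phi \<circ> f = teich_prod B xs"
  using splitting_extension[OF inf A fc(1) M] by blast
 have gB: "phi \<circ> g \<in> witt_polys B" by (rule witt_polys_hom[OF A B(1,2) g])
 then have gBc: "phi \<circ> g \<in> witt_carrier B" by (rule witt_polys_carrier)
 obtain N where N: "\<forall>n>N. (phi \<circ> g) n = \<zero>\<^bsub>B\<^esub>" using gB by (auto simp: witt_polys_def)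
 obtain C :: "'a ring" and psi ys where C: "cring C" "psi \<in> ring_hom B C" "inj_on psi (carrier B)" "set ys \<subseteq> carrier C" "psi \<circ> (phi \<circ> g) = teich_prod C ys"
  using splitting_extension[OF inf B(1) gBc N] by blast
 define h where "h = psi \<circ> phi"
 have h: "h \<in> ring_hom A C" unfolding h_def by (rule ring_hom_trans[OF B(2) C(2)])
 interpret h: ring_hom_cring A C h using h by (intro ring_hom_cringI) (auto intro: A C)
 have hinj: "inj_on h (carrier A)" unfolding h_def
  by (rule comp_inj_on[OF B(3) inj_on_subset[OF C(3)]]) (use ring_hom_closed[OF B(2)] in auto)
 have "set (map psi xs) \<subseteq> carrier C" using B(4) ring_hom_closed[OF C(2)] by auto
 moreover have "h \<circ> f = teich_prod C (map psi xs)"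
  unfolding h_def comp_assoc B(5) by (rule teich_prod_hom[OF B(1) C(1,2) B(4)])
 moreover have "h \<circ> g = teich_prod C ys" unfolding h_def comp_assoc C(5) ..
 ultimately obtain zs where zs: "set zs \<subseteq> carrier C" "witt_mult C (h \<circ> f) (h \<circ> g) = teich_prod C zs"
  using teich_prod_witt_mult[OF C(1) _ C(4), of "map psi xs"] by metis
 then have "h \<circ> witt_mult A f g \<in> witt_polys C"
  using witt_mult_hom[OF A C(1) h fc] teich_prod_polys[OF C(1) zs(1)] by simp
 then obtain D where D: "\<forall>n>D. h (witt_mult A f g n) = \<zero>\<^bsub>C\<^esub>" by (auto simp: witt_polys_def)
 have w: "witt_mult A f g \<in> witt_carrier A" using W.m_closed[of f g] fc by simp
 have "witt_mult A f g n = \<zero>\<^bsub>A\<^esub>" if "n > D" for n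
  using D that inj_onD[OF hinj, of "witt_mult A f g n" "\<zero>\<^bsub>A\<^esub>"] witt_carrierD(1)[OF w] by simp
 then show ?thesis using w unfolding witt_polys_def by blast
qed

lemma rat_carrierI:
 assumes "f \<in> witt_carrier A" "Q \<in> witt_polys A" "ps_mult A f Q \<in> witt_polys A"
 shows "f \<in> rat_carrier A"
 using assms unfolding rat_carrier_def by blast

lemma rat_carrier_polys: "cring A ==> f \<in> witt_polys A ==> f \<in> rat_carrier A"
 by (rule rat_carrierI[OF witt_polys_carrier witt_polys_zero]) (simp_all add: witt_polys_add witt_polys_zero del: Witt_simps)

lemma rat_subring:
 fixes A :: "'a ring"
 assumes inf: "infinite (UNIV :: 'a set)" and A: "cring A"
 shows "subring (rat_carrier A) (Witt A)"
proof -
 interpret A: cring A by fact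
 interpret W: cring "Witt A" by (rule Witt_cring[OF A])
 note add = witt_polys_add[OF A] and mult = witt_polys_mult[OF inf A]
 have rat: "f \<in> witt_carrier A \<and> (\<exists>Q \<in> witt_polys A. Q \<in> witt_carrier A \<and> ps_mult A f Q \<in> witt_polys A)" if "f \<in> rat_carrier A" for f
  using that witt_polys_carrier unfolding rat_carrier_def by blast
 show ?thesis
 proof (rule W.subringI)
  show "rat_carrier A \<subseteq> carrier (Witt A)" by (auto simp: rat_carrier_def)
  show "\<one>\<^bsub>Witt A\<^esub> \<in> rat_carrier A" using rat_carrier_polys[OF A witt_polys_teich[OF A A.one_closed]] by simp
 next
  fix f assume "f \<in> rat_carrier A"
  then obtain Q where f: "f \<in> witt_carrier A" and Q: "Q \<in> witt_polys A" "Q \<in> witt_carrier A" "ps_mult A f Q \<in> witt_polys A"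
   using rat by blast
  \<comment> \<open>Negation in the Witt ring is inversion of series, so it exchanges numerator and
    denominator.\<close>
  have c: "\<ominus>\<^bsub>Witt A\<^esub> f \<in> witt_carrier A" using W.a_inv_closed[of f] f by simp
  have "ps_mult A (\<ominus>\<^bsub>Witt A\<^esub> f) (ps_mult A f Q) = Q" using W.r_neg1[of f Q] f Q(2) by simp
  then show "\<ominus>\<^bsub>Witt A\<^esub> f \<in> rat_carrier A" using Q(1) by (intro rat_carrierI[OF c Q(3)]) simp
 next
  fix f g assume "f \<in> rat_carrier A" "g \<in> rat_carrier A"
  then obtain P Q where fg: "f \<in> witt_carrier A" "g \<in> witt_carrier A" and P: "P \<in> witt_polys A" "P \<in> witt_carrier A" "ps_mult A f P \<in> witt_polys A"
   and Q: "Q \<in> witt_polys A" "Q \<in> witt_carrier A" "ps_mult A g Q \<in> witt_polys A" using rat by meson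
  have c: "f \<in> carrier (Witt A)" "P \<in> carrier (Witt A)" "g \<in> carrier (Witt A)" "Q \<in> carrier (Witt A)" using fg P Q by auto
  have "witt_mult A f g \<in> rat_carrier A"
  proof (rule rat_carrierI)
   show "witt_mult A f g \<in> witt_carrier A" using W.m_closed[OF c(1,3)] by simp
   show "ps_mult A (witt_mult A (ps_mult A f P) Q) (witt_mult A P (ps_mult A g Q)) \<in> witt_polys A"
    by (intro add mult P Q)
   have "ps_mult A (witt_mult A (ps_mult A f P) (ps_mult A g Q)) (witt_mult A P Q) \<in> witt_polys A"
    by (intro add mult P Q)
   then show "ps_mult A (witt_mult A f g) (ps_mult A (witt_mult A (ps_mult A f P) Q) (witt_mult A P (ps_mult A g Q))) \<in> witt_polys A"
    using W.difference_mult[OF c] by simp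
  qed
  then show "f \<otimes>\<^bsub>Witt A\<^esub> g \<in> rat_carrier A" by simp
  have "ps_mult A f g \<in> rat_carrier A"
  proof (rule rat_carrierI)
   show "ps_mult A f g \<in> witt_carrier A" using W.a_closed[OF c(1,3)] by simp
   show "ps_mult A P Q \<in> witt_polys A" by (intro add P Q)
   have "(f \<oplus>\<^bsub>Witt A\<^esub> g) \<oplus>\<^bsub>Witt A\<^esub> (P \<oplus>\<^bsub>Witt A\<^esub> Q) = (f \<oplus>\<^bsub>Witt A\<^esub> P) \<oplus>\<^bsub>Witt A\<^esub> (g \<oplus>\<^bsub>Witt A\<^esub> Q)"
    using c by (simp add: W.a_ac del: Witt_simps)
   then show "ps_mult A (ps_mult A f g) (ps_mult A P Q) \<in> witt_polys A"
    using add[OF P(3) Q(3)] by simp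
  qed
  then show "f \<oplus>\<^bsub>Witt A\<^esub> g \<in> rat_carrier A" by simp
 qed
qed

lemma rat_carrier_hom:
 assumes "cring A" "cring B" "phi \<in> ring_hom A B" "f \<in> rat_carrier A"
 shows "phi \<circ> f \<in> rat_carrier B"
proof -
 obtain Q where f: "f \<in> witt_carrier A" and Q: "Q \<in> witt_polys A" "ps_mult A f Q \<in> witt_polys A"
  using assms(4) unfolding rat_carrier_def by blast
 have "phi \<circ> ps_mult A f Q = ps_mult B (phi \<circ> f) (phi \<circ> Q)"
  by (rule ps_mult_hom[OF assms(1-3) witt_carrierD(1)[OF f] witt_carrierD(1)[OF witt_polys_carrier[OF Q(1)]]])
 then have "ps_mult B (phi \<circ> f) (phi \<circ> Q) \<in> witt_polys B" using witt_polys_hom[OF assms(1-3) Q(2)] by simp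
 then show ?thesis by (rule rat_carrierI[OF witt_carrier_hom[OF assms(3) f] witt_polys_hom[OF assms(1-3) Q(1)]])
qed

lemma leibniz_det_ring_hom:
 assumes A: "cring A" and B: "cring B" and phi: "phi \<in> ring_hom A B" and M: "!!i j. M i j \<in> carrier A"
 shows "phi (leibniz_det A n M) = leibniz_det B n (\<lambda>i j. phi (M i j))"
proof -
 interpret A: cring A by fact
 interpret B: cring B by fact
 interpret h: ring_hom_cring A B phi using phi by (intro ring_hom_cringI) (auto intro: A B)
 interpret g: group_hom "add_monoid A" "add_monoid B" phi
  by unfold_locales (auto simp: hom_def)
 have pow: "phi (add_pow A k x) = add_pow B k (phi x)" if "x \<in> carrier A" for x and k :: int
  using g.hom_int_pow[of x k] that unfolding add_pow_def by simp
 have pr: "phi (\<Otimes>\<^bsub>A\<^esub>i\<in>{..<n}. M i (p i)) = (\<Otimes>\<^bsub>B\<^esub>i\<in>{..<n}. phi (M i (p i)))" for p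
  using h.hom_finprod[of "\<lambda>i. M i (p i)" "{..<n}"] M by (simp add: comp_def)
 have cl: "(\<Otimes>\<^bsub>A\<^esub>i\<in>{..<n}. M i (p i)) \<in> carrier A" for p using M by (intro A.finprod_closed) auto
 have cl': "(\<Otimes>\<^bsub>B\<^esub>i\<in>{..<n}. phi (M i (p i))) \<in> carrier B" for p using M by (intro B.finprod_closed) auto
 let ?t = "\<lambda>p. add_pow A (sign p) (\<Otimes>\<^bsub>A\<^esub>i\<in>{..<n}. M i (p i))"
 have "phi (leibniz_det A n M) = finsum B (phi \<circ> ?t) {p. p permutes {..<n}}"
  unfolding leibniz_det_def by (rule h.hom_finsum) (use cl in auto)
 also have "\<dots> = leibniz_det B n (\<lambda>i j. phi (M i j))"
  unfolding leibniz_det_def by (rule B.finsum_cong') (use cl cl' pow pr in \<open>auto simp: comp_def\<close>)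
 finally show ?thesis .
qed

lemma J_carrier_hom:
 assumes "cring A" "cring B" "phi \<in> ring_hom A B" "f \<in> J_carrier A"
 shows "phi \<circ> f \<in> J_carrier B"
proof -
 obtain n where f: "f \<in> witt_carrier A" and n: "n \<ge> 1" "minors_vanish A (n + 1) (hankel f)"
  using assms(4) unfolding J_carrier_def by blast
 have "leibniz_det B (n + 1) (\<lambda>i j. hankel (phi \<circ> f) (r i) (c j)) = phi (leibniz_det A (n + 1) (\<lambda>i j. hankel f (r i) (c j)))" for r c
  using leibniz_det_ring_hom[OF assms(1-3), of "\<lambda>i j. hankel f (r i) (c j)" "n + 1"] witt_carrierD(1)[OF f]
  by (simp add: hankel_def)
 moreover have "phi \<zero>\<^bsub>A\<^esub> = \<zero>\<^bsub>B\<^esub>" using ring_hom_zero[OF assms(3)] assms(1,2) by (simp add: cring_def)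
 ultimately have "minors_vanish B (n + 1) (hankel (phi \<circ> f))" using n(2) unfolding minors_vanish_def by simp
 then show ?thesis using witt_carrier_hom[OF assms(3) f] n(1) unfolding J_carrier_def by blast
qed

lemma domain_J_rational:
 assumes B: "domain B" "noetherian_ring B" and f: "f \<in> J_carrier B"
 shows "f \<in> rat_carrier B"
proof -
 interpret domain B by fact
 have cB: "cring B" by (rule is_cring)
 obtain n where fc: "f \<in> witt_carrier B" and n: "minors_vanish B (n + 1) (hankel f)" using f unfolding J_carrier_def by blast
 note fD = witt_carrierD[OF fc]
 obtain D c where c: "\<forall>l. c l \<in> carrier B" "\<forall>j. f (D + j) = (\<Oplus>\<^bsub>B\<^esub>l\<in>{..<D}. c l \<otimes>\<^bsub>B\<^esub> f (l + j))"
  using domain_Hankel_recurrence[OF B fD(1) n] by blast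
 obtain Q where Q: "\<forall>i. Q i \<in> carrier B" "Q 0 = \<one>\<^bsub>B\<^esub>" "\<forall>n>D. Q n = \<zero>\<^bsub>B\<^esub>" "\<forall>n\<ge>D. ps_mult B f Q n = \<zero>\<^bsub>B\<^esub>"
  using rational_of_recurrence[OF cB fD(2,1) c(1)[rule_format] c(2)[rule_format]] by blast
 have "Q \<in> witt_polys B" using Q unfolding witt_polys_def witt_carrier_def by blast
 moreover have "ps_mult B f Q \<in> witt_polys B"
  using ps_mult_closed[OF cB fc witt_polys_carrier[OF \<open>Q \<in> witt_polys B\<close>]] Q(4) unfolding witt_polys_def
  by (auto intro!: exI[of _ D])
 ultimately show ?thesis by (rule rat_carrierI[OF fc])
qed

text \<open>The maps to the components are surjective, so the denominator on each of them lifts to a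
  polynomial over \<open>A\<close>; the product of the lifts clears all denominators at
  once.\<close>

lemma common_denominator:
 fixes A :: "'a ring"
 assumes A: "cring A" and S: "finite S" "!!B phi. (B, phi) \<in> S ==> cring B \<and> phi \<in> ring_hom A B \<and> phi ` carrier A = carrier B"
  and h: "h \<in> witt_carrier A" and rat: "!!B phi. (B, phi) \<in> S ==> phi \<circ> h \<in> rat_carrier B"
 shows "\<exists>Q \<in> witt_polys A. \<forall>(B, phi) \<in> S. phi \<circ> ps_mult A h Q \<in> witt_polys B"
 using S rat
proof (induction S rule: finite_induct)
 case empty
 show ?case using witt_polys_zero[OF A] by blast
next
 case (insert s S)
 interpret A: cring A by fact
 obtain B phi where s: "s = (B, phi)" by force
 have B: "cring B" and phi: "phi \<in> ring_hom A B" and surj: "phi ` carrier A = carrier B"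
  using insert(4)[of B phi] s by auto
 have r: "phi \<circ> h \<in> rat_carrier B" by (rule insert(5)) (simp add: s)
 have "\<exists>Q \<in> witt_polys A. \<forall>(B, phi) \<in> S. phi \<circ> ps_mult A h Q \<in> witt_polys B"
  by (rule insert(3)) (use insert(4,5) in auto)
 then obtain Q where Q: "Q \<in> witt_polys A" "!!B phi. (B, phi) \<in> S ==> phi \<circ> ps_mult A h Q \<in> witt_polys B" by blast
 obtain q where q: "q \<in> witt_polys B" "ps_mult B (phi \<circ> h) q \<in> witt_polys B" using r unfolding rat_carrier_def by blast
 then obtain N where N: "\<forall>n>N. q n = \<zero>\<^bsub>B\<^esub>" by (auto simp: witt_polys_def)
 note qD = witt_carrierD[OF witt_polys_carrier[OF q(1)]]
 interpret hom: ring_hom_cring A B phi using phi by (intro ring_hom_cringI) (auto intro: A B)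
 \<comment> \<open>Arbitrary preimages of 1 and 0 need not be 1 and 0. The constant term and the
   terms beyond \<open>N\<close> are set by hand, so that the lift is a polynomial with constant
   term 1.\<close>
 define q' where "q' = (\<lambda>n. if n = 0 then \<one>\<^bsub>A\<^esub> else if n > N then \<zero>\<^bsub>A\<^esub> else inv_into (carrier A) phi (q n))"
 have pre: "inv_into (carrier A) phi (q n) \<in> carrier A" "phi (inv_into (carrier A) phi (q n)) = q n" for n
  using qD(1)[of n] surj by (auto intro: inv_into_into f_inv_into_f)
 have "\<forall>n>N. q' n = \<zero>\<^bsub>A\<^esub>" by (simp add: q'_def)
 moreover have "q' \<in> witt_carrier A" using pre by (simp add: witt_carrier_def q'_def)
 ultimately have q': "q' \<in> witt_polys A" unfolding witt_polys_def by blast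
 have "phi \<circ> q' = q" using pre qD N by (auto simp: q'_def fun_eq_iff)
 note Qc = witt_polys_carrier[OF Q(1)] and q'c = witt_polys_carrier[OF q']
 have hom': "psi \<circ> ps_mult A f g = ps_mult C (psi \<circ> f) (psi \<circ> g)"
  if "(C, psi) \<in> insert s S" "f \<in> witt_carrier A" "g \<in> witt_carrier A" for C psi f g
  using insert(4)[OF that(1)] ps_mult_hom[OF A, of C psi f g] witt_carrierD(1) that(2,3) by blast
 have polys: "psi \<circ> f \<in> witt_polys C" if "(C, psi) \<in> insert s S" "f \<in> witt_polys A" for C psi f
  using insert(4)[OF that(1)] witt_polys_hom[OF A _ _ that(2)] by blast
 have ad: "ps_mult C f g \<in> witt_polys C" if "(C, psi) \<in> insert s S" "f \<in> witt_polys C" "g \<in> witt_polys C" for C psi f g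
  using insert(4)[OF that(1)] witt_polys_add that(2,3) by blast
 note cl = ps_mult_closed[OF A]
 show ?case
 proof (rule bexI[OF _ witt_polys_add[OF A Q(1) q']], clarify)
  fix C psi assume C: "(C, psi) \<in> insert s S"
  show "psi \<circ> ps_mult A h (ps_mult A Q q') \<in> witt_polys C"
  proof (cases "(C, psi) \<in> S")
   case True
   have "ps_mult A h (ps_mult A Q q') = ps_mult A (ps_mult A h Q) q'"
    by (rule witt_ring_laws(2)[OF A h Qc q'c, symmetric])
   then have "psi \<circ> ps_mult A h (ps_mult A Q q') = ps_mult C (psi \<circ> ps_mult A h Q) (psi \<circ> q')"
    using hom'[OF C cl[OF h Qc] q'c] by simp
   then show ?thesis using ad[OF C Q(2)[OF True] polys[OF C q']] by simp
  next
   case False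
   then have C': "C = B" "psi = phi" using C s by auto
   have "ps_mult A h (ps_mult A Q q') = ps_mult A (ps_mult A h q') Q"
    using witt_ring_laws(1)[OF A Qc q'c h] witt_ring_laws(2)[OF A h q'c Qc] by simp
   then have "psi \<circ> ps_mult A h (ps_mult A Q q') = ps_mult C (ps_mult C (psi \<circ> h) (psi \<circ> q')) (psi \<circ> Q)"
    using hom'[OF C cl[OF h q'c] Qc] hom'[OF C h q'c] by simp
   then show ?thesis using ad[OF C _ polys[OF C Q(1)]] q(2) \<open>phi \<circ> q' = q\<close> unfolding C' by simp
  qed
 qed
qed

lemma seq_module_finsum:
 fixes A :: "'a ring" (structure)
 assumes A: "cring A" and N: "seq_module A N" and "finite F" and y: "!!l. l \<in> F ==> a l \<in> carrier A \<and> y l \<in> N"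
 shows "(\<lambda>j. \<Oplus>l\<in>F. a l \<otimes> y l j) \<in> N"
 using assms(3) y
proof (induction F rule: finite_induct)
 case empty
 interpret cring A by fact
 show ?case using seq_moduleD(2)[OF N] by simp
next
 case (insert k F)
 interpret cring A by fact
 note D = seq_moduleD[OF N]
 have "(\<lambda>j. a k \<otimes> y k j \<oplus> (\<Oplus>l\<in>F. a l \<otimes> y l j)) \<in> N"
  by (rule D(3)[OF D(4)]) (use insert in auto)
 moreover have "(\<Oplus>l\<in>insert k F. a l \<otimes> y l j) = a k \<otimes> y k j \<oplus> (\<Oplus>l\<in>F. a l \<otimes> y l j)" for j
  by (rule finsum_insert) (use insert D(1) in auto)
 ultimately show ?case by simp
qed

text \<open>On every component the common denominator gives a recurrence for \<open>h\<close>. Each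
  row of the Hankel matrix therefore agrees, up to elements that vanish on all components, with a
  combination of the first \<open>D\<close> rows. This is a decomposition C B + E as in
  \<open>leibniz_det_nilpotent\<close>, in which any \<open>k\<close> entries of \<open>E\<close>
  multiply to zero.\<close>

lemma rational_components_J:
 fixes A :: "'a ring" (structure)
 assumes A: "cring A" and S: "finite S" "!!B phi. (B, phi) \<in> S ==> cring B \<and> phi \<in> ring_hom A B \<and> phi ` carrier A = carrier B"
  and nil: "\<forall>xs. set xs \<subseteq> carrier A \<and> length xs = k \<and> (\<forall>x \<in> set xs. \<forall>(B, phi) \<in> S. phi x = \<zero>\<^bsub>B\<^esub>) --> lprod A xs = \<zero>"
  and h: "h \<in> witt_carrier A" and rat: "!!B phi. (B, phi) \<in> S ==> phi \<circ> h \<in> rat_carrier B"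
 shows "h \<in> J_carrier A"
proof -
 interpret A: cring A by fact
 note hD = witt_carrierD[OF h]
 obtain Q where Q: "Q \<in> witt_polys A" "!!B phi. (B, phi) \<in> S ==> phi \<circ> ps_mult A h Q \<in> witt_polys B"
  using common_denominator[OF A S h rat] by blast
 note Qc = witt_polys_carrier[OF Q(1)]
 note QD = witt_carrierD[OF Qc]
 obtain N where N: "\<forall>n>N. Q n = \<zero>" using Q(1) by (auto simp: witt_polys_def)
 have "\<exists>M. \<forall>s \<in> S. \<forall>n>M. snd s (ps_mult A h Q n) = \<zero>\<^bsub>fst s\<^esub>"
 proof -
  have "\<forall>s \<in> S. \<exists>M. \<forall>n>M. snd s (ps_mult A h Q n) = \<zero>\<^bsub>fst s\<^esub>" using Q(2) by (fastforce simp: witt_polys_def)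
  then obtain m where m: "\<forall>s \<in> S. \<forall>n>m s. snd s (ps_mult A h Q n) = \<zero>\<^bsub>fst s\<^esub>" by metis
  have "\<forall>s \<in> S. m s \<le> Max (insert 0 (m ` S))" using S(1) by auto
  then show ?thesis using m by (intro exI[of _ "Max (insert 0 (m ` S))"]) (meson le_less_trans)
 qed
 then obtain M where M: "!!B phi n. (B, phi) \<in> S ==> n > M ==> phi (ps_mult A h Q n) = \<zero>\<^bsub>B\<^esub>" by fastforce
 \<comment> \<open>\<open>D\<close> exceeds the degree bound \<open>N\<close> of \<open>Q\<close>,
   so the recurrence has at most \<open>D\<close> terms besides the leading one, and it exceeds
   \<open>M\<close>, so h Q vanishes on the components from degree \<open>D\<close> on. The summand
   2 makes the size at least 2, as the condition n \<ge> 1 for minors of size n + 1 demands.\<close>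
 define D where "D = M + N + 2"
 define t where "t n = (\<Oplus>l\<in>{1..D}. Q l \<otimes> h (n - l))" for n
 have tc: "t n \<in> carrier A" for n using hD QD by (simp add: t_def)
 have rec: "ps_mult A h Q n = h n \<oplus> t n" if n: "n \<ge> D" for n
 proof -
  have "ps_mult A h Q n = ps_mult A Q h n" using witt_ring_laws(1)[OF A h Qc h] by simp
  also have "\<dots> = (\<Oplus>l\<in>insert 0 {1..D}. Q l \<otimes> h (n - l))" unfolding ps_mult_def
   by (rule A.add.finprod_mono_neutral_cong_right) (use n N hD QD in \<open>auto simp: D_def\<close>)
  also have "\<dots> = Q 0 \<otimes> h (n - 0) \<oplus> t n" unfolding t_def
   by (rule A.finsum_insert) (use hD QD in auto)
  finally show ?thesis using hD QD by simp
 qed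
 let ?R = "row_span A h {..<D}"
 have Rm: "seq_module A ?R" by (rule row_span_module[OF A hD(1)])
 \<comment> \<open>Strong induction on the row index: on every component, row \<open>i\<close> is
   minus a combination of the \<open>D\<close> rows before it, and each of these is replaced by its
   representative in the span of the first \<open>D\<close> rows.\<close>
 have rows: "\<exists>y \<in> ?R. \<forall>j. \<forall>(B, phi) \<in> S. phi (h (i + j)) = phi (y j)" for i
 proof (induction i rule: less_induct)
  case (less i)
  show ?case
  proof (cases "i < D")
   case True
   have "(\<lambda>j. h (i + j)) \<in> ?R" unfolding row_span_def
    by (rule seq_span_self[OF A]) (use True hD in auto)
   then show ?thesis by (rule bexI[rotated]) auto
  next
   case False
   have "\<forall>l \<in> {1..D}. \<exists>y \<in> ?R. \<forall>j. \<forall>(B, phi) \<in> S. phi (h (i - l + j)) = phi (y j)"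
   proof
    fix l assume "l \<in> {1..D}"
    then have "i - l < i" using False by (auto simp: D_def)
    then show "\<exists>y \<in> ?R. \<forall>j. \<forall>(B, phi) \<in> S. phi (h (i - l + j)) = phi (y j)" by (rule less)
   qed
   then obtain y where y: "!!l. l \<in> {1..D} ==> y l \<in> ?R"
    "!!l j B phi. l \<in> {1..D} ==> (B, phi) \<in> S ==> phi (h (i - l + j)) = phi (y l j)" by (metis (mono_tags, lifting) case_prodD)
   define z where "z j = (\<Oplus>l\<in>{1..D}. Q l \<otimes> y l j)" for j
   have zR: "(\<lambda>j. z j) \<in> ?R" unfolding z_def by (rule seq_module_finsum[OF A Rm]) (use y(1) QD in auto)
   have yc: "y l j \<in> carrier A" if "l \<in> {1..D}" for l j by (rule seq_moduleD(1)[OF Rm y(1)[OF that]])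
   have zc: "z j \<in> carrier A" for j using seq_moduleD(1)[OF Rm zR] by simp
   have "(\<lambda>j. (\<ominus> \<one>) \<otimes> z j) \<in> ?R" by (rule seq_moduleD(4)[OF Rm _ zR]) simp
   then have mR: "(\<lambda>j. \<ominus> z j) \<in> ?R" using zc by (simp add: A.l_minus)
   have claim: "phi (h (i + j)) = phi (\<ominus> z j)" if B: "(B, phi) \<in> S" for B phi j
   proof -
    have cB: "cring B" "phi \<in> ring_hom A B" using S(2)[OF B] by auto
    interpret B: cring B by (rule cB)
    interpret f: ring_hom_cring A B phi using cB by (intro ring_hom_cringI) (auto intro: A)
    have iD: "i + j \<ge> D" using False by simp
    have "phi (h (i + j) \<oplus> t (i + j)) = \<zero>\<^bsub>B\<^esub>"
     using M[OF B, of "i + j"] rec[OF iD] iD by (simp add: D_def)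
    then have e: "phi (h (i + j)) \<oplus>\<^bsub>B\<^esub> phi (t (i + j)) = \<zero>\<^bsub>B\<^esub>" using hD tc by simp
    have "phi (t (i + j)) = (\<Oplus>\<^bsub>B\<^esub>l\<in>{1..D}. phi (Q l) \<otimes>\<^bsub>B\<^esub> phi (h (i + j - l)))"
     unfolding t_def by (subst f.hom_finsum) (use hD QD in \<open>auto simp: comp_def\<close>)
    also have "\<dots> = (\<Oplus>\<^bsub>B\<^esub>l\<in>{1..D}. phi (Q l) \<otimes>\<^bsub>B\<^esub> phi (y l j))"
    proof (rule B.finsum_cong')
     fix l assume l: "l \<in> {1..D}"
     then have "i + j - l = i - l + j" using False by auto
     then show "phi (Q l) \<otimes>\<^bsub>B\<^esub> phi (h (i + j - l)) = phi (Q l) \<otimes>\<^bsub>B\<^esub> phi (y l j)" using y(2)[OF l B, of j] by simp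
    qed (use QD yc in auto)
    also have "\<dots> = finsum B (phi \<circ> (\<lambda>l. Q l \<otimes> y l j)) {1..D}"
     by (rule B.finsum_cong') (use yc QD in auto)
    also have "\<dots> = phi (z j)" unfolding z_def by (rule f.hom_finsum[symmetric]) (use yc QD in auto)
    finally have "phi (t (i + j)) = phi (z j)" .
    then have "phi (h (i + j)) = \<ominus>\<^bsub>B\<^esub> phi (z j)" using e B.minus_equality[of "phi (h (i + j))" "phi (z j)"] hD zc by simp
    then show ?thesis using zc by simp
   qed
   show ?thesis
   proof (rule bexI[OF _ mR], clarify)
    fix j B phi assume "(B, phi) \<in> S"
    then show "phi (h (i + j)) = phi (\<ominus> z j)" by (rule claim)
   qed
  qed
 qed
 then obtain y where y: "!!i. y i \<in> ?R" "!!i j B phi. (B, phi) \<in> S ==> phi (h (i + j)) = phi (y i j)"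
  by (metis (mono_tags, lifting) case_prodD)
 have "\<forall>i. \<exists>c. (\<forall>l. c l \<in> carrier A) \<and> (\<forall>j. y i j = (\<Oplus>l\<in>{..<D}. c l \<otimes> h (l + j)))"
  using row_span_coeffs[OF A hD(1) y(1)] by blast
 then obtain C where C: "!!i l. C i l \<in> carrier A" "!!i j. y i j = (\<Oplus>l\<in>{..<D}. C i l \<otimes> h (l + j))" by metis
 have yc: "y i j \<in> carrier A" for i j by (rule seq_moduleD(1)[OF Rm y(1)])
 define E where "E i j = h (i + j) \<ominus> y i j" for i j
 have Ec: "E i j \<in> carrier A" for i j using hD yc by (simp add: E_def)
 have EN: "phi (E i j) = \<zero>\<^bsub>B\<^esub>" if B: "(B, phi) \<in> S" for B phi i j
 proof -
  have cB: "cring B" "phi \<in> ring_hom A B" using S(2)[OF B] by auto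
  interpret B: cring B by (rule cB)
  interpret f: ring_hom_cring A B phi using cB by (intro ring_hom_cringI) (auto intro: A)
  have "phi (E i j) = phi (h (i + j)) \<oplus>\<^bsub>B\<^esub> \<ominus>\<^bsub>B\<^esub> phi (y i j)" using hD yc by (simp add: E_def a_minus_def)
  then show ?thesis using y(2)[OF B] yc by (simp add: B.r_neg)
 qed
 have decomp: "h (i + j) = (\<Oplus>l\<in>{..<D}. C i l \<otimes> h (l + j)) \<oplus> E i j" for i j
  using A.a_comm[OF hD(1)[of "i + j"] A.a_inv_closed[OF yc[of i j]]] A.r_neg2[OF yc[of i j] hD(1)[of "i + j"]]
  by (simp add: E_def C(2)[symmetric] a_minus_def)
 have "minors_vanish A (D + k) (hankel h)" unfolding minors_vanish_def
 proof (intro allI impI)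
  fix r c :: "nat => nat"
  have "leibniz_det A (D + k) (\<lambda>i j. (\<Oplus>l\<in>{..<D}. C (r i) l \<otimes> h (l + c j)) \<oplus> E (r i) (c j)) = \<zero>"
  proof (rule leibniz_det_nilpotent[OF A])
   fix xs assume xs: "length xs = k" "set xs \<subseteq> {E (r i) (c j) |i j. True}"
   then have "set xs \<subseteq> carrier A \<and> length xs = k \<and> (\<forall>x \<in> set xs. \<forall>(B, phi) \<in> S. phi x = \<zero>\<^bsub>B\<^esub>)"
    using Ec EN by fastforce
   then show "lprod A xs = \<zero>" using nil by blast
  qed (use C Ec hD in auto)
  then show "leibniz_det A (D + k) (\<lambda>i j. hankel h (r i) (c j)) = \<zero>"
   unfolding hankel_def by (simp only: decomp[symmetric])
 qed
 moreover have "D + k = (D + k - 1) + 1" "D + k - 1 \<ge> 1" by (auto simp: D_def)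
 ultimately show ?thesis using h unfolding J_carrier_def by (metis (mono_tags, lifting) mem_Collect_eq)
qed

text \<open>The covering is independent of \<open>h\<close>. Restriction to a component preserves
  vanishing minors, which over a Noetherian domain force rationality; the converse is
  \<open>rational_components_J\<close>. Both the subring property and local surjectivity are read
  off from this description.\<close>

lemma J_carrier_components:
 fixes A :: "'a ring"
 assumes A: "A \<in> noeth"
 shows "\<exists>S. S \<subseteq> arrows_into A \<and> finite S \<and> (\<forall>(B, phi) \<in> S. closed_immersion A B phi) \<and> jointly_surjective A S \<and>
  J_carrier A = {h \<in> witt_carrier A. \<forall>(B, phi) \<in> S. phi \<circ> h \<in> rat_carrier B}"
proof -
 obtain S k where S: "S \<subseteq> arrows_into A" "finite S" "\<forall>(B, phi) \<in> S. closed_immersion A B phi \<and> domain B" "jointly_surjective A S"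
  "\<forall>xs. set xs \<subseteq> carrier A \<and> length xs = k \<and> (\<forall>x \<in> set xs. \<forall>(B, phi) \<in> S. phi x = \<zero>\<^bsub>B\<^esub>) --> lprod A xs = \<zero>\<^bsub>A\<^esub>"
  by atomize_elim (rule component_covering[OF A])
 have S': "cring B" "noetherian_ring B" "phi \<in> ring_hom A B" "phi ` carrier A = carrier B" "domain B" if "(B, phi) \<in> S" for B phi
  using subsetD[OF S(1) that] bspec[OF S(3) that] by (simp_all add: arrows_into_def noeth_def homs_def closed_immersion_def)
 have "h \<in> J_carrier A \<longleftrightarrow> h \<in> witt_carrier A \<and> (\<forall>(B, phi) \<in> S. phi \<circ> h \<in> rat_carrier B)" for h
 proof
  assume h: "h \<in> J_carrier A"
  have "phi \<circ> h \<in> rat_carrier B" if "(B, phi) \<in> S" for B phi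
   using domain_J_rational[OF S'(5,2) J_carrier_hom[OF noeth_cring[OF A] S'(1,3) h]] that by blast
  then show "h \<in> witt_carrier A \<and> (\<forall>(B, phi) \<in> S. phi \<circ> h \<in> rat_carrier B)" using h by (auto simp: J_carrier_def)
 next
  assume h: "h \<in> witt_carrier A \<and> (\<forall>(B, phi) \<in> S. phi \<circ> h \<in> rat_carrier B)"
  show "h \<in> J_carrier A"
   by (rule rational_components_J[OF noeth_cring[OF A] S(2) _ S(5)]) (use S' h in auto)
 qed
 then show ?thesis using S by (intro exI[of _ S]) auto
qed

text \<open>By \<open>J_carrier_components\<close> the set is an intersection of preimages of the
  subrings \<open>rat_carrier B\<close> under ring homomorphisms from W(A) to W(B).\<close>

lemma J_subring:
 fixes A :: "'a ring"
 assumes inf: "infinite (UNIV :: 'a set)" and A: "A \<in> noeth"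
 shows "subring (J_carrier A) (Witt A)" "rat_carrier A \<subseteq> J_carrier A"
proof -
 have cA: "cring A" by (rule noeth_cring[OF A])
 interpret A: cring A by fact
 interpret W: cring "Witt A" by (rule Witt_cring[OF cA])
 obtain S where S: "S \<subseteq> arrows_into A" "J_carrier A = {h \<in> witt_carrier A. \<forall>(B, phi) \<in> S. phi \<circ> h \<in> rat_carrier B}"
  using J_carrier_components[OF A] by blast
 have S': "cring B" "phi \<in> ring_hom A B" if "(B, phi) \<in> S" for B phi
  using S(1) that by (auto simp: arrows_into_def noeth_def homs_def)
 show "rat_carrier A \<subseteq> J_carrier A"
 proof
  fix f assume f: "f \<in> rat_carrier A"
  have "phi \<circ> f \<in> rat_carrier B" if "(B, phi) \<in> S" for B phi by (rule rat_carrier_hom[OF cA S'[OF that] f])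
  then show "f \<in> J_carrier A" using f unfolding S(2) by (auto simp: rat_carrier_def[of A])
 qed
 have sub: "subring (rat_carrier B) (Witt B)" and hom: "(\<lambda>f. phi \<circ> f) \<in> ring_hom (Witt A) (Witt B)" "cring (Witt B)" if "(B, phi) \<in> S" for B phi
  using rat_subring[OF inf S'(1)[OF that]] Witt_hom[OF cA S'[OF that]] Witt_cring[OF S'(1)[OF that]] by auto
 have neg: "phi \<circ> (\<ominus>\<^bsub>Witt A\<^esub> f) = \<ominus>\<^bsub>Witt B\<^esub> (phi \<circ> f)" if "(B, phi) \<in> S" "f \<in> carrier (Witt A)" for B phi f
 proof -
  interpret f: ring_hom_cring "Witt A" "Witt B" "\<lambda>f. phi \<circ> f"
   by (rule ring_hom_cringI) (auto intro: hom[OF that(1)] W.is_cring)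
  show ?thesis using f.hom_a_inv[OF that(2)] by simp
 qed
 have mem: "f \<in> J_carrier A \<longleftrightarrow> f \<in> carrier (Witt A) \<and> (\<forall>B phi. (B, phi) \<in> S --> phi \<circ> f \<in> rat_carrier B)" for f
  unfolding S(2) by auto
 show "subring (J_carrier A) (Witt A)"
 proof (rule W.subringI)
  show "J_carrier A \<subseteq> carrier (Witt A)" unfolding S(2) by auto
  show "\<one>\<^bsub>Witt A\<^esub> \<in> J_carrier A"
   using \<open>rat_carrier A \<subseteq> J_carrier A\<close> subringE(3)[OF rat_subring[OF inf cA]] by blast
 next
  fix f assume "f \<in> J_carrier A"
  then have f: "f \<in> carrier (Witt A)" "!!B phi. (B, phi) \<in> S ==> phi \<circ> f \<in> rat_carrier B" using mem by blast+
  show "\<ominus>\<^bsub>Witt A\<^esub> f \<in> J_carrier A" unfolding mem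
   using W.a_inv_closed[OF f(1)] neg[OF _ f(1)] subringE(5)[OF sub f(2)] by metis
 next
  fix f g assume "f \<in> J_carrier A" "g \<in> J_carrier A"
  then have f: "f \<in> carrier (Witt A)" "!!B phi. (B, phi) \<in> S ==> phi \<circ> f \<in> rat_carrier B"
   and g: "g \<in> carrier (Witt A)" "!!B phi. (B, phi) \<in> S ==> phi \<circ> g \<in> rat_carrier B" using mem by blast+
  show "f \<otimes>\<^bsub>Witt A\<^esub> g \<in> J_carrier A" unfolding mem
   using W.m_closed[OF f(1) g(1)] ring_hom_mult[OF hom(1) f(1) g(1)] subringE(6)[OF sub f(2) g(2)] by metis
  show "f \<oplus>\<^bsub>Witt A\<^esub> g \<in> J_carrier A" unfolding mem
   using W.a_closed[OF f(1) g(1)] ring_hom_add[OF hom(1) f(1) g(1)] subringE(7)[OF sub f(2) g(2)] by metis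
 qed
qed

section \<open>The presheaves of Witt vectors\<close>

text \<open>Common form of \<open>W_pre\<close>, \<open>W_rat_pre\<close> and
  \<open>W_J_pre\<close>, which differ only in their carriers; facts about inclusions and about the
  map from the monoid ring are proved once for all of them.\<close>

definition witt_sub :: "('a ring => (nat => 'a) set) => ('a, nat => 'a) presheaf" where
 "witt_sub C = \<lparr>sec = (\<lambda>A. (Witt A)\<lparr>carrier := C A\<rparr>), res = (\<lambda>A B phi f. phi \<circ> f)\<rparr>"

lemma witt_sub_simps [simp]:
 "carrier (sec (witt_sub C) A) = C A" "sec (witt_sub C) A = (Witt A)\<lparr>carrier := C A\<rparr>" "res (witt_sub C) A B phi f = phi \<circ> f"
 by (simp_all add: witt_sub_def)

lemma W_pre_eq: "(W_pre :: ('a, nat => 'a) presheaf) = witt_sub witt_carrier"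
proof -
 have "(\<lambda>A :: 'a ring. (Witt A)\<lparr>carrier := witt_carrier A\<rparr>) = Witt"
  by (rule ext) (simp add: Witt_def witt_ring_with_def)
 then show ?thesis unfolding W_pre_def witt_sub_def by simp
qed

lemma W_rat_pre_eq: "W_rat_pre = witt_sub rat_carrier"
 by (simp add: W_rat_pre_def witt_sub_def fun_eq_iff Witt_rat_eq)

lemma W_J_pre_eq: "W_J_pre = witt_sub J_carrier"
 by (simp add: W_J_pre_def witt_sub_def fun_eq_iff Witt_J_eq)

lemma compose_comp: "(!!n. p n \<in> carrier A) ==> hcomp A psi phi \<circ> p = psi \<circ> (phi \<circ> p)"
 by (auto simp: compose_def fun_eq_iff)

lemma witt_sub_presheaf:
 fixes C :: "'a ring => (nat => 'a) set"
 assumes sub: "!!A. A \<in> noeth ==> subring (C A) (Witt A)"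
  and hom: "!!A B phi f. A \<in> noeth ==> B \<in> noeth ==> phi \<in> homs A B ==> f \<in> C A ==> phi \<circ> f \<in> C B"
 shows "presheaf_of_rings (witt_sub C)"
proof -
 have C: "C A \<subseteq> witt_carrier A" if "A \<in> noeth" for A using subringE(1)[OF sub[OF that]] by simp
 have "cring ((Witt A)\<lparr>carrier := C A\<rparr>)" if "A \<in> noeth" for A
 proof -
  interpret W: cring "Witt A" by (rule Witt_cring[OF noeth_cring[OF that]])
  show ?thesis using W.subcring_iff[of "C A"] W.subcringI'[OF sub[OF that]] C[OF that] by simp
 qed
 moreover have "(\<lambda>f. phi \<circ> f) \<in> ring_hom ((Witt A)\<lparr>carrier := C A\<rparr>) ((Witt B)\<lparr>carrier := C B\<rparr>)"
  if "A \<in> noeth" "B \<in> noeth" "phi \<in> homs A B" for A B phi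
 proof -
  note h = Witt_hom[OF noeth_cring[OF that(1)] noeth_cring[OF that(2)] homs_ring_hom[OF that(3)]]
  show ?thesis
   by (rule ring_hom_memI)
    (use C[OF that(1)] hom[OF that] ring_hom_mult[OF h] ring_hom_add[OF h] ring_hom_one[OF h] in \<open>auto simp: subset_iff\<close>)
 qed
 moreover have "id_hom A \<circ> f = f" if "A \<in> noeth" "f \<in> C A" for A f
  using C[OF that(1)] that(2) by (fastforce simp: id_hom_def witt_carrier_def)
 moreover have "hcomp A psi phi \<circ> f = psi \<circ> (phi \<circ> f)" if "A \<in> noeth" "f \<in> C A" for A f and phi psi :: "'a => 'a"
  by (rule compose_comp) (use C[OF that(1)] that(2) in \<open>auto simp: witt_carrier_def\<close>)
 moreover have "(\<lambda>f. phi \<circ> f) = (\<circ>) phi" for phi :: "'a => 'a" by (rule ext) simp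
 ultimately show ?thesis unfolding presheaf_of_rings_def witt_sub_def by simp
qed

lemma witt_sub_incl:
 assumes "!!A. A \<in> noeth ==> C A \<subseteq> D A"
 shows "presheaf_morphism (witt_sub C) (witt_sub D) incl"
 unfolding presheaf_morphism_def
proof (intro conjI ballI)
 fix A :: "'a ring" assume A: "A \<in> noeth"
 show "incl A \<in> ring_hom (sec (witt_sub C) A) (sec (witt_sub D) A)"
  by (rule ring_hom_memI) (use assms[OF A] in \<open>auto simp: incl_def\<close>)
qed (simp add: incl_def)

lemma W_pre_presheaf: "presheaf_of_rings W_pre"
 unfolding W_pre_eq
proof (rule witt_sub_presheaf)
 fix A :: "'a ring" assume A: "A \<in> noeth"
 interpret W: cring "Witt A" by (rule Witt_cring[OF noeth_cring[OF A]])
 show "subring (witt_carrier A) (Witt A)" using W.carrier_is_subring by simp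
qed (auto intro: witt_carrier_hom homs_ring_hom)

lemma W_rat_pre_presheaf: "infinite (UNIV :: 'a set) ==> presheaf_of_rings (W_rat_pre :: ('a, nat => 'a) presheaf)"
 unfolding W_rat_pre_eq by (rule witt_sub_presheaf) (auto intro: rat_subring rat_carrier_hom homs_ring_hom noeth_cring)

lemma W_J_pre_presheaf: "infinite (UNIV :: 'a set) ==> presheaf_of_rings (W_J_pre :: ('a, nat => 'a) presheaf)"
 unfolding W_J_pre_eq by (rule witt_sub_presheaf) (auto intro: J_subring J_carrier_hom homs_ring_hom noeth_cring)

section \<open>Coverings by components and by adjoined roots\<close>

context site
begin

text \<open>Both halves of the theorem use closed coverings in this form. In the first they belong
  to \<open>K\<close> by hypothesis; in the second they are coverings by finite morphisms, because
  closed immersions are finite, and so have a refinement in \<open>K\<close>.\<close>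

lemma closed_covering_refined:
 assumes K: "contains_finite_closed_coverings K \<or> finer K f_pretopology" and A: "A \<in> noeth"
  and S: "S \<subseteq> arrows_into A" "finite S" "\<forall>(B, phi) \<in> S. closed_immersion A B phi" "jointly_surjective A S"
 shows "\<exists>R \<in> K A. refines A R S"
 using K
proof
 assume "contains_finite_closed_coverings K"
 then have "S \<in> K A" using A S unfolding contains_finite_closed_coverings_def by blast
 moreover have "refines A S S" unfolding refines_def
 proof clarify
  fix B phi assume B: "(B, phi) \<in> S"
  then have "B \<in> noeth" "phi \<in> homs A B" using S(1) by (auto simp: arrows_into_def)
  then show "\<exists>(C, psi) \<in> S. \<exists>rho \<in> homs C B. phi = hcomp A rho psi"
   using id_hom_compose[of phi A B] id_hom_homs[OF noeth_cring[of B]]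
   by (intro bexI[OF _ B]) (auto intro!: bexI[of _ "id_hom B"])
 qed
 ultimately show ?thesis by blast
next
 assume "finer K f_pretopology"
 moreover have "\<forall>(B, phi) \<in> S. finite_morphism A B phi"
  using S(1,3) closed_immersion_finite[OF A] by fast
 then have "S \<in> f_pretopology A" using S(1,4) by (simp add: f_pretopology_def)
 ultimately show ?thesis using A unfolding finer_def by blast
qed

lemma locally_refine:
 assumes A: "A \<in> noeth" and R: "R \<in> K A" "refines A R S"
  and Pr: "!!B phi D rho. (B, phi) \<in> S ==> D \<in> noeth ==> rho \<in> homs B D ==> Pr D (hcomp A rho phi)"
 shows "locally A Pr"
 unfolding locally_def
proof (rule bexI[OF _ R(1)], clarify)
 fix D chi assume D: "(D, chi) \<in> R"
 then obtain B phi rho where "(B, phi) \<in> S" "rho \<in> homs B D" "chi = hcomp A rho phi"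
  using R(2) unfolding refines_def by blast
 then show "Pr D chi" using Pr cover_arrow(1)[OF A R(1) D] by simp
qed

definition splits :: "(nat => 'a) => 'a ring => ('a => 'a) => bool" where
 "splits p D chi \<longleftrightarrow> (\<exists>xs. set xs \<subseteq> carrier D \<and> chi \<circ> p = teich_prod D xs)"

lemma stable_splits:
 assumes A: "A \<in> noeth" and p: "p \<in> witt_carrier A"
 shows "stable A (splits p)"
proof (rule stableI)
 fix D chi E rho assume D: "D \<in> noeth" "chi \<in> homs A D" "E \<in> noeth" "rho \<in> homs D E" "splits p D chi"
 then obtain xs where xs: "set xs \<subseteq> carrier D" "chi \<circ> p = teich_prod D xs" unfolding splits_def by blast
 have "hcomp A rho chi \<circ> p = rho \<circ> (chi \<circ> p)" by (rule compose_comp) (rule witt_carrierD(1)[OF p])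
 also have "\<dots> = teich_prod E (map rho xs)"
  unfolding xs(2) by (rule teich_prod_hom[OF noeth_cring[OF D(1)] noeth_cring[OF D(3)] homs_ring_hom[OF D(4)] xs(1)])
 finally show "splits p E (hcomp A rho chi)"
  unfolding splits_def using homs_closed[OF D(4)] xs(1) by (intro exI[of _ "map rho xs"]) auto
qed

text \<open>In contrast to \<open>splitting_extension\<close>, every stage has to be a covering of
  the site. The ring with one root adjoined is finite over \<open>A\<close>, hence Noetherian, and
  the basis property lets \<open>lying_over\<close> prove surjectivity on spectra. The cofactor has
  smaller degree and is split by induction.\<close>

lemma locally_splits:
 assumes inf: "infinite (UNIV :: 'a set)" and K: "finer K f_pretopology"
  and A: "A \<in> noeth" and p: "p \<in> witt_carrier A" "\<forall>n>d. p n = \<zero>\<^bsub>A\<^esub>"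
 shows "locally A (splits p)"
 using A p
proof (induction d arbitrary: A p)
 case 0
 show ?case
 proof (rule locally_all[OF 0(1)])
  fix D chi assume D: "D \<in> noeth" "chi \<in> homs A D"
  have "chi \<circ> \<zero>\<^bsub>Witt A\<^esub> = teich_prod D []"
   using teich_prod_hom[OF noeth_cring[OF 0(1)] noeth_cring[OF D(1)] homs_ring_hom[OF D(2)], of "[]"] by (simp add: teich_prod_simps)
  moreover have "p = \<zero>\<^bsub>Witt A\<^esub>" using 0(3) witt_carrierD(2)[OF 0(2)] by (auto simp: fun_eq_iff)
  ultimately show "splits p D chi" unfolding splits_def by (intro exI[of _ "[]"]) simp
 qed
next
 case (Suc d)
 have cA: "cring A" "noetherian_ring A" using Suc(2) by (auto simp: noeth_def)
 obtain B phi x q where B: "cring B" and phi: "phi \<in> homs A B" and x: "x \<in> carrier B" and q: "q \<in> witt_carrier B" "\<forall>n>d. q n = \<zero>\<^bsub>B\<^esub>"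
  and pq: "phi \<circ> p = ps_mult B (teich B x) q"
  and gen: "\<forall>b \<in> carrier B. \<exists>c. (\<forall>i. c i \<in> carrier A) \<and> b = (\<Oplus>\<^bsub>B\<^esub>i\<in>{..<Suc d}. phi (c i) \<otimes>\<^bsub>B\<^esub> x [^]\<^bsub>B\<^esub> i)"
  and basis: "\<forall>I a c. ideal I A --> a \<in> carrier A --> (\<forall>i. c i \<in> I) -->
   phi a = (\<Oplus>\<^bsub>B\<^esub>i\<in>{..<Suc d}. phi (c i) \<otimes>\<^bsub>B\<^esub> x [^]\<^bsub>B\<^esub> i) --> a \<in> I"
  by atomize_elim (rule adjoin_root_split[OF inf cA(1) Suc(3,4)])
 interpret B: cring B by fact
 note hom = homs_ring_hom[OF phi]
 have y: "x [^]\<^bsub>B\<^esub> i \<in> carrier B" for i :: nat using x by simp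
 have nB: "noetherian_ring B" by (rule noetherian_finite_algebra[OF cA B hom y gen[rule_format]])
 then have Bn: "B \<in> noeth" using B by (simp add: noeth_def)
 have "jointly_surjective A {(B, phi)}" unfolding jointly_surjective_def
 proof (intro allI impI)
  fix I assume I: "primeideal I A"
  have "\<exists>J. primeideal J B \<and> I = {a \<in> carrier A. phi a \<in> J}"
   by (rule lying_over[OF cA(1) B nB hom y gen[rule_format] I]) (use basis primeideal.axioms(1)[OF I] in blast)+
  then show "\<exists>(B, phi) \<in> {(B, phi)}. \<exists>J. primeideal J B \<and> I = {a \<in> carrier A. phi a \<in> J}" by simp
 qed
 then have "{(B, phi)} \<in> f_pretopology A"
  using finite_morphismI[OF cA(1) B hom y gen[rule_format]] Bn phi by (simp add: f_pretopology_def arrows_into_def)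
 then obtain R where R: "R \<in> K A" "refines A R {(B, phi)}" using K Suc(2) unfolding finer_def by blast
 have IH: "locally B (splits q)" by (rule Suc(1)[OF Bn q])
 \<comment> \<open>\<open>K\<close> need not contain the one-member covering by \<open>B\<close>, it
   only refines it. The splitting obtained over \<open>B\<close> is therefore pulled back along
   \<open>rho\<close> to the members of the refinement.\<close>
 show ?case
 proof (rule locally_locally[OF _ Suc(2)], rule locally_refine[OF Suc(2) R])
  fix B' phi' D rho assume "(B', phi') \<in> {(B, phi)}" and D: "D \<in> noeth" "rho \<in> homs B' D"
  then have B': "B' = B" "phi' = phi" by auto
  note D = D[unfolded B']
  have "locally D (\<lambda>E eta. splits q E (hcomp B eta rho))"
   by (rule locally_pull[OF IH stable_splits[OF Bn q(1)] Bn D])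
  then show "locally D (\<lambda>E eta. splits p E (hcomp A eta (hcomp A rho phi')))"
  proof (rule locally_mono[OF _ D(1)])
   fix E eta assume E: "E \<in> noeth" "eta \<in> homs D E" and sp: "splits q E (hcomp B eta rho)"
   define sigma where "sigma = hcomp B eta rho"
   have sigma: "sigma \<in> homs B E" unfolding sigma_def by (rule homs_compose[OF B D(2) E(2)])
   note sigmah = homs_ring_hom[OF sigma]
   obtain xs where xs: "set xs \<subseteq> carrier E" "sigma \<circ> q = teich_prod E xs" using sp unfolding splits_def sigma_def by blast
   have "hcomp A sigma phi \<circ> p = sigma \<circ> (phi \<circ> p)" by (rule compose_comp) (rule witt_carrierD(1)[OF Suc(3)])
   also have "\<dots> = ps_mult E (sigma \<circ> teich B x) (sigma \<circ> q)" unfolding pq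
    by (rule ps_mult_hom[OF B noeth_cring[OF E(1)] sigmah]) (use teich_closed[OF B x] q(1) witt_carrierD in auto)
   also have "\<dots> = teich_prod E (sigma x # xs)"
    unfolding xs(2) teich_hom[OF B noeth_cring[OF E(1)] sigmah x] teich_prod_simps ..
   finally have "hcomp A sigma phi \<circ> p = teich_prod E (sigma x # xs)" .
   moreover have "hcomp A eta (hcomp A rho phi') = hcomp A sigma phi"
    unfolding sigma_def B' by (rule homs_compose_assoc[OF phi])
   ultimately show "splits p E (hcomp A eta (hcomp A rho phi'))"
    unfolding splits_def using xs(1) homs_closed[OF sigma x] by (intro exI[of _ "sigma x # xs"]) simp
  qed
 qed
qed

end

lemma incl_morphism:
 assumes "pretopology K" "presheaf_of_rings (witt_sub C)" "presheaf_of_rings (witt_sub D)" "!!A. A \<in> noeth ==> C A \<subseteq> D A"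
 shows "site_morphism K (witt_sub C) (witt_sub D) incl"
 by unfold_locales (use assms witt_sub_incl[OF assms(4)] in auto)

lemma incl_locally_injective:
 assumes "site_morphism K (witt_sub C) (witt_sub D) incl"
 shows "site_morphism.locally_injective K (witt_sub C) incl"
proof -
 interpret site_morphism K "witt_sub C" "witt_sub D" incl by fact
 show ?thesis unfolding locally_injective_def
 proof (intro ballI impI)
  fix A :: "'a ring" and x y assume A: "A \<in> noeth" and "incl A x = incl A y"
  then have "x = y" by (simp add: incl_def)
  then show "F.locally A (\<lambda>D chi. res (witt_sub C) A D chi x = res (witt_sub C) A D chi y)" by (intro F.locally_all[OF A]) simp
 qed
qed

lemma rat_J_locally_surjective:
 fixes K :: "'a covers"
 assumes m: "site_morphism K (witt_sub rat_carrier) (witt_sub J_carrier) incl"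
  and K: "contains_finite_closed_coverings K \<or> finer K f_pretopology"
 shows "site_morphism.locally_surjective K (witt_sub rat_carrier) (witt_sub J_carrier) incl"
proof -
 interpret site_morphism K "witt_sub rat_carrier" "witt_sub J_carrier" incl by fact
 show ?thesis unfolding locally_surjective_def
 proof (intro ballI)
  fix A :: "'a ring" and y assume A: "A \<in> noeth" and "y \<in> carrier (sec (witt_sub J_carrier) A)"
  then have y: "y \<in> J_carrier A" by simp
  obtain S where S: "S \<subseteq> arrows_into A" "finite S" "\<forall>(B, phi) \<in> S. closed_immersion A B phi" "jointly_surjective A S"
   "J_carrier A = {h \<in> witt_carrier A. \<forall>(B, phi) \<in> S. phi \<circ> h \<in> rat_carrier B}"
   using J_carrier_components[OF A] by blast
  obtain R where R: "R \<in> K A" "refines A R S" using F.closed_covering_refined[OF K A S(1-4)] by blast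
  show "F.locally A (\<lambda>D chi. \<exists>x \<in> carrier (sec (witt_sub rat_carrier) D). incl D x = res (witt_sub J_carrier) A D chi y)"
  proof (rule F.locally_refine[OF A R])
   fix B phi D rho assume B: "(B, phi) \<in> S" and D: "D \<in> noeth" "rho \<in> homs B D"
   have cB: "cring B" using S(1) B by (auto simp: arrows_into_def noeth_def)
   have yw: "y \<in> witt_carrier A" and yB: "phi \<circ> y \<in> rat_carrier B" using y S(5) B by auto
   have "hcomp A rho phi \<circ> y = rho \<circ> (phi \<circ> y)" by (rule compose_comp) (rule witt_carrierD(1)[OF yw])
   then have "hcomp A rho phi \<circ> y \<in> rat_carrier D"
    using rat_carrier_hom[OF cB noeth_cring[OF D(1)] homs_ring_hom[OF D(2)] yB] by simp
   then show "\<exists>x \<in> carrier (sec (witt_sub rat_carrier) D). incl D x = res (witt_sub J_carrier) A D (hcomp A rho phi) y"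
    by (intro bexI[of _ "hcomp A rho phi \<circ> y"]) (simp_all add: incl_def)
  qed
 qed
qed

section \<open>The reduced monoid ring\<close>

text \<open>A finitely supported function is determined by its pairings with all test functions.
  Under the pairing, convolution becomes an iterated pairing, and the laws of the monoid ring follow
  from those of the multiplication of \<open>A\<close> without rearranging sums over fibres.\<close>

definition pairing :: "('a => int) => ('a => int) => int" where
 "pairing x g = (\<Sum>a | x a \<noteq> 0. x a * g a)"

definition monomial :: "int => 'a => 'a => int" where
 "monomial k a = (\<lambda>b. if b = a then k else 0)"

lemma pairing_superset: "finite S ==> {a. x a \<noteq> 0} \<subseteq> S ==> pairing x g = (\<Sum>a\<in>S. x a * g a)"
 unfolding pairing_def by (rule sum.mono_neutral_left) auto

lemma pairing_monomial [simp]: "pairing (monomial k a) g = k * g a"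
proof -
 have "{b. monomial k a b \<noteq> 0} \<subseteq> {a}" by (auto simp: monomial_def)
 then have "pairing (monomial k a) g = (\<Sum>b\<in>{a}. monomial k a b * g b)" by (intro pairing_superset) simp_all
 then show ?thesis by (simp add: monomial_def)
qed

lemma pairing_delta:
 assumes "finite {a. x a \<noteq> 0}"
 shows "pairing x (monomial 1 a) = x a"
proof -
 let ?S = "insert a {a. x a \<noteq> 0}"
 have "pairing x (monomial 1 a) = (\<Sum>b\<in>?S. x b * monomial 1 a b)" by (rule pairing_superset) (use assms in auto)
 also have "\<dots> = (\<Sum>b\<in>?S. if b = a then x b else 0)" by (rule sum.cong) (auto simp: monomial_def)
 also have "\<dots> = x a" using assms by simp
 finally show ?thesis .
qed

lemma pairing_ext:
 assumes "finite {a. x a \<noteq> 0}" "finite {a. y a \<noteq> 0}" "!!g. pairing x g = pairing y g"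
 shows "x = y"
 using assms(3)[of "monomial 1 _"] by (intro ext) (simp add: pairing_delta assms(1,2))

lemma pairing_cong: "(!!a. x a \<noteq> 0 ==> g a = h a) ==> pairing x g = pairing x h"
 unfolding pairing_def by (rule sum.cong) auto

lemma pairing_mult_right: "pairing x (\<lambda>a. k * g a) = k * pairing x g"
 unfolding pairing_def by (simp add: sum_distrib_left mult.left_commute)

lemma pairing_swap: "pairing x (\<lambda>a. pairing y (\<lambda>b. g a b)) = pairing y (\<lambda>b. pairing x (\<lambda>a. g a b))"
proof -
 have "pairing x (\<lambda>a. pairing y (\<lambda>b. g a b)) = (\<Sum>a | x a \<noteq> 0. \<Sum>b | y b \<noteq> 0. x a * (y b * g a b))"
  unfolding pairing_def by (simp add: sum_distrib_left)
 also have "\<dots> = (\<Sum>b | y b \<noteq> 0. \<Sum>a | x a \<noteq> 0. x a * (y b * g a b))" by (rule sum.swap)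
 also have "\<dots> = pairing y (\<lambda>b. pairing x (\<lambda>a. g a b))"
  unfolding pairing_def by (simp add: sum_distrib_left mult.left_commute)
 finally show ?thesis .
qed

lemma pairing_add_left:
 assumes "finite {a. x a \<noteq> 0}" "finite {a. y a \<noteq> 0}"
 shows "pairing (\<lambda>a. x a + y a) g = pairing x g + pairing y g"
proof -
 let ?S = "{a. x a \<noteq> 0} \<union> {a. y a \<noteq> 0}"
 have S: "finite ?S" using assms by simp
 have "pairing (\<lambda>a. x a + y a) g = (\<Sum>a\<in>?S. (x a + y a) * g a)" by (rule pairing_superset[OF S]) auto
 also have "\<dots> = pairing x g + pairing y g"
  by (simp add: distrib_right sum.distrib pairing_superset[OF S, of x] pairing_superset[OF S, of y])
 finally show ?thesis .
qed

text \<open>Push-forward of finitely supported weights along \<open>f\<close>. Both the product of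
  the monoid ring, along multiplication of pairs, and \<open>monoid_ring_map\<close>, along
  \<open>phi\<close>, are instances.\<close>

lemma pairing_pushforward:
 assumes fin: "finite P"
 shows "finite {c. (\<Sum>p\<in>{p \<in> P. f p = c}. w p) \<noteq> 0}"
  "pairing (\<lambda>c. \<Sum>p\<in>{p \<in> P. f p = c}. w p) g = (\<Sum>p\<in>P. w p * g (f p))"
proof -
 have sub: "{c. (\<Sum>p\<in>{p \<in> P. f p = c}. w p) \<noteq> 0} \<subseteq> f ` P"
 proof
  fix c assume "c \<in> {c. (\<Sum>p\<in>{p \<in> P. f p = c}. w p) \<noteq> 0}"
  then have "{p \<in> P. f p = c} \<noteq> {}" by (metis (mono_tags, lifting) mem_Collect_eq sum.empty)
  then show "c \<in> f ` P" by auto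
 qed
 show "finite {c. (\<Sum>p\<in>{p \<in> P. f p = c}. w p) \<noteq> 0}" by (rule finite_subset[OF sub]) (simp add: fin)
 have "pairing (\<lambda>c. \<Sum>p\<in>{p \<in> P. f p = c}. w p) g = (\<Sum>c\<in>f ` P. (\<Sum>p\<in>{p \<in> P. f p = c}. w p) * g c)"
  by (rule pairing_superset[OF _ sub]) (simp add: fin)
 also have "\<dots> = (\<Sum>c\<in>f ` P. \<Sum>p\<in>{p \<in> P. f p = c}. w p * g (f p))"
  by (rule sum.cong) (simp_all add: sum_distrib_right)
 also have "\<dots> = (\<Sum>p\<in>P. w p * g (f p))" by (rule sum.group) (simp_all add: fin)
 finally show "pairing (\<lambda>c. \<Sum>p\<in>{p \<in> P. f p = c}. w p) g = (\<Sum>p\<in>P. w p * g (f p))" .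
qed

lemma monoid_ring_simps [simp]:
 "\<one>\<^bsub>monoid_ring A\<^esub> = monomial 1 \<one>\<^bsub>A\<^esub>" "\<zero>\<^bsub>monoid_ring A\<^esub> = (\<lambda>_. 0)" "x \<oplus>\<^bsub>monoid_ring A\<^esub> y = (\<lambda>a. x a + y a)"
 by (simp_all add: monoid_ring_def monomial_def)

lemma monoid_ring_carrier: "x \<in> carrier (monoid_ring A) \<longleftrightarrow> finite {a. x a \<noteq> 0} \<and> (\<forall>a. x a \<noteq> 0 --> a \<in> carrier A)"
 by (auto simp: monoid_ring_def)

lemma monoid_ring_mult:
 fixes A (structure)
 assumes "finite {a. x a \<noteq> 0}" "finite {a. y a \<noteq> 0}"
 shows "finite {c. (x \<otimes>\<^bsub>monoid_ring A\<^esub> y) c \<noteq> 0}"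
  "pairing (x \<otimes>\<^bsub>monoid_ring A\<^esub> y) g = pairing x (\<lambda>a. pairing y (\<lambda>b. g (a \<otimes> b)))"
proof -
 let ?P = "{a. x a \<noteq> 0} \<times> {b. y b \<noteq> 0}"
 have P: "finite ?P" using assms by simp
 have set: "{(a, b). x a \<noteq> 0 \<and> y b \<noteq> 0 \<and> a \<otimes> b = c} = {p \<in> ?P. fst p \<otimes> snd p = c}" for c by auto
 have eq: "x \<otimes>\<^bsub>monoid_ring A\<^esub> y = (\<lambda>c. \<Sum>p\<in>{p \<in> ?P. fst p \<otimes> snd p = c}. x (fst p) * y (snd p))"
  unfolding monoid_ring_def monoid.simps set by (simp add: case_prod_unfold)
 note pf = pairing_pushforward[OF P, where f = "\<lambda>p. fst p \<otimes> snd p" and w = "\<lambda>p. x (fst p) * y (snd p)"]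
 show "finite {c. (x \<otimes>\<^bsub>monoid_ring A\<^esub> y) c \<noteq> 0}" unfolding eq by (rule pf)
 have "pairing (x \<otimes>\<^bsub>monoid_ring A\<^esub> y) g = (\<Sum>p\<in>?P. x (fst p) * y (snd p) * g (fst p \<otimes> snd p))"
  unfolding eq by (rule pf)
 also have "\<dots> = (\<Sum>a | x a \<noteq> 0. \<Sum>b | y b \<noteq> 0. x a * y b * g (a \<otimes> b))"
  by (simp add: sum.cartesian_product case_prod_unfold)
 also have "\<dots> = pairing x (\<lambda>a. pairing y (\<lambda>b. g (a \<otimes> b)))"
  unfolding pairing_def by (simp add: sum_distrib_left mult.assoc)
 finally show "pairing (x \<otimes>\<^bsub>monoid_ring A\<^esub> y) g = pairing x (\<lambda>a. pairing y (\<lambda>b. g (a \<otimes> b)))" .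
qed

lemma pairing_support:
 assumes "finite {a. x a \<noteq> 0}" "!!g. (!!a. a \<in> S ==> g a = 0) ==> pairing x g = 0" "x a \<noteq> 0"
 shows "a \<in> S"
proof (rule ccontr)
 assume "a \<notin> S"
 then have "pairing x (monomial 1 a) = 0" by (intro assms(2)) (auto simp: monomial_def)
 then show False using pairing_delta[OF assms(1)] assms(3) by simp
qed

lemma pairing_0: "(!!a. x a \<noteq> 0 ==> g a = 0) ==> pairing x g = 0"
 unfolding pairing_def by (rule sum.neutral) auto

lemma monoid_ring_mult_closed:
 assumes A: "cring A" and x: "x \<in> carrier (monoid_ring A)" and y: "y \<in> carrier (monoid_ring A)"
 shows "x \<otimes>\<^bsub>monoid_ring A\<^esub> y \<in> carrier (monoid_ring A)"
proof -
 interpret cring A by fact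
 have f: "finite {a. x a \<noteq> 0}" "finite {a. y a \<noteq> 0}" using x y by (auto simp: monoid_ring_carrier)
 note m = monoid_ring_mult[OF f, where A = A]
 have "c \<in> carrier A" if "(x \<otimes>\<^bsub>monoid_ring A\<^esub> y) c \<noteq> 0" for c
 proof (rule pairing_support[OF m(1) _ that])
  fix g :: "'a => int" assume g: "!!a. a \<in> carrier A ==> g a = 0"
  show "pairing (x \<otimes>\<^bsub>monoid_ring A\<^esub> y) g = 0"
   unfolding m(2) by (intro pairing_0) (use g x y in \<open>auto simp: monoid_ring_carrier\<close>)
 qed
 then show ?thesis using m(1) unfolding monoid_ring_carrier by blast
qed

lemma monoid_ring_cring:
 fixes A (structure)
 assumes A: "cring A"
 shows "cring (monoid_ring A)"
proof -
 interpret cring A by fact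
 let ?M = "monoid_ring A"
 have fin: "finite {a. x a \<noteq> 0}" and car: "x a \<noteq> 0 ==> a \<in> carrier A" if "x \<in> carrier ?M" for x a
  using that by (auto simp: monoid_ring_carrier)
 have eqI: "x = y" if "x \<in> carrier ?M" "y \<in> carrier ?M" "!!g. pairing x g = pairing y g" for x y
  by (rule pairing_ext) (use that fin in auto)
 note cl = monoid_ring_mult_closed[OF A]
 have pm: "pairing (x \<otimes>\<^bsub>?M\<^esub> y) g = pairing x (\<lambda>a. pairing y (\<lambda>b. g (a \<otimes> b)))"
  if "x \<in> carrier ?M" "y \<in> carrier ?M" for x y g by (rule monoid_ring_mult(2)[OF fin[OF that(1)] fin[OF that(2)]])
 have add: "(\<lambda>a. x a + y a) \<in> carrier ?M" if "x \<in> carrier ?M" "y \<in> carrier ?M" for x y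
 proof -
  have "{a. x a + y a \<noteq> 0} \<subseteq> {a. x a \<noteq> 0} \<union> {a. y a \<noteq> 0}" by auto
  then have "finite {a. x a + y a \<noteq> 0}" by (rule finite_subset) (simp add: fin that)
  moreover have "a \<in> carrier A" if "x a + y a \<noteq> 0" for a
   using that car[OF \<open>x \<in> carrier ?M\<close>, of a] car[OF \<open>y \<in> carrier ?M\<close>, of a] by fastforce
  ultimately show ?thesis unfolding monoid_ring_carrier by blast
 qed
 have one: "monomial 1 \<one> \<in> carrier ?M" by (auto simp: monoid_ring_carrier monomial_def)
 have zero: "(\<lambda>_. 0) \<in> carrier ?M" by (simp add: monoid_ring_carrier)
 show ?thesis
 proof (rule cringI)
  show "abelian_group ?M"
  proof (rule abelian_groupI)
   fix x assume x: "x \<in> carrier ?M"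
   then have "(\<lambda>a. - x a) \<in> carrier ?M" by (simp add: monoid_ring_carrier)
   then show "\<exists>y \<in> carrier ?M. y \<oplus>\<^bsub>?M\<^esub> x = \<zero>\<^bsub>?M\<^esub>" by (rule bexI[rotated]) simp
  qed (auto simp: add zero fun_eq_iff)
  show "comm_monoid ?M"
  proof (rule comm_monoidI)
   fix x y z assume x: "x \<in> carrier ?M" and y: "y \<in> carrier ?M" and z: "z \<in> carrier ?M"
   show "x \<otimes>\<^bsub>?M\<^esub> y \<in> carrier ?M" by (rule cl[OF x y])
   show "x \<otimes>\<^bsub>?M\<^esub> y \<otimes>\<^bsub>?M\<^esub> z = x \<otimes>\<^bsub>?M\<^esub> (y \<otimes>\<^bsub>?M\<^esub> z)"
    by (intro eqI cl x y z) (use x y z cl in \<open>auto simp: pm car[OF x] car[OF y] car[OF z] m_assoc intro!: pairing_cong\<close>)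
   show "x \<otimes>\<^bsub>?M\<^esub> y = y \<otimes>\<^bsub>?M\<^esub> x"
   proof (intro eqI cl x y)
    fix g :: "'a => int"
    have "pairing (x \<otimes>\<^bsub>?M\<^esub> y) g = pairing x (\<lambda>a. pairing y (\<lambda>b. g (b \<otimes> a)))"
     unfolding pm[OF x y] by (intro pairing_cong) (use car[OF x] car[OF y] m_comm in simp)
    then show "pairing (x \<otimes>\<^bsub>?M\<^esub> y) g = pairing (y \<otimes>\<^bsub>?M\<^esub> x) g"
     unfolding pm[OF y x] pairing_swap[of x] .
   qed
   show "\<one>\<^bsub>?M\<^esub> \<otimes>\<^bsub>?M\<^esub> x = x"
   proof (rule eqI[OF _ x])
    show "\<one>\<^bsub>?M\<^esub> \<otimes>\<^bsub>?M\<^esub> x \<in> carrier ?M" using cl[OF one x] by simp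
    fix g :: "'a => int"
    have "pairing (\<one>\<^bsub>?M\<^esub> \<otimes>\<^bsub>?M\<^esub> x) g = pairing x (\<lambda>b. g (\<one> \<otimes> b))" using pm[OF one x] by simp
    also have "\<dots> = pairing x g" by (rule pairing_cong) (use car[OF x] in simp)
    finally show "pairing (\<one>\<^bsub>?M\<^esub> \<otimes>\<^bsub>?M\<^esub> x) g = pairing x g" .
   qed
  qed (use one in simp)
  fix x y z assume x: "x \<in> carrier ?M" and y: "y \<in> carrier ?M" and z: "z \<in> carrier ?M"
  show "(x \<oplus>\<^bsub>?M\<^esub> y) \<otimes>\<^bsub>?M\<^esub> z = x \<otimes>\<^bsub>?M\<^esub> z \<oplus>\<^bsub>?M\<^esub> y \<otimes>\<^bsub>?M\<^esub> z"
   unfolding monoid_ring_simps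
  proof (intro eqI cl add x y z)
   fix g :: "'a => int"
   show "pairing ((\<lambda>a. x a + y a) \<otimes>\<^bsub>?M\<^esub> z) g = pairing (\<lambda>a. (x \<otimes>\<^bsub>?M\<^esub> z) a + (y \<otimes>\<^bsub>?M\<^esub> z) a) g"
    by (simp add: pm add cl x y z pairing_add_left fin)
  qed
 qed
qed

lemma monomial_closed: "a \<in> carrier A ==> monomial k a \<in> carrier (monoid_ring A)"
 by (auto simp: monoid_ring_carrier monomial_def)

lemma monoid_ring_induct [consumes 1, case_names zero add]:
 assumes "x \<in> carrier (monoid_ring A)" and "P (\<lambda>_. 0)"
  and "!!x k a. x \<in> carrier (monoid_ring A) ==> a \<in> carrier A ==> P x ==> P (\<lambda>b. x b + monomial k a b)"
 shows "P x"
proof -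
 have "P x" if "finite S" "{a. x a \<noteq> 0} = S" "S \<subseteq> carrier A" for S x
  using that
 proof (induction S arbitrary: x rule: finite_induct)
  case empty
  then have "x = (\<lambda>_. 0)" by auto
  then show ?case using assms(2) by simp
 next
  case (insert a S)
  have s: "{b. (x(a := 0)) b \<noteq> 0} = S" using insert(2,4) by auto
  have P: "P (x(a := 0))" by (rule insert(3)[OF s]) (use insert(5) in simp)
  have "x(a := 0) \<in> carrier (monoid_ring A)" unfolding monoid_ring_carrier s using insert(1,5) s by blast
  then have "P (\<lambda>b. (x(a := 0)) b + monomial (x a) a b)" by (rule assms(3)[OF _ _ P]) (use insert(5) in simp)
  moreover have "(\<lambda>b. (x(a := 0)) b + monomial (x a) a b) = x" by (auto simp: monomial_def)
  ultimately show ?case by simp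
 qed
 then show ?thesis using assms(1) by (auto simp: monoid_ring_carrier)
qed

lemma monoid_ring_map:
 assumes "finite {a. x a \<noteq> 0}"
 shows "finite {b. monoid_ring_map phi x b \<noteq> 0}" "pairing (monoid_ring_map phi x) g = pairing x (\<lambda>a. g (phi a))"
proof -
 have eq: "monoid_ring_map phi x = (\<lambda>b. \<Sum>a\<in>{a \<in> {a. x a \<noteq> 0}. phi a = b}. x a)" by (simp add: monoid_ring_map_def)
 show "finite {b. monoid_ring_map phi x b \<noteq> 0}" unfolding eq by (rule pairing_pushforward(1)[OF assms])
 show "pairing (monoid_ring_map phi x) g = pairing x (\<lambda>a. g (phi a))"
  unfolding eq pairing_pushforward(2)[OF assms] by (simp add: pairing_def)
qed

lemma monoid_ring_map_closed:
 assumes phi: "!!a. a \<in> carrier A ==> phi a \<in> carrier B" and x: "x \<in> carrier (monoid_ring A)"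
 shows "monoid_ring_map phi x \<in> carrier (monoid_ring B)"
proof -
 have f: "finite {a. x a \<noteq> 0}" using x by (auto simp: monoid_ring_carrier)
 have "b \<in> carrier B" if "monoid_ring_map phi x b \<noteq> 0" for b
 proof (rule pairing_support[OF monoid_ring_map(1)[OF f] _ that])
  fix g :: "'a => int" assume g: "!!a. a \<in> carrier B ==> g a = 0"
  show "pairing (monoid_ring_map phi x) g = 0"
   unfolding monoid_ring_map(2)[OF f] by (intro pairing_0) (use g phi x in \<open>auto simp: monoid_ring_carrier\<close>)
 qed
 then show ?thesis using monoid_ring_map(1)[OF f] unfolding monoid_ring_carrier by blast
qed

lemma monoid_ring_map_monomial: "monoid_ring_map phi (monomial k a) = monomial k (phi a)"
proof -
 have f: "finite {b. monomial k c b \<noteq> 0}" for c :: 'a by (simp add: monomial_def)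
 show ?thesis by (rule pairing_ext[OF monoid_ring_map(1)[OF f] f]) (simp add: monoid_ring_map(2)[OF f])
qed

lemma monoid_ring_map_add:
 assumes "finite {a. x a \<noteq> 0}" "finite {a. y a \<noteq> 0}"
 shows "monoid_ring_map phi (\<lambda>a. x a + y a) = (\<lambda>b. monoid_ring_map phi x b + monoid_ring_map phi y b)"
proof (rule pairing_ext)
 have f: "finite {a. u a + v a \<noteq> 0}" if "finite {a. u a \<noteq> 0}" "finite {a. v a \<noteq> 0}" for u v :: "'a => int"
 proof -
  have "{a. u a + v a \<noteq> 0} \<subseteq> {a. u a \<noteq> 0} \<union> {a. v a \<noteq> 0}" by auto
  then show ?thesis by (rule finite_subset) (simp add: that)
 qed
 note m = monoid_ring_map(1)[OF assms(1), of phi] monoid_ring_map(1)[OF assms(2), of phi]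
 show "finite {b. monoid_ring_map phi (\<lambda>a. x a + y a) b \<noteq> 0}" by (rule monoid_ring_map(1)[OF f[OF assms]])
 show "finite {b. monoid_ring_map phi x b + monoid_ring_map phi y b \<noteq> 0}" by (rule f[OF m])
 show "pairing (monoid_ring_map phi (\<lambda>a. x a + y a)) g = pairing (\<lambda>b. monoid_ring_map phi x b + monoid_ring_map phi y b) g" for g
  by (simp add: monoid_ring_map(2) f assms pairing_add_left m)
qed

lemma monoid_ring_map_hom:
 assumes A: "cring A" and B: "cring B" and phi: "phi \<in> ring_hom A B"
 shows "monoid_ring_map phi \<in> ring_hom (monoid_ring A) (monoid_ring B)"
proof (rule ring_hom_memI)
 have fin: "finite {a. x a \<noteq> 0}" if "x \<in> carrier (monoid_ring C)" for x and C :: "'a ring"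
  using that by (auto simp: monoid_ring_carrier)
 have cl: "monoid_ring_map phi x \<in> carrier (monoid_ring B)" if "x \<in> carrier (monoid_ring A)" for x
  by (rule monoid_ring_map_closed[OF _ that]) (rule ring_hom_closed[OF phi])
 fix x assume x: "x \<in> carrier (monoid_ring A)"
 show "monoid_ring_map phi x \<in> carrier (monoid_ring B)" by (rule cl[OF x])
 fix y assume y: "y \<in> carrier (monoid_ring A)"
 show "monoid_ring_map phi (x \<oplus>\<^bsub>monoid_ring A\<^esub> y) = monoid_ring_map phi x \<oplus>\<^bsub>monoid_ring B\<^esub> monoid_ring_map phi y"
  by (simp add: monoid_ring_map_add fin[OF x] fin[OF y])
 show "monoid_ring_map phi (x \<otimes>\<^bsub>monoid_ring A\<^esub> y) = monoid_ring_map phi x \<otimes>\<^bsub>monoid_ring B\<^esub> monoid_ring_map phi y"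
 proof (rule pairing_ext)
  have xy: "x \<otimes>\<^bsub>monoid_ring A\<^esub> y \<in> carrier (monoid_ring A)" by (rule monoid_ring_mult_closed[OF A x y])
  show "finite {b. monoid_ring_map phi (x \<otimes>\<^bsub>monoid_ring A\<^esub> y) b \<noteq> 0}" by (rule fin[OF cl[OF xy]])
  show "finite {b. (monoid_ring_map phi x \<otimes>\<^bsub>monoid_ring B\<^esub> monoid_ring_map phi y) b \<noteq> 0}"
   by (rule fin[OF monoid_ring_mult_closed[OF B cl[OF x] cl[OF y]]])
  fix g :: "'a => int"
  have "pairing (monoid_ring_map phi (x \<otimes>\<^bsub>monoid_ring A\<^esub> y)) g = pairing x (\<lambda>a. pairing y (\<lambda>b. g (phi (a \<otimes>\<^bsub>A\<^esub> b))))"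
   unfolding monoid_ring_map(2)[OF fin[OF xy]] monoid_ring_mult(2)[OF fin[OF x] fin[OF y]] ..
  also have "\<dots> = pairing x (\<lambda>a. pairing y (\<lambda>b. g (phi a \<otimes>\<^bsub>B\<^esub> phi b)))"
   by (intro pairing_cong) (use x y ring_hom_mult[OF phi] in \<open>simp add: monoid_ring_carrier\<close>)
  also have "\<dots> = pairing (monoid_ring_map phi x \<otimes>\<^bsub>monoid_ring B\<^esub> monoid_ring_map phi y) g"
   unfolding monoid_ring_mult(2)[OF fin[OF cl[OF x]] fin[OF cl[OF y]]] monoid_ring_map(2)[OF fin[OF x]] monoid_ring_map(2)[OF fin[OF y]] ..
  finally show "pairing (monoid_ring_map phi (x \<otimes>\<^bsub>monoid_ring A\<^esub> y)) g = pairing (monoid_ring_map phi x \<otimes>\<^bsub>monoid_ring B\<^esub> monoid_ring_map phi y) g" .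
 qed
next
 show "monoid_ring_map phi \<one>\<^bsub>monoid_ring A\<^esub> = \<one>\<^bsub>monoid_ring B\<^esub>"
  using ring_hom_one[OF phi] by (simp add: monoid_ring_map_monomial)
qed

lemma zero_multiples_eq: "zero_multiples A = range (\<lambda>k. monomial k \<zero>\<^bsub>A\<^esub>)"
 unfolding zero_multiples_def monomial_def ..

lemma zero_multiples_ideal:
 fixes A (structure)
 assumes A: "cring A"
 shows "ideal (zero_multiples A) (monoid_ring A)"
proof -
 interpret A: cring A by fact
 let ?M = "monoid_ring A"
 interpret M: cring ?M by (rule monoid_ring_cring[OF A])
 have zc: "monomial k \<zero> \<in> carrier ?M" for k by (rule monomial_closed) simp
 have zm: "monomial k \<zero> \<otimes>\<^bsub>?M\<^esub> x \<in> zero_multiples A" if x: "x \<in> carrier ?M" for k x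
 proof -
  have f: "finite {a. x a \<noteq> 0}" "finite {a. monomial l \<zero> a \<noteq> 0}" for l using x zc[of l] by (auto simp: monoid_ring_carrier)
  \<comment> \<open>Zero absorbs every basis element, so multiplying by a multiple of (0) only sees
    the sum of the coefficients of \<open>x\<close>, its augmentation
    \<open>pairing x (\<lambda>_. 1)\<close>.\<close>
  have "pairing (monomial k \<zero> \<otimes>\<^bsub>?M\<^esub> x) g = pairing (monomial (k * pairing x (\<lambda>_. 1)) \<zero>) g" for g
  proof -
   have "pairing (monomial k \<zero> \<otimes>\<^bsub>?M\<^esub> x) g = k * pairing x (\<lambda>b. g (\<zero> \<otimes> b))"
    by (simp add: monoid_ring_mult(2)[OF f(2,1)])
   also have "pairing x (\<lambda>b. g (\<zero> \<otimes> b)) = pairing x (\<lambda>b. g \<zero> * 1)"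
    by (rule pairing_cong) (use x in \<open>simp add: monoid_ring_carrier\<close>)
   finally show ?thesis unfolding pairing_mult_right by simp
  qed
  then have "monomial k \<zero> \<otimes>\<^bsub>?M\<^esub> x = monomial (k * pairing x (\<lambda>_. 1)) \<zero>"
   by (rule pairing_ext[OF monoid_ring_mult(1)[OF f(2,1)] f(2)])
  then show ?thesis unfolding zero_multiples_eq by blast
 qed
 have ad: "(\<lambda>a. monomial k \<zero> a + monomial l \<zero> a) = monomial (k + l) \<zero>" for k l by (auto simp: monomial_def)
 have mi: "\<ominus>\<^bsub>?M\<^esub> monomial k \<zero> = monomial (- k) \<zero>" for k
  by (rule M.minus_equality[OF _ zc zc]) (auto simp: ad monomial_def)
 show ?thesis
 proof (rule idealI[OF M.ring_axioms])
  show "subgroup (zero_multiples A) (add_monoid ?M)"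
  proof (rule group.subgroupI[OF M.a_group])
   show "zero_multiples A \<subseteq> carrier (add_monoid ?M)" using zc unfolding zero_multiples_eq by auto
   show "zero_multiples A \<noteq> {}" unfolding zero_multiples_eq by blast
   fix u v assume "u \<in> zero_multiples A" "v \<in> zero_multiples A"
   then obtain k l where u: "u = monomial k \<zero>" "v = monomial l \<zero>" unfolding zero_multiples_eq by blast
   show "inv\<^bsub>add_monoid ?M\<^esub> u \<in> zero_multiples A" using mi[of k] unfolding u zero_multiples_eq by (auto simp: a_inv_def)
   show "u \<otimes>\<^bsub>add_monoid ?M\<^esub> v \<in> zero_multiples A" using ad[of k l] unfolding u zero_multiples_eq by auto
  qed
  fix u x assume "u \<in> zero_multiples A" and x: "x \<in> carrier ?M"
  then obtain k where u: "u = monomial k \<zero>" unfolding zero_multiples_eq by blast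
  show "u \<otimes>\<^bsub>?M\<^esub> x \<in> zero_multiples A" unfolding u by (rule zm[OF x])
  then show "x \<otimes>\<^bsub>?M\<^esub> u \<in> zero_multiples A" unfolding u M.m_comm[OF x zc] .
 qed
qed

lemma coset_absorb:
 assumes R: "ring R" and J: "ideal J R" and j: "j \<in> J" and x: "x \<in> carrier R"
 shows "J +>\<^bsub>R\<^esub> (j \<oplus>\<^bsub>R\<^esub> x) = J +>\<^bsub>R\<^esub> x"
proof -
 interpret R: ring R by fact
 interpret J: abelian_subgroup J R by (rule abelian_subgroupI3[OF ideal.axioms(1)[OF J] R.is_abelian_group])
 have "j \<oplus>\<^bsub>R\<^esub> x \<in> J +>\<^bsub>R\<^esub> x" using j unfolding a_r_coset_def' by blast
 then show ?thesis using J.a_repr_independence'[OF _ x] by simp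
qed

lemma ring_hom_quotient:
 assumes R: "ring R" and I: "ideal I R" and psi: "psi \<in> ring_hom R T" and F: "!!x. x \<in> carrier R ==> F (I +>\<^bsub>R\<^esub> x) = psi x"
 shows "F \<in> ring_hom (R Quot I) T"
proof -
 interpret R: ring R by fact
 interpret I: ideal I R by fact
 note q = I.rcos_ring_hom
 show ?thesis
 proof (rule ring_hom_memI)
  fix u assume "u \<in> carrier (R Quot I)"
  then obtain x where x: "x \<in> carrier R" "u = I +>\<^bsub>R\<^esub> x" unfolding quot_carrier by blast
  show "F u \<in> carrier T" using F[OF x(1)] ring_hom_closed[OF psi x(1)] x(2) by simp
  fix v assume "v \<in> carrier (R Quot I)"
  then obtain y where y: "y \<in> carrier R" "v = I +>\<^bsub>R\<^esub> y" unfolding quot_carrier by blast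
  show "F (u \<otimes>\<^bsub>R Quot I\<^esub> v) = F u \<otimes>\<^bsub>T\<^esub> F v"
   unfolding x(2) y(2) using ring_hom_mult[OF q x(1) y(1)] F[OF R.m_closed[OF x(1) y(1)]] F[OF x(1)] F[OF y(1)]
    ring_hom_mult[OF psi x(1) y(1)] by simp
  show "F (u \<oplus>\<^bsub>R Quot I\<^esub> v) = F u \<oplus>\<^bsub>T\<^esub> F v"
   unfolding x(2) y(2) using ring_hom_add[OF q x(1) y(1)] F[OF R.a_closed[OF x(1) y(1)]] F[OF x(1)] F[OF y(1)]
    ring_hom_add[OF psi x(1) y(1)] by simp
 next
  show "F \<one>\<^bsub>R Quot I\<^esub> = \<one>\<^bsub>T\<^esub>" using ring_hom_one[OF q] F[OF R.one_closed] ring_hom_one[OF psi] by simp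
 qed
qed

abbreviation zclass :: "'a ring => ('a => int) => ('a => int) set" where
 "zclass A x \<equiv> zero_multiples A +>\<^bsub>monoid_ring A\<^esub> x"

lemma Z_pre_carrier: "carrier (sec Z_pre A) = zclass A ` carrier (monoid_ring A)"
 by (simp add: Z_pre_def reduced_monoid_ring_def quot_carrier)

lemma zclass_member:
 assumes A: "cring A" and x: "x \<in> carrier (monoid_ring A)"
 shows "x \<in> zclass A x" "x' \<in> zclass A x ==> \<exists>k. x' = monomial k \<zero>\<^bsub>A\<^esub> \<oplus>\<^bsub>monoid_ring A\<^esub> x"
proof -
 interpret M: cring "monoid_ring A" by (rule monoid_ring_cring[OF A])
 interpret J: abelian_subgroup "zero_multiples A" "monoid_ring A"
  by (rule abelian_subgroupI3[OF ideal.axioms(1)[OF zero_multiples_ideal[OF A]] M.is_abelian_group])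
 show "x \<in> zclass A x" by (rule J.a_rcos_self[OF x])
 show "x' \<in> zclass A x ==> \<exists>k. x' = monomial k \<zero>\<^bsub>A\<^esub> \<oplus>\<^bsub>monoid_ring A\<^esub> x"
  unfolding a_r_coset_def' zero_multiples_eq by blast
qed

lemma zero_monomial_closed: "cring A ==> monomial k \<zero>\<^bsub>A\<^esub> \<in> carrier (monoid_ring A)"
 by (rule monomial_closed) (simp add: cring.cring_simprules)

lemma zclass_eqI:
 assumes A: "cring A" and x: "x \<in> carrier (monoid_ring A)" "y \<in> carrier (monoid_ring A)"
  and d: "x \<ominus>\<^bsub>monoid_ring A\<^esub> y \<in> zero_multiples A"
 shows "zclass A x = zclass A y"
proof -
 interpret M: cring "monoid_ring A" by (rule monoid_ring_cring[OF A])
 have "x = (x \<ominus>\<^bsub>monoid_ring A\<^esub> y) \<oplus>\<^bsub>monoid_ring A\<^esub> y"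
  using x by (simp add: a_minus_def M.a_assoc M.l_neg del: monoid_ring_simps)
 then show ?thesis using coset_absorb[OF M.ring_axioms zero_multiples_ideal[OF A] d x(2)] by simp
qed

text \<open>The restriction of \<open>Z_pre\<close> is a union over a coset; all cosets in this
  union coincide, because \<open>phi\<close> maps multiples of (0) to multiples of (0).\<close>

lemma Z_pre_res:
 assumes A: "cring A" and B: "cring B" and phi: "phi \<in> ring_hom A B" and x: "x \<in> carrier (monoid_ring A)"
 shows "res Z_pre A B phi (zclass A x) = zclass B (monoid_ring_map phi x)"
proof -
 interpret M: cring "monoid_ring B" by (rule monoid_ring_cring[OF B])
 note h = monoid_ring_map_hom[OF A B phi]
 have z: "phi \<zero>\<^bsub>A\<^esub> = \<zero>\<^bsub>B\<^esub>" using ring_hom_zero[OF phi] A B by (simp add: cring_def)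
 have "zclass B (monoid_ring_map phi x') = zclass B (monoid_ring_map phi x)" if x': "x' \<in> zclass A x" for x'
 proof -
  obtain k where "x' = monomial k \<zero>\<^bsub>A\<^esub> \<oplus>\<^bsub>monoid_ring A\<^esub> x" using zclass_member(2)[OF A x x'] by blast
  then have "monoid_ring_map phi x' = monomial k \<zero>\<^bsub>B\<^esub> \<oplus>\<^bsub>monoid_ring B\<^esub> monoid_ring_map phi x"
   using ring_hom_add[OF h zero_monomial_closed[OF A] x] by (simp add: monoid_ring_map_monomial z)
  then show ?thesis
   using coset_absorb[OF M.ring_axioms zero_multiples_ideal[OF B] _ ring_hom_closed[OF h x], of "monomial k \<zero>\<^bsub>B\<^esub>"]
   by (auto simp: zero_multiples_eq)
 qed
 then have "(\<Union>x'\<in>zclass A x. zclass B (monoid_ring_map phi x')) = zclass B (monoid_ring_map phi x)"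
  by (intro SUP_eq_const) (use zclass_member(1)[OF A x] in blast)+
 then show ?thesis by (simp add: Z_pre_def)
qed

lemma Z_pre_presheaf: "presheaf_of_rings Z_pre"
 unfolding presheaf_of_rings_def
proof (intro conjI ballI)
 fix A :: "'a ring" assume A: "A \<in> noeth"
 note cA = noeth_cring[OF A]
 interpret M: cring "monoid_ring A" by (rule monoid_ring_cring[OF cA])
 have sec: "sec Z_pre A = monoid_ring A Quot zero_multiples A" by (simp add: Z_pre_def reduced_monoid_ring_def)
 show "cring (sec Z_pre A)" unfolding sec by (rule ideal.quotient_is_cring[OF zero_multiples_ideal[OF cA] M.is_cring])
 {
  fix U assume "U \<in> carrier (sec Z_pre A)"
  then obtain x where x: "x \<in> carrier (monoid_ring A)" "U = zclass A x" unfolding Z_pre_carrier by blast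
  have f: "finite {a. x a \<noteq> 0}" using x by (simp add: monoid_ring_carrier)
  have "monoid_ring_map (id_hom A) x = x"
  proof (rule pairing_ext[OF monoid_ring_map(1)[OF f] f])
   show "pairing (monoid_ring_map (id_hom A) x) g = pairing x g" for g
    unfolding monoid_ring_map(2)[OF f] by (rule pairing_cong) (use x in \<open>simp add: monoid_ring_carrier id_hom_def\<close>)
  qed
  then show "res Z_pre A A (id_hom A) U = U"
   using Z_pre_res[OF cA cA homs_ring_hom[OF id_hom_homs[OF cA]] x(1)] x(2) by simp
 }
 fix B :: "'a ring" and phi assume B: "B \<in> noeth" and phi: "phi \<in> homs A B"
 note cB = noeth_cring[OF B] and h = monoid_ring_map_hom[OF cA noeth_cring[OF B] homs_ring_hom[OF phi]]
 have secB: "sec Z_pre B = monoid_ring B Quot zero_multiples B" by (simp add: Z_pre_def reduced_monoid_ring_def)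
 show "res Z_pre A B phi \<in> ring_hom (sec Z_pre A) (sec Z_pre B)" unfolding sec secB
  by (rule ring_hom_quotient[OF M.ring_axioms zero_multiples_ideal[OF cA] ring_hom_trans[OF h ideal.rcos_ring_hom[OF zero_multiples_ideal[OF cB]]]])
   (simp add: Z_pre_res[OF cA cB homs_ring_hom[OF phi]])
 fix C :: "'a ring" and psi U assume C: "C \<in> noeth" and psi: "psi \<in> homs B C" and "U \<in> carrier (sec Z_pre A)"
 then obtain x where x: "x \<in> carrier (monoid_ring A)" "U = zclass A x" unfolding Z_pre_carrier by blast
 note cC = noeth_cring[OF C]
 have f: "finite {a. x a \<noteq> 0}" using x by (simp add: monoid_ring_carrier)
 have "monoid_ring_map (hcomp A psi phi) x = monoid_ring_map psi (monoid_ring_map phi x)"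
 proof (rule pairing_ext[OF monoid_ring_map(1)[OF f] monoid_ring_map(1)[OF monoid_ring_map(1)[OF f]]])
  show "pairing (monoid_ring_map (hcomp A psi phi) x) g = pairing (monoid_ring_map psi (monoid_ring_map phi x)) g" for g
   unfolding monoid_ring_map(2)[OF f] monoid_ring_map(2)[OF monoid_ring_map(1)[OF f]]
   by (rule pairing_cong) (use x in \<open>simp add: monoid_ring_carrier compose_def\<close>)
 qed
 then show "res Z_pre A C (hcomp A psi phi) U = res Z_pre B C psi (res Z_pre A B phi U)"
  unfolding x(2) Z_pre_res[OF cA cB homs_ring_hom[OF phi] x(1)] Z_pre_res[OF cB cC homs_ring_hom[OF psi] ring_hom_closed[OF h x(1)]]
   Z_pre_res[OF cA cC homs_ring_hom[OF homs_compose[OF cA phi psi]] x(1)] by simp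
qed

section \<open>The map from the monoid ring to the Witt ring\<close>

lemma omega_lift_superset:
 assumes A: "cring A" and S: "finite S" "{a. x a \<noteq> 0} \<subseteq> S" "S \<subseteq> carrier A"
 shows "omega_lift A x = (\<Oplus>\<^bsub>Witt A\<^esub>a\<in>S. add_pow (Witt A) (x a) (teich A a))"
proof -
 interpret W: cring "Witt A" by (rule Witt_cring[OF A])
 have t: "teich A a \<in> carrier (Witt A)" if "a \<in> S" for a using teich_closed[OF A] S(3) that by auto
 have z: "add_pow (Witt A) (0::int) u = \<zero>\<^bsub>Witt A\<^esub>" for u by (simp add: add_pow_def del: Witt_simps)
 show ?thesis unfolding omega_lift_def
  by (rule W.add.finprod_mono_neutral_cong_left) (use S t in \<open>auto simp: z simp del: Witt_simps intro!: W.add.int_pow_closed\<close>)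
qed

lemma omega_lift_monomial:
 assumes A: "cring A" and a: "a \<in> carrier A"
 shows "omega_lift A (monomial k a) = add_pow (Witt A) k (teich A a)"
proof -
 interpret W: cring "Witt A" by (rule Witt_cring[OF A])
 have "teich A a \<in> carrier (Witt A)" using teich_closed[OF A a] by simp
 then have "add_pow (Witt A) k (teich A a) \<in> carrier (Witt A)" by (rule W.add.int_pow_closed)
 moreover have "omega_lift A (monomial k a) = (\<Oplus>\<^bsub>Witt A\<^esub>b\<in>{a}. add_pow (Witt A) (monomial k a b) (teich A b))"
  by (rule omega_lift_superset[OF A]) (use a in \<open>auto simp: monomial_def\<close>)
 ultimately show ?thesis by (simp add: monomial_def del: Witt_simps)
qed

lemma omega_lift_0:
 assumes "cring A"
 shows "omega_lift A (\<lambda>_. 0) = \<zero>\<^bsub>Witt A\<^esub>"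
proof -
 interpret W: cring "Witt A" by (rule Witt_cring[OF assms])
 show ?thesis using omega_lift_superset[OF assms, of "{}" "\<lambda>_. 0"] by (simp del: Witt_simps)
qed

lemma omega_lift_add:
 assumes A: "cring A" and x: "x \<in> carrier (monoid_ring A)" and y: "y \<in> carrier (monoid_ring A)"
 shows "omega_lift A (\<lambda>a. x a + y a) = omega_lift A x \<oplus>\<^bsub>Witt A\<^esub> omega_lift A y"
proof -
 interpret W: cring "Witt A" by (rule Witt_cring[OF A])
 let ?S = "{a. x a \<noteq> 0} \<union> {a. y a \<noteq> 0}"
 have S: "finite ?S" "?S \<subseteq> carrier A" using x y by (auto simp: monoid_ring_carrier)
 have t: "teich A a \<in> carrier (Witt A)" if "a \<in> ?S" for a using teich_closed[OF A] S(2) that by auto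
 have cl: "add_pow (Witt A) (z a :: int) (teich A a) \<in> carrier (Witt A)" if "a \<in> ?S" for a and z :: "'a => int"
  by (rule W.add.int_pow_closed[OF t[OF that]])
 have "omega_lift A (\<lambda>a. x a + y a) = (\<Oplus>\<^bsub>Witt A\<^esub>a\<in>?S. add_pow (Witt A) (x a + y a) (teich A a))"
  by (rule omega_lift_superset[OF A S(1) _ S(2)]) auto
 also have "\<dots> = (\<Oplus>\<^bsub>Witt A\<^esub>a\<in>?S. add_pow (Witt A) (x a) (teich A a) \<oplus>\<^bsub>Witt A\<^esub> add_pow (Witt A) (y a) (teich A a))"
  by (rule W.finsum_cong') (use t cl in \<open>auto simp: W.add.int_pow_mult simp del: Witt_simps\<close>)
 also have "\<dots> = (\<Oplus>\<^bsub>Witt A\<^esub>a\<in>?S. add_pow (Witt A) (x a) (teich A a)) \<oplus>\<^bsub>Witt A\<^esub> (\<Oplus>\<^bsub>Witt A\<^esub>a\<in>?S. add_pow (Witt A) (y a) (teich A a))"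
  by (rule W.finsum_addf) (use cl in blast)+
 also have "\<dots> = omega_lift A x \<oplus>\<^bsub>Witt A\<^esub> omega_lift A y"
  using omega_lift_superset[OF A S(1) _ S(2), of x] omega_lift_superset[OF A S(1) _ S(2), of y] by (simp del: Witt_simps)
 finally show ?thesis .
qed

lemma omega_lift_rat:
 fixes A :: "'a ring"
 assumes inf: "infinite (UNIV :: 'a set)" and A: "cring A" and x: "x \<in> carrier (monoid_ring A)"
 shows "omega_lift A x \<in> rat_carrier A"
proof -
 interpret W: cring "Witt A" by (rule Witt_cring[OF A])
 note sub = rat_subring[OF inf A]
 have pow: "add_pow (Witt A) (k::int) f \<in> rat_carrier A" if "f \<in> rat_carrier A" for k f
  using group.subgroup_int_pow_closed[OF W.a_group subring.axioms(1)[OF sub] that] by (simp add: add_pow_def)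
 show ?thesis using x
 proof (induction x rule: monoid_ring_induct)
  case zero
  show ?case unfolding omega_lift_0[OF A] by (rule subringE(2)[OF sub])
 next
  case (add x k a)
  show ?case unfolding omega_lift_add[OF A add(1) monomial_closed[OF add(2)]] omega_lift_monomial[OF A add(2)]
   by (rule subringE(7)[OF sub add(3) pow[OF rat_carrier_polys[OF A witt_polys_teich[OF A add(2)]]]])
 qed
qed

lemma omega_lift_closed:
 assumes A: "cring A" and x: "x \<in> carrier (monoid_ring A)"
 shows "omega_lift A x \<in> carrier (Witt A)"
proof -
 interpret W: cring "Witt A" by (rule Witt_cring[OF A])
 show ?thesis using x
 proof (induction x rule: monoid_ring_induct)
  case zero
  show ?case unfolding omega_lift_0[OF A] by (rule W.zero_closed)
 next
  case (add x k a)
  have "teich A a \<in> carrier (Witt A)" using teich_closed[OF A add(2)] by simp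
  then show ?case unfolding omega_lift_add[OF A add(1) monomial_closed[OF add(2)]] omega_lift_monomial[OF A add(2)]
   by (intro W.a_closed add(3) W.add.int_pow_closed)
 qed
qed

text \<open>Additivity in both arguments reduces multiplicativity to monomials, where it is the
  axiom on products of factors 1 - a T.\<close>

lemma omega_lift_hom:
 assumes A: "cring A"
 shows "omega_lift A \<in> ring_hom (monoid_ring A) (Witt A)"
proof -
 interpret A: cring A by fact
 interpret W: cring "Witt A" by (rule Witt_cring[OF A])
 interpret M: cring "monoid_ring A" by (rule monoid_ring_cring[OF A])
 note cl = omega_lift_closed[OF A] and mc = monomial_closed and add = omega_lift_add[OF A] and mon = omega_lift_monomial[OF A]
 have tc: "teich A a \<in> carrier (Witt A)" if "a \<in> carrier A" for a using teich_closed[OF A that] by simp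
 have plus: "(\<lambda>a. x a + y a) = x \<oplus>\<^bsub>monoid_ring A\<^esub> y" for x y by simp
 have mm: "monomial k a \<otimes>\<^bsub>monoid_ring A\<^esub> monomial l b = monomial (k * l) (a \<otimes>\<^bsub>A\<^esub> b)" for k l a b
 proof -
  have f: "finite {b. monomial k a b \<noteq> 0}" for k and a :: 'a by (simp add: monomial_def)
  show ?thesis by (rule pairing_ext[OF monoid_ring_mult(1)[OF f f] f]) (simp add: monoid_ring_mult(2)[OF f f])
 qed
 have ma: "omega_lift A (monomial k a \<otimes>\<^bsub>monoid_ring A\<^esub> y) = omega_lift A (monomial k a) \<otimes>\<^bsub>Witt A\<^esub> omega_lift A y"
  if a: "a \<in> carrier A" and y: "y \<in> carrier (monoid_ring A)" for k a y
  using y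
 proof (induction y rule: monoid_ring_induct)
  case zero
  have "monomial k a \<otimes>\<^bsub>monoid_ring A\<^esub> \<zero>\<^bsub>monoid_ring A\<^esub> = \<zero>\<^bsub>monoid_ring A\<^esub>" by (rule M.r_null[OF mc[OF a]])
  then show ?case using W.r_null[OF cl[OF mc[OF a]]] by (simp add: omega_lift_0[OF A] del: Witt_simps)
 next
  case (add y l b)
  have "omega_lift A (monomial k a \<otimes>\<^bsub>monoid_ring A\<^esub> monomial l b) = add_pow (Witt A) (k * l) (teich A a \<otimes>\<^bsub>Witt A\<^esub> teich A b)"
   unfolding mm using mon[OF A.m_closed[OF a add(2)]] witt_mult_teich[OF A a add(2)] by simp
  also have "\<dots> = add_pow (Witt A) k (teich A a) \<otimes>\<^bsub>Witt A\<^esub> add_pow (Witt A) l (teich A b)"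
   using W.add_pow_ldistr_int[OF tc[OF a] W.add.int_pow_closed[OF tc[OF add(2)]], of k l]
    W.add_pow_rdistr_int[OF tc[OF a] tc[OF add(2)], of l] W.add.int_pow_pow[OF W.m_closed[OF tc[OF a] tc[OF add(2)]]]
   by (simp add: mult.commute del: Witt_simps)
  finally have e: "omega_lift A (monomial k a \<otimes>\<^bsub>monoid_ring A\<^esub> monomial l b) = omega_lift A (monomial k a) \<otimes>\<^bsub>Witt A\<^esub> omega_lift A (monomial l b)"
   unfolding mon[OF a] mon[OF add(2)] .
  have "monomial k a \<otimes>\<^bsub>monoid_ring A\<^esub> (\<lambda>c. y c + monomial l b c) =
    (\<lambda>c. (monomial k a \<otimes>\<^bsub>monoid_ring A\<^esub> y) c + (monomial k a \<otimes>\<^bsub>monoid_ring A\<^esub> monomial l b) c)"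
   unfolding plus by (rule M.r_distr[OF add(1) mc[OF add(2)] mc[OF a]])
  then have "omega_lift A (monomial k a \<otimes>\<^bsub>monoid_ring A\<^esub> (\<lambda>c. y c + monomial l b c)) =
    omega_lift A (monomial k a) \<otimes>\<^bsub>Witt A\<^esub> omega_lift A y \<oplus>\<^bsub>Witt A\<^esub> omega_lift A (monomial k a) \<otimes>\<^bsub>Witt A\<^esub> omega_lift A (monomial l b)"
   using omega_lift_add[OF A M.m_closed[OF mc[OF a] add(1)] M.m_closed[OF mc[OF a] mc[OF add(2)]]] add(3) e
   by (simp del: Witt_simps monoid_ring_simps)
  then show ?case
   using W.r_distr[OF cl[OF add(1)] cl[OF mc[OF add(2)]] cl[OF mc[OF a]]] omega_lift_add[OF A add(1) mc[OF add(2)]]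
   by (simp del: Witt_simps monoid_ring_simps)
 qed
 show ?thesis
 proof (rule ring_hom_memI)
  fix x y assume x: "x \<in> carrier (monoid_ring A)" and y: "y \<in> carrier (monoid_ring A)"
  show "omega_lift A (x \<oplus>\<^bsub>monoid_ring A\<^esub> y) = omega_lift A x \<oplus>\<^bsub>Witt A\<^esub> omega_lift A y"
   using add[OF x y] by (simp del: Witt_simps)
  show "omega_lift A (x \<otimes>\<^bsub>monoid_ring A\<^esub> y) = omega_lift A x \<otimes>\<^bsub>Witt A\<^esub> omega_lift A y"
   using x
  proof (induction x rule: monoid_ring_induct)
   case zero
   have "\<zero>\<^bsub>monoid_ring A\<^esub> \<otimes>\<^bsub>monoid_ring A\<^esub> y = \<zero>\<^bsub>monoid_ring A\<^esub>" by (rule M.l_null[OF y])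
   then show ?case using W.l_null[OF cl[OF y]] by (simp add: omega_lift_0[OF A] del: Witt_simps)
  next
   case (add x k a)
   have "(\<lambda>c. x c + monomial k a c) \<otimes>\<^bsub>monoid_ring A\<^esub> y =
     (\<lambda>c. (x \<otimes>\<^bsub>monoid_ring A\<^esub> y) c + (monomial k a \<otimes>\<^bsub>monoid_ring A\<^esub> y) c)"
    unfolding plus by (rule M.l_distr[OF add(1) mc[OF add(2)] y])
   then have "omega_lift A ((\<lambda>c. x c + monomial k a c) \<otimes>\<^bsub>monoid_ring A\<^esub> y) =
     omega_lift A x \<otimes>\<^bsub>Witt A\<^esub> omega_lift A y \<oplus>\<^bsub>Witt A\<^esub> omega_lift A (monomial k a) \<otimes>\<^bsub>Witt A\<^esub> omega_lift A y"
    using omega_lift_add[OF A M.m_closed[OF add(1) y] M.m_closed[OF mc[OF add(2)] y]] add(3) ma[OF add(2) y]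
    by (simp del: Witt_simps monoid_ring_simps)
   then show ?case
    using W.l_distr[OF cl[OF add(1)] cl[OF mc[OF add(2)]] cl[OF y]] omega_lift_add[OF A add(1) mc[OF add(2)]]
    by (simp del: Witt_simps monoid_ring_simps)
  qed
 next
  have "add_pow (Witt A) (1::int) (teich A \<one>\<^bsub>A\<^esub>) = teich A \<one>\<^bsub>A\<^esub>"
   using W.add.int_pow_1[OF tc[OF A.one_closed]] by simp
  then show "omega_lift A \<one>\<^bsub>monoid_ring A\<^esub> = \<one>\<^bsub>Witt A\<^esub>" by (simp add: mon)
 qed (rule cl)
qed

lemma omega_lift_natural:
 fixes A B :: "'a ring"
 assumes A: "cring A" and B: "cring B" and phi: "phi \<in> ring_hom A B" and x: "x \<in> carrier (monoid_ring A)"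
 shows "omega_lift B (monoid_ring_map phi x) = phi \<circ> omega_lift A x"
 using x
proof (induction x rule: monoid_ring_induct)
 case zero
 interpret h: ring_hom_cring A B phi using phi by (intro ring_hom_cringI) (auto intro: A B)
 have "monoid_ring_map phi (\<lambda>_. 0) = (\<lambda>_. 0)" by (simp add: monoid_ring_map_def)
 then show ?case by (auto simp: omega_lift_0[OF A] omega_lift_0[OF B])
next
 case (add x k a)
 interpret WA: cring "Witt A" by (rule Witt_cring[OF A])
 interpret WB: cring "Witt B" by (rule Witt_cring[OF B])
 note h = Witt_hom[OF A B phi]
 interpret h: ring_hom_cring "Witt A" "Witt B" "\<lambda>f. phi \<circ> f"
  by (rule ring_hom_cringI) (auto intro: h WA.is_cring WB.is_cring)
 interpret g: group_hom "add_monoid (Witt A)" "add_monoid (Witt B)" "\<lambda>f. phi \<circ> f"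
  by unfold_locales (auto simp: hom_def simp del: Witt_simps)
 have tc: "teich A a \<in> carrier (Witt A)" using teich_closed[OF A add(2)] by simp
 have phia: "phi a \<in> carrier B" by (rule ring_hom_closed[OF phi add(2)])
 have pow: "phi \<circ> add_pow (Witt A) k (teich A a) = add_pow (Witt B) k (teich B (phi a))"
  using g.hom_int_pow[of "teich A a" k] tc teich_hom[OF A B phi add(2)] by (simp add: add_pow_def del: Witt_simps)
 have f: "finite {a. x a \<noteq> 0}" "finite {b. monomial k a b \<noteq> 0}" using add(1) by (auto simp: monoid_ring_carrier monomial_def)
 have mx: "monoid_ring_map phi x \<in> carrier (monoid_ring B)" by (rule ring_hom_closed[OF monoid_ring_map_hom[OF A B phi] add(1)])
 have "omega_lift B (monoid_ring_map phi (\<lambda>b. x b + monomial k a b)) = (phi \<circ> omega_lift A x) \<oplus>\<^bsub>Witt B\<^esub> (phi \<circ> omega_lift A (monomial k a))"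
  unfolding monoid_ring_map_add[OF f] monoid_ring_map_monomial omega_lift_add[OF B mx monomial_closed[OF phia]]
   omega_lift_monomial[OF B phia] omega_lift_monomial[OF A add(2)] pow add(3) ..
 also have "\<dots> = phi \<circ> omega_lift A (\<lambda>b. x b + monomial k a b)"
  unfolding omega_lift_add[OF A add(1) monomial_closed[OF add(2)]]
  by (rule ring_hom_add[OF h omega_lift_closed[OF A add(1)] omega_lift_closed[OF A monomial_closed[OF add(2)]], symmetric])
 finally show ?case .
qed

lemma teich_zero: "cring A ==> teich A \<zero>\<^bsub>A\<^esub> = \<zero>\<^bsub>Witt A\<^esub>"
proof -
 assume "cring A"
 then interpret cring A .
 show ?thesis by (auto simp: teich_def fun_eq_iff)
qed

text \<open>The basis element (0) goes to 1 - 0 T, the zero of the Witt ring. So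
  \<open>omega_lift\<close> is constant on each coset, and its image there is a singleton.\<close>

lemma omega_zclass:
 assumes A: "cring A" and x: "x \<in> carrier (monoid_ring A)"
 shows "omega A (zclass A x) = omega_lift A x"
proof -
 interpret A: cring A by fact
 interpret W: cring "Witt A" by (rule Witt_cring[OF A])
 have "omega_lift A x' = omega_lift A x" if x': "x' \<in> zclass A x" for x'
 proof -
  obtain k where k: "x' = (\<lambda>a. monomial k \<zero>\<^bsub>A\<^esub> a + x a)" using zclass_member(2)[OF A x x'] by auto
  have "omega_lift A (monomial k \<zero>\<^bsub>A\<^esub>) = \<zero>\<^bsub>Witt A\<^esub>"
   unfolding omega_lift_monomial[OF A A.zero_closed] teich_zero[OF A] using W.add.int_pow_one[of k] by (simp add: add_pow_def)
  then show ?thesis unfolding k omega_lift_add[OF A zero_monomial_closed[OF A] x]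
   using W.l_zero[OF omega_lift_closed[OF A x]] by (simp del: Witt_simps)
 qed
 then have "omega_lift A ` zclass A x = (\<lambda>_. omega_lift A x) ` zclass A x" by (rule image_cong[OF refl])
 then have "omega_lift A ` zclass A x = {omega_lift A x}" using zclass_member(1)[OF A x] by (simp only: image_constant)
 then show ?thesis by (simp add: omega_def)
qed

text \<open>In a domain, a product of factors \<open>1 - x T\<close> determines its nonzero \<open>x\<close> with multiplicity.
 Padding with zeros makes the two lists equally long; then the reversed polynomial \<open>\<Prod>(t - x)\<close>
 vanishes exactly at the entries of the list, and a common factor can be cancelled.\<close>

lemma teich_prod_degree:
 assumes A: "cring A" and xs: "set xs \<subseteq> carrier A" and n: "n > length xs"
 shows "teich_prod A xs n = \<zero>\<^bsub>A\<^esub>"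
 using xs n
proof (induction xs arbitrary: n)
 case Nil
 then show ?case by (simp add: teich_prod_simps)
next
 case (Cons x xs)
 interpret cring A by fact
 obtain m where n: "n = Suc m" using Cons(3) by (cases n) auto
 have x: "x \<in> carrier A" "set xs \<subseteq> carrier A" using Cons(2) by auto
 have "teich_prod A xs (Suc m) = \<zero>\<^bsub>A\<^esub>" "teich_prod A xs m = \<zero>\<^bsub>A\<^esub>" using Cons(1)[OF x(2)] Cons(3) n by auto
 then show ?case
  using ps_mult_teich(2)[OF A x(1) witt_carrierD(1)[OF teich_prod_closed[OF A x(2)]], where m = m] x(1)
  by (simp add: n teich_prod_simps a_minus_def)
qed

text \<open>If \<open>E\<close> is the reversed value for \<open>xs\<close>, the recursion
  \<open>ps_mult_teich\<close> for the coefficients of (1 - x T) f turns the value for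
  \<open>x # xs\<close> into t E - x E.\<close>

lemma teich_prod_reversed_eval:
 fixes A (structure)
 assumes A: "cring A" and xs: "set xs \<subseteq> carrier A" and t: "t \<in> carrier A"
 shows "(\<Oplus>i\<in>{..length xs}. teich_prod A xs i \<otimes> t [^] (length xs - i)) = lprod A (map (\<lambda>x. t \<ominus> x) xs)"
 using xs
proof (induction xs)
 case Nil
 interpret cring A by fact
 show ?case by (simp add: teich_prod_simps)
next
 case (Cons x xs)
 interpret cring A by fact
 have x: "x \<in> carrier A" "set xs \<subseteq> carrier A" using Cons(2) by auto
 let ?N = "length xs" and ?f = "teich_prod A xs" and ?g = "teich_prod A (x # xs)"
 have fc: "?f i \<in> carrier A" for i by (rule witt_carrierD(1)[OF teich_prod_closed[OF A x(2)]])
 have g: "?g 0 = ?f 0" "?g (Suc m) = ?f (Suc m) \<ominus> x \<otimes> ?f m" for m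
  using ps_mult_teich[OF A x(1) fc] by (simp_all add: teich_prod_simps)
 define E where "E = (\<Oplus>i\<in>{..?N}. ?f i \<otimes> t [^] (?N - i))"
 have Ec: "E \<in> carrier A" using fc t by (simp add: E_def)
 have gc: "?g i \<in> carrier A" for i by (rule witt_carrierD(1)[OF teich_prod_closed[OF A Cons(2)]])
 let ?u = "\<lambda>i. ?f i \<otimes> t [^] (Suc ?N - i)"
 have sp: "{..Suc ?N} = insert 0 (Suc ` {..?N})" by (rule atMost_Suc_eq_insert_0)
 have split: "finsum A w {..Suc ?N} = w 0 \<oplus> (\<Oplus>m\<in>{..?N}. w (Suc m))" if w: "!!i. w i \<in> carrier A" for w
 proof -
  have "finsum A w (insert 0 (Suc ` {..?N})) = w 0 \<oplus> finsum A w (Suc ` {..?N})"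
   by (rule finsum_insert) (use w in auto)
  moreover have "finsum A w (Suc ` {..?N}) = (\<Oplus>m\<in>{..?N}. w (Suc m))"
   by (rule add.finprod_reindex) (use w in auto)
  ultimately show ?thesis unfolding sp by simp
 qed
 have tE: "finsum A ?u {..Suc ?N} = t \<otimes> E"
 proof -
  have "{..Suc ?N} = insert (Suc ?N) {..?N}" by auto
  then have "finsum A ?u {..Suc ?N} = ?u (Suc ?N) \<oplus> finsum A ?u {..?N}" using fc t by simp
  also have "?u (Suc ?N) = \<zero>" using teich_prod_degree[OF A x(2), of "Suc ?N"] by simp
  also have "finsum A ?u {..?N} = (\<Oplus>i\<in>{..?N}. t \<otimes> (?f i \<otimes> t [^] (?N - i)))"
   by (rule finsum_cong') (use fc t in \<open>auto simp: Suc_diff_le m_ac\<close>)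
  also have "\<dots> = t \<otimes> E" unfolding E_def by (rule finsum_rdistr[symmetric]) (use fc t in auto)
  finally show ?thesis using Ec t by simp
 qed
 have xE: "(\<Oplus>m\<in>{..?N}. (x \<otimes> ?f m) \<otimes> t [^] (?N - m)) = x \<otimes> E"
 proof -
  have "(\<Oplus>m\<in>{..?N}. (x \<otimes> ?f m) \<otimes> t [^] (?N - m)) = (\<Oplus>m\<in>{..?N}. x \<otimes> (?f m \<otimes> t [^] (?N - m)))"
   by (rule finsum_cong') (use fc t x in \<open>auto simp: m_assoc\<close>)
  also have "\<dots> = x \<otimes> E" unfolding E_def by (rule finsum_rdistr[symmetric]) (use fc t x in auto)
  finally show ?thesis .
 qed
 let ?a = "\<lambda>m. ?f (Suc m) \<otimes> t [^] (?N - m)" and ?b = "\<lambda>m. (x \<otimes> ?f m) \<otimes> t [^] (?N - m)"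
 have ab: "?a m \<in> carrier A" "?b m \<in> carrier A" for m using fc t x by auto
 have sab: "finsum A ?a {..?N} \<in> carrier A" "finsum A ?b {..?N} \<in> carrier A" using ab by auto
 have "(\<Oplus>m\<in>{..?N}. ?a m \<ominus> ?b m) \<oplus> finsum A ?b {..?N} = (\<Oplus>m\<in>{..?N}. (?a m \<ominus> ?b m) \<oplus> ?b m)"
  by (rule finsum_addf[symmetric]) (use ab in auto)
 also have "\<dots> = finsum A ?a {..?N}"
  by (rule finsum_cong') (use ab in \<open>auto simp: a_minus_def a_assoc l_neg\<close>)
 finally have diff: "(\<Oplus>m\<in>{..?N}. ?a m \<ominus> ?b m) \<oplus> x \<otimes> E = finsum A ?a {..?N}" unfolding xE .
 define G where "G = (\<Oplus>i\<in>{..Suc ?N}. ?g i \<otimes> t [^] (Suc ?N - i))"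
 have dc: "(\<Oplus>m\<in>{..?N}. ?a m \<ominus> ?b m) \<in> carrier A" using ab by (intro finsum_closed) auto
 have Gc: "G \<in> carrier A" unfolding G_def using gc t by (intro finsum_closed) auto
 have "G = ?g 0 \<otimes> t [^] (Suc ?N - 0) \<oplus> (\<Oplus>m\<in>{..?N}. ?g (Suc m) \<otimes> t [^] (Suc ?N - Suc m))"
  unfolding G_def by (rule split) (use gc t in auto)
 also have "(\<Oplus>m\<in>{..?N}. ?g (Suc m) \<otimes> t [^] (Suc ?N - Suc m)) = (\<Oplus>m\<in>{..?N}. ?a m \<ominus> ?b m)"
  by (rule finsum_cong') (use fc t x in \<open>auto simp: g a_minus_def l_distr l_minus\<close>)
 finally have "G \<oplus> x \<otimes> E = ?u 0 \<oplus> finsum A ?a {..?N}"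
  using diff dc x Ec fc t by (simp add: g(1) a_assoc)
 also have "\<dots> = finsum A ?u {..Suc ?N}" using split[of ?u] fc t by simp
 finally have "G \<oplus> x \<otimes> E = t \<otimes> E" unfolding tE .
 then have "G = t \<otimes> E \<ominus> x \<otimes> E"
  using Gc x Ec t by (metis add.inv_solve_right a_minus_def m_closed)
 also have "\<dots> = (t \<ominus> x) \<otimes> E" using x t Ec by (simp add: a_minus_def l_distr l_minus)
 finally show ?case using Cons(1)[OF x(2)] unfolding G_def E_def by simp
qed

lemma domain_lprod_zero:
 fixes A (structure)
 assumes A: "domain A" and xs: "set xs \<subseteq> carrier A" "lprod A xs = \<zero>"
 shows "\<zero> \<in> set xs"
 using xs
proof (induction xs)
 case Nil
 interpret domain A by fact
 show ?case using Nil one_not_zero by simp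
next
 case (Cons x xs)
 interpret domain A by fact
 have "lprod A xs \<in> carrier A" by (rule lprod_closed[OF is_cring]) (use Cons(2) in simp)
 then have "x = \<zero> \<or> lprod A xs = \<zero>" using Cons(2,3) integral[of x "lprod A xs"] by simp
 then show ?case using Cons by auto
qed

lemma teich_prod_mset_eq:
 fixes A (structure)
 assumes A: "domain A" and "set xs \<subseteq> carrier A" "set ys \<subseteq> carrier A" "length xs = length ys" "teich_prod A xs = teich_prod A ys"
 shows "mset xs = mset ys"
 using assms(2-)
proof (induction xs arbitrary: ys)
 case (Cons x xs)
 interpret domain A by fact
 have cA: "cring A" by (rule is_cring)
 interpret W: cring "Witt A" by (rule Witt_cring[OF cA])
 have x: "x \<in> carrier A" "set xs \<subseteq> carrier A" using Cons(2) by auto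
 have "lprod A (map (\<lambda>y. x \<ominus> y) ys) = lprod A (map (\<lambda>y. x \<ominus> y) (x # xs))"
  using teich_prod_reversed_eval[OF cA Cons(2) x(1)] teich_prod_reversed_eval[OF cA Cons(3) x(1)] Cons(4,5) by simp
 also have "\<dots> = \<zero>"
 proof -
  have "lprod A (map (\<lambda>y. x \<ominus> y) xs) \<in> carrier A" by (rule lprod_closed[OF cA]) (use x in auto)
  then show ?thesis using x(1) by (simp add: a_minus_def r_neg)
 qed
 finally have "\<zero> \<in> set (map (\<lambda>y. x \<ominus> y) ys)"
  by (rule domain_lprod_zero[OF A, rotated]) (use Cons(3) x in auto)
 then obtain y where y: "y \<in> set ys" "x \<ominus> y = \<zero>" by auto
 then have "x = y" using x(1) Cons(3) r_right_minus_eq[of x y] by auto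
 then obtain us vs where ys: "ys = us @ x # vs" using y(1) split_list by metis
 have uv: "set us \<subseteq> carrier A" "set vs \<subseteq> carrier A" using Cons(3) ys by auto
 note tc = teich_prod_closed[OF cA] and tx = teich_closed[OF cA x(1)]
 have c: "teich A x \<in> carrier (Witt A)" "teich_prod A us \<in> carrier (Witt A)" "teich_prod A vs \<in> carrier (Witt A)" "teich_prod A xs \<in> carrier (Witt A)"
  using tc[OF uv(1)] tc[OF uv(2)] tc[OF x(2)] tx by auto
 have "teich_prod A ys = teich_prod A us \<oplus>\<^bsub>Witt A\<^esub> (teich A x \<oplus>\<^bsub>Witt A\<^esub> teich_prod A vs)"
  unfolding ys using teich_prod_append[OF cA uv(1), of "x # vs"] uv x(1) by (simp add: teich_prod_simps)
 also have "\<dots> = teich A x \<oplus>\<^bsub>Witt A\<^esub> (teich_prod A us \<oplus>\<^bsub>Witt A\<^esub> teich_prod A vs)"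
  using c by (simp add: W.a_lcomm del: Witt_simps)
 also have "teich_prod A us \<oplus>\<^bsub>Witt A\<^esub> teich_prod A vs = teich_prod A (us @ vs)"
  using teich_prod_append[OF cA uv] by simp
 finally have "teich A x \<oplus>\<^bsub>Witt A\<^esub> teich_prod A xs = teich A x \<oplus>\<^bsub>Witt A\<^esub> teich_prod A (us @ vs)"
  using Cons(5) by (simp add: teich_prod_simps)
 moreover have "teich_prod A (us @ vs) \<in> carrier (Witt A)" using tc[of "us @ vs"] uv by simp
 ultimately have "teich_prod A xs = teich_prod A (us @ vs)"
  using W.add.l_cancel[of "teich A x" "teich_prod A xs" "teich_prod A (us @ vs)"] c by (simp del: Witt_simps)
 then have "mset xs = mset (us @ vs)" by (intro Cons(1)) (use x uv Cons(4) ys in auto)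
 then show ?case by (simp add: ys)
qed simp

lemma teich_prod_replicate_zero: "cring A ==> teich_prod A (replicate n \<zero>\<^bsub>A\<^esub>) = \<zero>\<^bsub>Witt A\<^esub>"
proof (induction n)
 case (Suc n)
 interpret W: cring "Witt A" by (rule Witt_cring[OF Suc(2)])
 have "teich_prod A (replicate (Suc n) \<zero>\<^bsub>A\<^esub>) = \<zero>\<^bsub>Witt A\<^esub> \<oplus>\<^bsub>Witt A\<^esub> \<zero>\<^bsub>Witt A\<^esub>"
  using Suc(1)[OF Suc(2)] teich_zero[OF Suc(2)] by (simp add: teich_prod_simps)
 then show ?case using W.l_zero[OF W.zero_closed] by (simp only:)
qed (simp add: teich_prod_simps)

lemma teich_prod_count_eq:
 fixes A (structure)
 assumes A: "domain A" and xs: "set xs \<subseteq> carrier A" and ys: "set ys \<subseteq> carrier A" and eq: "teich_prod A xs = teich_prod A ys"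
  and a: "a \<noteq> \<zero>"
 shows "count (mset xs) a = count (mset ys) a"
proof -
 interpret domain A by fact
 have cA: "cring A" by (rule is_cring)
 interpret W: cring "Witt A" by (rule Witt_cring[OF cA])
 have pad: "teich_prod A (zs @ replicate n \<zero>) = teich_prod A zs" if "set zs \<subseteq> carrier A" for zs n
  using teich_prod_append[OF cA that, of "replicate n \<zero>"] W.r_zero[of "teich_prod A zs"] teich_prod_closed[OF cA that]
   teich_prod_replicate_zero[OF cA, of n] by (auto simp: set_replicate_conv_if)
 have "mset (xs @ replicate (length ys) \<zero>) = mset (ys @ replicate (length xs) \<zero>)"
  by (rule teich_prod_mset_eq[OF A]) (use xs ys eq in \<open>auto simp: pad set_replicate_conv_if split: if_splits\<close>)
 then have "count (mset (xs @ replicate (length ys) \<zero>)) a = count (mset (ys @ replicate (length xs) \<zero>)) a" by simp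
 then show ?thesis using a by simp
qed

section \<open>Kernel and local image of the map to the Witt ring\<close>

definition list_class :: "'a list => 'a => int" where
 "list_class xs = (\<lambda>a. int (count (mset xs) a))"

lemma list_class_closed: "set xs \<subseteq> carrier A ==> list_class xs \<in> carrier (monoid_ring A)"
proof -
 assume xs: "set xs \<subseteq> carrier A"
 have "{a. list_class xs a \<noteq> 0} = set xs" by (auto simp: list_class_def count_eq_zero_iff)
 moreover have "list_class xs a \<noteq> 0 ==> a \<in> carrier A" for a using calculation xs by blast
 ultimately show ?thesis unfolding monoid_ring_carrier by simp
qed

lemma omega_lift_list_class:
 assumes A: "cring A" and xs: "set xs \<subseteq> carrier A"
 shows "omega_lift A (list_class xs) = teich_prod A xs"
 using xs
proof (induction xs)
 case Nil
 show ?case using omega_lift_0[OF A] by (simp add: list_class_def teich_prod_simps)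
next
 case (Cons x xs)
 interpret W: cring "Witt A" by (rule Witt_cring[OF A])
 have x: "x \<in> carrier A" "set xs \<subseteq> carrier A" using Cons(2) by auto
 have tc: "teich A x \<in> carrier (Witt A)" "teich_prod A xs \<in> carrier (Witt A)" using teich_closed[OF A x(1)] teich_prod_closed[OF A x(2)] by auto
 have e: "list_class (x # xs) = (\<lambda>a. monomial 1 x a + list_class xs a)" by (auto simp: list_class_def monomial_def)
 have "add_pow (Witt A) (1::int) (teich A x) = teich A x" using W.add.int_pow_1[OF tc(1)] by simp
 then show ?case unfolding e omega_lift_add[OF A monomial_closed[OF x(1)] list_class_closed[OF x(2)]]
   omega_lift_monomial[OF A x(1)] Cons(1)[OF x(2)] by (simp add: teich_prod_simps)
qed

lemma int_difference_lists:
 fixes z :: "'a => int"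
 assumes "finite {a. z a \<noteq> 0}"
 shows "\<exists>xs ys. set xs \<subseteq> {a. z a \<noteq> 0} \<and> set ys \<subseteq> {a. z a \<noteq> 0} \<and> (\<forall>a. z a = list_class xs a - list_class ys a)"
proof -
 have ex: "\<exists>xs. \<forall>a. count (mset xs) a = f a" if "!!a. f a \<noteq> 0 ==> z a \<noteq> 0" for f :: "'a => nat"
 proof -
  have "finite {a. 0 < f a}" by (rule finite_subset[OF _ assms]) (use that in auto)
  then have "count (Abs_multiset f) = f" by (rule count_Abs_multiset)
  moreover obtain xs where "mset xs = Abs_multiset f" using ex_mset by blast
  ultimately show ?thesis by metis
 qed
 obtain xs where xs: "\<forall>a. count (mset xs) a = nat (z a)" using ex[of "\<lambda>a. nat (z a)"] by auto
 obtain ys where ys: "\<forall>a. count (mset ys) a = nat (- z a)" using ex[of "\<lambda>a. nat (- z a)"] by auto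
 have "a \<in> {a. z a \<noteq> 0}" if "a \<in> set xs" for a
  using that xs count_greater_zero_iff[of "mset xs" a] by (auto intro: ccontr)
 moreover have "a \<in> {a. z a \<noteq> 0}" if "a \<in> set ys" for a
  using that ys count_greater_zero_iff[of "mset ys" a] by (auto intro: ccontr)
 moreover have "\<forall>a. z a = list_class xs a - list_class ys a" using xs ys by (auto simp: list_class_def)
 ultimately show ?thesis by blast
qed

text \<open>Separate the positive and the negative coefficients of \<open>z\<close> into two lists.
  The kernel condition says that their products of linear factors coincide, so every nonzero element
  occurs equally often in both, and only a multiple of (0) is left of \<open>z\<close>.\<close>

lemma domain_omega_lift_kernel:
 assumes B: "domain B" and z: "z \<in> carrier (monoid_ring B)" and k: "omega_lift B z = \<zero>\<^bsub>Witt B\<^esub>"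
 shows "z \<in> zero_multiples B"
proof -
 interpret domain B by fact
 have cB: "cring B" by (rule is_cring)
 interpret W: cring "Witt B" by (rule Witt_cring[OF cB])
 have fin: "finite {a. z a \<noteq> 0}" "{a. z a \<noteq> 0} \<subseteq> carrier B" using z by (auto simp: monoid_ring_carrier)
 obtain xs ys where l: "set xs \<subseteq> {a. z a \<noteq> 0}" "set ys \<subseteq> {a. z a \<noteq> 0}" "\<forall>a. z a = list_class xs a - list_class ys a"
  using int_difference_lists[OF fin(1)] by blast
 have xs: "set xs \<subseteq> carrier B" and ys: "set ys \<subseteq> carrier B" using l(1,2) fin(2) by blast+
 have "list_class xs = (\<lambda>a. z a + list_class ys a)" using l(3) by auto
 then have "teich_prod B xs = \<zero>\<^bsub>Witt B\<^esub> \<oplus>\<^bsub>Witt B\<^esub> teich_prod B ys"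
  using omega_lift_add[OF cB z list_class_closed[OF ys]] k omega_lift_list_class[OF cB xs] omega_lift_list_class[OF cB ys]
  by (simp del: Witt_simps)
 also have "\<dots> = teich_prod B ys" by (rule W.l_zero) (use teich_prod_closed[OF cB ys] in simp)
 finally have "z a = 0" if "a \<noteq> \<zero>\<^bsub>B\<^esub>" for a
  using teich_prod_count_eq[OF B xs ys _ that] l(3) by (simp add: list_class_def)
 then have "z = monomial (z \<zero>\<^bsub>B\<^esub>) \<zero>\<^bsub>B\<^esub>" by (auto simp: monomial_def)
 then show ?thesis unfolding zero_multiples_eq by blast
qed

text \<open>The target stays open because the map is needed both into the rational vectors and into
  all Witt vectors.\<close>

lemma omega_presheaf_morphism:
 assumes C: "!!A x. A \<in> noeth ==> x \<in> carrier (monoid_ring A) ==> omega_lift A x \<in> C A"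
 shows "presheaf_morphism Z_pre (witt_sub C) omega"
 unfolding presheaf_morphism_def
proof (intro conjI ballI)
 fix A :: "'a ring" assume A: "A \<in> noeth"
 note cA = noeth_cring[OF A]
 interpret M: cring "monoid_ring A" by (rule monoid_ring_cring[OF cA])
 have sec: "sec Z_pre A = monoid_ring A Quot zero_multiples A" by (simp add: Z_pre_def reduced_monoid_ring_def)
 note h = omega_lift_hom[OF cA]
 have h': "omega_lift A \<in> ring_hom (monoid_ring A) (sec (witt_sub C) A)"
  by (rule ring_hom_memI)
   (use C[OF A] ring_hom_mult[OF h] ring_hom_add[OF h] ring_hom_one[OF h] in \<open>simp_all del: Witt_simps monoid_ring_simps\<close>)
 show "omega A \<in> ring_hom (sec Z_pre A) (sec (witt_sub C) A)" unfolding sec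
  by (rule ring_hom_quotient[OF M.ring_axioms zero_multiples_ideal[OF cA] h' omega_zclass[OF cA]])
 fix B :: "'a ring" and phi U assume B: "B \<in> noeth" and phi: "phi \<in> homs A B" and "U \<in> carrier (sec Z_pre A)"
 then obtain x where x: "x \<in> carrier (monoid_ring A)" "U = zclass A x" unfolding Z_pre_carrier by blast
 note cB = noeth_cring[OF B] and phih = homs_ring_hom[OF phi]
 have mx: "monoid_ring_map phi x \<in> carrier (monoid_ring B)" by (rule ring_hom_closed[OF monoid_ring_map_hom[OF cA cB phih] x(1)])
 show "omega B (res Z_pre A B phi U) = res (witt_sub C) A B phi (omega A U)"
  unfolding x(2) Z_pre_res[OF cA cB phih x(1)] omega_zclass[OF cB mx] omega_zclass[OF cA x(1)] omega_lift_natural[OF cA cB phih x(1)]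
  by simp
qed

text \<open>Over \<open>A\<close> itself there can be a kernel: orthogonal idempotents e and f with
  sum 1 satisfy (1 - e T)(1 - f T) = 1 - T. On an integral component the kernel consists of
  multiples of (0), and the components form a closed covering that \<open>K\<close> refines.\<close>

lemma omega_locally_injective:
 fixes K :: "'a covers"
 assumes m: "site_morphism K Z_pre (witt_sub C) omega" and K: "finer K f_pretopology"
 shows "site_morphism.locally_injective K Z_pre omega"
proof -
 interpret site_morphism K Z_pre "witt_sub C" omega by fact
 show ?thesis unfolding locally_injective_def
 proof (intro ballI impI)
  fix A :: "'a ring" and U V assume A: "A \<in> noeth" and "U \<in> carrier (sec Z_pre A)" "V \<in> carrier (sec Z_pre A)"
   and eq: "omega A U = omega A V"
  then obtain x y where x: "x \<in> carrier (monoid_ring A)" "U = zclass A x" and y: "y \<in> carrier (monoid_ring A)" "V = zclass A y"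
   unfolding Z_pre_carrier by blast
  note cA = noeth_cring[OF A]
  interpret M: cring "monoid_ring A" by (rule monoid_ring_cring[OF cA])
  interpret W: cring "Witt A" by (rule Witt_cring[OF cA])
  interpret h: ring_hom_cring "monoid_ring A" "Witt A" "omega_lift A"
   by (rule ring_hom_cringI) (auto intro: omega_lift_hom[OF cA] M.is_cring W.is_cring)
  define z where "z = x \<ominus>\<^bsub>monoid_ring A\<^esub> y"
  have z: "z \<in> carrier (monoid_ring A)" unfolding z_def by (rule M.minus_closed[OF x(1) y(1)])
  have exy: "omega_lift A x = omega_lift A y" using eq omega_zclass[OF cA x(1)] omega_zclass[OF cA y(1)] x(2) y(2) by simp
  have "omega_lift A z = omega_lift A x \<oplus>\<^bsub>Witt A\<^esub> \<ominus>\<^bsub>Witt A\<^esub> omega_lift A y"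
   unfolding z_def a_minus_def using h.hom_add[OF x(1) M.a_inv_closed[OF y(1)]] h.hom_a_inv[OF y(1)] by (simp only:)
  then have oz: "omega_lift A z = \<zero>\<^bsub>Witt A\<^esub>" unfolding exy using W.r_neg[OF omega_lift_closed[OF cA y(1)]] by (simp only:)
  obtain S k where S: "S \<subseteq> arrows_into A" "finite S" "\<forall>(B, phi) \<in> S. closed_immersion A B phi \<and> domain B" "jointly_surjective A S"
   "\<forall>xs. set xs \<subseteq> carrier A \<and> length xs = k \<and> (\<forall>x \<in> set xs. \<forall>(B, phi) \<in> S. phi x = \<zero>\<^bsub>B\<^esub>) --> lprod A xs = \<zero>\<^bsub>A\<^esub>"
   by atomize_elim (rule component_covering[OF A])
  have "\<forall>(B, phi) \<in> S. closed_immersion A B phi" using S(3) by blast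
  then obtain R where R: "R \<in> K A" "refines A R S" using F.closed_covering_refined[OF _ A S(1,2) _ S(4)] K by blast
  show "F.locally A (\<lambda>D chi. res Z_pre A D chi U = res Z_pre A D chi V)"
  proof (rule F.locally_refine[OF A R])
   fix B phi D rho assume B: "(B, phi) \<in> S" and D: "D \<in> noeth" "rho \<in> homs B D"
   have cB: "cring B" and phi: "phi \<in> homs A B" and dB: "domain B"
    using subsetD[OF S(1) B] bspec[OF S(3) B] by (simp_all add: arrows_into_def noeth_def)
   note cD = noeth_cring[OF D(1)] and phih = homs_ring_hom[OF phi] and rhoh = homs_ring_hom[OF D(2)]
   interpret phi: ring_hom_cring A B phi using phih by (intro ring_hom_cringI) (auto intro: cA cB)
   interpret rho: ring_hom_cring B D rho using rhoh by (intro ring_hom_cringI) (auto intro: cB cD)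
   have "phi \<circ> \<zero>\<^bsub>Witt A\<^esub> = \<zero>\<^bsub>Witt B\<^esub>" by (auto simp: fun_eq_iff)
   then have "omega_lift B (monoid_ring_map phi z) = \<zero>\<^bsub>Witt B\<^esub>" using omega_lift_natural[OF cA cB phih z] oz by simp
   then have "monoid_ring_map phi z \<in> zero_multiples B"
    by (rule domain_omega_lift_kernel[OF dB ring_hom_closed[OF monoid_ring_map_hom[OF cA cB phih] z]])
   then obtain k where k: "monoid_ring_map phi z = monomial k \<zero>\<^bsub>B\<^esub>" unfolding zero_multiples_eq by blast
   define chi where "chi = hcomp A rho phi"
   have chi: "chi \<in> ring_hom A D" unfolding chi_def by (rule homs_ring_hom[OF homs_compose[OF cA phi D(2)]])
   have f: "finite {a. z a \<noteq> 0}" using z by (simp add: monoid_ring_carrier)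
   have "monoid_ring_map chi z = monoid_ring_map rho (monoid_ring_map phi z)"
   proof (rule pairing_ext[OF monoid_ring_map(1)[OF f] monoid_ring_map(1)[OF monoid_ring_map(1)[OF f]]])
    show "pairing (monoid_ring_map chi z) g = pairing (monoid_ring_map rho (monoid_ring_map phi z)) g" for g
     unfolding monoid_ring_map(2)[OF f] monoid_ring_map(2)[OF monoid_ring_map(1)[OF f]]
     by (rule pairing_cong) (use z in \<open>simp add: monoid_ring_carrier compose_def chi_def\<close>)
   qed
   then have zz: "monoid_ring_map chi z \<in> zero_multiples D"
    unfolding k monoid_ring_map_monomial using rho.hom_zero by (simp add: zero_multiples_eq)
   interpret MD: cring "monoid_ring D" by (rule monoid_ring_cring[OF cD])
   interpret chi: ring_hom_cring "monoid_ring A" "monoid_ring D" "monoid_ring_map chi"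
    by (rule ring_hom_cringI) (auto intro: monoid_ring_map_hom[OF cA cD chi] M.is_cring MD.is_cring)
   have "monoid_ring_map chi x \<ominus>\<^bsub>monoid_ring D\<^esub> monoid_ring_map chi y = monoid_ring_map chi z"
    unfolding z_def a_minus_def using chi.hom_add[OF x(1) M.a_inv_closed[OF y(1)]] chi.hom_a_inv[OF y(1)] by (simp only:)
   then have "zclass D (monoid_ring_map chi x) = zclass D (monoid_ring_map chi y)"
    using zz by (intro zclass_eqI[OF cD chi.hom_closed[OF x(1)] chi.hom_closed[OF y(1)]]) (simp only:)
   then show "res Z_pre A D (hcomp A rho phi) U = res Z_pre A D (hcomp A rho phi) V"
    unfolding chi_def[symmetric] x(2) y(2) Z_pre_res[OF cA cD chi x(1)] Z_pre_res[OF cA cD chi y(1)] .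
  qed
 qed
qed

text \<open>Write f = P / Q and pass to a covering on which both polynomials split. The difference
  of the classes of the two lists of factors is a preimage, since subtraction in the Witt ring is
  division of series.\<close>

lemma omega_locally_surjective:
 fixes K :: "'a covers"
 assumes inf: "infinite (UNIV :: 'a set)" and m: "site_morphism K Z_pre (witt_sub rat_carrier) omega" and K: "finer K f_pretopology"
 shows "site_morphism.locally_surjective K Z_pre (witt_sub rat_carrier) omega"
proof -
 interpret site_morphism K Z_pre "witt_sub rat_carrier" omega by fact
 show ?thesis unfolding locally_surjective_def
 proof (intro ballI)
  fix A :: "'a ring" and f assume A: "A \<in> noeth" and "f \<in> carrier (sec (witt_sub rat_carrier) A)"
  then obtain Q where fw: "f \<in> witt_carrier A" and Q: "Q \<in> witt_polys A" "ps_mult A f Q \<in> witt_polys A"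
   by (auto simp: rat_carrier_def)
  define P where "P = ps_mult A f Q"
  note Qw = witt_polys_carrier[OF Q(1)] and Pw = witt_polys_carrier[OF Q(2), folded P_def]
  have sp: "F.locally A (F.splits p)" if "p \<in> witt_polys A" for p
  proof -
   obtain N where "\<forall>n>N. p n = \<zero>\<^bsub>A\<^esub>" using \<open>p \<in> witt_polys A\<close> by (auto simp: witt_polys_def)
   then show ?thesis by (rule F.locally_splits[OF inf K A witt_polys_carrier[OF that]])
  qed
  have "F.locally A (\<lambda>D chi. F.splits P D chi \<and> F.splits Q D chi)"
   by (rule F.locally_conj[OF sp F.stable_splits[OF A Pw] sp[OF Q(1)] F.stable_splits[OF A Qw] A]) (simp add: P_def Q)
  then show "F.locally A (\<lambda>D chi. \<exists>x \<in> carrier (sec Z_pre D). omega D x = res (witt_sub rat_carrier) A D chi f)"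
  proof (rule F.locally_mono[OF _ A])
   fix D chi assume D: "D \<in> noeth" "chi \<in> homs A D" and "F.splits P D chi \<and> F.splits Q D chi"
   then obtain xs ys where xs: "set xs \<subseteq> carrier D" "chi \<circ> P = teich_prod D xs" and ys: "set ys \<subseteq> carrier D" "chi \<circ> Q = teich_prod D ys"
    unfolding F.splits_def by blast
   note cA = noeth_cring[OF A] and cD = noeth_cring[OF D(1)] and chi = homs_ring_hom[OF D(2)]
   interpret M: cring "monoid_ring D" by (rule monoid_ring_cring[OF cD])
   interpret W: cring "Witt D" by (rule Witt_cring[OF cD])
   interpret h: ring_hom_cring "monoid_ring D" "Witt D" "omega_lift D"
    by (rule ring_hom_cringI) (auto intro: omega_lift_hom[OF cD] M.is_cring W.is_cring)
   note lx = list_class_closed[OF xs(1)] and ly = list_class_closed[OF ys(1)]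
   define z where "z = list_class xs \<ominus>\<^bsub>monoid_ring D\<^esub> list_class ys"
   have z: "z \<in> carrier (monoid_ring D)" unfolding z_def by (rule M.minus_closed[OF lx ly])
   have zy: "list_class xs = z \<oplus>\<^bsub>monoid_ring D\<^esub> list_class ys"
    unfolding z_def using lx ly by (simp add: a_minus_def M.a_assoc M.l_neg del: monoid_ring_simps)
   have "omega_lift D z \<oplus>\<^bsub>Witt D\<^esub> teich_prod D ys = teich_prod D xs"
    using h.hom_add[OF z ly] omega_lift_list_class[OF cD xs(1)] omega_lift_list_class[OF cD ys(1)] unfolding zy[symmetric] by (simp only:)
   moreover have "(chi \<circ> f) \<oplus>\<^bsub>Witt D\<^esub> teich_prod D ys = teich_prod D xs"
    using ps_mult_hom[OF cA cD chi witt_carrierD(1)[OF fw] witt_carrierD(1)[OF Qw]] xs(2) ys(2) by (simp add: P_def)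
   moreover have "omega_lift D z \<in> carrier (Witt D)" "chi \<circ> f \<in> carrier (Witt D)" "teich_prod D ys \<in> carrier (Witt D)"
    using omega_lift_closed[OF cD z] witt_carrier_hom[OF chi fw] teich_prod_closed[OF cD ys(1)] by simp_all
   ultimately have "omega_lift D z = chi \<circ> f"
    using W.add.right_cancel by metis
   then show "\<exists>x \<in> carrier (sec Z_pre D). omega D x = res (witt_sub rat_carrier) A D chi f"
    by (intro bexI[of _ "zclass D z"]) (use z omega_zclass[OF cD z] in \<open>simp_all add: Z_pre_carrier\<close>)
  qed
 qed
qed

theorem proposition4p8:
 fixes K :: "'a covers"
 assumes "infinite (UNIV :: 'a set)"
  and "pretopology K"
 shows
  "(contains_finite_closed_coverings K \<longrightarrow>
    sheaf_iso K (sheafify K W_rat_pre) (sheafify K W_J_pre)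
     (sheafify_map K W_rat_pre W_J_pre incl)) \<and>
  (finer K f_pretopology \<longrightarrow>
    sheaf_iso K (sheafify K Z_pre) (sheafify K W_rat_pre)
     (sheafify_map K Z_pre W_rat_pre omega) \<and>
    sheaf_iso K (sheafify K W_rat_pre) (sheafify K W_J_pre)
     (sheafify_map K W_rat_pre W_J_pre incl) \<and>
    sheaf_mono K (sheafify K Z_pre) (sheafify K W_pre) (sheafify_map K Z_pre W_pre omega) \<and>
    sheaf_mono K (sheafify K W_rat_pre) (sheafify K W_pre) (sheafify_map K W_rat_pre W_pre incl) \<and>
    sheaf_mono K (sheafify K W_J_pre) (sheafify K W_pre) (sheafify_map K W_J_pre W_pre incl) \<and>
    (\<forall>A \<in> noeth. \<forall>x \<in> carrier (sec (sheafify K Z_pre) A).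
     sheafify_map K W_rat_pre W_pre incl A (sheafify_map K Z_pre W_rat_pre omega A x) =
     sheafify_map K Z_pre W_pre omega A x) \<and>
    (\<forall>A \<in> noeth. \<forall>x \<in> carrier (sec (sheafify K W_rat_pre) A).
     sheafify_map K W_J_pre W_pre incl A (sheafify_map K W_rat_pre W_J_pre incl A x) =
     sheafify_map K W_rat_pre W_pre incl A x))"
proof -
 note inf = assms(1) and K = assms(2)
 note pre = W_pre_presheaf[unfolded W_pre_eq] W_rat_pre_presheaf[OF inf, unfolded W_rat_pre_eq] W_J_pre_presheaf[OF inf, unfolded W_J_pre_eq]
 have sub: "rat_carrier A \<subseteq> J_carrier A" "rat_carrier A \<subseteq> witt_carrier A" "J_carrier A \<subseteq> witt_carrier A" if "A \<in> noeth" for A :: "'a ring"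
  using J_subring(2)[OF inf that] by (auto simp: rat_carrier_def J_carrier_def)
 have rJ: "site_morphism K (witt_sub rat_carrier) (witt_sub J_carrier) incl" by (rule incl_morphism[OF K pre(2,3) sub(1)])
 have rW: "site_morphism K (witt_sub rat_carrier) (witt_sub witt_carrier) incl" by (rule incl_morphism[OF K pre(2,1) sub(2)])
 have JW: "site_morphism K (witt_sub J_carrier) (witt_sub witt_carrier) incl" by (rule incl_morphism[OF K pre(3,1) sub(3)])
 have Zr: "site_morphism K Z_pre (witt_sub rat_carrier) omega"
  by unfold_locales (use K Z_pre_presheaf pre(2) omega_presheaf_morphism[of rat_carrier] omega_lift_rat[OF inf noeth_cring] in auto)
 have omW: "omega_lift A x \<in> witt_carrier A" if "A \<in> noeth" "x \<in> carrier (monoid_ring A)" for A :: "'a ring" and x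
  using omega_lift_closed[OF noeth_cring[OF that(1)] that(2)] by simp
 have ZW: "site_morphism K Z_pre (witt_sub witt_carrier) omega"
  by unfold_locales (use K Z_pre_presheaf pre(1) omega_presheaf_morphism[of witt_carrier] omW in auto)
 have iso1: "sheaf_iso K (sheafify K (witt_sub rat_carrier)) (sheafify K (witt_sub J_carrier))
   (sheafify_map K (witt_sub rat_carrier) (witt_sub J_carrier) incl)"
  if "contains_finite_closed_coverings K \<or> finer K f_pretopology"
  by (rule site_morphism.sheafify_iso[OF rJ incl_locally_injective[OF rJ] rat_J_locally_surjective[OF rJ that]])
 have iso2: "sheaf_iso K (sheafify K Z_pre) (sheafify K (witt_sub rat_carrier)) (sheafify_map K Z_pre (witt_sub rat_carrier) omega)"
  if "finer K f_pretopology"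
  by (rule site_morphism.sheafify_iso[OF Zr omega_locally_injective[OF Zr that] omega_locally_surjective[OF inf Zr that]])
 have mono1: "sheaf_mono K (sheafify K Z_pre) (sheafify K (witt_sub witt_carrier)) (sheafify_map K Z_pre (witt_sub witt_carrier) omega)"
  if "finer K f_pretopology"
  by (rule site_morphism.sheafify_mono[OF ZW omega_locally_injective[OF ZW that]])
 note mono2 = site_morphism.sheafify_mono[OF rW incl_locally_injective[OF rW]]
 note mono3 = site_morphism.sheafify_mono[OF JW incl_locally_injective[OF JW]]
 \<comment> \<open>The two compatibilities with the monomorphisms into the sheaf of all Witt vectors
   express that the isomorphisms are isomorphisms of its subsheaves.\<close>
 have comp1: "sheafify_map K (witt_sub rat_carrier) (witt_sub witt_carrier) incl A (sheafify_map K Z_pre (witt_sub rat_carrier) omega A x) =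
   sheafify_map K Z_pre (witt_sub witt_carrier) omega A x"
  if "A \<in> noeth" "x \<in> carrier (sec (sheafify K Z_pre) A)" for A x
  by (rule sheafify_map_comp[OF Zr rW ZW _ that]) (simp add: incl_def)
 have comp2: "sheafify_map K (witt_sub J_carrier) (witt_sub witt_carrier) incl A (sheafify_map K (witt_sub rat_carrier) (witt_sub J_carrier) incl A x) =
   sheafify_map K (witt_sub rat_carrier) (witt_sub witt_carrier) incl A x"
  if "A \<in> noeth" "x \<in> carrier (sec (sheafify K (witt_sub rat_carrier)) A)" for A x
  by (rule sheafify_map_comp[OF rJ JW rW _ that]) (simp add: incl_def)
 show ?thesis unfolding W_pre_eq W_rat_pre_eq W_J_pre_eq
  using iso1 iso2 mono1 mono2 mono3 comp1 comp2 by blast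
qed

end
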